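(* Let $h=1/N$ be sufficiently small. Suppose that the solutions $(\eta,u)$ of the initial-boundary-value problems (CB) and (SCB) (stated in the context) are such that $\eta\in C(0,T;C^3)$, $\eta_t\in C(0,T;C^2)$, and $u,u_t\in C(0,T;C_0^3)$. Then the semidiscrete problems (CB$_h$) and (SCB$_h$) (stated in the context), i.e. the standard Galerkin semidiscretizations with continuous piecewise linear functions on the uniform mesh with initial values $\eta_h(0)=I_h\eta_0$, $u_h(0)=I_{h,0}u_0$, have unique solutions $(\eta_h,u_h)$ for $0\le t\le T$, and there is a constant $C$ independent of $h$ such that, in each case, \[ (i)\quad \max_{0\le t\le T}\|\eta(t)-\eta_h(t)\|\le Ch^{3/2},\qquad \max_{0\le t\le T}\|u(t)-u_h(t)\|_1\le Ch, \] \[ (ii)\quad \max_{0\le t\le T}\|u(t)-u_h(t)\|\le Ch^{2},\qquad \max_{0\le t\le T}\|u_t(t)-u_{ht}(t)\|\le Ch^{2}. \]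
   Context: Function spaces on $[0,1]$: $C^k=C^k[0,1]$, $C_0^k=\{\phi\in C^k:\phi(0)=\phi(1)=0\}$; $(\cdot,\cdot)$ and $\|\cdot\|$ are the inner product and norm of $L^2(0,1)$; $\|v\|_1=(\|v\|^2+\tfrac13\|v'\|^2)^{1/2}$. $C(0,T;X)$ is the space of functions $\phi=\phi(t)$ with values in the Banach space $X$ for each $t\in[0,T]$ and such that $t\mapsto\|\phi(t)\|_X$ is continuous on $[0,T]$. $0<T<\infty$ is such that the problems below have solutions on $[0,T]$. Problem (CB): $\eta_t+u_x+(\eta u)_x=0$, $u_t+\eta_x+uu_x-\tfrac13u_{xxt}=0$ for $(x,t)\in[0,1]\times[0,T]$; $\eta(x,0)=\eta_0(x)$, $u(x,0)=u_0(x)$ for $x\in[0,1]$; $u(0,t)=u(1,t)=0$ for $t\in[0,T]$. Problem (SCB): $\eta_t+u_x+\tfrac12(\eta u)_x=0$, $u_t+\eta_x+\tfrac32uu_x+\tfrac12\eta\eta_x-\tfrac13u_{xxt}=0$ for $(x,t)\in[0,1]\times[0,T]$, with the same initial and boundary conditions. Mesh and finite element spaces: for an integer $N\ge2$, $h=1/N$, $x_i=(i-1)h$, $i=1,\dots,N+1$; $S_h^2=\{\phi\in C^0[0,1]:\phi|_{[x_j,x_{j+1}]}\in\mathbb P_1,\ 1\le j\le N\}$ ($\mathbb P_r$: polynomials of degree $\le r$), $S_{h,0}^2=\{\phi\in S_h^2:\phi(0)=\phi(1)=0\}$. $I_h$, $I_{h,0}$ are the operators of interpolation at the nodes $x_j$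 into $S_h^2$, $S_{h,0}^2$ respectively. $a(\psi,\chi)=(\psi,\chi)+\tfrac13(\psi',\chi')$. Semidiscrete problem (CB$_h$): find $\eta_h:[0,T]\to S_h^2$, $u_h:[0,T]\to S_{h,0}^2$ such that for $t\in[0,T]$ $(\eta_{ht},\phi)+(u_{hx},\phi)+((\eta_hu_h)_x,\phi)=0$ for all $\phi\in S_h^2$, and $a(u_{ht},\chi)+(\eta_{hx},\chi)+(u_hu_{hx},\chi)=0$ for all $\chi\in S_{h,0}^2$, with $\eta_h(0)=I_h\eta_0$, $u_h(0)=I_{h,0}u_0$. Semidiscrete problem (SCB$_h$): the same with the equations replaced by $(\eta_{ht},\phi)+(u_{hx},\phi)+\tfrac12((\eta_hu_h)_x,\phi)=0$ for all $\phi\in S_h^2$, and $a(u_{ht},\chi)+(\eta_{hx},\chi)+\tfrac32(u_hu_{hx},\chi)+\tfrac12(\eta_h\eta_{hx},\chi)=0$ for all $\chi\in S_{h,0}^2$. *)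

theory Defs
  imports "HOL-Analysis.Analysis" "HOL-Computational_Algebra.Polynomial"
begin

text \<open>
  Functions on [0,1] are represented by functions of type \<^typ>\<open>real \<Rightarrow> real\<close> whose values
  outside [0,1] are irrelevant; functions of space and time are written \<open>f t x\<close>, so that
  \<open>f t\<close> is the spatial profile at time \<open>t\<close>. Derivatives are one-sided at end points.
  A piecewise linear function has no derivative at the mesh nodes, where \<open>Dx\<close> takes an
  unspecified value; being a finite set, the nodes do not influence any of the integrals below.
\<close>

definition Dx :: "(real \<Rightarrow> real) \<Rightarrow> real \<Rightarrow> real" where
  "Dx f x = vector_derivative f (at x within {0..1})"

definition Dt :: "real \<Rightarrow> (real \<Rightarrow> real \<Rightarrow> real) \<Rightarrow> real \<Rightarrow> real \<Rightarrow> real" where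
  "Dt T f t x = vector_derivative (\<lambda>s. f s x) (at t within {0..T})"

definition Ck :: "nat \<Rightarrow> (real \<Rightarrow> real) set" where
  "Ck k = {f. (\<forall>j<k. (Dx ^^ j) f differentiable_on {0..1}) \<and>
              (\<forall>j\<le>k. continuous_on {0..1} ((Dx ^^ j) f))}"

definition Ck0 :: "nat \<Rightarrow> (real \<Rightarrow> real) set" where
  "Ck0 k = {f \<in> Ck k. f 0 = 0 \<and> f 1 = 0}"

definition Ck_norm :: "nat \<Rightarrow> (real \<Rightarrow> real) \<Rightarrow> real" where
  "Ck_norm k f = Max ((\<lambda>j. SUP x\<in>{0..1}. \<bar>(Dx ^^ j) f x\<bar>) ` {..k})"

text \<open>
  \<open>C(0,T;X)\<close> for a space with carrier \<open>X\<close> and norm \<open>nrm\<close>. Only the norm is required to be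
  continuous in time, which is implied by continuity of \<open>\<phi>\<close> as an \<open>X\<close>-valued map.
\<close>

definition C_time :: "real \<Rightarrow> (real \<Rightarrow> real) set \<Rightarrow> ((real \<Rightarrow> real) \<Rightarrow> real) \<Rightarrow>
    (real \<Rightarrow> real \<Rightarrow> real) set" where
  "C_time T X nrm = {\<phi>. (\<forall>t\<in>{0..T}. \<phi> t \<in> X) \<and> continuous_on {0..T} (\<lambda>t. nrm (\<phi> t))}"

definition ip :: "(real \<Rightarrow> real) \<Rightarrow> (real \<Rightarrow> real) \<Rightarrow> real" where
  "ip f g = (LBINT x:{0..1}. f x * g x)"

definition L2norm :: "(real \<Rightarrow> real) \<Rightarrow> real" where
  "L2norm f = sqrt (ip f f)"

definition norm1 :: "(real \<Rightarrow> real) \<Rightarrow> real" where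
  "norm1 v = sqrt ((L2norm v)\<^sup>2 + 1/3 * (L2norm (Dx v))\<^sup>2)"

definition a_form :: "(real \<Rightarrow> real) \<Rightarrow> (real \<Rightarrow> real) \<Rightarrow> real" where
  "a_form \<psi> \<omega> = ip \<psi> \<omega> + 1/3 * ip (Dx \<psi>) (Dx \<omega>)"

text \<open>Existence of all partial derivatives occurring in the two systems.\<close>

definition classical :: "real \<Rightarrow> (real \<Rightarrow> real \<Rightarrow> real) \<Rightarrow> (real \<Rightarrow> real \<Rightarrow> real) \<Rightarrow> bool" where
  "classical T \<eta> u \<longleftrightarrow> (\<forall>t\<in>{0..T}. \<forall>x\<in>{0..1}.
     (\<lambda>s. \<eta> s x) differentiable (at t within {0..T}) \<and>
     (\<lambda>s. u s x) differentiable (at t within {0..T}) \<and>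
     \<eta> t differentiable (at x within {0..1}) \<and>
     u t differentiable (at x within {0..1}) \<and>
     Dx (u t) differentiable (at x within {0..1}) \<and>
     (\<lambda>s. Dx (Dx (u s)) x) differentiable (at t within {0..T}))"

definition init_bdry :: "real \<Rightarrow> (real \<Rightarrow> real) \<Rightarrow> (real \<Rightarrow> real) \<Rightarrow>
    (real \<Rightarrow> real \<Rightarrow> real) \<Rightarrow> (real \<Rightarrow> real \<Rightarrow> real) \<Rightarrow> bool" where
  "init_bdry T \<eta>0 u0 \<eta> u \<longleftrightarrow>
     (\<forall>x\<in>{0..1}. \<eta> 0 x = \<eta>0 x \<and> u 0 x = u0 x) \<and>
     (\<forall>t\<in>{0..T}. u t 0 = 0 \<and> u t 1 = 0)"

definition CB :: "real \<Rightarrow> (real \<Rightarrow> real) \<Rightarrow> (real \<Rightarrow> real) \<Rightarrow>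
    (real \<Rightarrow> real \<Rightarrow> real) \<Rightarrow> (real \<Rightarrow> real \<Rightarrow> real) \<Rightarrow> bool" where
  "CB T \<eta>0 u0 \<eta> u \<longleftrightarrow> classical T \<eta> u \<and> init_bdry T \<eta>0 u0 \<eta> u \<and>
     (\<forall>t\<in>{0..T}. \<forall>x\<in>{0..1}.
        Dt T \<eta> t x + Dx (u t) x + Dx (\<lambda>y. \<eta> t y * u t y) x = 0 \<and>
        Dt T u t x + Dx (\<eta> t) x + u t x * Dx (u t) x
          - 1/3 * Dt T (\<lambda>s. Dx (Dx (u s))) t x = 0)"

definition SCB :: "real \<Rightarrow> (real \<Rightarrow> real) \<Rightarrow> (real \<Rightarrow> real) \<Rightarrow>
    (real \<Rightarrow> real \<Rightarrow> real) \<Rightarrow> (real \<Rightarrow> real \<Rightarrow> real) \<Rightarrow> bool" where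
  "SCB T \<eta>0 u0 \<eta> u \<longleftrightarrow> classical T \<eta> u \<and> init_bdry T \<eta>0 u0 \<eta> u \<and>
     (\<forall>t\<in>{0..T}. \<forall>x\<in>{0..1}.
        Dt T \<eta> t x + Dx (u t) x + 1/2 * Dx (\<lambda>y. \<eta> t y * u t y) x = 0 \<and>
        Dt T u t x + Dx (\<eta> t) x + 3/2 * (u t x * Dx (u t) x) + 1/2 * (\<eta> t x * Dx (\<eta> t) x)
          - 1/3 * Dt T (\<lambda>s. Dx (Dx (u s))) t x = 0)"

definition node :: "nat \<Rightarrow> nat \<Rightarrow> real" where
  "node N i = (real i - 1) * (1 / real N)"

definition Sh :: "nat \<Rightarrow> (real \<Rightarrow> real) set" where
  "Sh N = {\<phi>. continuous_on {0..1} \<phi> \<and>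
     (\<forall>j\<in>{1..N}. \<exists>p :: real poly. degree p \<le> 1 \<and>
        (\<forall>x\<in>{node N j..node N (j + 1)}. \<phi> x = poly p x))}"

definition Sh0 :: "nat \<Rightarrow> (real \<Rightarrow> real) set" where
  "Sh0 N = {\<phi> \<in> Sh N. \<phi> 0 = 0 \<and> \<phi> 1 = 0}"

text \<open>
  The interpolant of \<open>v\<close> at the nodes in the space \<open>S\<close>; it is determined on [0,1] only
  (and \<open>S = Sh0 N\<close> presupposes that \<open>v\<close> vanishes at 0 and 1).
\<close>

definition interp :: "(real \<Rightarrow> real) set \<Rightarrow> nat \<Rightarrow> (real \<Rightarrow> real) \<Rightarrow> real \<Rightarrow> real" where
  "interp S N v = (SOME \<phi>. \<phi> \<in> S \<and> (\<forall>i\<in>{1..N+1}. \<phi> (node N i) = v (node N i)))"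

text \<open>
  In a finite-dimensional space of functions, differentiability in time is the same as
  differentiability in time at each point \<open>x\<close>.
\<close>

definition semidiscrete :: "nat \<Rightarrow> real \<Rightarrow> (real \<Rightarrow> real) \<Rightarrow> (real \<Rightarrow> real) \<Rightarrow>
    (real \<Rightarrow> real \<Rightarrow> real) \<Rightarrow> (real \<Rightarrow> real \<Rightarrow> real) \<Rightarrow> bool" where
  "semidiscrete N T \<eta>0 u0 \<eta>h uh \<longleftrightarrow>
     (\<forall>t\<in>{0..T}. \<eta>h t \<in> Sh N \<and> uh t \<in> Sh0 N) \<and>
     (\<forall>t\<in>{0..T}. \<forall>x\<in>{0..1}.
        (\<lambda>s. \<eta>h s x) differentiable (at t within {0..T}) \<and>
        (\<lambda>s. uh s x) differentiable (at t within {0..T})) \<and>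
     (\<forall>x\<in>{0..1}. \<eta>h 0 x = interp (Sh N) N \<eta>0 x \<and> uh 0 x = interp (Sh0 N) N u0 x)"

definition CBh :: "nat \<Rightarrow> real \<Rightarrow> (real \<Rightarrow> real) \<Rightarrow> (real \<Rightarrow> real) \<Rightarrow>
    (real \<Rightarrow> real \<Rightarrow> real) \<Rightarrow> (real \<Rightarrow> real \<Rightarrow> real) \<Rightarrow> bool" where
  "CBh N T \<eta>0 u0 \<eta>h uh \<longleftrightarrow> semidiscrete N T \<eta>0 u0 \<eta>h uh \<and>
     (\<forall>t\<in>{0..T}.
        (\<forall>\<phi>\<in>Sh N. ip (Dt T \<eta>h t) \<phi> + ip (Dx (uh t)) \<phi>
           + ip (Dx (\<lambda>x. \<eta>h t x * uh t x)) \<phi> = 0) \<and>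
        (\<forall>\<omega>\<in>Sh0 N. a_form (Dt T uh t) \<omega> + ip (Dx (\<eta>h t)) \<omega>
           + ip (\<lambda>x. uh t x * Dx (uh t) x) \<omega> = 0))"

definition SCBh :: "nat \<Rightarrow> real \<Rightarrow> (real \<Rightarrow> real) \<Rightarrow> (real \<Rightarrow> real) \<Rightarrow>
    (real \<Rightarrow> real \<Rightarrow> real) \<Rightarrow> (real \<Rightarrow> real \<Rightarrow> real) \<Rightarrow> bool" where
  "SCBh N T \<eta>0 u0 \<eta>h uh \<longleftrightarrow> semidiscrete N T \<eta>0 u0 \<eta>h uh \<and>
     (\<forall>t\<in>{0..T}.
        (\<forall>\<phi>\<in>Sh N. ip (Dt T \<eta>h t) \<phi> + ip (Dx (uh t)) \<phi>
           + 1/2 * ip (Dx (\<lambda>x. \<eta>h t x * uh t x)) \<phi> = 0) \<and>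
        (\<forall>\<omega>\<in>Sh0 N. a_form (Dt T uh t) \<omega> + ip (Dx (\<eta>h t)) \<omega>
           + 3/2 * ip (\<lambda>x. uh t x * Dx (uh t) x) \<omega>
           + 1/2 * ip (\<lambda>x. \<eta>h t x * Dx (\<eta>h t) x) \<omega> = 0))"

definition same_on :: "real \<Rightarrow> (real \<Rightarrow> real \<Rightarrow> real) \<Rightarrow> (real \<Rightarrow> real \<Rightarrow> real) \<Rightarrow> bool" where
  "same_on T f g \<longleftrightarrow> (\<forall>t\<in>{0..T}. \<forall>x\<in>{0..1}. f t x = g t x)"

end

(*
Both systems are instances of a family with parameters alpha, beta, gamma. The discrete solution is
compared with the nodal interpolants of eta and u. Since interpolation is the elliptic projection
for the form (v', w'), and since on a uniform mesh the cell means of the interpolation errors vary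
slowly, the residual of the first equation is O(h^2) except for two boundary terms, which cost a
factor h^(-1/2); the energy method gives O(h^(3/2)) for theta = I eta - eta_h in L2 and
xi = I u - u_h in H1. The boundary terms are invisible in a negative norm: the energy method for the
antiderivative A of theta and for the derivative of the solution of -G'' = xi, with interpolants as
test functions, gives O(h^2) for A and for xi in L2, where the terms of lower order contain a
factor h in front of the O(h^(3/2)) bound of the first step. Solving -G'' = xi_t instead bounds xi_t.
Existence follows by truncation of the nonlinearity, whose effect is excluded by a continuity argument.
*)

theory Submission imports Defs begin

text \<open>One obstacle sets all orders: theta is controlled in L2 only, so a nodal value of theta
  costs \<open>h^(-1/2)\<close>, and summation by parts leaves nodal values. In the second step the
  test function for theta interpolates some F with \<open>F' = - A\<close>; its slope is about as
  small as the quantity being estimated, so the plain \<open>O(h^2)\<close> size of the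
  interpolation errors of \<eta> and \<open>u\<close> suffices. What remains is the error of
  replacing F by its interpolant. It is proportional to theta and meets theta or theta_t, for which
  the first step gives \<open>h^(3/2)\<close> and \<open>h^(1/2)\<close>, so it contributes
  \<open>h^4\<close> to the squared estimate. Since A(1) need not vanish, it is bounded separately
  by testing with the constant 1. The linearised equations have coefficients that contain the
  discrete solution. Inverse inequalities bound them as long as the squared energy error is at most
  \<open>h\<close>; the first step improves this to \<open>C h^3\<close>, which closes the
  continuation argument for small \<open>h\<close>. The equations contain \<open>(u_xx)_t\<close>,
  the weak form needs \<open>(u_t)_xx\<close>; with only norms continuous in time their equality
  needs a proof of its own.\<close>

section \<open>Bounded measurable functions on [0,1] and the L2 inner product\<close>

text \<open>Values outside [0,1] are arbitrary, so measurability is asked of the function cut off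
  there. Boundedness instead of square integrability makes the class closed under products.\<close>

definition bm :: "(real \<Rightarrow> real) set" where
  "bm = {f. (\<lambda>x. indicator {0..1} x * f x) \<in> borel_measurable borel \<and> (\<exists>B. \<forall>x\<in>{0..1}. \<bar>f x\<bar> \<le> B)}"

lemma bm_obtain_bound: assumes "f \<in> bm" obtains B where "\<And>x. x \<in> {0..1} \<Longrightarrow> \<bar>f x\<bar> \<le> B"
  using assms unfolding bm_def by blast

lemma bm_continuous: "continuous_on {0..1} f \<Longrightarrow> f \<in> bm"
proof -
  assume c: "continuous_on {0..1} f"
  have "compact (f ` {0..1})" using c compact_continuous_image by blast
  then obtain B where "\<forall>x\<in>{0..1}. \<bar>f x\<bar> \<le> B"
    by (force dest: compact_imp_bounded simp: bounded_iff)
  moreover have "(\<lambda>x. indicator {0..1} x *\<^sub>R f x) \<in> borel_measurable borel"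
    by (rule borel_measurable_continuous_on_indicator) (use c in auto)
  ultimately show ?thesis by (auto simp: bm_def)
qed

lemma bm_const: "(\<lambda>x. c) \<in> bm"
  by (rule bm_continuous) auto

lemma bm_mult: assumes "f \<in> bm" "g \<in> bm" shows "(\<lambda>x. f x * g x) \<in> bm"
proof -
  obtain A where A: "\<And>x. x\<in>{0..1} \<Longrightarrow> \<bar>f x\<bar> \<le> A"
    using bm_obtain_bound[OF assms(1)] by blast
  obtain B where B: "\<And>x. x\<in>{0..1} \<Longrightarrow> \<bar>g x\<bar> \<le> B"
    using bm_obtain_bound[OF assms(2)] by blast
  have "(\<lambda>x. (indicator {0..1} x * f x) * (indicator {0..1} x * g x)) \<in> borel_measurable borel"
    using assms unfolding bm_def by (intro borel_measurable_times[of "\<lambda>x. indicator {0..1} x * f x"]) blast+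
  also have "(\<lambda>x. (indicator {0..1} x * f x) * (indicator {0..1} x * g x)) =
    (\<lambda>x::real. indicator {0..1} x * (f x * g x))" by (auto simp: indicator_def)
  finally have "(\<lambda>x. indicator {0..1} x * (f x * g x)) \<in> borel_measurable borel" .
  moreover have "\<forall>x\<in>{0..1}. \<bar>f x * g x\<bar> \<le> A * B"
    using A B by (auto simp: abs_mult intro!: mult_mono')
  ultimately show ?thesis unfolding bm_def by blast
qed

lemma bm_add: assumes "f \<in> bm" "g \<in> bm" shows "(\<lambda>x. f x + g x) \<in> bm"
proof -
  obtain A where A: "\<And>x. x\<in>{0..1} \<Longrightarrow> \<bar>f x\<bar> \<le> A"
    using bm_obtain_bound[OF assms(1)] by blast
  obtain B where B: "\<And>x. x\<in>{0..1} \<Longrightarrow> \<bar>g x\<bar> \<le> B"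
    using bm_obtain_bound[OF assms(2)] by blast
  have "(\<lambda>x. (indicator {0..1} x * f x) + (indicator {0..1} x * g x)) \<in> borel_measurable borel"
    using assms unfolding bm_def by (intro borel_measurable_add) blast+
  then have "(\<lambda>x. indicator {0..1} x * (f x + g x)) \<in> borel_measurable borel"
    by (simp add: algebra_simps)
  moreover have "\<forall>x\<in>{0..1}. \<bar>f x + g x\<bar> \<le> A + B" using A B by (smt (verit))
  ultimately show ?thesis unfolding bm_def by auto
qed

lemma bm_cmult: "f \<in> bm \<Longrightarrow> (\<lambda>x. c * f x) \<in> bm"
  using bm_mult[OF bm_const] by blast

lemma bm_uminus: "f \<in> bm \<Longrightarrow> (\<lambda>x. - f x) \<in> bm"
  using bm_cmult[of f "-1"] by simp

lemma bm_diff: "f \<in> bm \<Longrightarrow> g \<in> bm \<Longrightarrow> (\<lambda>x. f x - g x) \<in> bm"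
  using bm_add[OF _ bm_uminus] by fastforce

lemma bm_sum: "(\<And>i. i \<in> I \<Longrightarrow> f i \<in> bm) \<Longrightarrow> (\<lambda>x. \<Sum>i\<in>I. f i x) \<in> bm"
  by (induction I rule: infinite_finite_induct) (auto intro: bm_const bm_add)

lemmas bm_intros = bm_const bm_mult bm_add bm_uminus bm_diff bm_sum

text \<open>Needed for \<open>Dx\<close> of a piecewise linear function, which takes unspecified
  values at the nodes.\<close>

lemma bm_change:
  assumes "f \<in> bm" "finite S" "\<And>x. x \<in> {0..1} - S \<Longrightarrow> g x = f x"
  shows "g \<in> bm"
proof -
  obtain A where A: "\<And>x. x\<in>{0..1} \<Longrightarrow> \<bar>f x\<bar> \<le> A"
    using bm_obtain_bound[OF assms(1)] by blast
  have "(\<lambda>x. indicator {0..1} x * g x) \<in> borel_measurable borel"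
    by (rule measurable_discrete_difference[of "\<lambda>x. indicator {0..1} x * f x" _ _ S])
       (use assms in \<open>auto simp: bm_def countable_finite indicator_def\<close>)
  moreover have "\<bar>g x\<bar> \<le> \<bar>A\<bar> + (\<Sum>s\<in>S. \<bar>g s\<bar>)" if x: "x \<in> {0..1}" for x
  proof (cases "x \<in> S")
    case True
    then have "\<bar>g x\<bar> \<le> (\<Sum>s\<in>S. \<bar>g s\<bar>)" using assms(2) by (intro member_le_sum) auto
    then show ?thesis by simp
  next
    case False
    then have "\<bar>g x\<bar> \<le> \<bar>A\<bar>" using A[OF x] assms(3)[of x] x by auto
    then show ?thesis by (smt (verit) sum_nonneg abs_ge_zero)
  qed
  ultimately show ?thesis unfolding bm_def by blast
qed

lemma bm_cong: "f \<in> bm \<Longrightarrow> (\<And>x. x \<in> {0..1} \<Longrightarrow> g x = f x) \<Longrightarrow> g \<in> bm"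
  using bm_change[of f "{}" g] by auto

lemma bm_set_integrable:
  assumes "f \<in> bm" "0 \<le> a" "b \<le> 1"
  shows "set_integrable lborel {a..b} f"
proof -
  obtain A where A: "\<And>x. x\<in>{0..1} \<Longrightarrow> \<bar>f x\<bar> \<le> A"
    using bm_obtain_bound[OF assms(1)] by blast
  have m: "(\<lambda>x. indicator {0..1} x * f x) \<in> borel_measurable borel" using assms(1) by (simp add: bm_def)
  have "set_integrable lborel {a..b} (\<lambda>x. indicator {0..1} x * f x)"
    unfolding set_integrable_def
  proof (rule Bochner_Integration.integrable_bound[where f = "\<lambda>x. indicator {a..b} x * \<bar>A\<bar>"])
    show "integrable lborel (\<lambda>x::real. indicat_real {a..b} x * \<bar>A\<bar>)"
      by (rule integrable_mult_left) (auto simp: emeasure_lborel_Icc_eq)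
    show "(\<lambda>x. indicat_real {a..b} x *\<^sub>R (indicat_real {0..1} x * f x)) \<in> borel_measurable lborel"
      using m by (intro borel_measurable_scaleR) auto
    have "norm (indicat_real {a..b} x *\<^sub>R (indicat_real {0..1} x * f x)) \<le> norm (indicat_real {a..b} x * \<bar>A\<bar>)" for x
      using A[of x] by (auto simp: indicator_def split: if_splits)
    then show "AE x in lborel. norm (indicat_real {a..b} x *\<^sub>R (indicat_real {0..1} x * f x)) \<le> norm (indicat_real {a..b} x * \<bar>A\<bar>)"
      by auto
  qed
  also have "set_integrable lborel {a..b} (\<lambda>x. indicator {0..1} x * f x) = set_integrable lborel {a..b} f"
    unfolding set_integrable_def using assms
    by (intro Bochner_Integration.integrable_cong) (auto simp: indicator_def)
  finally show ?thesis .
qed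

lemma bm_integrable: "f \<in> bm \<Longrightarrow> 0 \<le> a \<Longrightarrow> b \<le> 1 \<Longrightarrow> f integrable_on {a..b}"
  using bm_set_integrable set_borel_integral_eq_integral(1) by blast

lemma ip_integral: "f \<in> bm \<Longrightarrow> g \<in> bm \<Longrightarrow> ip f g = integral {0..1} (\<lambda>x. f x * g x)"
  unfolding ip_def using bm_set_integrable[of "\<lambda>x. f x * g x" 0 1] bm_mult[of f g]
  by (simp add: set_borel_integral_eq_integral(2))

lemma ip_commute: "ip f g = ip g f"
  by (simp add: ip_def mult.commute)

lemma ip_cong: "(\<And>x. x \<in> {0..1} \<Longrightarrow> f x * g x = f' x * g' x) \<Longrightarrow> ip f g = ip f' g'"
  unfolding ip_def by (rule set_lebesgue_integral_cong) auto

lemma ip_add_left: "f \<in> bm \<Longrightarrow> f' \<in> bm \<Longrightarrow> g \<in> bm \<Longrightarrow> ip (\<lambda>x. f x + f' x) g = ip f g + ip f' g"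
  by (simp add: ip_integral bm_intros distrib_right bm_integrable integral_add)

lemma ip_cmult_left: "ip (\<lambda>x. c * f x) g = c * ip f g"
  by (simp add: ip_def mult.assoc)

lemma ip_uminus_left: "ip (\<lambda>x. - f x) g = - ip f g"
  using ip_cmult_left[of "-1" f g] by simp

lemma ip_diff_left: "f \<in> bm \<Longrightarrow> f' \<in> bm \<Longrightarrow> g \<in> bm \<Longrightarrow> ip (\<lambda>x. f x - f' x) g = ip f g - ip f' g"
  using ip_add_left[of f "\<lambda>x. - f' x" g] by (simp add: bm_uminus ip_uminus_left)

lemma ip_zero_left: "ip (\<lambda>x. 0) g = 0"
  using ip_cmult_left[of 0 "\<lambda>x. 0" g] by simp

lemma ip_sum_left:
  "(\<And>i. i \<in> I \<Longrightarrow> f i \<in> bm) \<Longrightarrow> g \<in> bm \<Longrightarrow> ip (\<lambda>x. \<Sum>i\<in>I. f i x) g = (\<Sum>i\<in>I. ip (f i) g)"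
  by (induction I rule: infinite_finite_induct) (auto simp: ip_zero_left ip_add_left bm_sum)

lemma ip_add_right: "f \<in> bm \<Longrightarrow> f' \<in> bm \<Longrightarrow> g \<in> bm \<Longrightarrow> ip g (\<lambda>x. f x + f' x) = ip g f + ip g f'"
  using ip_add_left[of f f' g] by (simp add: ip_commute)

lemma ip_diff_right: "f \<in> bm \<Longrightarrow> f' \<in> bm \<Longrightarrow> g \<in> bm \<Longrightarrow> ip g (\<lambda>x. f x - f' x) = ip g f - ip g f'"
  using ip_diff_left[of f f' g] by (simp add: ip_commute)

lemma ip_cmult_right: "ip g (\<lambda>x. c * f x) = c * ip g f"
  using ip_cmult_left[of c f g] by (simp add: ip_commute)

lemma ip_sum_right:
  "(\<And>i. i \<in> I \<Longrightarrow> f i \<in> bm) \<Longrightarrow> g \<in> bm \<Longrightarrow> ip g (\<lambda>x. \<Sum>i\<in>I. f i x) = (\<Sum>i\<in>I. ip g (f i))"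
  using ip_sum_left[of I f g] by (simp add: ip_commute)

lemma ip_self_nonneg: "0 \<le> ip f f"
  unfolding ip_def set_lebesgue_integral_def
  by (rule Bochner_Integration.integral_nonneg_AE) (auto simp: indicator_def)

lemma L2norm_nonneg: "0 \<le> L2norm f"
  by (simp add: L2norm_def ip_self_nonneg)

lemma L2norm_sq: "(L2norm f)\<^sup>2 = ip f f"
  by (simp add: L2norm_def ip_self_nonneg)

lemma ip_cong_finite:
  assumes "f \<in> bm" "g \<in> bm" "finite S" "\<And>x. x \<in> {0..1} - S \<Longrightarrow> f' x * g' x = f x * g x"
  shows "ip f' g' = ip f g"
proof -
  have "(\<lambda>x. f' x * g' x) \<in> bm"
    by (rule bm_change[OF bm_mult[OF assms(1,2)] assms(3)]) (use assms in auto)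
  then have "ip f' g' = integral {0..1} (\<lambda>x. f' x * g' x)"
    unfolding ip_def using bm_set_integrable[of "\<lambda>x. f' x * g' x" 0 1]
    by (simp add: set_borel_integral_eq_integral(2))
  also have "\<dots> = integral {0..1} (\<lambda>x. f x * g x)"
    by (rule integral_spike[of S]) (use assms in \<open>auto simp: negligible_finite\<close>)
  finally show ?thesis by (simp add: ip_integral assms)
qed

lemma ip_CS: assumes "f \<in> bm" "g \<in> bm" shows "\<bar>ip f g\<bar> \<le> L2norm f * L2norm g"
proof -
  let ?a = "ip f f" and ?b = "ip f g" and ?c = "ip g g"
  have q: "0 \<le> ?a * s^2 - 2 * s * r * ?b + r^2 * ?c" for s r
  proof -
    have "0 \<le> ip (\<lambda>x. s * f x - r * g x) (\<lambda>x. s * f x - r * g x)" by (rule ip_self_nonneg)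
    also have "\<dots> = ?a * s^2 - 2 * s * r * ?b + r^2 * ?c"
      using assms by (simp add: ip_diff_left ip_diff_right bm_intros bm_cmult ip_cmult_left ip_cmult_right
          ip_commute[of g f] power2_eq_square algebra_simps)
    finally show ?thesis .
  qed
  have "?b^2 \<le> ?a * ?c"
  proof (cases "?a = 0")
    case True
    show ?thesis
    proof (cases "?b = 0")
      case False
      \<comment> \<open>With \<open>?a = 0\<close> the form is affine in \<open>s\<close> for
        \<open>r = 1\<close>; this \<open>s\<close> would give it the value -1.\<close>
      have "2 * ((?c + 1) / (2 * ?b)) * ?b = ?c + 1" using False by simp
      then show ?thesis using q[of "(?c+1)/(2*?b)" 1] True by simp
    qed (use True in simp)
  next
    case False
    then have a: "?a > 0" using ip_self_nonneg[of f] by simp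
    \<comment> \<open>The quadratic form at \<open>s = ?b\<close>, \<open>r = ?a\<close>, a multiple
      of its minimiser.\<close>
    have "0 \<le> ?a * (?a * ?c - ?b^2)"
      using q[of ?b ?a] by (simp add: power2_eq_square algebra_simps)
    then show ?thesis using a by (simp add: zero_le_mult_iff)
  qed
  then have "sqrt (?b^2) \<le> sqrt (?a * ?c)" by (rule real_sqrt_le_mono)
  then show ?thesis by (simp add: L2norm_def real_sqrt_mult)
qed

lemma L2norm_triangle: assumes "f \<in> bm" "g \<in> bm"
  shows "L2norm (\<lambda>x. f x + g x) \<le> L2norm f + L2norm g"
proof (rule power2_le_imp_le)
  have "(L2norm (\<lambda>x. f x + g x))\<^sup>2 = ip f f + 2 * ip f g + ip g g"
    using assms by (simp add: L2norm_sq ip_add_left ip_add_right bm_intros ip_commute[of g f])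
  also have "\<dots> \<le> ip f f + 2 * (L2norm f * L2norm g) + ip g g"
    using ip_CS[OF assms] by linarith
  also have "\<dots> = (L2norm f + L2norm g)\<^sup>2"
    by (simp add: power2_sum L2norm_sq)
  finally show "(L2norm (\<lambda>x. f x + g x))\<^sup>2 \<le> (L2norm f + L2norm g)\<^sup>2" .
qed (simp add: L2norm_nonneg)

lemma L2norm_uminus: "L2norm (\<lambda>x. - f x) = L2norm f"
  by (simp add: L2norm_def ip_def)

lemma L2norm_cmult: "L2norm (\<lambda>x. c * f x) = \<bar>c\<bar> * L2norm f"
  by (simp add: L2norm_def ip_cmult_left ip_cmult_right real_sqrt_mult flip: mult.assoc power2_eq_square)

lemma L2norm_triangle_diff: assumes "f \<in> bm" "g \<in> bm"
  shows "L2norm (\<lambda>x. f x - g x) \<le> L2norm f + L2norm g"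
  using L2norm_triangle[of f "\<lambda>x. - g x"] assms by (simp add: bm_uminus L2norm_uminus)

lemma L2norm_cong: "(\<And>x. x \<in> {0..1} \<Longrightarrow> f x = g x) \<Longrightarrow> L2norm f = L2norm g"
  unfolding L2norm_def using ip_cong[of f f g g] by auto

lemma ip_mono:
  assumes "f \<in> bm" "g \<in> bm" "f' \<in> bm" "g' \<in> bm" "\<And>x. x \<in> {0..1} \<Longrightarrow> f x * g x \<le> f' x * g' x"
  shows "ip f g \<le> ip f' g'"
  using assms by (auto simp: ip_integral intro!: integral_le bm_integrable bm_intros)

lemma L2norm_mult_le:
  assumes "w \<in> bm" "f \<in> bm" "\<And>x. x \<in> {0..1} \<Longrightarrow> \<bar>w x\<bar> \<le> K" "0 \<le> K"
  shows "L2norm (\<lambda>x. w x * f x) \<le> K * L2norm f"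
proof -
  have "ip (\<lambda>x. w x * f x) (\<lambda>x. w x * f x) \<le> ip (\<lambda>x. K * f x) (\<lambda>x. K * f x)"
  proof (rule ip_mono)
    fix x :: real assume x: "x \<in> {0..1}"
    have "(w x)\<^sup>2 \<le> K\<^sup>2" using assms(3)[OF x] by (simp add: abs_le_square_iff[symmetric] assms(4))
    then show "w x * f x * (w x * f x) \<le> K * f x * (K * f x)"
      using mult_right_mono[of "(w x)\<^sup>2" "K\<^sup>2" "(f x)\<^sup>2"] by (simp add: power2_eq_square algebra_simps)
  qed (use assms in \<open>auto intro!: bm_intros\<close>)
  then have "L2norm (\<lambda>x. w x * f x) \<le> L2norm (\<lambda>x. K * f x)"
    unfolding L2norm_def by simp
  then show ?thesis using assms(4) by (simp add: L2norm_cmult)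
qed

lemma ip_const: "ip (\<lambda>x. c) (\<lambda>x. d) = c * d"
  by (simp add: ip_integral bm_const)

lemma L2norm_const: "L2norm (\<lambda>x. c) = \<bar>c\<bar>"
  by (simp add: L2norm_def ip_const)

lemma L2norm_le_sup:
  assumes "f \<in> bm" "\<And>x. x \<in> {0..1} \<Longrightarrow> \<bar>f x\<bar> \<le> K" "0 \<le> K"
  shows "L2norm f \<le> K"
  using L2norm_mult_le[of f "\<lambda>x. 1" K] assms by (simp add: bm_const L2norm_const)

section \<open>Functions with a derivative outside a finite set; integration by parts\<close>

text \<open>A function together with a representative of its derivative. Carrying \<open>f\<close>
  explicitly avoids \<open>Dx\<close> at the nodes, and an arbitrary finite exceptional set lets
  smooth and piecewise linear functions be added and multiplied freely.\<close>

definition wd :: "(real \<Rightarrow> real) \<Rightarrow> (real \<Rightarrow> real) \<Rightarrow> bool" where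
  "wd F f \<longleftrightarrow> continuous_on {0..1} F \<and> f \<in> bm \<and>
     (\<exists>S. finite S \<and> (\<forall>x\<in>{0<..<1} - S. (F has_real_derivative f x) (at x)))"

lemma wd_bm: "wd F f \<Longrightarrow> F \<in> bm" "wd F f \<Longrightarrow> f \<in> bm"
  by (auto simp: wd_def intro: bm_continuous)

lemma wd_FTC:
  assumes "wd F f" "0 \<le> a" "a \<le> b" "b \<le> 1"
  shows "integral {a..b} f = F b - F a"
proof -
  obtain S where S: "finite S" "\<And>x. x\<in>{0<..<1} - S \<Longrightarrow> (F has_real_derivative f x) (at x)"
    using assms by (auto simp: wd_def)
  have "(f has_integral (F b - F a)) {a..b}"
    by (rule fundamental_theorem_of_calculus_interior_strong[OF S(1) assms(3)])
       (use S(2) assms in \<open>auto simp: has_real_derivative_iff_has_vector_derivative[symmetric] wd_def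
         intro: continuous_on_subset\<close>)
  then show ?thesis by (rule integral_unique)
qed

lemma wd_const: "wd (\<lambda>x. c) (\<lambda>x. 0)"
  unfolding wd_def by (auto intro: bm_const exI[of _ "{}"])

lemma wd_add: assumes "wd F f" "wd G g" shows "wd (\<lambda>x. F x + G x) (\<lambda>x. f x + g x)"
proof -
  obtain S R where S: "finite S" "\<And>x. x\<in>{0<..<1} - S \<Longrightarrow> (F has_real_derivative f x) (at x)"
    and R: "finite R" "\<And>x. x\<in>{0<..<1} - R \<Longrightarrow> (G has_real_derivative g x) (at x)"
    using assms by (auto simp: wd_def)
  show ?thesis unfolding wd_def
    by (intro conjI exI[of _ "S \<union> R"] ballI continuous_intros bm_intros)
      (use assms S R in \<open>auto simp: wd_def intro!: derivative_eq_intros\<close>)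
qed

lemma wd_mult: assumes "wd F f" "wd G g" shows "wd (\<lambda>x. F x * G x) (\<lambda>x. f x * G x + F x * g x)"
proof -
  obtain S R where S: "finite S" "\<And>x. x\<in>{0<..<1} - S \<Longrightarrow> (F has_real_derivative f x) (at x)"
    and R: "finite R" "\<And>x. x\<in>{0<..<1} - R \<Longrightarrow> (G has_real_derivative g x) (at x)"
    using assms by (auto simp: wd_def)
  show ?thesis unfolding wd_def
    by (intro conjI exI[of _ "S \<union> R"] ballI continuous_intros bm_intros wd_bm(2)[OF assms(1)] wd_bm(1)[OF assms(2)]
         wd_bm(1)[OF assms(1)] wd_bm(2)[OF assms(2)])
      (use assms S R in \<open>auto simp: wd_def algebra_simps intro!: derivative_eq_intros\<close>)
qed

lemma wd_cmult: "wd F f \<Longrightarrow> wd (\<lambda>x. c * F x) (\<lambda>x. c * f x)"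
  using wd_mult[OF wd_const[of c], of F f] by simp

lemma wd_uminus: "wd F f \<Longrightarrow> wd (\<lambda>x. - F x) (\<lambda>x. - f x)"
  using wd_cmult[of F f "-1"] by simp

lemma wd_diff: "wd F f \<Longrightarrow> wd G g \<Longrightarrow> wd (\<lambda>x. F x - G x) (\<lambda>x. f x - g x)"
  using wd_add[OF _ wd_uminus] by fastforce

lemma wd_by_parts:
  assumes "wd F f" "wd G g"
  shows "ip f G + ip F g = F 1 * G 1 - F 0 * G 0"
proof -
  note [simp] = wd_bm[OF assms(1)] wd_bm[OF assms(2)]
  have "ip f G + ip F g = integral {0..1} (\<lambda>x. f x * G x + F x * g x)"
    by (simp add: ip_integral integral_add bm_integrable bm_intros)
  also have "\<dots> = F 1 * G 1 - F 0 * G 0"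
    using wd_FTC[OF wd_mult[OF assms], of 0 1] by simp
  finally show ?thesis .
qed

lemma Dx_at: "(F has_real_derivative d) (at x within {0..1}) \<Longrightarrow> x \<in> {0..1} \<Longrightarrow> Dx F x = d"
  unfolding Dx_def has_real_derivative_iff_has_vector_derivative
  by (rule vector_derivative_within_cbox[of 0 1, simplified]) auto

lemma wd_Dx_finite:
  assumes "wd F f" obtains S where "finite S" "\<And>x. x \<in> {0..1} - S \<Longrightarrow> Dx F x = f x"
proof -
  obtain S where S: "finite S" "\<And>x. x\<in>{0<..<1} - S \<Longrightarrow> (F has_real_derivative f x) (at x)"
    using assms by (auto simp: wd_def)
  \<comment> \<open>The end points join the exceptional set because \<open>wd\<close> says nothing
    about derivatives there.\<close>
  show thesis
    by (rule that[of "insert 0 (insert 1 S)"])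
      (use S in \<open>auto intro!: Dx_at intro: has_field_derivative_at_within\<close>)
qed

lemma wd_Dx_bm: assumes "wd F f" shows "Dx F \<in> bm"
  using wd_Dx_finite[OF assms] bm_change[OF wd_bm(2)[OF assms]] by metis

lemma wd_ip_Dx:
  assumes "wd F f" "g \<in> bm" shows "ip (Dx F) g = ip f g"
  using wd_Dx_finite[OF assms(1)] ip_cong_finite[OF wd_bm(2)[OF assms(1)] assms(2)] by metis

lemma wd_ip_Dx2:
  assumes "wd F f" "wd G g" shows "ip (Dx F) (Dx G) = ip f g"
  using wd_ip_Dx[OF assms(1) wd_Dx_bm[OF assms(2)]] wd_ip_Dx[OF assms(2) wd_bm(2)[OF assms(1)]]
  by (simp add: ip_commute)

lemma wd_L2norm_Dx: "wd F f \<Longrightarrow> L2norm (Dx F) = L2norm f"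
  by (simp add: L2norm_def wd_ip_Dx2)

lemma wd_norm1: "wd F f \<Longrightarrow> norm1 F = sqrt (ip F F + 1/3 * ip f f)"
  by (simp add: norm1_def wd_L2norm_Dx L2norm_sq)

lemma wd_a_form: "wd F f \<Longrightarrow> wd G g \<Longrightarrow> a_form F G = ip F G + 1/3 * ip f g"
  by (simp add: a_form_def wd_ip_Dx2)

lemma wd_has_derivative:
  assumes "continuous_on {0..1} F" "continuous_on {0..1} f"
    "\<And>x. x \<in> {0..1} \<Longrightarrow> (F has_real_derivative f x) (at x within {0..1})"
  shows "wd F f"
  unfolding wd_def
  using assms(1,2) assms(3)[simplified] bm_continuous[of f]
  by (auto intro!: exI[of _ "{}"]) (metis at_within_Icc_at less_eq_real_def)

definition J :: "(real \<Rightarrow> real) \<Rightarrow> real \<Rightarrow> real" where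
  "J f x = integral {0..x} f"

lemma J_0 [simp]: "J f 0 = 0"
  by (simp add: J_def)

lemma J_deriv:
  assumes "continuous_on {0..1} f" "x \<in> {0..1}"
  shows "(J f has_real_derivative f x) (at x within {0..1})"
  unfolding J_def has_real_derivative_iff_has_vector_derivative
  by (rule integral_has_vector_derivative[OF assms])

lemma wd_J: assumes "continuous_on {0..1} f" shows "wd (J f) f"
  by (rule wd_has_derivative)
    (use assms in \<open>auto intro!: J_deriv DERIV_continuous_on[OF J_deriv]\<close>)

text \<open>Cauchy-Schwarz with the indicator of \<open>{0..x}\<close>, whose norm is at most
  1.\<close>

lemma J_bound:
  assumes "f \<in> bm" "x \<in> {0..1}" shows "\<bar>J f x\<bar> \<le> L2norm f"
proof -
  have f: "f integrable_on {0..x}" using assms by (auto intro: bm_integrable)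
  have i: "(\<lambda>y. indicator {0..x} y) \<in> bm"
    unfolding bm_def by (auto intro!: exI[of _ 1] simp: indicator_def)
  have "J f x = ip (\<lambda>y. indicator {0..x} y) f"
  proof -
    have "ip (\<lambda>y. indicator {0..x} y) f = integral {0..1} (\<lambda>y. if y \<in> {0..x} then f y else 0)"
      unfolding ip_integral[OF i assms(1)]
      by (intro arg_cong[where f="integral {0..1}"] ext) (simp add: indicator_def)
    also have "\<dots> = integral ({0..1} \<inter> {0..x}) f"
      by (subst integral_restrict_Int) (simp add: Int_commute)
    also have "{0..1} \<inter> {0..x} = {0..x}" using assms by auto
    finally show ?thesis by (simp add: J_def)
  qed
  then have "\<bar>J f x\<bar> \<le> L2norm (\<lambda>y. indicator {0..x} y) * L2norm f"
    using ip_CS[OF i assms(1)] by simp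
  also have "\<dots> \<le> 1 * L2norm f"
    by (intro mult_right_mono L2norm_le_sup i L2norm_nonneg) (auto simp: indicator_def)
  finally show ?thesis by simp
qed

lemma L2norm_J: "continuous_on {0..1} f \<Longrightarrow> L2norm (J f) \<le> L2norm f"
  by (rule L2norm_le_sup) (auto intro: J_bound bm_continuous L2norm_nonneg wd_bm(1)[OF wd_J])

section \<open>Piecewise linear functions given by nodal values\<close>

declare of_nat_Suc [simp del]

text \<open>The minimum puts the point 1 into the last cell; every other node belongs to the cell on
  its right.\<close>

definition cell :: "nat \<Rightarrow> real \<Rightarrow> nat" where
  "cell N x = min (N - 1) (nat \<lfloor>real N * x\<rfloor>)"

text \<open>Nodal values are indexed from 0: \<open>a i\<close> belongs to the point
  \<open>i / N\<close>, so indices are one less than those of \<open>node\<close>. Coefficient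
  sequences instead of functions make the unknowns of the discrete problem explicit; for
  \<open>0 < N\<close> only the entries up to \<open>N\<close> matter.\<close>

definition pl :: "nat \<Rightarrow> (nat \<Rightarrow> real) \<Rightarrow> real \<Rightarrow> real" where
  "pl N a x = a (cell N x) + (a (Suc (cell N x)) - a (cell N x)) * (real N * x - real (cell N x))"

definition dpl :: "nat \<Rightarrow> (nat \<Rightarrow> real) \<Rightarrow> real \<Rightarrow> real" where
  "dpl N a x = real N * (a (Suc (cell N x)) - a (cell N x))"

definition nod :: "nat \<Rightarrow> (real \<Rightarrow> real) \<Rightarrow> nat \<Rightarrow> real" where
  "nod N v i = v (real i / real N)"

lemma cell_eq:
  assumes "j < N" "real j / real N \<le> x" "x < real (Suc j) / real N"
  shows "cell N x = j"
proof -
  have "real j \<le> real N * x" "real N * x < real j + 1"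
    using assms by (auto simp: field_simps)
  then have "\<lfloor>real N * x\<rfloor> = int j" by (intro floor_unique) auto
  then show ?thesis using assms by (simp add: cell_def)
qed

lemma cell_less: "0 < N \<Longrightarrow> cell N x < N"
  by (simp add: cell_def)

lemma cell_right:
  assumes "j < N"
  shows "cell N (real (Suc j) / real N) = (if Suc j < N then Suc j else j)"
proof -
  have "real N * (real (Suc j) / real N) = real (Suc j)" using assms by simp
  then have "\<lfloor>real N * (real (Suc j) / real N)\<rfloor> = int (Suc j)" by (metis floor_of_nat)
  then show ?thesis using assms unfolding cell_def by auto
qed

lemma cell_mem:
  assumes "0 < N" "x \<in> {0..1}"
  shows "x \<in> {real (cell N x) / real N..real (Suc (cell N x)) / real N}"
proof (cases "x = 1")
  case True
  then have "cell N x = N - 1" using assms by (simp add: cell_def)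
  then show ?thesis using assms True by (auto simp: of_nat_diff field_simps)
next
  case False
  then have x: "real N * x < real N" "0 \<le> real N * x" using assms by (auto simp: mult_less_cancel_left2)
  then have "nat \<lfloor>real N * x\<rfloor> < N" by linarith
  then have c: "real (cell N x) = of_int \<lfloor>real N * x\<rfloor>" using x by (simp add: cell_def)
  have "real (cell N x) \<le> real N * x" "real N * x \<le> real (Suc (cell N x))"
    using c x by (auto simp: cell_def) linarith+
  then show ?thesis using assms by (auto simp: field_simps)
qed

lemma cell_subset:
  assumes "j < N" shows "{real j / real N..real (Suc j) / real N} \<subseteq> {0..1}"
proof -
  have "real (Suc j) / real N \<le> 1" "0 \<le> real j / real N" using assms by auto
  then show ?thesis by auto
qed

lemma pl_on:
  assumes "j < N" "x \<in> {real j / real N..real (Suc j) / real N}"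
  shows "pl N a x = a j + (a (Suc j) - a j) * (real N * x - real j)"
proof (cases "x < real (Suc j) / real N")
  case True
  then show ?thesis using assms cell_eq[of j N x] by (simp add: pl_def)
next
  case False
  then have x: "x = real (Suc j) / real N" using assms by simp
  have n: "real N * x = real (Suc j)" using x assms by simp
  \<comment> \<open>A right end point other than 1 lies in the next cell, but the formulas of both
    cells give \<open>a (Suc j)\<close> there.\<close>
  show ?thesis using cell_right[OF assms(1)] unfolding pl_def n x[symmetric]
    by (auto simp: of_nat_Suc)
qed

lemma dpl_on:
  assumes "j < N" "x \<in> {real j / real N..<real (Suc j) / real N}"
  shows "dpl N a x = real N * (a (Suc j) - a j)"
  using assms cell_eq[of j N x] by (simp add: dpl_def)

lemma pl_node: "j \<le> N \<Longrightarrow> 0 < N \<Longrightarrow> pl N a (real j / real N) = a j"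
proof (cases "j = N")
  case True
  assume "0 < N"
  then have "real N / real N \<in> {real (N - 1) / real N..real (Suc (N - 1)) / real N}" by (auto simp: field_simps)
  from pl_on[OF _ this, of a] show ?thesis using \<open>0 < N\<close> True by (simp add: of_nat_diff of_nat_Suc)
next
  case False
  assume "j \<le> N" "0 < N"
  then have "real j / real N \<in> {real j / real N..real (Suc j) / real N}" by (auto simp: field_simps)
  from pl_on[OF _ this, of a] show ?thesis using \<open>j \<le> N\<close> \<open>0 < N\<close> False by simp
qed

lemma pl_0: "0 < N \<Longrightarrow> pl N a 0 = a 0"
  using pl_node[of 0 N a] by simp

lemma pl_1: "0 < N \<Longrightarrow> pl N a 1 = a N"
  using pl_node[of N N a] by simp

lemma pl_add: "pl N (\<lambda>i. a i + b i) x = pl N a x + pl N b x"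
  by (simp add: pl_def algebra_simps)

lemma pl_cmult: "pl N (\<lambda>i. c * a i) x = c * pl N a x"
  by (simp add: pl_def algebra_simps)

lemma pl_diff: "pl N (\<lambda>i. a i - b i) x = pl N a x - pl N b x"
  by (simp add: pl_def algebra_simps)

lemma dpl_add: "dpl N (\<lambda>i. a i + b i) x = dpl N a x + dpl N b x"
  by (simp add: dpl_def algebra_simps)

lemma dpl_cmult: "dpl N (\<lambda>i. c * a i) x = c * dpl N a x"
  by (simp add: dpl_def algebra_simps)

lemma dpl_diff: "dpl N (\<lambda>i. a i - b i) x = dpl N a x - dpl N b x"
  by (simp add: dpl_def algebra_simps)

lemma pl_zero: "pl N (\<lambda>i. 0) x = 0"
  by (simp add: pl_def)

lemma dpl_zero: "dpl N (\<lambda>i. 0) x = 0"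
  by (simp add: dpl_def)

lemma pl_const: "pl N (\<lambda>i. c) x = c"
  by (simp add: pl_def)

lemma dpl_const: "dpl N (\<lambda>i. c) x = 0"
  by (simp add: dpl_def)

lemma pl_sum: "pl N (\<lambda>i. \<Sum>k\<in>K. a k i) x = (\<Sum>k\<in>K. pl N (a k) x)"
  by (induction K rule: infinite_finite_induct) (auto simp: pl_zero pl_add)

lemma dpl_sum: "dpl N (\<lambda>i. \<Sum>k\<in>K. a k i) x = (\<Sum>k\<in>K. dpl N (a k) x)"
  by (induction K rule: infinite_finite_induct) (auto simp: dpl_zero dpl_add)

lemma pl_cong: "0 < N \<Longrightarrow> (\<And>i. i \<le> N \<Longrightarrow> a i = b i) \<Longrightarrow> pl N a = pl N b"
  using cell_less[of N] by (auto simp: pl_def Suc_le_eq less_imp_le)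

lemma dpl_cong: "0 < N \<Longrightarrow> (\<And>i. i \<le> N \<Longrightarrow> a i = b i) \<Longrightarrow> dpl N a = dpl N b"
  using cell_less[of N] by (auto simp: dpl_def Suc_le_eq less_imp_le)

lemma pl_sup:
  assumes "0 < N" "\<And>i. i \<le> N \<Longrightarrow> \<bar>a i\<bar> \<le> B" "x \<in> {0..1}"
  shows "\<bar>pl N a x\<bar> \<le> B"
proof -
  define j where "j = cell N x"
  define s where "s = real N * x - real j"
  have j: "j < N" using assms by (simp add: j_def cell_less)
  have s: "0 \<le> s" "s \<le> 1" using cell_mem[OF assms(1,3)] assms(1) by (auto simp: s_def j_def field_simps)
  have "pl N a x = (1 - s) * a j + s * a (Suc j)"
    by (simp add: pl_def j_def s_def algebra_simps)
  also have "\<bar>\<dots>\<bar> \<le> (1 - s) * B + s * B"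
    using s j assms(2)[of j] assms(2)[of "Suc j"]
    by (intro order.trans[OF abs_triangle_ineq] add_mono) (auto simp: abs_mult intro!: mult_left_mono)
  finally show ?thesis by (simp add: algebra_simps)
qed

lemma dpl_sup:
  assumes "0 < N" "\<And>i. i < N \<Longrightarrow> \<bar>real N * (a (Suc i) - a i)\<bar> \<le> B"
  shows "\<bar>dpl N a x\<bar> \<le> B"
  using assms(2)[OF cell_less[OF assms(1)]] by (simp add: dpl_def)

lemma dpl_bm: assumes "0 < N" shows "dpl N a \<in> bm"
proof -
  have "(\<lambda>k. real N * (a (Suc (min (N - 1) (nat k))) - a (min (N - 1) (nat k)))) \<circ> (\<lambda>x. \<lfloor>real N * x\<rfloor>) \<in> borel_measurable borel"
    by (rule measurable_comp[of _ _ "count_space UNIV"]) simp_all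
  then have "dpl N a \<in> borel_measurable borel"
    unfolding dpl_def[abs_def] cell_def comp_def .
  then have "(\<lambda>x. indicator {0..1} x * dpl N a x) \<in> borel_measurable borel"
    by (intro borel_measurable_times) auto
  moreover have "\<forall>x\<in>{0..1}. \<bar>dpl N a x\<bar> \<le> (\<Sum>i<N. \<bar>real N * (a (Suc i) - a i)\<bar>)"
    by (intro ballI dpl_sup assms member_le_sum[of _ "{..<N}" "\<lambda>i. \<bar>real N * (a (Suc i) - a i)\<bar>"]) auto
  ultimately show ?thesis by (auto simp: bm_def)
qed

lemma unit_cells: assumes "0 < N" shows "{0..1} = (\<Union>j<N. {real j / real N..real (Suc j) / real N})"
  using cell_mem[OF assms] cell_less[OF assms] cell_subset[of _ N] by blast

lemma pl_continuous: assumes "0 < N" shows "continuous_on {0..1} (pl N a)"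
  unfolding unit_cells[OF assms]
proof (rule continuous_on_closed_Union)
  fix j assume j: "j \<in> {..<N}"
  have "continuous_on {real j / real N..real (Suc j) / real N} (\<lambda>x. a j + (a (Suc j) - a j) * (real N * x - real j))"
    by (intro continuous_intros)
  then show "continuous_on {real j / real N..real (Suc j) / real N} (pl N a)"
    by (rule continuous_on_eq) (use pl_on[of j N] j in auto)
qed auto

lemma wd_pl: assumes "0 < N" shows "wd (pl N a) (dpl N a)"
  unfolding wd_def
proof (intro conjI exI ballI)
  show "finite ((\<lambda>i. real i / real N) ` {..N})" by auto
  fix x :: real assume x: "x \<in> {0<..<1} - (\<lambda>i. real i / real N) ` {..N}"
  define j where "j = cell N x"
  have j: "j < N" using assms by (simp add: j_def cell_less)
  have m: "x \<in> {real j / real N..real (Suc j) / real N}" using cell_mem[OF assms, of x] x by (simp add: j_def)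
  moreover have "x \<noteq> real j / real N" "x \<noteq> real (Suc j) / real N"
    using x j by (fastforce simp: image_iff Suc_le_eq)+
  ultimately have x2: "x \<in> {real j / real N<..<real (Suc j) / real N}" by simp
  have "((\<lambda>x. a j + (a (Suc j) - a j) * (real N * x - real j)) has_real_derivative dpl N a x) (at x)"
    using x2 j by (subst dpl_on[of j]) (auto intro!: derivative_eq_intros)
  then show "(pl N a has_real_derivative dpl N a x) (at x)"
    by (rule has_field_derivative_transform_within_open[OF _ _ x2]) (use pl_on[OF j] in auto)
qed (auto intro: pl_continuous dpl_bm assms)

lemma pl_bm: "0 < N \<Longrightarrow> pl N a \<in> bm"
  using wd_bm(1)[OF wd_pl] by blast

section \<open>Integration cell by cell and inverse inequalities\<close>

lemma integral_cells_upto: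
  assumes "0 < N" "f \<in> bm" "n \<le> N"
  shows "integral {0..real n / real N} f = (\<Sum>j<n. integral {real j / real N..real (Suc j) / real N} f)"
  using assms(3)
proof (induction n)
  case (Suc n)
  have "real (Suc n) / real N \<le> 1" using Suc.prems by simp
  then have "integral {0..real n / real N} f + integral {real n / real N..real (Suc n) / real N} f
      = integral {0..real (Suc n) / real N} f"
    using Suc.prems assms(1,2)
    by (intro Henstock_Kurzweil_Integration.integral_combine bm_integrable) (auto simp: divide_right_mono)
  then show ?case using Suc by simp
qed simp

lemma integral_cells:
  assumes "0 < N" "f \<in> bm"
  shows "integral {0..1} f = (\<Sum>j<N. integral {real j / real N..real (Suc j) / real N} f)"
  using integral_cells_upto[OF assms order.refl] assms(1) by simp

text \<open>The comparison is required on the open cell only, since \<open>dpl\<close> jumps at the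
  end points.\<close>

lemma integral_cell_le:
  assumes "f \<in> bm" "g \<in> bm" "j < N"
    "\<And>x. x \<in> {real j / real N<..<real (Suc j) / real N} \<Longrightarrow> f x \<le> g x"
  shows "integral {real j / real N..real (Suc j) / real N} f \<le> integral {real j / real N..real (Suc j) / real N} g"
proof -
  have *: "f integrable_on {real j / real N..real (Suc j) / real N}" if "f \<in> bm" for f
    using that assms(3) by (intro bm_integrable) auto
  have "integral {real j / real N<..<real (Suc j) / real N} f \<le> integral {real j / real N<..<real (Suc j) / real N} g"
    by (intro integral_le) (use assms *[of f] *[of g] in \<open>auto simp: integrable_on_open_interval_real\<close>)
  then show ?thesis by (simp add: integral_open_interval_real)
qed

lemma integral_cell_const: "0 < N \<Longrightarrow> integral {real j / real N..real (Suc j) / real N} (\<lambda>x. c) = c / real N"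
  by (simp add: field_simps of_nat_Suc)

lemma integral_cell_abs_le:
  assumes "f \<in> bm" "j < N"
    "\<And>x. x \<in> {real j / real N<..<real (Suc j) / real N} \<Longrightarrow> \<bar>f x\<bar> \<le> c"
  shows "\<bar>integral {real j / real N..real (Suc j) / real N} f\<bar> \<le> c / real N"
proof -
  have "integral {real j / real N..real (Suc j) / real N} f \<le> c / real N"
    using integral_cell_le[OF assms(1) bm_const[of c] assms(2)] assms integral_cell_const[of N j c] by fastforce
  moreover have "(-c) / real N \<le> integral {real j / real N..real (Suc j) / real N} f"
    using integral_cell_le[OF bm_const[of "-c"] assms(1) assms(2)] assms integral_cell_const[of N j "-c"] by fastforce
  ultimately show ?thesis by simp
qed

lemma ip_step_bound:
  assumes "0 < N" "f \<in> bm"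
    "\<And>j x. j < N \<Longrightarrow> x \<in> {real j / real N<..<real (Suc j) / real N} \<Longrightarrow> (f x)\<^sup>2 \<le> c j"
  shows "ip f f \<le> (\<Sum>j<N. c j) / real N"
proof -
  have *: "integral {real j / real N..real (Suc j) / real N} (\<lambda>x. f x * f x) \<le> c j / real N" if "j < N" for j
    by (rule order.trans[OF abs_ge_self integral_cell_abs_le])
      (use assms that in \<open>auto intro!: bm_mult simp: power2_eq_square abs_mult\<close>)
  have "ip f f = (\<Sum>j<N. integral {real j / real N..real (Suc j) / real N} (\<lambda>x. f x * f x))"
    using assms by (simp add: ip_integral integral_cells bm_mult)
  also have "\<dots> \<le> (\<Sum>j<N. c j / real N)"
    by (intro sum_mono *) auto
  finally show ?thesis by (simp add: sum_divide_distrib)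
qed

lemma integral_cell_dpl:
  assumes "j < N" "f \<in> bm"
  shows "integral {real j / real N..real (Suc j) / real N} (\<lambda>x. f x * dpl N c x) =
     real N * (c (Suc j) - c j) * integral {real j / real N..real (Suc j) / real N} f"
proof -
  have "integral {real j / real N<..<real (Suc j) / real N} (\<lambda>x. f x * dpl N c x) =
     integral {real j / real N<..<real (Suc j) / real N} (\<lambda>x. real N * (c (Suc j) - c j) * f x)"
    by (intro integral_cong) (use dpl_on[OF assms(1)] in auto)
  then show ?thesis by (simp add: integral_open_interval_real)
qed

lemma ip_dpl:
  assumes "0 < N" "f \<in> bm"
  shows "ip f (dpl N c) = (\<Sum>j<N. real N * (c (Suc j) - c j) * integral {real j / real N..real (Suc j) / real N} f)"
  using assms by (simp add: ip_integral dpl_bm integral_cells bm_mult integral_cell_dpl)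

text \<open>\<open>dpl N c\<close> is constant on each cell, so only the increments of
  \<open>e\<close> over the cells enter, and these vanish. Applied with \<open>e\<close> an
  interpolation error.\<close>

lemma ip_orth_dpl:
  assumes "0 < N" "wd e e'" "\<And>j. j \<le> N \<Longrightarrow> e (real j / real N) = 0"
  shows "ip e' (dpl N c) = 0"
  unfolding ip_dpl[OF assms(1) wd_bm(2)[OF assms(2)]]
proof (intro sum.neutral ballI)
  fix j assume j: "j \<in> {..<N}"
  then have "integral {real j / real N..real (Suc j) / real N} e' = e (real (Suc j) / real N) - e (real j / real N)"
    by (intro wd_FTC[OF assms(2)]) (auto simp: divide_right_mono)
  then show "real N * (c (Suc j) - c j) * integral {real j / real N..real (Suc j) / real N} e' = 0"
    using assms(3)[of j] assms(3)[of "Suc j"] j by simp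
qed

lemma ip_dpl_dpl:
  assumes "0 < N"
  shows "ip (dpl N c) (dpl N c) = (\<Sum>j<N. real N * (c (Suc j) - c j)\<^sup>2)"
  unfolding ip_dpl[OF assms dpl_bm[OF assms]]
proof (intro sum.cong refl)
  fix j assume j: "j \<in> {..<N}"
  then have "integral {real j / real N..real (Suc j) / real N} (dpl N c) = pl N c (real (Suc j) / real N) - pl N c (real j / real N)"
    by (intro wd_FTC[OF wd_pl[OF assms]]) (auto simp: divide_right_mono)
  also have "\<dots> = c (Suc j) - c j" using j by (simp only: pl_node lessThan_iff Suc_leI less_imp_le assms)
  finally show "real N * (c (Suc j) - c j) * integral {real j / real N..real (Suc j) / real N} (dpl N c) = real N * (c (Suc j) - c j)\<^sup>2"
    by (simp add: power2_eq_square)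
qed

text \<open>With end values \<open>p\<close> and \<open>q\<close> the integral equals
  \<open>(p^2 + p q + q^2) / (3 N)\<close>, and the numerator is at least
  \<open>(p^2 + q^2) / 2\<close> because \<open>(p + q)^2\<close> is non-negative.\<close>

lemma integral_cell_pl_sq:
  assumes "j < N"
  shows "((a j)\<^sup>2 + (a (Suc j))\<^sup>2) / (6 * real N) \<le>
     integral {real j / real N..real (Suc j) / real N} (\<lambda>x. pl N a x * pl N a x)"
proof -
  define d where "d = a (Suc j) - a j"
  define F where "F x = (a j)\<^sup>2 * x + a j * d * (real N * x - real j)\<^sup>2 / real N
     + d\<^sup>2 * (real N * x - real j)^3 / (3 * real N)" for x
  have n: "real N > 0" using assms by simp
  have "((\<lambda>x. (a j + d * (real N * x - real j))\<^sup>2) has_integral F (real (Suc j) / real N) - F (real j / real N))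
     {real j / real N..real (Suc j) / real N}"
  proof (rule fundamental_theorem_of_calculus)
    fix x
    have "(F has_real_derivative (a j + d * (real N * x - real j))\<^sup>2) (at x within {real j / real N..real (Suc j) / real N})"
      unfolding F_def using n
      by (auto intro!: derivative_eq_intros simp: power2_eq_square field_simps)
    then show "(F has_vector_derivative (a j + d * (real N * x - real j))\<^sup>2) (at x within {real j / real N..real (Suc j) / real N})"
      by (simp add: has_real_derivative_iff_has_vector_derivative)
  qed (auto simp: divide_right_mono)
  then have i: "integral {real j / real N..real (Suc j) / real N} (\<lambda>x. (a j + d * (real N * x - real j))\<^sup>2)
     = F (real (Suc j) / real N) - F (real j / real N)" by (rule integral_unique)
  have "integral {real j / real N..real (Suc j) / real N} (\<lambda>x. pl N a x * pl N a x)
    = integral {real j / real N..real (Suc j) / real N} (\<lambda>x. (a j + d * (real N * x - real j))\<^sup>2)"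
    by (intro integral_cong) (simp add: pl_on[OF assms] d_def power2_eq_square)
  also have "\<dots> = ((a j)\<^sup>2 + a j * d + d\<^sup>2 / 3) / real N"
    unfolding i F_def using n by (simp add: field_simps of_nat_Suc)
  finally have *: "integral {real j / real N..real (Suc j) / real N} (\<lambda>x. pl N a x * pl N a x) = ((a j)\<^sup>2 + a j * d + d\<^sup>2 / 3) / real N" .
  have "0 \<le> (a j + a (Suc j))\<^sup>2" by simp
  then have "((a j)\<^sup>2 + (a (Suc j))\<^sup>2) / 6 \<le> (a j)\<^sup>2 + a j * d + d\<^sup>2 / 3"
    by (simp add: d_def power2_eq_square field_simps)
  then have "((a j)\<^sup>2 + (a (Suc j))\<^sup>2) / 6 / real N \<le> ((a j)\<^sup>2 + a j * d + d\<^sup>2 / 3) / real N"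
    using n by (intro divide_right_mono) auto
  then show ?thesis using * by simp
qed

lemma pl_lower:
  assumes "0 < N"
  shows "(\<Sum>j<N. (a j)\<^sup>2 + (a (Suc j))\<^sup>2) \<le> 6 * real N * ip (pl N a) (pl N a)"
proof -
  have "(\<Sum>j<N. ((a j)\<^sup>2 + (a (Suc j))\<^sup>2) / (6 * real N)) \<le> ip (pl N a) (pl N a)"
    using assms by (auto simp: ip_integral pl_bm integral_cells bm_mult intro!: integral_cell_pl_sq sum_mono)
  then show ?thesis using assms by (simp add: sum_divide_distrib[symmetric] field_simps)
qed

lemma pl_node_sq: assumes "0 < N" "j \<le> N" shows "(a j)\<^sup>2 \<le> 6 * real N * ip (pl N a) (pl N a)"
proof -
  have "(a j)\<^sup>2 \<le> (\<Sum>j<N. (a j)\<^sup>2 + (a (Suc j))\<^sup>2)"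
  proof (cases "j < N")
    case True
    then have "(a j)\<^sup>2 + (a (Suc j))\<^sup>2 \<le> (\<Sum>j<N. (a j)\<^sup>2 + (a (Suc j))\<^sup>2)"
      by (intro member_le_sum[of _ _ "\<lambda>j. (a j)\<^sup>2 + (a (Suc j))\<^sup>2"]) auto
    then show ?thesis by (smt (verit) zero_le_power2)
  next
    case False
    then have "(a (N-1))\<^sup>2 + (a (Suc (N-1)))\<^sup>2 \<le> (\<Sum>j<N. (a j)\<^sup>2 + (a (Suc j))\<^sup>2)"
      using assms by (intro member_le_sum[of _ _ "\<lambda>j. (a j)\<^sup>2 + (a (Suc j))\<^sup>2"]) auto
    moreover have "Suc (N - 1) = j" using False assms by simp
    ultimately show ?thesis by (smt (verit) zero_le_power2)
  qed
  then show ?thesis using pl_lower[OF assms(1), of a] by simp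
qed

text \<open>The loss \<open>sqrt N\<close> of this inverse inequality is what separates the order
  3/2 from the order 2. The constant 3 is sqrt 6 rounded up.\<close>

lemma pl_node_bound: assumes "0 < N" "j \<le> N" shows "\<bar>a j\<bar> \<le> 3 * sqrt (real N) * L2norm (pl N a)"
proof -
  have "(a j)\<^sup>2 \<le> 9 * real N * ip (pl N a) (pl N a)"
    using pl_node_sq[OF assms, of a] ip_self_nonneg[of "pl N a"]
    by (smt (verit) mult_right_mono of_nat_0_le_iff mult_nonneg_nonneg)
  then have "sqrt ((a j)\<^sup>2) \<le> sqrt (9 * real N * ip (pl N a) (pl N a))" by (rule real_sqrt_le_mono)
  then show ?thesis by (simp add: real_sqrt_mult L2norm_def)
qed

lemma dpl_node_bound: assumes "0 < N" "j < N" shows "\<bar>real N * (a (Suc j) - a j)\<bar> \<le> sqrt (real N) * L2norm (dpl N a)"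
proof -
  have "real N * (a (Suc j) - a j)\<^sup>2 \<le> ip (dpl N a) (dpl N a)"
    unfolding ip_dpl_dpl[OF assms(1)]
    using assms by (intro member_le_sum[of _ _ "\<lambda>j. real N * (a (Suc j) - a j)\<^sup>2"]) auto
  then have "real N * (real N * (a (Suc j) - a j)\<^sup>2) \<le> real N * ip (dpl N a) (dpl N a)"
    by (intro mult_left_mono) auto
  then have "(real N * (a (Suc j) - a j))\<^sup>2 \<le> real N * ip (dpl N a) (dpl N a)"
    by (simp add: power2_eq_square algebra_simps)
  then have "sqrt ((real N * (a (Suc j) - a j))\<^sup>2) \<le> sqrt (real N * ip (dpl N a) (dpl N a))" by (rule real_sqrt_le_mono)
  then show ?thesis by (simp add: real_sqrt_mult L2norm_def)
qed

lemma sq_cell_diff: "(y - x)\<^sup>2 \<le> 2 * (x\<^sup>2 + y\<^sup>2)" for x y :: real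
  using zero_le_power2[of "x + y"] by (simp add: power2_eq_square algebra_simps)

text \<open>Slopes are scaled differences of nodal values, and \<open>pl_lower\<close> controls the
  squares of the latter. The constant 4 is sqrt 12 rounded up.\<close>

lemma inverse_ineq: assumes "0 < N" shows "L2norm (dpl N a) \<le> 4 * real N * L2norm (pl N a)"
proof (rule power2_le_imp_le)
  have "ip (dpl N a) (dpl N a) = real N * (\<Sum>j<N. (a (Suc j) - a j)\<^sup>2)"
    by (simp add: ip_dpl_dpl[OF assms] sum_distrib_left)
  also have "\<dots> \<le> real N * (\<Sum>j<N. 2 * ((a j)\<^sup>2 + (a (Suc j))\<^sup>2))"
    by (intro mult_left_mono sum_mono sq_cell_diff) auto
  also have "\<dots> = real N * (2 * (\<Sum>j<N. (a j)\<^sup>2 + (a (Suc j))\<^sup>2))"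
    by (simp only: sum_distrib_left)
  also have "\<dots> \<le> real N * (2 * (6 * real N * ip (pl N a) (pl N a)))"
    by (intro mult_left_mono pl_lower assms) auto
  also have "\<dots> \<le> 16 * (real N)\<^sup>2 * ip (pl N a) (pl N a)"
    using mult_right_mono[of 12 16 "(real N)\<^sup>2 * ip (pl N a) (pl N a)"] ip_self_nonneg[of "pl N a"]
    by (simp add: power2_eq_square algebra_simps)
  finally show "(L2norm (dpl N a))\<^sup>2 \<le> (4 * real N * L2norm (pl N a))\<^sup>2"
    by (simp add: L2norm_sq power_mult_distrib)
qed (simp add: L2norm_nonneg)

section \<open>Errors of nodal interpolation\<close>

text \<open>Rolle's theorem makes the error of the slope at most the oscillation of the derivative.\<close>

lemma linear_interp_error:
  fixes v v' :: "real \<Rightarrow> real"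
  assumes "a < b" "continuous_on {a..b} v"
    and d: "\<And>x. a < x \<Longrightarrow> x < b \<Longrightarrow> (v has_real_derivative v' x) (at x)"
    and osc: "\<And>x y. a < x \<Longrightarrow> x < b \<Longrightarrow> a < y \<Longrightarrow> y < b \<Longrightarrow> \<bar>v' x - v' y\<bar> \<le> L"
  shows "\<And>x. x \<in> {a<..<b} \<Longrightarrow> \<bar>v' x - (v b - v a) / (b - a)\<bar> \<le> L"
    and "\<And>x. x \<in> {a..b} \<Longrightarrow> \<bar>v x - (v a + (v b - v a) / (b - a) * (x - a))\<bar> \<le> L * (b - a)"
proof -
  obtain l z where z: "a < z" "z < b" "(v has_real_derivative l) (at z)" "v b - v a = (b - a) * l"
    using MVT[OF assms(1,2)] d by (metis real_differentiable_def)
  have "l = v' z" using z d[of z] DERIV_unique by blast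
  then have sl: "(v b - v a) / (b - a) = v' z" using z assms(1) by simp
  show 1: "\<bar>v' x - (v b - v a) / (b - a)\<bar> \<le> L" if "x \<in> {a<..<b}" for x
    using osc[of x z] that z sl by simp
  have L: "0 \<le> L" using osc[of z z] z by simp
  show "\<bar>v x - (v a + (v b - v a) / (b - a) * (x - a))\<bar> \<le> L * (b - a)" if x: "x \<in> {a..b}" for x
  proof (cases "x = a")
    case True
    then show ?thesis using L assms(1) by simp
  next
    case False
    then have ax: "a < x" using x by simp
    have "continuous_on {a..x} v" using assms(2) x by (auto intro: continuous_on_subset)
    moreover have "v differentiable at y" if "a < y" "y < x" for y
      using d[of y] that x by (auto simp: real_differentiable_def)
    ultimately obtain l y where y: "a < y" "y < x" "(v has_real_derivative l) (at y)" "v x - v a = (x - a) * l"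
      using MVT[OF ax] by blast
    have l: "l = v' y" using y d[of y] x DERIV_unique by fastforce
    have "v x - (v a + (v b - v a) / (b - a) * (x - a)) = (v' y - v' z) * (x - a)"
      using y(4) l sl by (simp add: algebra_simps)
    also have "\<bar>\<dots>\<bar> \<le> L * (b - a)"
      using osc[of y z] y z x L by (auto simp: abs_mult intro!: mult_mono)
    finally show ?thesis .
  qed
qed

lemma pl_nod_on:
  assumes "j < N" "x \<in> {real j / real N..real (Suc j) / real N}"
  shows "pl N (nod N v) x = v (real j / real N) + (v (real (Suc j) / real N) - v (real j / real N)) /
     (real (Suc j) / real N - real j / real N) * (x - real j / real N)"
proof -
  have n: "real (Suc j) / real N - real j / real N = 1 / real N" using assms by (simp add: field_simps)
  show ?thesis unfolding pl_on[OF assms] n nod_def using assms(1) by (simp add: field_simps)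
qed

lemma interp_cell_error:
  assumes "j < N" "continuous_on {0..1} v"
    and d: "\<And>x. x \<in> {0<..<1} \<Longrightarrow> (v has_real_derivative v' x) (at x)"
    and osc: "\<And>x y. x \<in> {real j / real N<..<real (Suc j) / real N} \<Longrightarrow> y \<in> {real j / real N<..<real (Suc j) / real N} \<Longrightarrow> \<bar>v' x - v' y\<bar> \<le> L"
  shows "\<And>x. x \<in> {real j / real N<..<real (Suc j) / real N} \<Longrightarrow> \<bar>v' x - dpl N (nod N v) x\<bar> \<le> L"
    and "\<And>x. x \<in> {real j / real N..real (Suc j) / real N} \<Longrightarrow> \<bar>v x - pl N (nod N v) x\<bar> \<le> L / real N"
proof -
  have n: "real (Suc j) / real N - real j / real N = 1 / real N" using assms by (simp add: field_simps)
  have lt: "real j / real N < real (Suc j) / real N" using assms by (simp add: divide_strict_right_mono)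
  have sub: "{real j / real N..real (Suc j) / real N} \<subseteq> {0..1}" by (rule cell_subset[OF assms(1)])
  then have sub0: "0 \<le> real j / real N" "real (Suc j) / real N \<le> 1" using lt by auto
  have d': "(v has_real_derivative v' x) (at x)" if "real j / real N < x" "x < real (Suc j) / real N" for x
  proof -
    have "0 < x" "x < 1" using that sub0 by linarith+
    then show ?thesis by (intro d) auto
  qed
  note le = linear_interp_error[OF lt continuous_on_subset[OF assms(2) sub] d', of L]
  show "\<bar>v' x - dpl N (nod N v) x\<bar> \<le> L" if "x \<in> {real j / real N<..<real (Suc j) / real N}" for x
    using le(1)[of x] that osc unfolding n by (subst dpl_on[OF assms(1)]) (auto simp: nod_def mult.commute)
  show "\<bar>v x - pl N (nod N v) x\<bar> \<le> L / real N" if "x \<in> {real j / real N..real (Suc j) / real N}" for x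
    using le(2)[of x] that osc unfolding pl_nod_on[OF assms(1) that] n by auto
qed

lemma cell_point:
  assumes "j < N" "x \<in> {real j / real N<..<real (Suc j) / real N}"
  shows "x \<in> {0<..<1}"
proof -
  have "real (Suc j) / real N \<le> 1" "0 \<le> real j / real N" using assms by auto
  then show ?thesis using assms(2) unfolding greaterThanLessThan_iff by linarith
qed

lemma cell_diam:
  assumes "x \<in> {real j / real N..real (Suc j) / real N}" "y \<in> {real j / real N..real (Suc j) / real N}"
  shows "\<bar>x - y\<bar> \<le> 1 / real N"
proof -
  have "real (Suc j) / real N = real j / real N + 1 / real N"
    by (simp add: of_nat_Suc add_divide_distrib)
  then show ?thesis using assms unfolding atLeastAtMost_iff by linarith
qed

text \<open>Phrased with a Lipschitz bound for the first derivative, so that it covers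
  \<open>C^2\<close> data such as \<open>\<eta>_t\<close>.\<close>

lemma interp_sup:
  assumes "0 < N" "continuous_on {0..1} v"
    and d: "\<And>x. x \<in> {0<..<1} \<Longrightarrow> (v has_real_derivative v' x) (at x)"
    and lip: "\<And>x y. x \<in> {0<..<1} \<Longrightarrow> y \<in> {0<..<1} \<Longrightarrow> \<bar>v' x - v' y\<bar> \<le> B * \<bar>x - y\<bar>"
    and B: "0 \<le> B"
  shows "x \<in> {0..1} \<Longrightarrow> \<bar>v x - pl N (nod N v) x\<bar> \<le> B / (real N)\<^sup>2"
    and "v' \<in> bm \<Longrightarrow> L2norm (\<lambda>x. v' x - dpl N (nod N v) x) \<le> B / real N"
proof -
  have osc: "\<bar>v' x - v' y\<bar> \<le> B / real N"
    if "j < N" "x \<in> {real j / real N<..<real (Suc j) / real N}" "y \<in> {real j / real N<..<real (Suc j) / real N}" for j x y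
  proof -
    have "\<bar>v' x - v' y\<bar> \<le> B * \<bar>x - y\<bar>" using that by (intro lip cell_point)
    also have "\<dots> \<le> B * (1 / real N)" using that by (intro mult_left_mono B cell_diam[of _ j]) auto
    finally show ?thesis by simp
  qed
  show "\<bar>v x - pl N (nod N v) x\<bar> \<le> B / (real N)\<^sup>2" if "x \<in> {0..1}"
    using interp_cell_error(2)[OF cell_less[OF assms(1)] assms(2) d osc[OF cell_less[OF assms(1)]] cell_mem[OF assms(1) that]]
    by (simp add: power2_eq_square)
  show "L2norm (\<lambda>x. v' x - dpl N (nod N v) x) \<le> B / real N" if "v' \<in> bm"
  proof (rule power2_le_imp_le)
    have "ip (\<lambda>x. v' x - dpl N (nod N v) x) (\<lambda>x. v' x - dpl N (nod N v) x) \<le> (\<Sum>j<N. (B / real N)\<^sup>2) / real N"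
    proof (rule ip_step_bound)
      fix j x assume j: "j < N" "x \<in> {real j / real N<..<real (Suc j) / real N}"
      show "(v' x - dpl N (nod N v) x)\<^sup>2 \<le> (B / real N)\<^sup>2"
        using interp_cell_error(1)[OF j(1) assms(2) d osc[OF j(1)] j(2)] by (simp add: power2_le_iff_abs_le B)
    qed (use assms that in \<open>auto intro!: bm_intros dpl_bm\<close>)
    then show "(L2norm (\<lambda>x. v' x - dpl N (nod N v) x))\<^sup>2 \<le> (B / real N)\<^sup>2"
      using assms(1) by (simp add: L2norm_sq)
  qed (use B in simp)
qed

text \<open>For auxiliary functions whose second derivative is itself discrete. The error has to be
  measured by the L2 norm of that derivative, since its maximum would cost \<open>h^(-1/2)\<close>.
  On each cell the oscillation of \<open>v'\<close> is bounded by the two end values of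
  \<open>b\<close>, and \<open>pl_lower\<close> sums their squares.\<close>

lemma interp_L2:
  assumes "0 < N" "continuous_on {0..1} v" "continuous_on {0..1} v'"
    and d: "\<And>x. x \<in> {0<..<1} \<Longrightarrow> (v has_real_derivative v' x) (at x)"
    and d2: "\<And>x. x \<in> {0<..<1} \<Longrightarrow> (v' has_real_derivative pl N b x) (at x)"
  shows "L2norm (\<lambda>x. v x - pl N (nod N v) x) \<le> 4 / (real N)\<^sup>2 * L2norm (pl N b)"
    and "L2norm (\<lambda>x. v' x - dpl N (nod N v) x) \<le> 4 / real N * L2norm (pl N b)"
proof -
  define L where "L j = (\<bar>b j\<bar> + \<bar>b (Suc j)\<bar>) / real N" for j
  have osc: "\<bar>v' x - v' y\<bar> \<le> L j"
    if j: "j < N" and x: "x \<in> {real j / real N<..<real (Suc j) / real N}" and y: "y \<in> {real j / real N<..<real (Suc j) / real N}" for j x y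
  proof -
    have "norm (v' x - v' y) \<le> (\<bar>b j\<bar> + \<bar>b (Suc j)\<bar>) * norm (x - y)"
    proof (rule field_differentiable_bound[OF convex_real_interval(8)[of "real j / real N" "real (Suc j) / real N"] _ _ x y])
      fix z assume z: "z \<in> {real j / real N<..<real (Suc j) / real N}"
      show "(v' has_field_derivative pl N b z) (at z within {real j / real N<..<real (Suc j) / real N})"
        using d2[OF cell_point[OF j z]] by (rule has_field_derivative_at_within)
      define s where "s = real N * z - real j"
      have s: "0 \<le> s" "s \<le> 1" using z assms(1) by (auto simp: s_def field_simps of_nat_Suc)
      have "pl N b z = (1 - s) * b j + s * b (Suc j)"
        using pl_on[OF j, of z b] z by (simp add: s_def algebra_simps)
      also have "\<bar>\<dots>\<bar> \<le> 1 * \<bar>b j\<bar> + 1 * \<bar>b (Suc j)\<bar>"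
        using s by (intro order.trans[OF abs_triangle_ineq] add_mono) (auto simp: abs_mult intro!: mult_left_le_one_le)
      finally show "norm (pl N b z) \<le> \<bar>b j\<bar> + \<bar>b (Suc j)\<bar>" by simp
    qed
    also have "\<dots> \<le> (\<bar>b j\<bar> + \<bar>b (Suc j)\<bar>) * (1 / real N)"
      using x y cell_diam[of x j N y] by (intro mult_left_mono) auto
    finally show ?thesis by (simp add: L_def)
  qed
  have sumL: "(\<Sum>j<N. (L j)\<^sup>2) / real N \<le> 16 / (real N)\<^sup>2 * ip (pl N b) (pl N b)"
  proof -
    have "(L j)\<^sup>2 \<le> 2 / (real N)\<^sup>2 * ((b j)\<^sup>2 + (b (Suc j))\<^sup>2)" for j
    proof -
      have "(\<bar>b j\<bar> + \<bar>b (Suc j)\<bar>)\<^sup>2 \<le> 2 * ((b j)\<^sup>2 + (b (Suc j))\<^sup>2)"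
        using sq_cell_diff[of "\<bar>b j\<bar>" "-\<bar>b (Suc j)\<bar>"] by (simp add: power2_eq_square algebra_simps)
      then show ?thesis by (simp add: L_def power_divide divide_right_mono)
    qed
    then have "(\<Sum>j<N. (L j)\<^sup>2) / real N \<le> (\<Sum>j<N. 2 / (real N)\<^sup>2 * ((b j)\<^sup>2 + (b (Suc j))\<^sup>2)) / real N"
      by (intro divide_right_mono sum_mono) auto
    also have "\<dots> = 2 / (real N)\<^sup>2 / real N * (\<Sum>j<N. (b j)\<^sup>2 + (b (Suc j))\<^sup>2)"
      by (simp only: sum_distrib_left[symmetric]) simp
    also have "\<dots> \<le> 2 / (real N)\<^sup>2 / real N * (6 * real N * ip (pl N b) (pl N b))"
      by (intro mult_left_mono pl_lower assms(1)) auto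
    also have "\<dots> = 12 / (real N)\<^sup>2 * ip (pl N b) (pl N b)" using assms(1) by simp
    also have "\<dots> \<le> 16 / (real N)\<^sup>2 * ip (pl N b) (pl N b)"
      by (intro mult_right_mono divide_right_mono ip_self_nonneg) auto
    finally show ?thesis .
  qed
  have bm: "v \<in> bm" "v' \<in> bm" using assms by (auto intro: bm_continuous)
  have "ip (\<lambda>x. v' x - dpl N (nod N v) x) (\<lambda>x. v' x - dpl N (nod N v) x) \<le> (\<Sum>j<N. (L j)\<^sup>2) / real N"
  proof (rule ip_step_bound)
    fix j x assume j: "j < N" "x \<in> {real j / real N<..<real (Suc j) / real N}"
    have "0 \<le> L j" by (simp add: L_def)
    then show "(v' x - dpl N (nod N v) x)\<^sup>2 \<le> (L j)\<^sup>2"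
      using interp_cell_error(1)[OF j(1) assms(2) d osc[OF j(1)] j(2)] by (simp add: power2_le_iff_abs_le)
  qed (use assms bm in \<open>auto intro!: bm_intros dpl_bm\<close>)
  then have "ip (\<lambda>x. v' x - dpl N (nod N v) x) (\<lambda>x. v' x - dpl N (nod N v) x) \<le> (4 / real N * L2norm (pl N b))\<^sup>2"
    using sumL by (simp add: power_mult_distrib power_divide L2norm_sq)
  then show "L2norm (\<lambda>x. v' x - dpl N (nod N v) x) \<le> 4 / real N * L2norm (pl N b)"
    using power2_le_imp_le[of "L2norm (\<lambda>x. v' x - dpl N (nod N v) x)"] by (auto simp: L2norm_sq L2norm_nonneg)
  have "ip (\<lambda>x. v x - pl N (nod N v) x) (\<lambda>x. v x - pl N (nod N v) x) \<le> (\<Sum>j<N. (L j / real N)\<^sup>2) / real N"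
  proof (rule ip_step_bound)
    fix j x assume j: "j < N" "x \<in> {real j / real N<..<real (Suc j) / real N}"
    have "0 \<le> L j / real N" by (simp add: L_def)
    moreover have "x \<in> {real j / real N..real (Suc j) / real N}" using j by simp
    ultimately show "(v x - pl N (nod N v) x)\<^sup>2 \<le> (L j / real N)\<^sup>2"
      using interp_cell_error(2)[OF j(1) assms(2) d osc[OF j(1)], of x] by (simp add: power2_le_iff_abs_le)
  qed (use assms bm in \<open>auto intro!: bm_intros pl_bm\<close>)
  also have "\<dots> = (\<Sum>j<N. (L j)\<^sup>2) / real N / (real N)\<^sup>2"
    by (simp add: power_divide sum_divide_distrib mult.commute)
  also have "\<dots> \<le> 16 / (real N)\<^sup>2 * ip (pl N b) (pl N b) / (real N)\<^sup>2"
    by (intro divide_right_mono sumL) auto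
  also have "\<dots> = (4 / (real N)\<^sup>2 * L2norm (pl N b))\<^sup>2"
    by (simp add: power_mult_distrib power_divide L2norm_sq)
  finally show "L2norm (\<lambda>x. v x - pl N (nod N v) x) \<le> 4 / (real N)\<^sup>2 * L2norm (pl N b)"
    using power2_le_imp_le[of "L2norm (\<lambda>x. v x - pl N (nod N v) x)"] by (auto simp: L2norm_sq L2norm_nonneg)
qed

section \<open>Superconvergence on the uniform mesh\<close>

lemma Abel_sum:
  fixes c q :: "nat \<Rightarrow> real"
  shows "(\<Sum>j<Suc n. (c (Suc j) - c j) * q j) = c (Suc n) * q n - c 0 * q 0 - (\<Sum>j<n. c (Suc j) * (q (Suc j) - q j))"
  by (induction n) (auto simp: algebra_simps)

text \<open>Against a piecewise constant function only the cell integrals of \<open>f\<close> count,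
  and summation by parts moves the difference quotient from \<open>c\<close> to them. The two
  boundary terms are at most \<open>S Q h^3\<close> each, and the differences, fewer than
  \<open>N\<close> terms of size \<open>S Q h^4\<close>, add up to no more than that; the factor
  \<open>N\<close> of the slopes leaves \<open>h^2\<close>.\<close>

lemma ip_dpl_slowly_varying:
  assumes N: "0 < N" and f: "f \<in> bm" and Q: "0 \<le> Q"
    and q: "\<And>j. j < N \<Longrightarrow> \<bar>integral {real j / real N..real (Suc j) / real N} f\<bar> \<le> Q / real N ^ 3"
    and dq: "\<And>j. Suc j < N \<Longrightarrow> \<bar>integral {real (Suc j) / real N..real (Suc (Suc j)) / real N} f
        - integral {real j / real N..real (Suc j) / real N} f\<bar> \<le> Q / real N ^ 4"
    and c: "\<And>j. j \<le> N \<Longrightarrow> \<bar>c j\<bar> \<le> S"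
  shows "\<bar>ip f (dpl N c)\<bar> \<le> 3 * Q * S / (real N)\<^sup>2"
proof -
  obtain n where n: "N = Suc n" using N gr0_implies_Suc by blast
  define p where "p j = integral {real j / real N..real (Suc j) / real N} f" for j
  have S: "0 \<le> S" using c[of 0] by simp
  have r: "real N > 0" using N by simp
  have "ip f (dpl N c) = real N * (\<Sum>j<N. (c (Suc j) - c j) * p j)"
    by (simp add: ip_dpl[OF N f] p_def sum_distrib_left algebra_simps)
  also have "\<dots> = real N * (c N * p n - c 0 * p 0 - (\<Sum>j<n. c (Suc j) * (p (Suc j) - p j)))"
    unfolding n by (simp only: Abel_sum)
  finally have e: "ip f (dpl N c) = real N * (c N * p n - c 0 * p 0 - (\<Sum>j<n. c (Suc j) * (p (Suc j) - p j)))" .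
  have 1: "\<bar>c N * p n\<bar> \<le> S * (Q / real N ^ 3)" "\<bar>c 0 * p 0\<bar> \<le> S * (Q / real N ^ 3)"
    unfolding abs_mult p_def using n by (intro mult_mono c q S abs_ge_zero; simp)+
  have "\<bar>\<Sum>j<n. c (Suc j) * (p (Suc j) - p j)\<bar> \<le> (\<Sum>j<n. S * (Q / real N ^ 4))"
    by (intro sum_abs[THEN order.trans] sum_mono, unfold abs_mult p_def, intro mult_mono c dq S abs_ge_zero) (use n in auto)
  also have "\<dots> \<le> real N * (S * (Q / real N ^ 4))"
    unfolding sum_constant card_lessThan using n Q S by (intro mult_right_mono) auto
  also have "\<dots> = S * (Q / real N ^ 3)" using r by (simp add: field_simps power_numeral_reduce)
  finally have 2: "\<bar>\<Sum>j<n. c (Suc j) * (p (Suc j) - p j)\<bar> \<le> S * (Q / real N ^ 3)" .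
  have "\<bar>ip f (dpl N c)\<bar> = real N * \<bar>c N * p n - c 0 * p 0 - (\<Sum>j<n. c (Suc j) * (p (Suc j) - p j))\<bar>"
    using r by (simp add: e abs_mult)
  also have "\<dots> \<le> real N * (3 * (S * (Q / real N ^ 3)))"
    using 1 2 by (intro mult_left_mono) linarith+
  also have "\<dots> = 3 * Q * S / (real N)\<^sup>2" using r by (simp add: field_simps power_numeral_reduce)
  finally show ?thesis .
qed

text \<open>The interpolation errors of adjacent cells differ by the error of the shifted difference
  \<open>v(x + h) - v(x)\<close>, whose second derivative is smaller by a factor \<open>h\<close>.\<close>

lemma superconvergence:
  assumes N: "0 < N" and v: "continuous_on {0..1} v" and w: "continuous_on {0..1} w"
    and d: "\<And>x. x \<in> {0<..<1} \<Longrightarrow> (v has_real_derivative v' x) (at x)"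
    and d2: "\<And>x. x \<in> {0<..<1} \<Longrightarrow> (v' has_real_derivative v'' x) (at x)"
    and b2: "\<And>x. x \<in> {0<..<1} \<Longrightarrow> \<bar>v'' x\<bar> \<le> B"
    and l2: "\<And>x y. x \<in> {0<..<1} \<Longrightarrow> y \<in> {0<..<1} \<Longrightarrow> \<bar>v'' x - v'' y\<bar> \<le> B * \<bar>x - y\<bar>"
    and w0: "\<And>x. x \<in> {0..1} \<Longrightarrow> \<bar>w x\<bar> \<le> K"
    and w1: "\<And>x y. x \<in> {0..1} \<Longrightarrow> y \<in> {0..1} \<Longrightarrow> \<bar>w x - w y\<bar> \<le> K * \<bar>x - y\<bar>"
    and c: "\<And>j. j \<le> N \<Longrightarrow> \<bar>c j\<bar> \<le> S"
  shows "\<bar>ip (\<lambda>x. w x * (v x - pl N (nod N v) x)) (dpl N c)\<bar> \<le> 6 * K * B * S / (real N)\<^sup>2"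
proof -
  define e where "e x = v x - pl N (nod N v) x" for x
  define h where "h = 1 / real N"
  have h: "0 < h" using N by (simp add: h_def)
  have B: "0 \<le> B" using b2[of "1/2"] by simp
  have K: "0 \<le> K" using w0[of 0] by simp
  have lip1: "\<bar>v' x - v' y\<bar> \<le> B * \<bar>x - y\<bar>" if "x \<in> {0<..<1}" "y \<in> {0<..<1}" for x y
  proof -
    have "norm (v' x - v' y) \<le> B * norm (x - y)"
      by (rule field_differentiable_bound[OF convex_real_interval(8)[of 0 1] _ _ that])
        (use d2 b2 in \<open>auto intro: has_field_derivative_at_within\<close>)
    then show ?thesis by simp
  qed
  have e0: "\<bar>e x\<bar> \<le> B * h\<^sup>2" if "x \<in> {0..1}" for x
    using interp_sup(1)[OF N v d lip1 B that] by (simp add: e_def h_def power_divide)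
  have ce: "continuous_on {0..1} (\<lambda>x. w x * e x)"
    unfolding e_def by (intro continuous_intros v w pl_continuous N)
  have mem: "x \<in> {0..1}" "x + h \<in> {real (Suc j) / real N..real (Suc (Suc j)) / real N}" "x + h \<in> {0..1}"
    if "Suc j < N" "x \<in> {real j / real N..real (Suc j) / real N}" for x j
  proof -
    show "x \<in> {0..1}" using subsetD[OF cell_subset[of j N] that(2)] that(1) by simp
    show *: "x + h \<in> {real (Suc j) / real N..real (Suc (Suc j)) / real N}"
      using that by (auto simp: h_def of_nat_Suc add_divide_distrib)
    show "x + h \<in> {0..1}" using subsetD[OF cell_subset[OF that(1)] *] .
  qed
  have shift: "\<bar>e (x + h) - e x\<bar> \<le> B * h ^ 3" if j: "Suc j < N" and x: "x \<in> {real j / real N..real (Suc j) / real N}" for x j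
  proof -
    have lt: "real j / real N < real (Suc j) / real N" using N by (simp add: divide_strict_right_mono)
    have hj: "real (Suc j) / real N = real j / real N + h" for j by (simp add: h_def of_nat_Suc add_divide_distrib)
    have co: "continuous_on {real j / real N..real (Suc j) / real N} (\<lambda>x. v (x + h) - v x)"
      by (intro continuous_intros continuous_on_subset[OF v] continuous_on_compose2[OF v])
        (use mem(1,3)[OF j] in blast)+
    have in1: "y \<in> {0<..<1}" "y + h \<in> {0<..<1}" if "real j / real N < y" "y < real (Suc j) / real N" for y
    proof -
      show "y \<in> {0<..<1}" using cell_point[of j N y] that j by auto
      show "y + h \<in> {0<..<1}" using cell_point[of "Suc j" N "y + h"] that j hj by auto
    qed
    have de: "((\<lambda>x. v (x + h) - v x) has_real_derivative v' (y + h) - v' y) (at y)"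
      if "real j / real N < y" "y < real (Suc j) / real N" for y
      using d[OF in1(1)[OF that]] d[OF in1(2)[OF that]] by (auto intro!: DERIV_diff simp: DERIV_shift)
    \<comment> \<open>One factor \<open>h\<close> is the distance of the shifted arguments of
      \<open>v''\<close>, the other the diameter of the cell.\<close>
    have osc: "\<bar>(v' (y + h) - v' y) - (v' (z + h) - v' z)\<bar> \<le> B * h * h"
      if y: "real j / real N < y" "y < real (Suc j) / real N" and z: "real j / real N < z" "z < real (Suc j) / real N" for y z
    proof -
      have "norm ((\<lambda>y. v' (y + h) - v' y) y - (\<lambda>y. v' (y + h) - v' y) z) \<le> (B * h) * norm (y - z)"
      proof (rule field_differentiable_bound[OF convex_real_interval(8)[of "real j / real N" "real (Suc j) / real N"]])
        fix t assume t: "t \<in> {real j / real N<..<real (Suc j) / real N}"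
        then have t': "t \<in> {0<..<1}" "t + h \<in> {0<..<1}" using in1[of t] by auto
        have "((\<lambda>y. v' (y + h) - v' y) has_real_derivative v'' (t + h) - v'' t) (at t)"
          using d2[OF t'(1)] d2[OF t'(2)] by (auto intro!: DERIV_diff simp: DERIV_shift)
        then show "((\<lambda>y. v' (y + h) - v' y) has_real_derivative v'' (t + h) - v'' t)
           (at t within {real j / real N<..<real (Suc j) / real N})"
          by (rule has_field_derivative_at_within)
        show "norm (v'' (t + h) - v'' t) \<le> B * h" using l2[OF t'(2,1)] h by simp
      qed (use y z in auto)
      also have "\<dots> \<le> (B * h) * h"
        using cell_diam[of y j N z] y z B h by (intro mult_left_mono) (auto simp: h_def)
      finally show ?thesis by simp
    qed
    have "\<bar>(v (x + h) - v x) - ((v (real j / real N + h) - v (real j / real N)) + ((v (real (Suc j) / real N + h) - v (real (Suc j) / real N))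
       - (v (real j / real N + h) - v (real j / real N))) / (real (Suc j) / real N - real j / real N) * (x - real j / real N))\<bar>
       \<le> B * h * h * (real (Suc j) / real N - real j / real N)"
      by (rule linear_interp_error(2)[OF lt co de osc x])
    also have "(v (x + h) - v x) - ((v (real j / real N + h) - v (real j / real N)) + ((v (real (Suc j) / real N + h) - v (real (Suc j) / real N))
       - (v (real j / real N + h) - v (real j / real N))) / (real (Suc j) / real N - real j / real N) * (x - real j / real N))
       = e (x + h) - e x"
      unfolding e_def pl_nod_on[OF Suc_lessD[OF j] x] pl_nod_on[OF j mem(2)[OF j x]] hj
      using h by (simp add: field_simps)
    also have "B * h * h * (real (Suc j) / real N - real j / real N) = B * h ^ 3"
      by (simp add: hj power3_eq_cube)
    finally show ?thesis .
  qed
  have "\<bar>ip (\<lambda>x. w x * e x) (dpl N c)\<bar> \<le> 3 * (2 * K * B) * S / (real N)\<^sup>2"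
  proof (rule ip_dpl_slowly_varying[OF N bm_continuous[OF ce] _ _ _ c])
    show "0 \<le> 2 * K * B" using B K by simp
    fix j assume j: "j < N"
    have "\<bar>integral {real j / real N..real (Suc j) / real N} (\<lambda>x. w x * e x)\<bar> \<le> K * (B * h\<^sup>2) / real N"
    proof (rule integral_cell_abs_le[OF bm_continuous[OF ce] j])
      fix x assume "x \<in> {real j / real N<..<real (Suc j) / real N}"
      then have "x \<in> {0<..<1}" by (rule cell_point[OF j])
      then show "\<bar>w x * e x\<bar> \<le> K * (B * h\<^sup>2)" using w0[of x] e0[of x] K by (auto simp: abs_mult intro!: mult_mono)
    qed
    also have "\<dots> \<le> 2 * K * B / real N ^ 3"
      using N B K by (simp add: h_def power_divide power2_eq_square power3_eq_cube divide_right_mono)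
    finally show "\<bar>integral {real j / real N..real (Suc j) / real N} (\<lambda>x. w x * e x)\<bar> \<le> 2 * K * B / real N ^ 3" .
  next
    fix j assume j: "Suc j < N"
    let ?I = "{real j / real N..real (Suc j) / real N}"
    have hj: "real (Suc j) / real N = real j / real N + h" for j by (simp add: h_def of_nat_Suc add_divide_distrib)
    have sub: "{real (Suc j) / real N..real (Suc (Suc j)) / real N} \<subseteq> {0..1}" by (rule cell_subset[OF j])
    have sh: "integral {real (Suc j) / real N..real (Suc (Suc j)) / real N} (\<lambda>x. w x * e x)
       = integral ?I (\<lambda>x. w (x + h) * e (x + h))"
      using integral_shift_Icc_real[of "real j / real N" "real (Suc j) / real N" "\<lambda>x. w x * e x" h]
      unfolding hj[symmetric] by (simp add: comp_def add.commute)
    have c1: "continuous_on ?I (\<lambda>x. w (x + h) * e (x + h))"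
      by (rule continuous_on_compose2[OF ce, of _ "\<lambda>x. x + h"]) (use mem(3)[OF j] in \<open>auto intro!: continuous_intros\<close>)
    have c2: "continuous_on ?I (\<lambda>x. w x * e x)"
      using continuous_on_subset[OF ce cell_subset] j by auto
    have "integral ?I (\<lambda>x. w (x + h) * e (x + h)) - integral ?I (\<lambda>x. w x * e x)
       = integral ?I (\<lambda>x. w (x + h) * e (x + h) - w x * e x)"
      using c1 c2 by (simp add: integral_diff integrable_continuous_real)
    also have "norm \<dots> \<le> 2 * K * B * h ^ 3 * (real (Suc j) / real N - real j / real N)"
    proof (rule integral_bound)
      show "continuous_on ?I (\<lambda>x. w (x + h) * e (x + h) - w x * e x)" by (intro continuous_intros c1 c2)
      fix x assume x: "x \<in> ?I"
      \<comment> \<open>Discrete product rule: the error varies by \<open>B h^3\<close>, and the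
        weight varies by \<open>K h\<close> against an error of size \<open>B h^2\<close>.\<close>
      have "w (x + h) * e (x + h) - w x * e x = w (x + h) * (e (x + h) - e x) + (w (x + h) - w x) * e x"
        by (simp add: algebra_simps)
      also have "\<bar>\<dots>\<bar> \<le> K * (B * h ^ 3) + (K * h) * (B * h\<^sup>2)"
        using w0[OF mem(3)[OF j x]] shift[OF j x] w1[OF mem(3,1)[OF j x]] e0[OF mem(1)[OF j x]] K h
        by (intro order.trans[OF abs_triangle_ineq] add_mono) (auto simp: abs_mult intro!: mult_mono)
      finally show "norm (w (x + h) * e (x + h) - w x * e x) \<le> 2 * K * B * h ^ 3"
        by (simp add: power2_eq_square power3_eq_cube algebra_simps)
    qed (use hj h in auto)
    also have "\<dots> = 2 * K * B / real N ^ 4"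
      by (simp add: hj) (simp add: h_def power_divide power_numeral_reduce)
    finally show "\<bar>integral {real (Suc j) / real N..real (Suc (Suc j)) / real N} (\<lambda>x. w x * e x)
        - integral ?I (\<lambda>x. w x * e x)\<bar> \<le> 2 * K * B / real N ^ 4"
      unfolding sh by simp
  qed
  then show ?thesis by (simp add: e_def)
qed

section \<open>Energy estimate, differentiation of norms and Gronwall's inequality\<close>

lemma abs_ip_le:
  assumes "f \<in> bm" "g \<in> bm" "L2norm f \<le> A" "L2norm g \<le> B"
  shows "\<bar>ip f g\<bar> \<le> A * B"
proof -
  have "\<bar>ip f g\<bar> \<le> L2norm f * L2norm g" by (rule ip_CS[OF assms(1,2)])
  also have "\<dots> \<le> A * B"
    using assms(3,4) L2norm_nonneg[of f] L2norm_nonneg[of g] by (intro mult_mono) auto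
  finally show ?thesis .
qed

lemma abs_ip_mult_le:
  assumes "w \<in> bm" "f \<in> bm" "g \<in> bm" "\<And>x. x \<in> {0..1} \<Longrightarrow> \<bar>w x\<bar> \<le> K" "L2norm f \<le> A" "L2norm g \<le> B"
  shows "\<bar>ip (\<lambda>x. w x * f x) g\<bar> \<le> K * A * B"
proof -
  have K: "0 \<le> K" using assms(4)[of 0] by simp
  have "L2norm (\<lambda>x. w x * f x) \<le> K * L2norm f" by (rule L2norm_mult_le) (use assms K in auto)
  also have "\<dots> \<le> K * A" by (intro mult_left_mono assms K)
  finally show ?thesis by (intro abs_ip_le) (use assms in \<open>auto intro!: bm_mult\<close>)
qed

text \<open>Serves both the error estimate and the uniqueness proof. The energy contains no
  derivative of \<open>a\<close>, so \<open>dpl N a\<close> has to be removed: in the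
  \<open>w1\<close> term by integration by parts, where \<open>b\<close> vanishes at the end points,
  and in the \<open>w2\<close> term because \<open>a a'\<close> is half the derivative of
  \<open>a^2\<close>, where \<open>w2\<close> vanishes there. In the second equation
  \<open>dpl N b\<close> belongs to the energy. The residual \<open>D\<close> is absorbed by Young's
  inequality.\<close>

lemma energy_estimate:
  assumes N: "0 < N" and b: "b 0 = 0" "b N = 0"
    and w: "wd w1 w1'" "wd w2 w2'" "w3 \<in> bm" "w4 \<in> bm" "w2 0 = 0" "w2 1 = 0"
    and K: "\<And>x. x \<in> {0..1} \<Longrightarrow> \<bar>w1 x\<bar> \<le> K" "\<And>x. x \<in> {0..1} \<Longrightarrow> \<bar>w1' x\<bar> \<le> K" "\<And>x. x \<in> {0..1} \<Longrightarrow> \<bar>w2' x\<bar> \<le> K"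
      "\<And>x. x \<in> {0..1} \<Longrightarrow> \<bar>w3 x\<bar> \<le> K" "\<And>x. x \<in> {0..1} \<Longrightarrow> \<bar>w4 x\<bar> \<le> K"
    and eq1: "\<bar>ip (pl N a') (pl N a) - (ip (\<lambda>x. w1 x * pl N b x) (dpl N a) + ip (\<lambda>x. w2 x * pl N a x) (dpl N a))\<bar> \<le> D * L2norm (pl N a)"
    and eq2: "\<bar>ip (pl N b') (pl N b) + 1/3 * ip (dpl N b') (dpl N b)
       - (ip (\<lambda>x. w3 x * pl N b x) (dpl N b) + ip (\<lambda>x. w4 x * pl N a x) (dpl N b))\<bar> \<le> D * (L2norm (pl N b) + L2norm (dpl N b))"
  shows "ip (pl N a') (pl N a) + (ip (pl N b') (pl N b) + 1/3 * ip (dpl N b') (dpl N b))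
     \<le> (5 * K + 2) * (ip (pl N a) (pl N a) + (ip (pl N b) (pl N b) + 1/3 * ip (dpl N b) (dpl N b))) + 2 * D\<^sup>2"
proof -
  define p q r where "p = L2norm (pl N a)" and "q = L2norm (pl N b)" and "r = L2norm (dpl N b)"
  note [simp] = pl_bm[OF N] dpl_bm[OF N] wd_bm[OF w(1)] wd_bm[OF w(2)] w(3,4)
  have K0: "0 \<le> K" using K(1)[of 0] by simp
  have "ip (\<lambda>x. w1' x * pl N b x + w1 x * dpl N b x) (pl N a) + ip (\<lambda>x. w1 x * pl N b x) (dpl N a) = 0"
    using wd_by_parts[OF wd_mult[OF w(1) wd_pl[OF N, of b]] wd_pl[OF N, of a]] b by (simp add: pl_0 pl_1 N)
  then have t1: "ip (\<lambda>x. w1 x * pl N b x) (dpl N a) = - (ip (\<lambda>x. w1' x * pl N b x) (pl N a) + ip (\<lambda>x. w1 x * dpl N b x) (pl N a))"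
    by (simp add: ip_add_left bm_mult)
  have 1: "\<bar>ip (\<lambda>x. w1' x * pl N b x) (pl N a)\<bar> \<le> K * q * p" "\<bar>ip (\<lambda>x. w1 x * dpl N b x) (pl N a)\<bar> \<le> K * r * p"
    by (intro abs_ip_mult_le K; simp add: p_def q_def r_def)+
  have "ip w2' (\<lambda>x. pl N a x * pl N a x) + ip w2 (\<lambda>x. dpl N a x * pl N a x + pl N a x * dpl N a x) = 0"
    using wd_by_parts[OF w(2) wd_mult[OF wd_pl[OF N, of a] wd_pl[OF N, of a]]] w(5,6) by simp
  moreover have "ip w2 (\<lambda>x. dpl N a x * pl N a x + pl N a x * dpl N a x) = 2 * ip (\<lambda>x. w2 x * pl N a x) (dpl N a)"
    by (subst ip_cmult_left[symmetric]) (rule ip_cong, simp)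
  moreover have "ip w2' (\<lambda>x. pl N a x * pl N a x) = ip (\<lambda>x. w2' x * pl N a x) (pl N a)"
    by (rule ip_cong) simp
  ultimately have t2: "2 * ip (\<lambda>x. w2 x * pl N a x) (dpl N a) = - ip (\<lambda>x. w2' x * pl N a x) (pl N a)" by simp
  have 2: "\<bar>ip (\<lambda>x. w2' x * pl N a x) (pl N a)\<bar> \<le> K * p * p"
    by (intro abs_ip_mult_le K) (simp_all add: p_def)
  have 3: "\<bar>ip (\<lambda>x. w3 x * pl N b x) (dpl N b)\<bar> \<le> K * q * r" "\<bar>ip (\<lambda>x. w4 x * pl N a x) (dpl N b)\<bar> \<le> K * p * r"
    by (intro abs_ip_mult_le K; simp add: p_def q_def r_def)+
  \<comment> \<open>Young's inequality in linear form: \<open>P\<close>, \<open>Q\<close>,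
    \<open>R\<close> stand for the squares of \<open>p\<close>, \<open>q\<close>, \<open>r\<close>,
    and \<open>X\<close>, \<open>Y\<close>, \<open>Z\<close> for their products.\<close>
  have lin1: "X + 2 * Y + P / 2 + Z \<le> 5 * (P + (Q + 1/3 * R))"
    if "2 * X \<le> Q + P" "2 * Y \<le> R + P" "2 * Z \<le> Q + R" "0 \<le> P" "0 \<le> Q" "0 \<le> R" for X Y Z P Q R :: real
    using that by argo
  have lin2: "X + Y + Z \<le> 2 * (P + (Q + 1/3 * R)) + 2 * E"
    if "2 * X \<le> E + P" "2 * Y \<le> E + Q" "2 * Z \<le> E + R" "0 \<le> P" "0 \<le> Q" "0 \<le> R" "0 \<le> E" for X Y Z P Q R E :: real
    using that by argo
  have sq: "2 * (x * y) \<le> x\<^sup>2 + y\<^sup>2" for x y :: real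
    using zero_le_power2[of "x - y"] by (simp add: power2_eq_square algebra_simps)
  have "ip (pl N a') (pl N a) + (ip (pl N b') (pl N b) + 1/3 * ip (dpl N b') (dpl N b))
     \<le> K * q * p + K * r * p + K * p * p / 2 + D * p + (K * q * r + K * p * r + D * (q + r))"
    using t1 1 t2 2 3 eq1 eq2 unfolding p_def[symmetric] q_def[symmetric] r_def[symmetric] by linarith
  also have "\<dots> = K * (q * p + 2 * (r * p) + p * p / 2 + q * r) + (D * p + D * q + D * r)"
    by (simp add: algebra_simps)
  also have "\<dots> \<le> K * (5 * (p\<^sup>2 + (q\<^sup>2 + 1/3 * r\<^sup>2))) + (2 * (p\<^sup>2 + (q\<^sup>2 + 1/3 * r\<^sup>2)) + 2 * D\<^sup>2)"
  proof (rule add_mono[OF mult_left_mono[OF _ K0]])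
    show "q * p + 2 * (r * p) + p * p / 2 + q * r \<le> 5 * (p\<^sup>2 + (q\<^sup>2 + 1/3 * r\<^sup>2))"
      using lin1[OF sq[of q p] sq[of r p] sq[of q r]] by (simp add: power2_eq_square)
    show "D * p + D * q + D * r \<le> 2 * (p\<^sup>2 + (q\<^sup>2 + 1/3 * r\<^sup>2)) + 2 * D\<^sup>2"
      using lin2[OF sq[of D p] sq[of D q] sq[of D r]] by simp
  qed
  also have "\<dots> = (5 * K + 2) * (p\<^sup>2 + (q\<^sup>2 + 1/3 * r\<^sup>2)) + 2 * D\<^sup>2" by (simp add: algebra_simps)
  finally show ?thesis by (simp add: p_def q_def r_def L2norm_sq)
qed

text \<open>\<open>L\<close> depends linearly on finitely many coefficients, so the norm is a
  quadratic form in them and no differentiation under the integral occurs. It is applied to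
  \<open>pl\<close>, \<open>dpl\<close>, the antiderivative of \<open>pl\<close>, and
  \<open>flux\<close>.\<close>

lemma ip_linear_deriv:
  assumes L: "\<And>a x. x \<in> {0..1} \<Longrightarrow> L a x = (\<Sum>i\<le>N. a i * l i x)" and l: "\<And>i. l i \<in> bm"
    and d: "\<And>i. i \<le> N \<Longrightarrow> ((\<lambda>t. c t i) has_real_derivative c' i) (at t within S)"
  shows "((\<lambda>t. ip (L (c t)) (L (c t))) has_real_derivative 2 * ip (L c') (L (c t))) (at t within S)"
proof -
  have e: "ip (L a) (L b) = (\<Sum>i\<le>N. \<Sum>j\<le>N. a i * b j * ip (l i) (l j))" for a b
  proof -
    have "ip (L a) (L b) = ip (\<lambda>x. \<Sum>i\<le>N. a i * l i x) (\<lambda>x. \<Sum>i\<le>N. b i * l i x)"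
      by (rule ip_cong) (simp add: L)
    also have "\<dots> = (\<Sum>i\<le>N. a i * ip (l i) (\<lambda>x. \<Sum>i\<le>N. b i * l i x))"
      by (subst ip_sum_left) (auto intro!: bm_intros l simp: ip_cmult_left)
    also have "\<dots> = (\<Sum>i\<le>N. \<Sum>j\<le>N. a i * b j * ip (l i) (l j))"
      by (subst ip_sum_right) (auto intro!: bm_intros l simp: ip_cmult_right sum_distrib_left mult.assoc)
    finally show ?thesis .
  qed
  have "((\<lambda>t. \<Sum>i\<le>N. \<Sum>j\<le>N. c t i * c t j * ip (l i) (l j)) has_real_derivative
     (\<Sum>i\<le>N. \<Sum>j\<le>N. (c' i * c t j + c t i * c' j) * ip (l i) (l j))) (at t within S)"
    by (auto intro!: derivative_eq_intros d simp: algebra_simps sum.distrib)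
  also have "(\<Sum>i\<le>N. \<Sum>j\<le>N. (c' i * c t j + c t i * c' j) * ip (l i) (l j)) = ip (L c') (L (c t)) + ip (L (c t)) (L c')"
    by (simp add: e distrib_right sum.distrib)
  also have "\<dots> = 2 * ip (L c') (L (c t))" by (simp add: ip_commute)
  finally show ?thesis by (simp add: e)
qed

text \<open>The inequality is assumed up to \<tau> only, while derivatives are taken within
  \<open>{0..T}\<close>: in the continuation argument the bounds are known on an initial
  interval.\<close>

lemma Gronwall:
  fixes y y' :: "real \<Rightarrow> real"
  assumes "0 \<le> C" "0 \<le> D" "0 \<le> t" "t \<le> \<tau>" "\<tau> \<le> T"
    and d: "\<And>s. s \<in> {0..\<tau>} \<Longrightarrow> (y has_real_derivative y' s) (at s within {0..T})"
    and le: "\<And>s. s \<in> {0..\<tau>} \<Longrightarrow> y' s \<le> C * y s + D"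
  shows "y t \<le> (y 0 + D * t) * exp (C * t)"
proof -
  \<comment> \<open>With the integrating factor the right-hand side becomes
    \<open>D * exp (- C * s)\<close>, which is at most \<open>D\<close>, so \<open>g\<close>
    decreases.\<close>
  define g where "g s = y s * exp (- C * s) - D * s" for s
  have "g t \<le> g 0"
  proof (cases "t = 0")
    case False
    have gd: "(g has_real_derivative (y' s * exp (- C * s) - C * y s * exp (- C * s) - D)) (at s within {0..T})"
      if "s \<in> {0..\<tau>}" for s
      unfolding g_def using d[OF that] by (auto intro!: derivative_eq_intros simp: algebra_simps)
    show ?thesis
    proof (rule DERIV_nonpos_imp_decreasing_open[of 0 t])
      show "0 \<le> t" using assms by simp
      fix s assume s: "0 < s" "s < t"
      then have "at s within {0..T} = at s" using assms by (intro at_within_Icc_at) auto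
      then have "(g has_real_derivative (y' s * exp (- C * s) - C * y s * exp (- C * s) - D)) (at s)"
        using gd[of s] s assms by simp
      moreover have *: "(y' s - C * y s) * exp (- C * s) \<le> D * 1"
      proof -
        have "(y' s - C * y s) * exp (- C * s) \<le> D * exp (- C * s)"
          using le[of s] s assms(4) by (intro mult_right_mono) (auto simp: algebra_simps)
        also have "\<dots> \<le> D * 1" using s assms by (intro mult_left_mono) auto
        finally show ?thesis .
      qed
      have "y' s * exp (- C * s) - C * y s * exp (- C * s) - D \<le> 0" using * by (simp add: algebra_simps)
      ultimately show "\<exists>z. DERIV g s :> z \<and> z \<le> 0" by blast
    next
      have "continuous_on {0..\<tau>} g"
        by (rule DERIV_continuous_on[OF DERIV_subset[OF gd]]) (use assms in auto)
      then show "continuous_on {0..t} g" by (rule continuous_on_subset) (use assms in auto)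
    qed
  qed simp
  then have "y t * exp (- C * t) \<le> y 0 + D * t" by (simp add: g_def)
  then have "y t * exp (- C * t) * exp (C * t) \<le> (y 0 + D * t) * exp (C * t)" by (intro mult_right_mono) auto
  then show ?thesis by (simp add: mult.assoc flip: exp_add)
qed

section \<open>Preparations for the negative norms\<close>

lemma L2norm_le_add:
  assumes "f \<in> bm" "g \<in> bm" "L2norm f \<le> A" "L2norm (\<lambda>x. f x - g x) \<le> B"
  shows "L2norm g \<le> A + B"
proof -
  have "L2norm g = L2norm (\<lambda>x. f x - (f x - g x))" by simp
  also have "\<dots> \<le> L2norm f + L2norm (\<lambda>x. f x - g x)"
    by (rule L2norm_triangle_diff) (use assms in \<open>auto intro!: bm_diff\<close>)
  finally show ?thesis using assms by linarith
qed

text \<open>The derivative of the solution \<open>G\<close> of \<open>- G'' = pl N e\<close>, \<open>G(0) = G(1) = 0\<close>.\<close>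

definition flux :: "nat \<Rightarrow> (nat \<Rightarrow> real) \<Rightarrow> real \<Rightarrow> real" where
  "flux N e x = J (J (pl N e)) 1 - J (pl N e) x"

lemma wd_J_pl: "0 < N \<Longrightarrow> wd (J (pl N e)) (pl N e)"
  by (intro wd_J pl_continuous)

lemma J_pl_continuous: "0 < N \<Longrightarrow> continuous_on {0..1} (J (pl N e))"
  using wd_J_pl by (simp add: wd_def)

lemma wd_flux: "0 < N \<Longrightarrow> wd (flux N e) (\<lambda>x. 0 - pl N e x)"
  unfolding flux_def by (intro wd_diff wd_const wd_J_pl)

lemma flux_continuous: "0 < N \<Longrightarrow> continuous_on {0..1} (flux N e)"
  using wd_flux by (simp add: wd_def)

text \<open>The constant in \<open>flux\<close> is the mean of \<open>J (pl N e)\<close>, which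
  makes the potential \<open>G = J (flux N e)\<close> return to 0 at 1.\<close>

lemma J_flux_1: "0 < N \<Longrightarrow> J (flux N e) 1 = 0"
  using J_pl_continuous[of N e]
  by (simp add: flux_def[abs_def] J_def[of "\<lambda>x. J (J (pl N e)) 1 - J (pl N e) x"] integral_diff integrable_continuous_real)
    (simp add: J_def[of "J (pl N e)"])

lemma flux_bound:
  assumes "0 < N" "x \<in> {0..1}" shows "\<bar>flux N e x\<bar> \<le> 2 * L2norm (pl N e)"
proof -
  have "\<bar>J (J (pl N e)) 1\<bar> \<le> L2norm (J (pl N e))"
    using J_bound[of "J (pl N e)" 1] wd_bm(1)[OF wd_J_pl[OF assms(1)]] by simp
  also have "\<dots> \<le> L2norm (pl N e)" by (intro L2norm_J pl_continuous assms)
  finally show ?thesis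
    using J_bound[OF pl_bm[OF assms(1)] assms(2), of e] unfolding flux_def by linarith
qed

section \<open>The error equations at a fixed time: first estimate\<close>

text \<open>\<open>a\<close> and \<open>b\<close> are the nodal values of theta and xi,
  \<open>a'\<close> and \<open>b'\<close> those of their time derivatives; \<rho>,
  \<open>\<rho>t\<close>, \<sigma>, \<open>\<sigma>t\<close> are the interpolation errors of \<eta>,
  \<open>\<eta>_t\<close>, \<open>u\<close>, \<open>u_t\<close>, and the weights come from
  linearisation. \<open>H\<close> is the square root of the mesh size, so that all orders are
  integer powers. The weight \<open>w4\<close> contains the discrete \<eta>, whose derivative is not
  assumed bounded; \<open>w5\<close> is its smooth part. \<open>super\<close> is the
  superconvergence bound, in terms of the maximal nodal value of the test function.\<close>

locale galerkin_error =
  fixes N :: nat and K H g :: real and a b a' b' :: "nat \<Rightarrow> real"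
    and \<rho> \<rho>t \<sigma> \<sigma>t w1 w1' w2 w2' w3 w4 w5 w5' :: "real \<Rightarrow> real"
  assumes N: "0 < N" and K: "1 \<le> K" and H_def: "H = 1 / sqrt (real N)"
    and bdry: "b 0 = 0" "b N = 0" "b' 0 = 0" "b' N = 0"
    and rs_bm: "\<rho> \<in> bm" "\<rho>t \<in> bm" "\<sigma> \<in> bm" "\<sigma>t \<in> bm"
    and small: "\<And>x. x \<in> {0..1} \<Longrightarrow> \<bar>\<rho> x\<bar> \<le> K * H ^ 4" "\<And>x. x \<in> {0..1} \<Longrightarrow> \<bar>\<rho>t x\<bar> \<le> K * H ^ 4"
      "\<And>x. x \<in> {0..1} \<Longrightarrow> \<bar>\<sigma> x\<bar> \<le> K * H ^ 4" "\<And>x. x \<in> {0..1} \<Longrightarrow> \<bar>\<sigma>t x\<bar> \<le> K * H ^ 4"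
    and wd1: "wd w1 w1'" and wd2: "wd w2 w2'" "w2 0 = 0" "w2 1 = 0" and w3_bm: "w3 \<in> bm" and wd5: "wd w5 w5'"
    and wK: "\<And>x. x \<in> {0..1} \<Longrightarrow> \<bar>w1 x\<bar> \<le> K" "\<And>x. x \<in> {0..1} \<Longrightarrow> \<bar>w1' x\<bar> \<le> K"
      "\<And>x. x \<in> {0..1} \<Longrightarrow> \<bar>w2 x\<bar> \<le> K" "\<And>x. x \<in> {0..1} \<Longrightarrow> \<bar>w2' x\<bar> \<le> K"
      "\<And>x. x \<in> {0..1} \<Longrightarrow> \<bar>w3 x\<bar> \<le> K" "\<And>x. x \<in> {0..1} \<Longrightarrow> \<bar>w4 x\<bar> \<le> K"
      "\<And>x. x \<in> {0..1} \<Longrightarrow> \<bar>w5 x\<bar> \<le> K" "\<And>x. x \<in> {0..1} \<Longrightarrow> \<bar>w5' x\<bar> \<le> K"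
    and w4: "\<And>x. x \<in> {0..1} \<Longrightarrow> w4 x = w5 x - g * (\<rho> x + pl N a x)" and gK: "\<bar>g\<bar> \<le> K"
    and super: "\<And>c S. (\<And>j. j \<le> N \<Longrightarrow> \<bar>c j\<bar> \<le> S) \<Longrightarrow>
       \<bar>ip (\<lambda>x. w1 x * \<sigma> x + w2 x * \<rho> x) (dpl N c)\<bar> \<le> K * S * H ^ 4"
    and eq1: "\<And>c. ip (pl N a') (pl N c) = - ip \<rho>t (pl N c)
       + ip (\<lambda>x. w1 x * (\<sigma> x + pl N b x) + w2 x * (\<rho> x + pl N a x)) (dpl N c)"
    and eq2: "\<And>c. c 0 = 0 \<Longrightarrow> c N = 0 \<Longrightarrow> ip (pl N b') (pl N c) + 1/3 * ip (dpl N b') (dpl N c) = - ip \<sigma>t (pl N c)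
       + ip (\<lambda>x. w3 x * (\<sigma> x + pl N b x) + w4 x * (\<rho> x + pl N a x)) (dpl N c)"
begin

lemma w_bm: "w1 \<in> bm" "w1' \<in> bm" "w2 \<in> bm" "w2' \<in> bm" "w4 \<in> bm" "w5 \<in> bm" "w5' \<in> bm"
proof -
  show *: "w1 \<in> bm" "w1' \<in> bm" "w2 \<in> bm" "w2' \<in> bm" "w5 \<in> bm" "w5' \<in> bm"
    using wd1 wd2 wd5 wd_bm by blast+
  show "w4 \<in> bm"
    by (rule bm_cong[OF _ w4]) (auto intro!: bm_intros pl_bm rs_bm * N)
qed

lemmas bms = w_bm w3_bm rs_bm pl_bm[OF N] dpl_bm[OF N]

lemma H_pos: "0 < H" and H_le_1: "H \<le> 1" and H2: "H\<^sup>2 = 1 / real N" and H_N: "real N * H\<^sup>2 = 1" and sqrt_H: "sqrt (real N) * H = 1"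
  using N by (auto simp: H_def power_divide)

lemma H4: "H ^ 4 = 1 / (real N)\<^sup>2"
proof -
  have "H ^ 4 = (H\<^sup>2)\<^sup>2" by (simp flip: power_mult)
  then show ?thesis by (simp add: H2 power_divide)
qed

lemma H_mono: "m \<le> n \<Longrightarrow> H ^ n \<le> H ^ m"
  using H_pos H_le_1 by (intro power_decreasing) auto

lemma H_nonneg: "0 \<le> H ^ n"
  using H_pos by simp

lemma K_nonneg: "0 \<le> K ^ n"
  using K by simp

lemma KH_mono: "i \<le> j \<Longrightarrow> m \<le> n \<Longrightarrow> K ^ i * H ^ n \<le> K ^ j * H ^ m"
  using K by (intro mult_mono H_mono power_increasing H_nonneg K_nonneg) auto

lemma eq1': "ip (pl N a') (pl N c) = - ip \<rho>t (pl N c) + ip (\<lambda>x. w1 x * \<sigma> x + w2 x * \<rho> x) (dpl N c)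
    + (ip (\<lambda>x. w1 x * pl N b x) (dpl N c) + ip (\<lambda>x. w2 x * pl N a x) (dpl N c))"
proof -
  have "ip (\<lambda>x. w1 x * (\<sigma> x + pl N b x) + w2 x * (\<rho> x + pl N a x)) (dpl N c)
     = ip (\<lambda>x. (w1 x * \<sigma> x + w2 x * \<rho> x) + (w1 x * pl N b x + w2 x * pl N a x)) (dpl N c)"
    by (rule ip_cong) (simp add: algebra_simps)
  also have "\<dots> = ip (\<lambda>x. w1 x * \<sigma> x + w2 x * \<rho> x) (dpl N c) + (ip (\<lambda>x. w1 x * pl N b x) (dpl N c) + ip (\<lambda>x. w2 x * pl N a x) (dpl N c))"
    by (subst ip_add_left, (intro bm_intros bms)+)+ simp
  finally show ?thesis by (simp add: eq1)
qed

lemma eq2': assumes "c 0 = 0" "c N = 0"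
  shows "ip (pl N b') (pl N c) + 1/3 * ip (dpl N b') (dpl N c) = - ip \<sigma>t (pl N c) + ip (\<lambda>x. w3 x * \<sigma> x + w4 x * \<rho> x) (dpl N c)
    + (ip (\<lambda>x. w3 x * pl N b x) (dpl N c) + ip (\<lambda>x. w4 x * pl N a x) (dpl N c))"
proof -
  have "ip (\<lambda>x. w3 x * (\<sigma> x + pl N b x) + w4 x * (\<rho> x + pl N a x)) (dpl N c)
     = ip (\<lambda>x. (w3 x * \<sigma> x + w4 x * \<rho> x) + (w3 x * pl N b x + w4 x * pl N a x)) (dpl N c)"
    by (rule ip_cong) (simp add: algebra_simps)
  also have "\<dots> = ip (\<lambda>x. w3 x * \<sigma> x + w4 x * \<rho> x) (dpl N c) + (ip (\<lambda>x. w3 x * pl N b x) (dpl N c) + ip (\<lambda>x. w4 x * pl N a x) (dpl N c))"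
    by (subst ip_add_left, (intro bm_intros bms)+)+ simp
  finally show ?thesis using eq2[OF assms] by linarith
qed

text \<open>The crude alternative to \<open>super\<close>: it uses only the size of the
  interpolation errors and pays with the slope of the test function instead of its nodal
  values.\<close>

lemma two_products_small:
  assumes "w \<in> bm" "w' \<in> bm" "\<And>x. x \<in> {0..1} \<Longrightarrow> \<bar>w x\<bar> \<le> K" "\<And>x. x \<in> {0..1} \<Longrightarrow> \<bar>w' x\<bar> \<le> K"
  shows "\<bar>ip (\<lambda>x. w x * \<sigma> x + w' x * \<rho> x) (dpl N c)\<bar> \<le> 2 * K\<^sup>2 * H ^ 4 * L2norm (dpl N c)"
proof (rule abs_ip_le[OF _ _ L2norm_le_sup order.refl])
  fix x :: real assume x: "x \<in> {0..1}"
  have "\<bar>w x * \<sigma> x + w' x * \<rho> x\<bar> \<le> K * (K * H ^ 4) + K * (K * H ^ 4)"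
    unfolding abs_mult
    by (intro order.trans[OF abs_triangle_ineq] add_mono, unfold abs_mult, (intro mult_mono assms small x abs_ge_zero, use K in simp)+)
  then show "\<bar>w x * \<sigma> x + w' x * \<rho> x\<bar> \<le> 2 * K\<^sup>2 * H ^ 4" by (simp add: power2_eq_square)
qed (use H_nonneg K_nonneg in \<open>auto intro!: bm_intros bms assms\<close>)

lemma small_ip: 
  "\<bar>ip \<rho>t (pl N c)\<bar> \<le> K * H ^ 4 * L2norm (pl N c)" "\<bar>ip \<sigma>t (pl N c)\<bar> \<le> K * H ^ 4 * L2norm (pl N c)"
  using K by (intro abs_ip_le[OF _ _ L2norm_le_sup order.refl] small bms; simp add: H_nonneg)+

text \<open>In the first equation \<open>super\<close> is applied to \<open>c = a\<close>; the nodal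
  values of \<open>a\<close> are at most \<open>3 sqrt N\<close> times its L2 norm, which turns
  \<open>H^4\<close> into \<open>H^3\<close>. In the second equation
  \<open>two_products_small\<close> loses nothing, since the slope of \<open>b\<close> is part of
  the energy.\<close>

lemma first_energy:
  "ip (pl N a') (pl N a) + (ip (pl N b') (pl N b) + 1/3 * ip (dpl N b') (dpl N b))
     \<le> (5 * K + 2) * (ip (pl N a) (pl N a) + (ip (pl N b) (pl N b) + 1/3 * ip (dpl N b) (dpl N b))) + 2 * (4 * K\<^sup>2 * H ^ 3)\<^sup>2"
proof (rule energy_estimate[OF N bdry(1,2) wd1 wd2(1) w3_bm w_bm(5) wd2(2,3) wK(1,2,4,5,6)])
  let ?p = "L2norm (pl N a)" and ?q = "L2norm (pl N b)" and ?r = "L2norm (dpl N b)"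
  have "\<bar>ip (\<lambda>x. w1 x * \<sigma> x + w2 x * \<rho> x) (dpl N a)\<bar> \<le> K * (3 * sqrt (real N) * ?p) * H ^ 4"
    by (rule super) (rule pl_node_bound[OF N])
  also have "\<dots> = (sqrt (real N) * H) * (3 * (K * H ^ 3) * ?p)" by (simp add: power_numeral_reduce)
  also have "\<dots> = 3 * (K * H ^ 3) * ?p" by (simp add: sqrt_H)
  finally have 1: "\<bar>ip (\<lambda>x. w1 x * \<sigma> x + w2 x * \<rho> x) (dpl N a)\<bar> \<le> 3 * (K * H ^ 3) * ?p" .
  have kh: "K * H ^ 4 \<le> K\<^sup>2 * H ^ 3" "K * H ^ 3 \<le> K\<^sup>2 * H ^ 3" "K\<^sup>2 * H ^ 4 \<le> K\<^sup>2 * H ^ 3"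
    using KH_mono[of 1 2 3 4] KH_mono[of 1 2 3 3] KH_mono[of 2 2 3 4] by auto
  have "\<bar>- ip \<rho>t (pl N a) + ip (\<lambda>x. w1 x * \<sigma> x + w2 x * \<rho> x) (dpl N a)\<bar> \<le> (K * H ^ 4 + 3 * (K * H ^ 3)) * ?p"
    using small_ip(1)[of a] 1 by (simp add: distrib_right)
  also have "\<dots> \<le> 4 * K\<^sup>2 * H ^ 3 * ?p"
    using kh by (intro mult_right_mono L2norm_nonneg) linarith
  finally show "\<bar>ip (pl N a') (pl N a) - (ip (\<lambda>x. w1 x * pl N b x) (dpl N a) + ip (\<lambda>x. w2 x * pl N a x) (dpl N a))\<bar> \<le> 4 * K\<^sup>2 * H ^ 3 * ?p"
    by (simp add: eq1')
  have "\<bar>- ip \<sigma>t (pl N b) + ip (\<lambda>x. w3 x * \<sigma> x + w4 x * \<rho> x) (dpl N b)\<bar> \<le> K * H ^ 4 * ?q + 2 * K\<^sup>2 * H ^ 4 * ?r"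
    using small_ip(2)[of b] two_products_small[OF w3_bm w_bm(5) wK(5,6), of b] by simp
  also have "\<dots> \<le> 4 * K\<^sup>2 * H ^ 3 * ?q + 4 * K\<^sup>2 * H ^ 3 * ?r"
    using kh K_nonneg[of 2] H_nonneg[of 3] mult_nonneg_nonneg[of "K\<^sup>2" "H ^ 3"] by (intro add_mono mult_right_mono L2norm_nonneg) linarith+
  finally show "\<bar>ip (pl N b') (pl N b) + 1/3 * ip (dpl N b') (dpl N b)
       - (ip (\<lambda>x. w3 x * pl N b x) (dpl N b) + ip (\<lambda>x. w4 x * pl N a x) (dpl N b))\<bar> \<le> 4 * K\<^sup>2 * H ^ 3 * (?q + ?r)"
    unfolding eq2'[OF bdry(1,2)] by (simp add: distrib_left)
qed

end

section \<open>The error equations at a fixed time: estimates in negative norms\<close>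

text \<open>The outcome of the first step, with a larger \<open>K\<close>, becomes a hypothesis.
  \<open>A1_small\<close> is needed because the antiderivative of theta starts at 0 but does not
  return to 0.\<close>

locale galerkin_error2 = galerkin_error +
  assumes p_small: "L2norm (pl N a) \<le> K * H ^ 3" and q_small: "L2norm (pl N b) \<le> K * H ^ 3"
    and A1_small: "\<bar>J (pl N a) 1\<bar> \<le> K * H ^ 4"
begin

text \<open>A preliminary bound from testing the second equation with \<open>b'\<close> itself; the
  \<open>O(h^(3/2))\<close> bounds for \<open>a\<close> and \<open>b\<close> limit its
  order.\<close>

lemma b'_bound: "L2norm (pl N b') \<le> 4 * (K\<^sup>2 * H ^ 3)"
proof -
  let ?P = "L2norm (pl N b')" and ?R = "L2norm (dpl N b')"
  define X where "X = K\<^sup>2 * H ^ 3"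
  have X: "0 \<le> X" unfolding X_def by (intro mult_nonneg_nonneg H_nonneg K_nonneg)
  have kh: "K * H ^ 4 \<le> X" "K\<^sup>2 * H ^ 4 \<le> X"
    using KH_mono[of 1 2 3 4] KH_mono[of 2 2 3 4] by (auto simp: X_def)
  have "\<bar>ip (\<lambda>x. w3 x * pl N b x) (dpl N b')\<bar> \<le> K * (K * H ^ 3) * ?R" "\<bar>ip (\<lambda>x. w4 x * pl N a x) (dpl N b')\<bar> \<le> K * (K * H ^ 3) * ?R"
    by (intro abs_ip_mult_le bms wK p_small q_small order.refl; assumption)+
  then have 1: "\<bar>ip (\<lambda>x. w3 x * pl N b x) (dpl N b')\<bar> \<le> X * ?R" "\<bar>ip (\<lambda>x. w4 x * pl N a x) (dpl N b')\<bar> \<le> X * ?R"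
    by (simp_all add: X_def power2_eq_square mult.assoc)
  have "?P\<^sup>2 + 1/3 * ?R\<^sup>2 \<le> K * H ^ 4 * ?P + 2 * K\<^sup>2 * H ^ 4 * ?R + (X * ?R + X * ?R)"
    unfolding L2norm_sq eq2'[OF bdry(3,4)]
    using 1 small_ip(2)[of b'] two_products_small[OF w3_bm w_bm(5) wK(5,6), of b'] by linarith
  also have "\<dots> \<le> X * ?P + 2 * X * ?R + (X * ?R + X * ?R)"
    using kh by (intro add_mono mult_right_mono L2norm_nonneg) linarith+
  finally have "?P\<^sup>2 + 1/3 * ?R\<^sup>2 \<le> X * ?P + 4 * X * ?R" by simp
  \<comment> \<open>Completing the square trades \<open>?R\<close> for \<open>12 X^2\<close>; the
    remaining quadratic in \<open>?P\<close> has the roots \<open>4 X\<close> and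
    \<open>- 3 X\<close>.\<close>
  moreover have "4 * X * ?R \<le> 1/3 * ?R\<^sup>2 + 12 * X\<^sup>2"
    using zero_le_power2[of "?R - 6 * X"] by (simp add: power2_eq_square algebra_simps)
  ultimately have "(?P - 4 * X) * (?P + 3 * X) \<le> 0" by (simp add: power2_eq_square algebra_simps)
  then have "\<not> 4 * X < ?P" using X L2norm_nonneg[of "pl N b'"] mult_pos_pos[of "?P - 4 * X" "?P + 3 * X"] by linarith
  then have "?P \<le> 4 * X" by simp
  then show ?thesis by (simp add: X_def)
qed

text \<open>No energy controls the slope of \<open>a'\<close>, so the inverse inequality costs a
  full factor \<open>N\<close> and leaves only \<open>h^(1/2)\<close>. That is enough, since
  \<open>a'\<close> will be paired with an interpolation error of order \<open>h^(7/2)\<close>. The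
  constant is 1 + 16.\<close>

lemma a'_bound: "L2norm (pl N a') \<le> 17 * (K\<^sup>2 * H)"
proof -
  let ?P = "L2norm (pl N a')" and ?R = "L2norm (dpl N a')"
  define X where "X = K\<^sup>2 * H ^ 3"
  have X: "0 \<le> X" unfolding X_def by (intro mult_nonneg_nonneg H_nonneg K_nonneg)
  have kh: "K * H ^ 4 \<le> K\<^sup>2 * H" "K\<^sup>2 * H ^ 4 \<le> X"
    using KH_mono[of 1 2 1 4] KH_mono[of 2 2 3 4] by (auto simp: X_def)
  have "\<bar>ip (\<lambda>x. w1 x * pl N b x) (dpl N a')\<bar> \<le> K * (K * H ^ 3) * ?R" "\<bar>ip (\<lambda>x. w2 x * pl N a x) (dpl N a')\<bar> \<le> K * (K * H ^ 3) * ?R"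
    by (intro abs_ip_mult_le bms wK p_small q_small order.refl; assumption)+
  then have 1: "\<bar>ip (\<lambda>x. w1 x * pl N b x) (dpl N a')\<bar> \<le> X * ?R" "\<bar>ip (\<lambda>x. w2 x * pl N a x) (dpl N a')\<bar> \<le> X * ?R"
    by (simp_all add: X_def power2_eq_square mult.assoc)
  have "?P\<^sup>2 \<le> K * H ^ 4 * ?P + 2 * K\<^sup>2 * H ^ 4 * ?R + (X * ?R + X * ?R)"
    unfolding L2norm_sq eq1'
    using 1 small_ip(1)[of a'] two_products_small[OF w_bm(1,3) wK(1,3), of a'] by linarith
  also have "\<dots> \<le> K\<^sup>2 * H * ?P + 2 * X * ?R + (X * ?R + X * ?R)"
    using kh by (intro add_mono mult_right_mono L2norm_nonneg) linarith+
  also have "\<dots> = K\<^sup>2 * H * ?P + 4 * X * ?R" by simp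
  also have "\<dots> \<le> K\<^sup>2 * H * ?P + 4 * X * (4 * real N * ?P)"
    using X by (intro add_mono[OF order.refl] mult_left_mono inverse_ineq N) auto
  also have "\<dots> = K\<^sup>2 * H * ?P + 16 * (real N * H\<^sup>2) * (K\<^sup>2 * H * ?P)"
    by (simp add: X_def power2_eq_square power3_eq_cube)
  also have "\<dots> = 17 * (K\<^sup>2 * H) * ?P" by (simp add: H_N)
  finally have "?P * ?P \<le> 17 * (K\<^sup>2 * H) * ?P" by (simp add: power2_eq_square)
  then show ?thesis using H_pos L2norm_nonneg[of "pl N a'"] 
    by (cases "?P = 0") (auto simp: mult_le_cancel_right)
qed

text \<open>Integration by parts turns the left side into the product of \<open>pl N a'\<close> with
  a function F satisfying \<open>F' = - A\<close>. F is not discrete, so its interpolant is used as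
  test function in the first equation. The slope of that interpolant is close to \<open>- A\<close>,
  hence every term is again bounded by the norms on the right, up to errors of interpolating
  F.\<close>

lemma A_energy:
  shows "\<bar>ip (J (pl N a')) (J (pl N a))\<bar> \<le> 100 * K ^ 3 * ((L2norm (J (pl N a)))\<^sup>2 + (L2norm (pl N b))\<^sup>2 + H ^ 8)"
proof -
  define A where "A = J (pl N a)"
  \<comment> \<open>The integral of A from \<open>x\<close> to 1. It vanishes at 1, where the
    antiderivative of \<open>pl N a'\<close> need not; at 0 the roles are exchanged.\<close>
  define F where "F x = J A 1 - J A x" for x
  define c where "c = nod N F"
  define s q where "s = L2norm A" and "q = L2norm (pl N b)"
  have s0: "0 \<le> s" "0 \<le> q" by (simp_all add: s_def q_def L2norm_nonneg)
  have wA: "wd A (pl N a)" unfolding A_def by (intro wd_J pl_continuous N)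
  have cA: "continuous_on {0..1} A" using wA by (simp add: wd_def)
  have wF: "wd F (\<lambda>x. 0 - A x)" unfolding F_def by (intro wd_diff wd_const wd_J cA)
  have dF: "(F has_real_derivative - A x) (at x)" if "x \<in> {0<..<1}" for x
    using J_deriv[OF cA, of x] that unfolding F_def by (auto intro!: derivative_eq_intros simp: at_within_Icc_at)
  have dA: "((\<lambda>x. - A x) has_real_derivative pl N (\<lambda>i. -1 * a i) x) (at x)" if "x \<in> {0<..<1}" for x
    using J_deriv[OF pl_continuous[OF N], of x a] that unfolding A_def pl_cmult
    by (auto intro!: derivative_eq_intros simp: at_within_Icc_at)
  note [simp] = wd_bm[OF wA] wd_bm[OF wF] bms
  have cF: "continuous_on {0..1} F" using wF by (simp add: wd_def)
  have np: "L2norm (pl N (\<lambda>i. -1 * a i)) = L2norm (pl N a)"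
    unfolding pl_cmult[abs_def] L2norm_cmult by simp
  have N4: "4 / (real N)\<^sup>2 = 4 * H ^ 4" "4 / real N = 4 * H\<^sup>2"
    using H4 H2 by auto
  have "L2norm (\<lambda>x. F x - pl N c x) \<le> 4 * H ^ 4 * L2norm (pl N a)" "L2norm (\<lambda>x. - A x - dpl N c x) \<le> 4 * H\<^sup>2 * L2norm (pl N a)"
    using interp_L2[OF N cF continuous_on_minus[OF cA] dF dA] unfolding c_def[symmetric] np N4 by auto
  moreover have "4 * H ^ 4 * L2norm (pl N a) \<le> 4 * H ^ 4 * (K * H ^ 3)" "4 * H\<^sup>2 * L2norm (pl N a) \<le> 4 * H\<^sup>2 * (K * H ^ 3)"
    using H_pos by (intro mult_left_mono p_small; simp)+
  ultimately have e1: "L2norm (\<lambda>x. F x - pl N c x) \<le> 4 * K * H ^ 7" and e2: "L2norm (\<lambda>x. - A x - dpl N c x) \<le> 4 * K * H ^ 5"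
    by (simp_all add: power_numeral_reduce algebra_simps)
  have Fs: "L2norm F \<le> 2 * s"
  proof (rule L2norm_le_sup)
    fix x :: real assume "x \<in> {0..1}"
    then show "\<bar>F x\<bar> \<le> 2 * s"
      using J_bound[of A x] J_bound[of A 1] unfolding F_def s_def by auto
  qed (use s0 in auto)
  have nc: "L2norm (pl N c) \<le> 2 * s + 4 * K * H ^ 7"
    by (rule L2norm_le_add[OF _ _ Fs e1]) auto
  have ndc: "L2norm (dpl N c) \<le> s + 4 * K * H ^ 5"
    by (rule L2norm_le_add[OF _ _ _ e2]) (auto simp: s_def L2norm_uminus bm_uminus)
  have wA': "wd (J (pl N a')) (pl N a')" by (intro wd_J pl_continuous N)
  have "ip (pl N a') F + ip (J (pl N a')) (\<lambda>x. 0 - A x) = 0"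
    using wd_by_parts[OF wA' wF] by (simp add: F_def)
  moreover have "ip (J (pl N a')) (\<lambda>x. 0 - A x) = - ip (J (pl N a')) A"
    using ip_cmult_right[of "J (pl N a')" "-1" A] by simp
  ultimately have main: "ip (J (pl N a')) A = ip (pl N a') F" by simp
  have "ip (pl N a') F = ip (pl N a') (\<lambda>x. pl N c x + (F x - pl N c x))" by simp
  also have "\<dots> = ip (pl N a') (pl N c) + ip (pl N a') (\<lambda>x. F x - pl N c x)"
    by (rule ip_add_right) (auto intro!: bm_intros)
  finally have t0: "ip (J (pl N a')) A = ip (pl N a') (pl N c) + ip (pl N a') (\<lambda>x. F x - pl N c x)" using main by simp
  have T0: "\<bar>ip (pl N a') (\<lambda>x. F x - pl N c x)\<bar> \<le> 17 * (K\<^sup>2 * H) * (4 * K * H ^ 7)"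
    by (intro abs_ip_le a'_bound e1 bm_intros) auto
  have T1: "\<bar>ip \<rho>t (pl N c)\<bar> \<le> K * H ^ 4 * (2 * s + 4 * K * H ^ 7)"
    by (rule order.trans[OF small_ip(1) mult_left_mono[OF nc]]) (use K H_nonneg[of 4] in simp)
  have T2: "\<bar>ip (\<lambda>x. w1 x * \<sigma> x + w2 x * \<rho> x) (dpl N c)\<bar> \<le> 2 * K\<^sup>2 * H ^ 4 * (s + 4 * K * H ^ 5)"
    by (rule order.trans[OF two_products_small[OF w_bm(1,3) wK(1,3)] mult_left_mono[OF ndc]]) (auto intro!: mult_nonneg_nonneg H_nonneg K_nonneg)
  have T3: "\<bar>ip (\<lambda>x. w1 x * pl N b x) (dpl N c)\<bar> \<le> K * q * (s + 4 * K * H ^ 5)"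
    by (intro abs_ip_mult_le bms wK ndc) (simp_all add: q_def)
  have "ip (\<lambda>x. w2 x * pl N a x) (dpl N c) = ip (\<lambda>x. w2 x * pl N a x) (\<lambda>x. - A x - (- A x - dpl N c x))"
    by simp
  also have "\<dots> = ip (\<lambda>x. w2 x * pl N a x) (\<lambda>x. - A x) - ip (\<lambda>x. w2 x * pl N a x) (\<lambda>x. - A x - dpl N c x)"
    by (rule ip_diff_right) (auto intro!: bm_intros)
  also have "ip (\<lambda>x. w2 x * pl N a x) (\<lambda>x. - A x) = - ip (\<lambda>x. w2 x * pl N a x) A"
    using ip_cmult_right[of "\<lambda>x. w2 x * pl N a x" "-1" A] by simp
  finally have t4: "ip (\<lambda>x. w2 x * pl N a x) (dpl N c) = - ip (\<lambda>x. w2 x * pl N a x) A - ip (\<lambda>x. w2 x * pl N a x) (\<lambda>x. - A x - dpl N c x)" .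
  have T4b: "\<bar>ip (\<lambda>x. w2 x * pl N a x) (\<lambda>x. - A x - dpl N c x)\<bar> \<le> K * (K * H ^ 3) * (4 * K * H ^ 5)"
    by (intro abs_ip_mult_le bms wK p_small e2 bm_intros) auto
  \<comment> \<open>\<open>pl N a\<close> is the derivative of A, so \<open>w2 a A\<close> is half
    of \<open>w2\<close> times the derivative of \<open>A^2\<close>; as \<open>w2\<close> vanishes
    at both ends, \<open>A(1)\<close> does not appear.\<close>
  have "ip w2' (\<lambda>x. A x * A x) + ip w2 (\<lambda>x. pl N a x * A x + A x * pl N a x) = 0"
    using wd_by_parts[OF wd2(1) wd_mult[OF wA wA]] wd2(2,3) by simp
  moreover have "ip w2 (\<lambda>x. pl N a x * A x + A x * pl N a x) = 2 * ip (\<lambda>x. w2 x * pl N a x) A"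
    by (subst ip_cmult_left[symmetric]) (rule ip_cong, simp)
  moreover have "ip w2' (\<lambda>x. A x * A x) = ip (\<lambda>x. w2' x * A x) A" by (rule ip_cong) simp
  moreover have "\<bar>ip (\<lambda>x. w2' x * A x) A\<bar> \<le> K * s * s"
    by (intro abs_ip_mult_le bms wK) (auto simp: s_def)
  ultimately have T4a: "2 * \<bar>ip (\<lambda>x. w2 x * pl N a x) A\<bar> \<le> K * s * s" by linarith
  \<comment> \<open>The remainders are balanced at \<open>H^8\<close>: order \<open>H\<close> for
    \<open>a'\<close> meets \<open>H^7\<close> for the error of F, and order \<open>H^3\<close> for
    \<open>a\<close> meets \<open>H^5\<close> for the error of its slope.\<close>
  define e where "e = H ^ 4"
  have e0: "0 \<le> e" by (simp add: e_def H_nonneg)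
  have e8: "H ^ 8 = e\<^sup>2" unfolding e_def by (simp flip: power_mult)
  have k3: "K \<le> K ^ 3" "K\<^sup>2 \<le> K ^ 3" using power_increasing[of 1 3 K] power_increasing[of 2 3 K] K by auto
  have h: "H ^ 11 \<le> e\<^sup>2" "H ^ 9 \<le> e\<^sup>2" "H ^ 5 \<le> e" unfolding e8[symmetric] using H_mono[of 8 11] H_mono[of 8 9] H_mono[of 4 5] by (auto simp: e_def)
  have B0: "17 * (K\<^sup>2 * H) * (4 * K * H ^ 7) = K ^ 3 * (68 * e\<^sup>2)" unfolding e8[symmetric] by (simp add: power_numeral_reduce)
  have B1: "K * H ^ 4 * (2 * s + 4 * K * H ^ 7) \<le> K ^ 3 * (2 * (e * s)) + K ^ 3 * (4 * e\<^sup>2)"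
  proof -
    have "K * H ^ 4 * (2 * s + 4 * K * H ^ 7) = K * (2 * (e * s)) + K\<^sup>2 * (4 * H ^ 11)"
      by (simp add: e_def power_numeral_reduce algebra_simps)
    also have "\<dots> \<le> K ^ 3 * (2 * (e * s)) + K ^ 3 * (4 * e\<^sup>2)"
      using k3 h e0 s0 K_nonneg[of 3] H_nonneg[of 11] by (intro add_mono mult_mono) auto
    finally show ?thesis .
  qed
  have B2: "2 * K\<^sup>2 * H ^ 4 * (s + 4 * K * H ^ 5) \<le> K ^ 3 * (2 * (e * s)) + K ^ 3 * (8 * e\<^sup>2)"
  proof -
    have "2 * K\<^sup>2 * H ^ 4 * (s + 4 * K * H ^ 5) = K\<^sup>2 * (2 * (e * s)) + K ^ 3 * (8 * H ^ 9)"
      by (simp add: e_def power_numeral_reduce algebra_simps)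
    also have "\<dots> \<le> K ^ 3 * (2 * (e * s)) + K ^ 3 * (8 * e\<^sup>2)"
      using k3 h e0 s0 K_nonneg[of 3] H_nonneg[of 9] by (intro add_mono mult_mono) auto
    finally show ?thesis .
  qed
  have B3: "K * q * (s + 4 * K * H ^ 5) \<le> K ^ 3 * (q * s) + K ^ 3 * (4 * (q * e))"
  proof -
    have "K * q * (s + 4 * K * H ^ 5) = K * (q * s) + K\<^sup>2 * (4 * (q * H ^ 5))"
      by (simp add: e_def power_numeral_reduce algebra_simps)
    also have "\<dots> \<le> K ^ 3 * (q * s) + K ^ 3 * (4 * (q * e))"
      using k3 h e0 s0 K_nonneg[of 3] H_nonneg[of 5] by (intro add_mono mult_mono mult_nonneg_nonneg) auto
    finally show ?thesis .
  qed
  have B4b: "K * (K * H ^ 3) * (4 * K * H ^ 5) = K ^ 3 * (4 * e\<^sup>2)" unfolding e8[symmetric] by (simp add: power_numeral_reduce)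
  have B4a: "K * s * s \<le> K ^ 3 * s\<^sup>2" using mult_right_mono[OF k3(1), of "s\<^sup>2"] by (simp add: power2_eq_square mult.assoc)
  have "\<bar>ip (J (pl N a')) A\<bar> \<le> K ^ 3 * (68 * e\<^sup>2) + (K ^ 3 * (2 * (e * s)) + K ^ 3 * (4 * e\<^sup>2)) + (K ^ 3 * (2 * (e * s)) + K ^ 3 * (8 * e\<^sup>2))
     + (K ^ 3 * (q * s) + K ^ 3 * (4 * (q * e))) + K ^ 3 * s\<^sup>2 + K ^ 3 * (4 * e\<^sup>2)"
    using t0 eq1'[of c] T0 T1 T2 T3 t4 T4a T4b B0 B1 B2 B3 B4a B4b by linarith
  also have "\<dots> = K ^ 3 * (84 * e\<^sup>2 + 4 * (e * s) + q * s + 4 * (q * e) + s\<^sup>2)" by (simp add: algebra_simps)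
  also have "\<dots> \<le> K ^ 3 * (100 * (s\<^sup>2 + q\<^sup>2 + e\<^sup>2))"
  proof (rule mult_left_mono)
    have sq: "2 * (x * y) \<le> x\<^sup>2 + y\<^sup>2" for x y :: real
      using zero_le_power2[of "x - y"] by (simp add: power2_eq_square algebra_simps)
    show "84 * e\<^sup>2 + 4 * (e * s) + q * s + 4 * (q * e) + s\<^sup>2 \<le> 100 * (s\<^sup>2 + q\<^sup>2 + e\<^sup>2)"
      using sq[of e s] sq[of q s] sq[of q e] zero_le_power2[of e] zero_le_power2[of q] zero_le_power2[of s] by argo
  qed (rule K_nonneg)
  finally show ?thesis by (simp add: A_def s_def q_def e8 algebra_simps)
qed

text \<open>The test function interpolates G with \<open>- G'' = pl N e\<close> and zero boundary
  values. Two integrations by parts turn the mass term into the flux product, and orthogonality of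
  the interpolation error turns the stiffness term into the product of \<open>b'\<close> and
  \<open>e\<close>. The choice \<open>e = b\<close> gives half the time derivative of a norm of
  \<open>b\<close>.\<close>

lemma G_energy:
  "\<bar>ip (flux N b') (flux N e) + 1/3 * ip (pl N b') (pl N e)\<bar>
     \<le> 60 * K ^ 3 * (H ^ 4 + L2norm (pl N b) + L2norm (J (pl N a))) * L2norm (pl N e)"
proof -
  define G where "G = J (flux N e)"
  define c where "c = nod N G"
  define k s q where "k = L2norm (pl N e)" and "s = L2norm (J (pl N a))" and "q = L2norm (pl N b)"
  define A where "A = J (pl N a)"
  have s0: "0 \<le> k" "0 \<le> s" "0 \<le> q" by (simp_all add: s_def q_def k_def L2norm_nonneg)
  have wf: "wd (flux N e) (\<lambda>x. 0 - pl N e x)" by (rule wd_flux[OF N])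
  have wG: "wd G (flux N e)" unfolding G_def by (intro wd_J flux_continuous N)
  have G01: "G 0 = 0" "G 1 = 0" by (simp_all add: G_def J_flux_1 N)
  have c0: "c 0 = 0" "c N = 0" using N by (simp_all add: c_def nod_def G01)
  have cG: "continuous_on {0..1} G" using wG by (simp add: wd_def)
  have dG: "(G has_real_derivative flux N e x) (at x)" if "x \<in> {0<..<1}" for x
    using J_deriv[OF flux_continuous[OF N], of x e] that unfolding G_def by (simp add: at_within_Icc_at)
  have df: "(flux N e has_real_derivative pl N (\<lambda>i. -1 * e i) x) (at x)" if "x \<in> {0<..<1}" for x
    using J_deriv[OF pl_continuous[OF N], of x e] that unfolding flux_def[abs_def] pl_cmult
    by (auto intro!: derivative_eq_intros simp: at_within_Icc_at)
  have wA: "wd A (pl N a)" unfolding A_def by (rule wd_J_pl[OF N])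
  note [simp] = wd_bm(1)[OF wf] wd_bm[OF wG] wd_bm(1)[OF wA] wd_bm(1)[OF wd_flux[OF N]] bms
  have np: "L2norm (pl N (\<lambda>i. -1 * e i)) = k"
    unfolding pl_cmult[abs_def] L2norm_cmult by (simp add: k_def)
  have N4: "4 / (real N)\<^sup>2 = 4 * H ^ 4" "4 / real N = 4 * H\<^sup>2"
    using H4 H2 by auto
  have e1: "L2norm (\<lambda>x. G x - pl N c x) \<le> 4 * H ^ 4 * k" and e2: "L2norm (\<lambda>x. flux N e x - dpl N c x) \<le> 4 * H\<^sup>2 * k"
    using interp_L2[OF N cG flux_continuous[OF N] dG df] unfolding c_def[symmetric] np N4 by auto
  have fb: "\<bar>flux N e x\<bar> \<le> 2 * k" if "x \<in> {0..1}" for x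
    using flux_bound[OF N that] by (simp add: k_def)
  have nf: "L2norm (flux N e) \<le> 2 * k" by (rule L2norm_le_sup) (use fb s0 in auto)
  \<comment> \<open>Slopes of the interpolant are cell means of \<open>flux N e\<close>, so they
    inherit its maximum bound.\<close>
  have dc: "\<bar>dpl N c x\<bar> \<le> 2 * k" for x
  proof (rule dpl_sup[OF N])
    fix i assume i: "i < N"
    have "c (Suc i) - c i = integral {real i / real N..real (Suc i) / real N} (flux N e)"
      unfolding c_def nod_def using i by (intro wd_FTC[OF wG, symmetric]) (auto simp: divide_right_mono)
    also have "\<bar>\<dots>\<bar> \<le> 2 * k / real N"
      by (rule integral_cell_abs_le[OF _ i]) (use fb cell_point[OF i] in fastforce)+
    finally show "\<bar>real N * (c (Suc i) - c i)\<bar> \<le> 2 * k" using N by (simp only: abs_mult) (simp add: field_simps)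
  qed
  have nd: "L2norm (dpl N c) \<le> 2 * k" by (rule L2norm_le_sup) (use dc s0 in auto)
  have nc: "L2norm (pl N c) \<le> 2 * k"
  proof (rule L2norm_le_sup)
    fix x :: real assume x: "x \<in> {0..1}"
    have "\<bar>c i\<bar> \<le> 2 * k" if "i \<le> N" for i
    proof -
      have "\<bar>c i\<bar> \<le> L2norm (flux N e)" unfolding c_def nod_def G_def
        by (rule J_bound) (use that N in auto)
      then show ?thesis using nf by simp
    qed
    then show "\<bar>pl N c x\<bar> \<le> 2 * k" using x by (rule pl_sup[OF N])
  qed (use s0 in auto)
  have T1: "\<bar>ip \<sigma>t (pl N c)\<bar> \<le> K * H ^ 4 * (2 * k)"
    by (rule order.trans[OF small_ip(2) mult_left_mono[OF nc]]) (use K H_nonneg[of 4] in simp)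
  have T2: "\<bar>ip (\<lambda>x. w3 x * \<sigma> x + w4 x * \<rho> x) (dpl N c)\<bar> \<le> 2 * K\<^sup>2 * H ^ 4 * (2 * k)"
    by (rule order.trans[OF two_products_small[OF w3_bm w_bm(5) wK(5,6)] mult_left_mono[OF nd]])
      (auto intro!: mult_nonneg_nonneg H_nonneg K_nonneg)
  have T3: "\<bar>ip (\<lambda>x. w3 x * pl N b x) (dpl N c)\<bar> \<le> K * q * (2 * k)"
    by (intro abs_ip_mult_le bms wK nd) (simp_all add: q_def)
  \<comment> \<open>The weight \<open>w4\<close> is split into the differentiable \<open>w5\<close>
    and a part proportional to the error of \<eta>; the latter gives a term quadratic in the errors,
    of order \<open>H^6\<close>, for which the maximum bound on \<open>dpl N c\<close> is
    used.\<close>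
  have t4: "ip (\<lambda>x. w4 x * pl N a x) (dpl N c) = ip (\<lambda>x. w5 x * pl N a x) (flux N e)
     - ip (\<lambda>x. w5 x * pl N a x) (\<lambda>x. flux N e x - dpl N c x) - g * ip (\<lambda>x. dpl N c x * pl N a x) (\<lambda>x. \<rho> x + pl N a x)"
  proof -
    have "ip (\<lambda>x. w4 x * pl N a x) (dpl N c) = ip (\<lambda>x. w5 x * pl N a x - g * (\<rho> x + pl N a x) * pl N a x) (dpl N c)"
      by (rule ip_cong) (simp add: w4 algebra_simps)
    also have "\<dots> = ip (\<lambda>x. w5 x * pl N a x) (dpl N c) - ip (\<lambda>x. g * (\<rho> x + pl N a x) * pl N a x) (dpl N c)"
      by (rule ip_diff_left) (auto intro!: bm_intros)
    also have "ip (\<lambda>x. g * (\<rho> x + pl N a x) * pl N a x) (dpl N c) = g * ip (\<lambda>x. dpl N c x * pl N a x) (\<lambda>x. \<rho> x + pl N a x)"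
      by (subst ip_cmult_left[symmetric]) (rule ip_cong, simp)
    also have "ip (\<lambda>x. w5 x * pl N a x) (dpl N c) = ip (\<lambda>x. w5 x * pl N a x) (\<lambda>x. flux N e x - (flux N e x - dpl N c x))" by simp
    also have "\<dots> = ip (\<lambda>x. w5 x * pl N a x) (flux N e) - ip (\<lambda>x. w5 x * pl N a x) (\<lambda>x. flux N e x - dpl N c x)"
      by (rule ip_diff_right) (auto intro!: bm_intros)
    finally show ?thesis .
  qed
  have T4b: "\<bar>ip (\<lambda>x. w5 x * pl N a x) (\<lambda>x. flux N e x - dpl N c x)\<bar> \<le> K * (K * H ^ 3) * (4 * H\<^sup>2 * k)"
    by (intro abs_ip_mult_le bms wK p_small e2 bm_intros) auto
  have nrp: "L2norm (\<lambda>x. \<rho> x + pl N a x) \<le> K * H ^ 4 + K * H ^ 3"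
    by (rule order.trans[OF L2norm_triangle add_mono[OF L2norm_le_sup p_small]]) (use small K H_nonneg in auto)
  have T4c': "\<bar>ip (\<lambda>x. dpl N c x * pl N a x) (\<lambda>x. \<rho> x + pl N a x)\<bar> \<le> (2 * k) * (K * H ^ 3) * (K * H ^ 4 + K * H ^ 3)"
    by (intro abs_ip_mult_le bms p_small nrp bm_intros dc)
  have T4c: "\<bar>g * ip (\<lambda>x. dpl N c x * pl N a x) (\<lambda>x. \<rho> x + pl N a x)\<bar> \<le> K * ((2 * k) * (K * H ^ 3) * (K * H ^ 4 + K * H ^ 3))"
    unfolding abs_mult using gK T4c' K by (intro mult_mono) auto
  \<comment> \<open>Since \<open>pl N a\<close> is the derivative of A, one integration by parts
    replaces theta by A. This is where the derivative of \<open>w5\<close> and the bound on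
    \<open>A(1)\<close> enter.\<close>
  have wwf: "wd (\<lambda>x. w5 x * flux N e x) (\<lambda>x. w5' x * flux N e x + w5 x * (0 - pl N e x))" by (intro wd_mult wd5 wf)
  have "ip (pl N a) (\<lambda>x. w5 x * flux N e x) + ip A (\<lambda>x. w5' x * flux N e x + w5 x * (0 - pl N e x)) = A 1 * (w5 1 * flux N e 1)"
    using wd_by_parts[OF wA wwf] by (simp add: A_def)
  moreover have "ip A (\<lambda>x. w5' x * flux N e x + w5 x * (0 - pl N e x)) = ip (\<lambda>x. w5' x * flux N e x) A - ip (\<lambda>x. w5 x * pl N e x) A"
    by (subst ip_commute, subst ip_diff_left[symmetric]) (auto intro!: bm_intros ip_cong simp: algebra_simps)
  moreover have "ip (pl N a) (\<lambda>x. w5 x * flux N e x) = ip (\<lambda>x. w5 x * pl N a x) (flux N e)"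
    by (rule ip_cong) simp
  moreover have "\<bar>ip (\<lambda>x. w5' x * flux N e x) A\<bar> \<le> K * (2 * k) * s" "\<bar>ip (\<lambda>x. w5 x * pl N e x) A\<bar> \<le> K * k * s"
    by (intro abs_ip_mult_le bms wK nf; simp add: s_def k_def A_def[symmetric])+
  moreover have "\<bar>A 1 * (w5 1 * flux N e 1)\<bar> \<le> (K * H ^ 4) * (K * (2 * k))"
    unfolding abs_mult using A1_small wK(7)[of 1] fb[of 1] K s0 H_nonneg[of 4]
    by (intro mult_mono) (auto simp: A_def)
  ultimately have T4a: "\<bar>ip (\<lambda>x. w5 x * pl N a x) (flux N e)\<bar> \<le> (K * H ^ 4) * (K * (2 * k)) + K * (2 * k) * s + K * k * s"
    by linarith
  \<comment> \<open>Replacing G by its interpolant changes only the mass term; the stiffness term is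
    unaffected by orthogonality.\<close>
  have lhs: "ip (pl N b') (pl N c) + 1/3 * ip (dpl N b') (dpl N c)
      = ip (flux N b') (flux N e) + 1/3 * ip (pl N b') (pl N e) - ip (pl N b') (\<lambda>x. G x - pl N c x)"
  proof -
    have "ip (\<lambda>x. flux N e x - dpl N c x) (dpl N b') = 0"
      by (rule ip_orth_dpl[OF N wd_diff[OF wG wd_pl[OF N, of c]]]) (simp add: pl_node N c_def nod_def)
    then have "ip (dpl N b') (dpl N c) = ip (dpl N b') (flux N e)"
      using ip_diff_left[of "flux N e" "dpl N c" "dpl N b'"] by (simp add: ip_commute)
    also have "\<dots> = - ip (pl N b') (\<lambda>x. 0 - pl N e x)"
      using wd_by_parts[OF wd_pl[OF N, of b'] wf] by (simp add: pl_0 pl_1 N bdry)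
    also have "\<dots> = ip (pl N b') (pl N e)"
      using ip_cmult_right[of "pl N b'" "-1" "pl N e"] by simp
    finally have 1: "ip (dpl N b') (dpl N c) = ip (pl N b') (pl N e)" .
    have "ip (\<lambda>x. 0 - pl N b' x) G + ip (flux N b') (flux N e) = 0"
      using wd_by_parts[OF wd_flux[OF N, of b'] wG] by (simp add: G01)
    moreover have "ip (\<lambda>x. 0 - pl N b' x) G = - ip (pl N b') G"
      using ip_uminus_left[of "pl N b'" G] by simp
    moreover have "ip (pl N b') (\<lambda>x. G x - pl N c x) = ip (pl N b') G - ip (pl N b') (pl N c)"
      by (rule ip_diff_right) auto
    ultimately show ?thesis using 1 by simp
  qed
  have T0: "\<bar>ip (pl N b') (\<lambda>x. G x - pl N c x)\<bar> \<le> (4 * (K\<^sup>2 * H ^ 3)) * (4 * H ^ 4 * k)"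
    by (intro abs_ip_le b'_bound e1 bm_intros) auto
  have k3: "K \<le> K ^ 3" "K\<^sup>2 \<le> K ^ 3" using power_increasing[of 1 3 K] power_increasing[of 2 3 K] K by auto
  define M where "M = K ^ 3 * (H ^ 4 * k)"
  define Q where "Q = K ^ 3 * (q * k)"
  define S where "S = K ^ 3 * (s * k)"
  have hk: "H ^ m * k \<le> H ^ 4 * k" if "4 \<le> m" for m using H_mono[OF that] s0 by (intro mult_right_mono)
  have hk0: "0 \<le> H ^ m * k" for m using s0 H_nonneg by simp
  have B: "K * (H ^ 4 * k) \<le> M" "K\<^sup>2 * (H ^ 4 * k) \<le> M" "K\<^sup>2 * (H ^ 5 * k) \<le> M" "K ^ 3 * (H ^ 7 * k) \<le> M" "K ^ 3 * (H ^ 6 * k) \<le> M"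
     "K\<^sup>2 * (H ^ 7 * k) \<le> M" "K * (q * k) \<le> Q" "K * (s * k) \<le> S"
    unfolding M_def Q_def S_def using s0 K_nonneg[of 3] hk0 by (intro mult_mono k3 order.refl hk; simp)+
  have "\<bar>ip (flux N b') (flux N e) + 1/3 * ip (pl N b') (pl N e)\<bar> \<le>
      (4 * (K\<^sup>2 * H ^ 3)) * (4 * H ^ 4 * k) + K * H ^ 4 * (2 * k) + 2 * K\<^sup>2 * H ^ 4 * (2 * k) + K * q * (2 * k)
      + ((K * H ^ 4) * (K * (2 * k)) + K * (2 * k) * s + K * k * s) + K * (K * H ^ 3) * (4 * H\<^sup>2 * k)
      + K * ((2 * k) * (K * H ^ 3) * (K * H ^ 4 + K * H ^ 3))"
    using lhs eq2'[OF c0] T0 T1 T2 T3 t4 T4a T4b T4c by linarith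
  also have "\<dots> = 16 * (K\<^sup>2 * (H ^ 7 * k)) + 2 * (K * (H ^ 4 * k)) + 4 * (K\<^sup>2 * (H ^ 4 * k)) + 2 * (K * (q * k))
      + 2 * (K\<^sup>2 * (H ^ 4 * k)) + 3 * (K * (s * k)) + 4 * (K\<^sup>2 * (H ^ 5 * k)) + 2 * (K ^ 3 * (H ^ 7 * k)) + 2 * (K ^ 3 * (H ^ 6 * k))"
    by (simp add: power_numeral_reduce algebra_simps)
  also have "\<dots> \<le> 60 * M + 60 * Q + 60 * S"
  proof -
    have "0 \<le> M" "0 \<le> Q" "0 \<le> S" unfolding M_def Q_def S_def using s0 K_nonneg[of 3] hk0 by simp_all
    then show ?thesis using B by linarith
  qed
  also have "\<dots> = 60 * K ^ 3 * (H ^ 4 + q + s) * k" by (simp add: M_def Q_def S_def algebra_simps)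
  finally show ?thesis by (simp add: k_def s_def q_def)
qed

lemma b'_final: "L2norm (pl N b') \<le> 180 * K ^ 3 * (H ^ 4 + L2norm (pl N b) + L2norm (J (pl N a)))"
proof -
  let ?P = "L2norm (pl N b')" and ?X = "60 * K ^ 3 * (H ^ 4 + L2norm (pl N b) + L2norm (J (pl N a)))"
  have "1/3 * ip (pl N b') (pl N b') \<le> ?X * ?P"
    using G_energy[of b'] ip_self_nonneg[of "flux N b'"] by linarith
  then have "?P * ?P \<le> (3 * ?X) * ?P" by (simp add: L2norm_sq[symmetric] power2_eq_square)
  moreover have "0 \<le> ?X" by (intro mult_nonneg_nonneg add_nonneg_nonneg L2norm_nonneg H_nonneg K_nonneg) simp
  ultimately show ?thesis using L2norm_nonneg[of "pl N b'"]
    by (cases "?P = 0") (auto simp: mult_le_cancel_right)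
qed

lemma second_energy:
  fixes z :: real
  assumes "z = ip (J (pl N a)) (J (pl N a)) + (ip (flux N b) (flux N b) + 1/3 * ip (pl N b) (pl N b))"
  shows "ip (J (pl N a')) (J (pl N a)) + (ip (flux N b') (flux N b) + 1/3 * ip (pl N b') (pl N b))
    \<le> 700 * K ^ 3 * (z + H ^ 8)"
proof -
  define s q e where "s = L2norm (J (pl N a))" and "q = L2norm (pl N b)" and "e = H ^ 4"
  have e8: "H ^ 8 = e\<^sup>2" unfolding e_def by (simp flip: power_mult)
  have sq: "2 * (x * y) \<le> x\<^sup>2 + y\<^sup>2" for x y :: real
    using zero_le_power2[of "x - y"] by (simp add: power2_eq_square algebra_simps)
  have *: "(e + q + s) * q \<le> 2 * (s\<^sup>2 + q\<^sup>2 + e\<^sup>2)"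
    using sq[of e q] sq[of s q] zero_le_power2[of e] zero_le_power2[of q] zero_le_power2[of s]
    unfolding distrib_right power2_eq_square[of q, symmetric] by argo
  have "ip (J (pl N a')) (J (pl N a)) + (ip (flux N b') (flux N b) + 1/3 * ip (pl N b') (pl N b))
    \<le> 100 * K ^ 3 * (s\<^sup>2 + q\<^sup>2 + e\<^sup>2) + 60 * K ^ 3 * ((e + q + s) * q)"
    using A_energy G_energy[of b] unfolding s_def[symmetric] q_def[symmetric] e_def[symmetric] e8 mult.assoc by linarith
  also have "\<dots> \<le> 100 * K ^ 3 * (s\<^sup>2 + q\<^sup>2 + e\<^sup>2) + 60 * K ^ 3 * (2 * (s\<^sup>2 + q\<^sup>2 + e\<^sup>2))"
    using K_nonneg[of 3] by (intro add_mono[OF order.refl] mult_left_mono *) simp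
  also have "\<dots> = K ^ 3 * (220 * (s\<^sup>2 + q\<^sup>2 + e\<^sup>2))" by (simp add: algebra_simps)
  also have "\<dots> \<le> K ^ 3 * (700 * (z + e\<^sup>2))"
  proof (rule mult_left_mono[OF _ K_nonneg])
    have "z = s\<^sup>2 + (ip (flux N b) (flux N b) + 1/3 * q\<^sup>2)" by (simp add: assms s_def q_def L2norm_sq)
    then show "220 * (s\<^sup>2 + q\<^sup>2 + e\<^sup>2) \<le> 700 * (z + e\<^sup>2)"
      using ip_self_nonneg[of "flux N b"] zero_le_power2[of e] zero_le_power2[of q] zero_le_power2[of s] by argo
  qed
  finally show ?thesis by (simp add: e8 algebra_simps)
qed

end

section \<open>Consequences of the regularity assumptions\<close>

lemma Ck_deriv:
  assumes "f \<in> Ck k" "j < k" "x \<in> {0..1}"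
  shows "((Dx ^^ j) f has_real_derivative Dx ((Dx ^^ j) f) x) (at x within {0..1})"
proof -
  have "(Dx ^^ j) f differentiable (at x within {0..1})"
    using assms unfolding Ck_def differentiable_on_def by blast
  then show ?thesis
    unfolding has_real_derivative_iff_has_vector_derivative Dx_def by (rule vector_derivative_works[THEN iffD1])
qed

lemma Ck_bound:
  assumes "f \<in> Ck k" "j \<le> k" "x \<in> {0..1}"
  shows "\<bar>(Dx ^^ j) f x\<bar> \<le> Ck_norm k f"
proof -
  have "continuous_on {0..1} (\<lambda>x. \<bar>(Dx ^^ j) f x\<bar>)"
    using assms unfolding Ck_def by (intro continuous_intros) blast
  then have "bounded ((\<lambda>x. \<bar>(Dx ^^ j) f x\<bar>) ` {0..1})"
    using compact_continuous_image compact_Icc compact_imp_bounded by blast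
  then have "\<bar>(Dx ^^ j) f x\<bar> \<le> (SUP x\<in>{0..1}. \<bar>(Dx ^^ j) f x\<bar>)"
    using assms(3) by (intro cSUP_upper bounded_imp_bdd_above) auto
  also have "\<dots> \<le> Ck_norm k f"
    unfolding Ck_norm_def using assms(2) by (intro Max_ge) auto
  finally show ?thesis .
qed

lemma Ck_facts:
  assumes "f \<in> Ck k" "Ck_norm k f \<le> M" "x \<in> {0..1}"
  shows "1 \<le> k \<Longrightarrow> (f has_real_derivative Dx f x) (at x within {0..1})"
    and "2 \<le> k \<Longrightarrow> (Dx f has_real_derivative Dx (Dx f) x) (at x within {0..1})"
    and "3 \<le> k \<Longrightarrow> (Dx (Dx f) has_real_derivative Dx (Dx (Dx f)) x) (at x within {0..1})"
    and "\<bar>f x\<bar> \<le> M"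
    and "1 \<le> k \<Longrightarrow> \<bar>Dx f x\<bar> \<le> M"
    and "2 \<le> k \<Longrightarrow> \<bar>Dx (Dx f) x\<bar> \<le> M"
    and "3 \<le> k \<Longrightarrow> \<bar>Dx (Dx (Dx f)) x\<bar> \<le> M"
  using Ck_deriv[OF assms(1) _ assms(3), of 0] Ck_deriv[OF assms(1) _ assms(3), of 1] Ck_deriv[OF assms(1) _ assms(3), of 2]
    Ck_bound[OF assms(1) _ assms(3), of 0] Ck_bound[OF assms(1) _ assms(3), of 1] Ck_bound[OF assms(1) _ assms(3), of 2]
    Ck_bound[OF assms(1) _ assms(3), of 3] assms(2)
  by (auto simp: eval_nat_numeral)

lemma Ck_continuous:
  assumes "f \<in> Ck k" shows "continuous_on {0..1} f"
  using assms unfolding Ck_def by (auto dest: spec[of _ 0])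

lemma Ck_continuous_Dx:
  assumes "f \<in> Ck k" "1 \<le> k" shows "continuous_on {0..1} (Dx f)"
  using assms unfolding Ck_def by (auto dest: spec[of _ 1])

lemma Ck_wd:
  assumes "f \<in> Ck k" "1 \<le> k" shows "wd f (Dx f)"
  using Ck_deriv[OF assms(1), of 0] assms(2)
  by (intro wd_has_derivative Ck_continuous[OF assms(1)] Ck_continuous_Dx[OF assms]) auto

lemma Ck_wd_Dx:
  assumes "f \<in> Ck k" "2 \<le> k" shows "wd (Dx f) (Dx (Dx f))"
proof (rule wd_has_derivative)
  show "continuous_on {0..1} (Dx f)" using Ck_continuous_Dx[OF assms(1)] assms(2) by simp
  show "continuous_on {0..1} (Dx (Dx f))" using assms unfolding Ck_def by (auto dest: spec[of _ 2] simp: numeral_2_eq_2)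
  show "(Dx f has_real_derivative Dx (Dx f) x) (at x within {0..1})" if "x \<in> {0..1}" for x
    using Ck_deriv[OF assms(1) _ that, of 1] assms(2) by simp
qed

lemma unit_lipschitz:
  fixes f f' :: "real \<Rightarrow> real"
  assumes "\<And>x. x \<in> {0..1} \<Longrightarrow> (f has_real_derivative f' x) (at x within {0..1})" "\<And>x. x \<in> {0..1} \<Longrightarrow> \<bar>f' x\<bar> \<le> M"
    "x \<in> {0..1}" "y \<in> {0..1}"
  shows "\<bar>f x - f y\<bar> \<le> M * \<bar>x - y\<bar>"
  using field_differentiable_bound[OF convex_real_interval(5)[of 0 1] assms(1) _ assms(3,4), of M] assms(2) by auto

lemma C_time_bounded:
  assumes "\<phi> \<in> C_time T X nrm" obtains M where "\<And>t. t \<in> {0..T} \<Longrightarrow> nrm (\<phi> t) \<le> M"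
proof -
  have "continuous_on {0..T} (\<lambda>t. nrm (\<phi> t))" using assms by (simp add: C_time_def)
  then have "bounded ((\<lambda>t. nrm (\<phi> t)) ` {0..T})" using compact_continuous_image compact_Icc compact_imp_bounded by blast
  then obtain M where "\<forall>t\<in>{0..T}. \<bar>nrm (\<phi> t)\<bar> \<le> M" by (auto simp: bounded_iff)
  then show thesis by (intro that[of M]) force
qed

lemma Dt_at:
  assumes "0 < T" "t \<in> {0..T}" "((\<lambda>s. f s x) has_real_derivative d) (at t within {0..T})"
  shows "Dt T f t x = d"
  unfolding Dt_def
  using vector_derivative_within_cbox[of 0 T t "\<lambda>s. f s x" d] assms
  by (simp add: has_real_derivative_iff_has_vector_derivative)

lemma Dt_works:
  assumes "(\<lambda>s. f s x) differentiable (at t within {0..T})"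
  shows "((\<lambda>s. f s x) has_real_derivative Dt T f t x) (at t within {0..T})"
  using assms unfolding Dt_def has_real_derivative_iff_has_vector_derivative
  by (rule vector_derivative_works[THEN iffD1])

section \<open>Interchanging the time derivative with two space derivatives\<close>

text \<open>Taylor's formula by two mean value inequalities. The bound involves only the Lipschitz
  constant of \<open>f2\<close>, so it is uniform in time when \<open>f\<close> is a spatial
  profile.\<close>

lemma second_difference:
  fixes f f1 f2 :: "real \<Rightarrow> real"
  assumes d1: "\<And>x. x \<in> {0..1} \<Longrightarrow> (f has_real_derivative f1 x) (at x within {0..1})"
    and d2: "\<And>x. x \<in> {0..1} \<Longrightarrow> (f1 has_real_derivative f2 x) (at x within {0..1})"
    and l2: "\<And>x y. x \<in> {0..1} \<Longrightarrow> y \<in> {0..1} \<Longrightarrow> \<bar>f2 x - f2 y\<bar> \<le> M * \<bar>x - y\<bar>"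
    and k: "0 < k" "0 \<le> x - k" "x + k \<le> 1"
  shows "\<bar>(f (x + k) - 2 * f x + f (x - k)) / k\<^sup>2 - f2 x\<bar> \<le> 2 * M * k"
proof -
  have M: "0 \<le> M" using l2[of 0 1] by simp
  have sub: "{x-k..x+k} \<subseteq> {0..1}" using k by auto
  have b1: "\<bar>(f1 y - f1 x) - (y - x) * f2 x\<bar> \<le> M * k * k" if y: "y \<in> {x-k..x+k}" for y
  proof -
    have "norm ((f1 y - y * f2 x) - (f1 x - x * f2 x)) \<le> (M * k) * norm (y - x)"
    proof (rule field_differentiable_bound[OF convex_real_interval(5)[of "x-k" "x+k"] _ _ y])
      fix z assume z: "z \<in> {x-k..x+k}"
      show "((\<lambda>y. f1 y - y * f2 x) has_real_derivative f2 z - f2 x) (at z within {x-k..x+k})"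
        using DERIV_subset[OF d2 sub, of z] z sub by (auto intro!: derivative_eq_intros)
      have "\<bar>f2 z - f2 x\<bar> \<le> M * \<bar>z - x\<bar>" using z sub k by (intro l2) auto
      also have "\<dots> \<le> M * k" using z M by (intro mult_left_mono) auto
      finally show "norm (f2 z - f2 x) \<le> M * k" by simp
    qed (use k in auto)
    also have "\<dots> \<le> (M * k) * k" using y M k by (intro mult_left_mono) auto
    finally show ?thesis by (simp add: algebra_simps)
  qed
  \<comment> \<open>The symmetrised remainder as a function of the step; its derivative combines the
    two first-order remainders bounded in \<open>b1\<close>.\<close>
  define p where "p r = f (x + r) + f (x - r) - r\<^sup>2 * f2 x" for r
  have "norm (p k - p 0) \<le> (2 * (M * k * k)) * norm (k - 0)"
  proof (rule field_differentiable_bound[OF convex_real_interval(5)[of 0 k]])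
    fix r assume r: "r \<in> {0..k}"
    have i: "(\<lambda>r. x + r) ` {0..k} \<subseteq> {0..1}" "(\<lambda>r. x - r) ` {0..k} \<subseteq> {0..1}" using k by auto
    have m: "x + r \<in> {0..1}" "x - r \<in> {0..1}" using r k by auto
    have e: "((\<lambda>r. f (x + r)) has_real_derivative f1 (x + r) * 1) (at r within {0..k})"
      by (rule DERIV_image_chain[OF DERIV_subset[OF d1[OF m(1)] i(1)], unfolded o_def]) (auto intro!: derivative_eq_intros)
    have e': "((\<lambda>r. f (x - r)) has_real_derivative f1 (x - r) * (-1)) (at r within {0..k})"
      by (rule DERIV_image_chain[OF DERIV_subset[OF d1[OF m(2)] i(2)], unfolded o_def]) (auto intro!: derivative_eq_intros)
    show "(p has_real_derivative f1 (x + r) - f1 (x - r) - 2 * r * f2 x) (at r within {0..k})"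
      unfolding p_def using e e' by (auto intro!: derivative_eq_intros)
    have "\<bar>(f1 (x + r) - f1 x) - r * f2 x\<bar> \<le> M * k * k" "\<bar>(f1 (x - r) - f1 x) + r * f2 x\<bar> \<le> M * k * k"
      using b1[of "x + r"] b1[of "x - r"] r by auto
    then show "norm (f1 (x + r) - f1 (x - r) - 2 * r * f2 x) \<le> 2 * (M * k * k)" by simp
  qed (use k in auto)
  then have "\<bar>f (x + k) - 2 * f x + f (x - k) - k\<^sup>2 * f2 x\<bar> \<le> 2 * M * k * k\<^sup>2"
    using k by (simp add: p_def power2_eq_square algebra_simps)
  then have "\<bar>f (x + k) - 2 * f x + f (x - k) - k\<^sup>2 * f2 x\<bar> / k\<^sup>2 \<le> 2 * M * k"
    using k by (simp add: field_simps)
  moreover have "\<bar>f (x + k) - 2 * f x + f (x - k) - k\<^sup>2 * f2 x\<bar> / k\<^sup>2 = \<bar>(f (x + k) - 2 * f x + f (x - k) - k\<^sup>2 * f2 x) / k\<^sup>2\<bar>"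
    by simp
  moreover have "(f (x + k) - 2 * f x + f (x - k) - k\<^sup>2 * f2 x) / k\<^sup>2 = (f (x + k) - 2 * f x + f (x - k)) / k\<^sup>2 - f2 x"
    using k by (simp add: field_simps)
  ultimately show ?thesis by simp
qed

lemma derivative_le_lipschitz:
  fixes f :: "real \<Rightarrow> real"
  assumes "0 < T" "t \<in> {0..T}" "(f has_real_derivative d) (at t within {0..T})"
    and "\<And>s. s \<in> {0..T} \<Longrightarrow> \<bar>f s - f t\<bar> \<le> L * \<bar>s - t\<bar>"
  shows "\<bar>d\<bar> \<le> L"
proof (rule tendsto_upperbound)
  show "((\<lambda>s. \<bar>(f s - f t) / (s - t)\<bar>) \<longlongrightarrow> \<bar>d\<bar>) (at t within {0..T})"
    using assms(3) by (intro tendsto_rabs) (simp add: has_field_derivative_iff)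
  show "\<forall>\<^sub>F s in at t within {0..T}. \<bar>(f s - f t) / (s - t)\<bar> \<le> L"
    unfolding eventually_at_filter
    by (intro always_eventually) (use assms(4) in \<open>auto simp: field_simps\<close>)
  show "at t within {0..T} \<noteq> bot"
    using assms(1,2) trivial_limit_within islimpt_Icc by blast
qed

text \<open>In general only the norms depend continuously on time, so Schwarz's theorem does not apply;
  instead second differences in space converge uniformly in time.\<close>

lemma mixed_partial:
  assumes T: "0 < T"
    and u: "\<And>t. t \<in> {0..T} \<Longrightarrow> u t \<in> Ck 3" "\<And>t. t \<in> {0..T} \<Longrightarrow> Ck_norm 3 (u t) \<le> M"
    and ut: "\<And>t. t \<in> {0..T} \<Longrightarrow> Dt T u t \<in> Ck 3" "\<And>t. t \<in> {0..T} \<Longrightarrow> Ck_norm 3 (Dt T u t) \<le> M"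
    and d: "\<And>t x. t \<in> {0..T} \<Longrightarrow> x \<in> {0..1} \<Longrightarrow> (\<lambda>s. u s x) differentiable (at t within {0..T})"
    and dxx: "(\<lambda>s. Dx (Dx (u s)) x) differentiable (at t within {0..T})"
    and t: "t \<in> {0..T}" and x: "x \<in> {0<..<1}"
  shows "Dt T (\<lambda>s. Dx (Dx (u s))) t x = Dx (Dx (Dt T u t)) x"
proof -
  define D where "D k s = (u s (x + k) - 2 * u s x + u s (x - k)) / k\<^sup>2" for k s
  define d where "d k s = (Dt T u s (x + k) - 2 * Dt T u s x + Dt T u s (x - k)) / k\<^sup>2" for k s
  define U where "U s = Dx (Dx (u s)) x" for s
  define w where "w = Dt T (\<lambda>s. Dx (Dx (u s))) t x"
  \<comment> \<open>The largest step for which both \<open>x - k\<close> and \<open>x + k\<close>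
    stay in [0,1].\<close>
  define k0 where "k0 = min x (1 - x)"
  have k0: "0 < k0" using x by (simp add: k0_def)
  have kx: "0 \<le> x - k" "x + k \<le> 1" if "k \<le> k0" for k using that by (auto simp: k0_def)
  have M: "0 \<le> M" using Ck_facts(4)[OF u[OF t], of 0] by simp
  have D_err: "\<bar>D k s - U s\<bar> \<le> 2 * M * k" if "0 < k" "k \<le> k0" "s \<in> {0..T}" for k s
    unfolding D_def U_def
    by (rule second_difference[OF _ _ unit_lipschitz[of "Dx (Dx (u s))" "Dx (Dx (Dx (u s)))"] that(1) kx[OF that(2)]])
      (use Ck_facts[OF u[OF that(3)]] in auto)
  have d_err: "\<bar>d k s - Dx (Dx (Dt T u s)) x\<bar> \<le> 2 * M * k" if "0 < k" "k \<le> k0" "s \<in> {0..T}" for k s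
    unfolding d_def
    by (rule second_difference[OF _ _ unit_lipschitz[of "Dx (Dx (Dt T u s))" "Dx (Dx (Dx (Dt T u s)))"] that(1) kx[OF that(2)]])
      (use Ck_facts[OF ut[OF that(3)]] in auto)
  have Dd: "(D k has_real_derivative d k s) (at s within {0..T})" if "0 < k" "k \<le> k0" "s \<in> {0..T}" for k s
    unfolding D_def[abs_def] d_def using that(1) x kx[OF that(2)]
    by (intro DERIV_cdivide DERIV_add DERIV_diff DERIV_cmult Dt_works assms(6) that(3)) auto
  \<comment> \<open>A bound proportional to \<open>\<bar>s - t\<bar>\<close> is needed, for then it
    passes to the derivative at \<open>t\<close>. It comes from comparing the steps \<open>k\<close>
    and \<open>m\<close>: the time derivative of \<open>D k - D m\<close> is at most
    \<open>2 * M * k + 2 * M * m\<close>, and \<open>m\<close> may be arbitrarily small.\<close>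
  have inc: "\<bar>(D k s - U s) - (D k t - U t)\<bar> \<le> 2 * M * k * \<bar>s - t\<bar>" if k: "0 < k" "k \<le> k0" and s: "s \<in> {0..T}" for k s
  proof (rule field_le_epsilon)
    fix e :: real assume e: "0 < e"
    \<comment> \<open>Chosen so that all contributions of \<open>m\<close> together stay below
      \<open>e\<close>; the summand 1 keeps the denominator positive.\<close>
    define m where "m = min k (e / (2 * M * \<bar>s - t\<bar> + 4 * M + 1))"
    have m: "0 < m" "m \<le> k0" "m \<le> k" using k e M by (auto simp: m_def add_nonneg_pos intro!: divide_pos_pos)
    have me: "m * (2 * M * \<bar>s - t\<bar> + 4 * M) \<le> e"
    proof -
      have pos: "0 < 2 * M * \<bar>s - t\<bar> + 4 * M + 1" using M by (intro add_nonneg_pos) auto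
      have "m * (2 * M * \<bar>s - t\<bar> + 4 * M) \<le> m * (2 * M * \<bar>s - t\<bar> + 4 * M + 1)" using m by simp
      also have "\<dots> \<le> e / (2 * M * \<bar>s - t\<bar> + 4 * M + 1) * (2 * M * \<bar>s - t\<bar> + 4 * M + 1)"
        using pos by (intro mult_right_mono) (auto simp: m_def)
      finally show ?thesis using pos by simp
    qed
    have "norm ((D k s - D m s) - (D k t - D m t)) \<le> (2 * M * k + 2 * M * m) * norm (s - t)"
    proof (rule field_differentiable_bound[OF convex_real_interval(5)[of 0 T] _ _ s t])
      fix r assume r: "r \<in> {0..T}"
      show "((\<lambda>s. D k s - D m s) has_real_derivative d k r - d m r) (at r within {0..T})"
        by (intro DERIV_diff Dd k m r)
      show "norm (d k r - d m r) \<le> 2 * M * k + 2 * M * m"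
        using d_err[OF k r] d_err[OF m(1,2) r] by simp
    qed
    moreover have "\<bar>D m s - U s\<bar> \<le> 2 * M * m" "\<bar>D m t - U t\<bar> \<le> 2 * M * m" by (intro D_err m s t)+
    ultimately have "\<bar>(D k s - U s) - (D k t - U t)\<bar> \<le> (2 * M * k + 2 * M * m) * \<bar>s - t\<bar> + 4 * M * m"
      by (auto simp: abs_le_iff)
    also have "\<dots> = 2 * M * k * \<bar>s - t\<bar> + m * (2 * M * \<bar>s - t\<bar> + 4 * M)" by (simp add: algebra_simps)
    finally show "\<bar>(D k s - U s) - (D k t - U t)\<bar> \<le> 2 * M * k * \<bar>s - t\<bar> + e" using me by simp
  qed
  have "\<bar>w - Dx (Dx (Dt T u t)) x\<bar> \<le> 4 * M * k" if k: "0 < k" "k \<le> k0" for k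
  proof -
    \<comment> \<open>\<open>d k t - w\<close> is the derivative of \<open>D k - U\<close> at
      \<open>t\<close>, whose difference quotients are bounded by \<open>inc\<close>.\<close>
    have "\<bar>d k t - w\<bar> \<le> 2 * M * k"
    proof (rule derivative_le_lipschitz[OF T t])
      show "((\<lambda>s. D k s - U s) has_real_derivative d k t - w) (at t within {0..T})"
        unfolding U_def w_def by (intro DERIV_diff Dd k t Dt_works[where f = "\<lambda>s. Dx (Dx (u s))", OF dxx])
    qed (use inc[OF k] in auto)
    then show ?thesis using d_err[OF k t] by simp
  qed
  note * = this
  have "\<bar>w - Dx (Dx (Dt T u t)) x\<bar> \<le> 0"
  proof (rule field_le_epsilon)
    fix e :: real assume e: "0 < e"
    define k where "k = min k0 (e / (4 * M + 1))"
    have k: "0 < k" "k \<le> k0" using k0 e M by (auto simp: k_def)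
    have "\<bar>w - Dx (Dx (Dt T u t)) x\<bar> \<le> 4 * M * k" by (rule *[OF k])
    also have "\<dots> \<le> (4 * M + 1) * k" using k by (intro mult_right_mono) auto
    also have "\<dots> \<le> (4 * M + 1) * (e / (4 * M + 1))" using M by (intro mult_left_mono) (auto simp: k_def)
    finally show "\<bar>w - Dx (Dx (Dt T u t)) x\<bar> \<le> 0 + e" using M by simp
  qed
  then show ?thesis by (simp add: w_def)
qed

section \<open>The common family of systems and the discrete equations for nodal values\<close>

definition GB :: "real \<Rightarrow> real \<Rightarrow> real \<Rightarrow> real \<Rightarrow> (real \<Rightarrow> real) \<Rightarrow> (real \<Rightarrow> real) \<Rightarrow>
    (real \<Rightarrow> real \<Rightarrow> real) \<Rightarrow> (real \<Rightarrow> real \<Rightarrow> real) \<Rightarrow> bool" where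
  "GB \<alpha> \<beta> \<gamma> T \<eta>0 u0 \<eta> u \<longleftrightarrow> classical T \<eta> u \<and> init_bdry T \<eta>0 u0 \<eta> u \<and>
     (\<forall>t\<in>{0..T}. \<forall>x\<in>{0..1}.
        Dt T \<eta> t x + Dx (u t) x + \<alpha> * Dx (\<lambda>y. \<eta> t y * u t y) x = 0 \<and>
        Dt T u t x + Dx (\<eta> t) x + \<beta> * (u t x * Dx (u t) x) + \<gamma> * (\<eta> t x * Dx (\<eta> t) x)
          - 1/3 * Dt T (\<lambda>s. Dx (Dx (u s))) t x = 0)"

definition GBh :: "real \<Rightarrow> real \<Rightarrow> real \<Rightarrow> nat \<Rightarrow> real \<Rightarrow> (real \<Rightarrow> real) \<Rightarrow> (real \<Rightarrow> real) \<Rightarrow>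
    (real \<Rightarrow> real \<Rightarrow> real) \<Rightarrow> (real \<Rightarrow> real \<Rightarrow> real) \<Rightarrow> bool" where
  "GBh \<alpha> \<beta> \<gamma> N T \<eta>0 u0 \<eta>h uh \<longleftrightarrow> semidiscrete N T \<eta>0 u0 \<eta>h uh \<and>
     (\<forall>t\<in>{0..T}.
        (\<forall>\<phi>\<in>Sh N. ip (Dt T \<eta>h t) \<phi> + ip (Dx (uh t)) \<phi>
           + \<alpha> * ip (Dx (\<lambda>x. \<eta>h t x * uh t x)) \<phi> = 0) \<and>
        (\<forall>\<omega>\<in>Sh0 N. a_form (Dt T uh t) \<omega> + ip (Dx (\<eta>h t)) \<omega>
           + \<beta> * ip (\<lambda>x. uh t x * Dx (uh t) x) \<omega>
           + \<gamma> * ip (\<lambda>x. \<eta>h t x * Dx (\<eta>h t) x) \<omega> = 0))"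

lemma CB_eq_GB: "CB = GB 1 1 0" and SCB_eq_GB: "SCB = GB (1/2) (3/2) (1/2)"
  and CBh_eq_GBh: "CBh = GBh 1 1 0" and SCBh_eq_GBh: "SCBh = GBh (1/2) (3/2) (1/2)"
  by (intro ext; simp add: CB_def SCB_def GB_def CBh_def SCBh_def GBh_def)+

text \<open>All space derivatives are moved to the test function. The boundary terms vanish in the
  first equation because the discrete \<open>u\<close> does so at the end points, in the second
  because the test function does. Thus no derivative of the discrete \<eta> occurs.\<close>

definition discrete_eqs :: "real \<Rightarrow> real \<Rightarrow> real \<Rightarrow> nat \<Rightarrow> (nat \<Rightarrow> real) \<Rightarrow> (nat \<Rightarrow> real) \<Rightarrow>
    (nat \<Rightarrow> real) \<Rightarrow> (nat \<Rightarrow> real) \<Rightarrow> bool" where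
  "discrete_eqs \<alpha> \<beta> \<gamma> N a b a' b' \<longleftrightarrow>
     (\<forall>c. ip (pl N a') (pl N c) = ip (\<lambda>x. pl N b x + \<alpha> * (pl N a x * pl N b x)) (dpl N c)) \<and>
     (\<forall>c. c 0 = 0 \<longrightarrow> c N = 0 \<longrightarrow> ip (pl N b') (pl N c) + 1/3 * ip (dpl N b') (dpl N c) =
        ip (\<lambda>x. pl N a x + \<beta> / 2 * (pl N b x * pl N b x) + \<gamma> / 2 * (pl N a x * pl N a x)) (dpl N c))"

lemma wd_lipschitz:
  assumes "wd F f" "\<And>x. x \<in> {0..1} \<Longrightarrow> \<bar>f x\<bar> \<le> L" "x \<in> {0..1}" "y \<in> {0..1}"
  shows "\<bar>F x - F y\<bar> \<le> L * \<bar>x - y\<bar>"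
proof -
  have *: "\<bar>F y - F x\<bar> \<le> L * (y - x)" if "x \<le> y" "x \<in> {0..1}" "y \<in> {0..1}" for x y
  proof -
    have "integral {x..y} f = F y - F x" using that by (intro wd_FTC assms(1)) auto
    moreover have "norm (integral {x..y} f) \<le> integral {x..y} (\<lambda>x. L)"
      by (rule integral_norm_bound_integral) (use that assms(2) bm_integrable[OF wd_bm(2)[OF assms(1)]] in auto)
    ultimately show ?thesis using that by (simp add: mult.commute)
  qed
  show ?thesis using *[of x y] *[of y x] assms(3,4) by (cases "x \<le> y") (auto simp: abs_minus_commute)
qed

definition kron :: "nat \<Rightarrow> nat \<Rightarrow> real" where
  "kron i j = (if j = i then 1 else 0)"

lemma kron_expand: "i \<le> N \<Longrightarrow> (\<Sum>k\<le>N. a k * kron k i) = a i"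
  by (simp add: kron_def if_distrib[of "\<lambda>x. _ * x"] sum.delta cong: if_cong)

lemma pl_expand: assumes "0 < N" shows "pl N a x = (\<Sum>k\<le>N. a k * pl N (kron k) x)"
proof -
  have "pl N a = pl N (\<lambda>i. \<Sum>k\<le>N. a k * kron k i)" using assms by (intro pl_cong) (auto simp: kron_expand)
  then show ?thesis by (simp add: pl_sum pl_cmult)
qed

lemma dpl_expand: assumes "0 < N" shows "dpl N a x = (\<Sum>k\<le>N. a k * dpl N (kron k) x)"
proof -
  have "dpl N a = dpl N (\<lambda>i. \<Sum>k\<le>N. a k * kron k i)" using assms by (intro dpl_cong) (auto simp: kron_expand)
  then show ?thesis by (simp add: dpl_sum dpl_cmult)
qed

lemma J_linear:
  fixes N :: nat
  assumes "\<And>y. y \<in> {0..1} \<Longrightarrow> f y = (\<Sum>k\<le>N. c k * g k y)" "\<And>k. continuous_on {0..1} (g k)" "x \<in> {0..1}"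
  shows "J f x = (\<Sum>k\<le>N. c k * J (g k) x)"
proof -
  have "J f x = integral {0..x} (\<lambda>y. \<Sum>k\<le>N. c k * g k y)"
    unfolding J_def using assms(1,3) by (intro integral_cong) auto
  also have "\<dots> = (\<Sum>k\<le>N. integral {0..x} (\<lambda>y. c k * g k y))"
    using assms(3) by (intro integral_sum) (auto intro!: integrable_continuous_real continuous_intros continuous_on_subset[OF assms(2)])
  finally show ?thesis by (simp add: J_def)
qed

lemma J_pl_expand:
  assumes "0 < N" "x \<in> {0..1}" shows "J (pl N a) x = (\<Sum>k\<le>N. a k * J (pl N (kron k)) x)"
  by (rule J_linear[OF pl_expand[OF assms(1)] pl_continuous[OF assms(1)] assms(2)])

lemma flux_expand:
  assumes "0 < N" "x \<in> {0..1}" shows "flux N a x = (\<Sum>k\<le>N. a k * flux N (kron k) x)"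
proof -
  have "J (J (pl N a)) 1 = (\<Sum>k\<le>N. a k * J (J (pl N (kron k))) 1)"
    by (rule J_linear[OF J_pl_expand J_pl_continuous]) (use assms in auto)
  then show ?thesis
    using J_pl_expand[OF assms, of a] by (simp add: flux_def sum_subtractf right_diff_distrib)
qed

context
  fixes N :: nat and c :: "real \<Rightarrow> nat \<Rightarrow> real" and c' t S
  assumes N: "0 < N" and c: "\<And>i. i \<le> N \<Longrightarrow> ((\<lambda>t. c t i) has_real_derivative c' i) (at t within S)"
begin

lemma ip_pl_deriv: "((\<lambda>t. ip (pl N (c t)) (pl N (c t))) has_real_derivative 2 * ip (pl N c') (pl N (c t))) (at t within S)"
  by (rule ip_linear_deriv[OF pl_expand[OF N] pl_bm[OF N] c])

lemma ip_dpl_deriv: "((\<lambda>t. ip (dpl N (c t)) (dpl N (c t))) has_real_derivative 2 * ip (dpl N c') (dpl N (c t))) (at t within S)"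
  by (rule ip_linear_deriv[OF dpl_expand[OF N] dpl_bm[OF N] c])

lemma ip_J_pl_deriv:
  "((\<lambda>t. ip (J (pl N (c t))) (J (pl N (c t)))) has_real_derivative 2 * ip (J (pl N c')) (J (pl N (c t)))) (at t within S)"
  by (rule ip_linear_deriv[OF J_pl_expand[OF N] wd_bm(1)[OF wd_J_pl[OF N]] c])

lemma ip_flux_deriv:
  "((\<lambda>t. ip (flux N (c t)) (flux N (c t))) has_real_derivative 2 * ip (flux N c') (flux N (c t))) (at t within S)"
  by (rule ip_linear_deriv[OF flux_expand[OF N] wd_bm(1)[OF wd_flux[OF N]] c])

lemma J_pl_1_deriv:
  "((\<lambda>t. J (pl N (c t)) 1) has_real_derivative J (pl N c') 1) (at t within S)"
proof -
  have "((\<lambda>t. \<Sum>k\<le>N. c t k * J (pl N (kron k)) 1) has_real_derivative (\<Sum>k\<le>N. c' k * J (pl N (kron k)) 1)) (at t within S)"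
    by (auto intro!: derivative_eq_intros c)
  then show ?thesis using J_pl_expand[OF N, of 1 c'] J_pl_expand[OF N, of 1 "c _"] by simp
qed

end

section \<open>The exact solution and its weak form\<close>

text \<open>One number \<open>M\<close> bounds the norms of the solution, the parameters and
  \<open>T\<close>; every later constant is built from \<open>M\<close> and \<open>T\<close>, which
  makes it independent of the mesh.\<close>

locale boussinesq =
  fixes \<alpha> \<beta> \<gamma> T M :: real and \<eta>0 u0 :: "real \<Rightarrow> real" and \<eta> u :: "real \<Rightarrow> real \<Rightarrow> real"
  assumes T: "0 < T" and M: "1 \<le> M" "T \<le> M" "\<bar>\<alpha>\<bar> \<le> M" "\<bar>\<beta>\<bar> \<le> M" "\<bar>\<gamma>\<bar> \<le> M"
    and pde: "GB \<alpha> \<beta> \<gamma> T \<eta>0 u0 \<eta> u"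
    and reg: "\<And>t. t \<in> {0..T} \<Longrightarrow> \<eta> t \<in> Ck 3" "\<And>t. t \<in> {0..T} \<Longrightarrow> Dt T \<eta> t \<in> Ck 2"
      "\<And>t. t \<in> {0..T} \<Longrightarrow> u t \<in> Ck0 3" "\<And>t. t \<in> {0..T} \<Longrightarrow> Dt T u t \<in> Ck0 3"
    and bnd: "\<And>t. t \<in> {0..T} \<Longrightarrow> Ck_norm 3 (\<eta> t) \<le> M" "\<And>t. t \<in> {0..T} \<Longrightarrow> Ck_norm 2 (Dt T \<eta> t) \<le> M"
      "\<And>t. t \<in> {0..T} \<Longrightarrow> Ck_norm 3 (u t) \<le> M" "\<And>t. t \<in> {0..T} \<Longrightarrow> Ck_norm 3 (Dt T u t) \<le> M"
begin

lemma bdry0: "t \<in> {0..T} \<Longrightarrow> u t 0 = 0" "t \<in> {0..T} \<Longrightarrow> u t 1 = 0"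
    "t \<in> {0..T} \<Longrightarrow> Dt T u t 0 = 0" "t \<in> {0..T} \<Longrightarrow> Dt T u t 1 = 0"
  and regu: "t \<in> {0..T} \<Longrightarrow> u t \<in> Ck 3" "t \<in> {0..T} \<Longrightarrow> Dt T u t \<in> Ck 3"
  using reg(3)[of t] reg(4)[of t] by (auto simp: Ck0_def)

lemma diffable: "t \<in> {0..T} \<Longrightarrow> x \<in> {0..1} \<Longrightarrow> (\<lambda>s. \<eta> s x) differentiable (at t within {0..T})"
    "t \<in> {0..T} \<Longrightarrow> x \<in> {0..1} \<Longrightarrow> (\<lambda>s. u s x) differentiable (at t within {0..T})"
    "t \<in> {0..T} \<Longrightarrow> x \<in> {0..1} \<Longrightarrow> (\<lambda>s. Dx (Dx (u s)) x) differentiable (at t within {0..T})"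
  using pde by (auto simp: GB_def classical_def)

context
  fixes t :: real assumes t: "t \<in> {0..T}"
begin

lemma wd_eta: "wd (\<eta> t) (Dx (\<eta> t))" and wd_u: "wd (u t) (Dx (u t))"
  and wd_etat: "wd (Dt T \<eta> t) (Dx (Dt T \<eta> t))" and wd_ut: "wd (Dt T u t) (Dx (Dt T u t))"
  and wd_utx: "wd (Dx (Dt T u t)) (Dx (Dx (Dt T u t)))"
  using Ck_wd[OF reg(1)[OF t]] Ck_wd[OF reg(2)[OF t]] Ck_wd[OF regu(1)[OF t]] Ck_wd[OF regu(2)[OF t]] Ck_wd_Dx[OF regu(2)[OF t]]
  by auto

lemma weak1:
  assumes N: "0 < N"
  shows "ip (Dt T \<eta> t) (pl N c) = ip (\<lambda>x. u t x + \<alpha> * (\<eta> t x * u t x)) (dpl N c)"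
proof -
  have w: "wd (\<lambda>x. u t x + \<alpha> * (\<eta> t x * u t x)) (\<lambda>x. Dx (u t) x + \<alpha> * (Dx (\<eta> t) x * u t x + \<eta> t x * Dx (u t) x))"
    by (intro wd_add wd_cmult wd_mult wd_eta wd_u)
  have "ip (Dt T \<eta> t) (pl N c) = ip (\<lambda>x. - (Dx (u t) x + \<alpha> * (Dx (\<eta> t) x * u t x + \<eta> t x * Dx (u t) x))) (pl N c)"
  proof (rule ip_cong)
    fix x :: real assume x: "x \<in> {0..1}"
    have "Dx (\<lambda>y. \<eta> t y * u t y) x = Dx (\<eta> t) x * u t x + \<eta> t x * Dx (u t) x"
      using DERIV_mult[OF Ck_facts(1)[OF reg(1)[OF t] bnd(1)[OF t] x] Ck_facts(1)[OF regu(1)[OF t] bnd(3)[OF t] x]]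
      by (intro Dx_at x) (simp add: mult.commute add.commute)
    moreover have "Dt T \<eta> t x + Dx (u t) x + \<alpha> * Dx (\<lambda>y. \<eta> t y * u t y) x = 0"
      using pde t x by (auto simp: GB_def)
    ultimately have "Dt T \<eta> t x = - (Dx (u t) x + \<alpha> * (Dx (\<eta> t) x * u t x + \<eta> t x * Dx (u t) x))" by simp
    then show "Dt T \<eta> t x * pl N c x = - (Dx (u t) x + \<alpha> * (Dx (\<eta> t) x * u t x + \<eta> t x * Dx (u t) x)) * pl N c x" by simp
  qed
  also have "\<dots> = - ip (\<lambda>x. Dx (u t) x + \<alpha> * (Dx (\<eta> t) x * u t x + \<eta> t x * Dx (u t) x)) (pl N c)"
    by (rule ip_uminus_left)
  also have "\<dots> = ip (\<lambda>x. u t x + \<alpha> * (\<eta> t x * u t x)) (dpl N c)"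
    using wd_by_parts[OF w wd_pl[OF N, of c]] by (simp add: bdry0[OF t])
  finally show ?thesis .
qed

text \<open>The dispersive term is integrated by parts once, which requires \<open>(u_t)_xx\<close>
  in place of \<open>(u_xx)_t\<close>.\<close>

lemma weak2:
  assumes N: "0 < N" and c: "c 0 = 0" "c N = 0"
  shows "ip (Dt T u t) (pl N c) + 1/3 * ip (Dx (Dt T u t)) (dpl N c)
     = ip (\<lambda>x. \<eta> t x + \<beta> / 2 * (u t x * u t x) + \<gamma> / 2 * (\<eta> t x * \<eta> t x)) (dpl N c)"
proof -
  let ?f = "\<lambda>x. Dx (\<eta> t) x + \<beta> / 2 * (Dx (u t) x * u t x + u t x * Dx (u t) x) + \<gamma> / 2 * (Dx (\<eta> t) x * \<eta> t x + \<eta> t x * Dx (\<eta> t) x)"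
  have w: "wd (\<lambda>x. \<eta> t x + \<beta> / 2 * (u t x * u t x) + \<gamma> / 2 * (\<eta> t x * \<eta> t x)) ?f"
    by (intro wd_add wd_cmult wd_mult wd_eta wd_u)
  note [simp] = wd_bm[OF wd_ut] wd_bm[OF wd_utx] pl_bm[OF N] dpl_bm[OF N] wd_bm(2)[OF w]
  have "ip (\<lambda>x. Dt T u t x - 1/3 * Dx (Dx (Dt T u t)) x) (pl N c) = ip (\<lambda>x. - ?f x) (pl N c)"
  \<comment> \<open>The derivatives are interchanged at interior points only; the two end points
    form a null set.\<close>
  proof (rule ip_cong_finite[of _ _ "{0,1}"])
    show "(\<lambda>x. - ?f x) \<in> bm" by (rule bm_uminus[OF wd_bm(2)[OF w]])
    fix x :: real assume "x \<in> {0..1} - {0, 1}"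
    then have x: "x \<in> {0<..<1}" "x \<in> {0..1}" by auto
    have "Dt T u t x + Dx (\<eta> t) x + \<beta> * (u t x * Dx (u t) x) + \<gamma> * (\<eta> t x * Dx (\<eta> t) x)
          - 1/3 * Dt T (\<lambda>s. Dx (Dx (u s))) t x = 0"
      using pde t x(2) by (auto simp: GB_def)
    moreover have "Dt T (\<lambda>s. Dx (Dx (u s))) t x = Dx (Dx (Dt T u t)) x"
      by (rule mixed_partial[OF T regu(1) bnd(3) regu(2) bnd(4) diffable(2) diffable(3)[OF t x(2)] t x(1)])
    ultimately have "Dt T u t x - 1/3 * Dx (Dx (Dt T u t)) x = - ?f x" by (simp add: algebra_simps)
    then show "(Dt T u t x - 1/3 * Dx (Dx (Dt T u t)) x) * pl N c x = - ?f x * pl N c x" by simp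
  qed auto
  also have "\<dots> = - ip ?f (pl N c)" by (rule ip_uminus_left)
  also have "\<dots> = ip (\<lambda>x. \<eta> t x + \<beta> / 2 * (u t x * u t x) + \<gamma> / 2 * (\<eta> t x * \<eta> t x)) (dpl N c)"
    using wd_by_parts[OF w wd_pl[OF N, of c]] by (simp add: pl_0 pl_1 N c)
  also have "ip (\<lambda>x. Dt T u t x - 1/3 * Dx (Dx (Dt T u t)) x) (pl N c)
     = ip (Dt T u t) (pl N c) - 1/3 * ip (Dx (Dx (Dt T u t))) (pl N c)"
    using ip_diff_left[of "Dt T u t" "\<lambda>x. 1/3 * Dx (Dx (Dt T u t)) x" "pl N c"]
    by (simp only: ip_cmult_left bm_cmult wd_bm[OF wd_ut] wd_bm[OF wd_utx] pl_bm[OF N] simp_thms)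
  also have "ip (Dx (Dx (Dt T u t))) (pl N c) = - ip (Dx (Dt T u t)) (dpl N c)"
    using wd_by_parts[OF wd_utx wd_pl[OF N, of c]] by (simp add: pl_0 pl_1 N c)
  finally show ?thesis by simp
qed

end

end

section \<open>Errors of a discrete solution and the equations they satisfy\<close>

context boussinesq
begin

text \<open>Nodal values of theta, and below of xi and of the two time derivatives, always
  interpolant minus discrete function.\<close>

definition ea :: "nat \<Rightarrow> real \<Rightarrow> (nat \<Rightarrow> real) \<Rightarrow> nat \<Rightarrow> real" where
  "ea N t a i = nod N (\<eta> t) i - a i"
definition eb :: "nat \<Rightarrow> real \<Rightarrow> (nat \<Rightarrow> real) \<Rightarrow> nat \<Rightarrow> real" where
  "eb N t b i = nod N (u t) i - b i"
definition ea' :: "nat \<Rightarrow> real \<Rightarrow> (nat \<Rightarrow> real) \<Rightarrow> nat \<Rightarrow> real" where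
  "ea' N t a i = nod N (Dt T \<eta> t) i - a i"
definition eb' :: "nat \<Rightarrow> real \<Rightarrow> (nat \<Rightarrow> real) \<Rightarrow> nat \<Rightarrow> real" where
  "eb' N t b i = nod N (Dt T u t) i - b i"

text \<open>The squared energy: the L2 norm of theta and the form \<open>a_form\<close> of xi with
  itself.\<close>

definition err2 :: "nat \<Rightarrow> real \<Rightarrow> (nat \<Rightarrow> real) \<Rightarrow> (nat \<Rightarrow> real) \<Rightarrow> real" where
  "err2 N t a b = ip (pl N (ea N t a)) (pl N (ea N t a)) +
     (ip (pl N (eb N t b)) (pl N (eb N t b)) + 1/3 * ip (dpl N (eb N t b)) (dpl N (eb N t b)))"

lemma dpl_nod_bound:
  assumes "0 < N" "\<And>x. x \<in> {0..1} \<Longrightarrow> (v has_real_derivative v' x) (at x within {0..1})"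
    "\<And>x. x \<in> {0..1} \<Longrightarrow> \<bar>v' x\<bar> \<le> L"
  shows "\<bar>dpl N (nod N v) x\<bar> \<le> L"
proof (rule dpl_sup[OF assms(1)])
  fix i assume i: "i < N"
  have m: "real i / real N \<in> {0..1}" "real (Suc i) / real N \<in> {0..1}" using i by auto
  have "\<bar>v (real (Suc i) / real N) - v (real i / real N)\<bar> \<le> L * \<bar>real (Suc i) / real N - real i / real N\<bar>"
    by (rule unit_lipschitz[OF assms(2,3) m(2,1)])
  also have "\<bar>real (Suc i) / real N - real i / real N\<bar> = 1 / real N"
    using assms(1) by (simp add: of_nat_Suc add_divide_distrib)
  finally show "\<bar>real N * (nod N v (Suc i) - nod N v i)\<bar> \<le> L"
    using assms(1) by (simp only: nod_def abs_mult) (simp add: field_simps)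
qed

text \<open>The threshold \<open>1 / N\<close> is just what the inverse inequalities can absorb: the
  squared nodal errors are at most \<open>6 N / N\<close>, hence bounded independently of the
  mesh.\<close>

lemma discrete_bounds:
  assumes t: "t \<in> {0..T}" and N: "0 < N" and y: "err2 N t a b \<le> 1 / real N"
  shows "x \<in> {0..1} \<Longrightarrow> \<bar>pl N a x\<bar> \<le> 4 * M" "x \<in> {0..1} \<Longrightarrow> \<bar>pl N b x\<bar> \<le> 4 * M" "\<bar>dpl N b x\<bar> \<le> 4 * M"
proof -
  note nn = ip_self_nonneg[of "pl N (ea N t a)"] ip_self_nonneg[of "pl N (eb N t b)"] ip_self_nonneg[of "dpl N (eb N t b)"]
  have n: "real N > 0" using N by simp
  have small: "ip (pl N (ea N t a)) (pl N (ea N t a)) \<le> 1 / real N" "ip (pl N (eb N t b)) (pl N (eb N t b)) \<le> 1 / real N"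
    "ip (dpl N (eb N t b)) (dpl N (eb N t b)) \<le> 3 * (1 / real N)"
    using y nn unfolding err2_def by linarith+
  have node: "\<bar>e i\<bar> \<le> 3" if "ip (pl N e) (pl N e) \<le> 1 / real N" "i \<le> N" for e i
  proof -
    have "(e i)\<^sup>2 \<le> 6 * real N * ip (pl N e) (pl N e)" by (rule pl_node_sq[OF N that(2)])
    also have "\<dots> \<le> 6 * real N * (1 / real N)" by (intro mult_left_mono that) simp
    also have "\<dots> \<le> 3\<^sup>2" using n by simp
    finally show ?thesis using power2_le_iff_abs_le[of 3 "e i"] by simp
  qed
  have a: "\<bar>a i\<bar> \<le> 4 * M" if "i \<le> N" for i
  proof -
    have "\<bar>nod N (\<eta> t) i\<bar> \<le> M" unfolding nod_def
      using Ck_facts(4)[OF reg(1)[OF t] bnd(1)[OF t], of "real i / real N"] that N by auto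
    then show ?thesis using node[OF small(1) that] M(1) unfolding ea_def by linarith
  qed
  have b: "\<bar>b i\<bar> \<le> 4 * M" if "i \<le> N" for i
  proof -
    have "\<bar>nod N (u t) i\<bar> \<le> M" unfolding nod_def
      using Ck_facts(4)[OF regu(1)[OF t] bnd(3)[OF t], of "real i / real N"] that N by auto
    then show ?thesis using node[OF small(2) that] M(1) unfolding eb_def by linarith
  qed
  show "x \<in> {0..1} \<Longrightarrow> \<bar>pl N a x\<bar> \<le> 4 * M" "x \<in> {0..1} \<Longrightarrow> \<bar>pl N b x\<bar> \<le> 4 * M"
    by (rule pl_sup[OF N]; use a b in auto)+
  \<comment> \<open>Each slope is at most sqrt 3, by the same balance of \<open>N\<close> against
    \<open>1 / N\<close>.\<close>
  have "\<bar>dpl N (eb N t b) x\<bar> \<le> 2"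
  proof (rule dpl_sup[OF N])
    fix i assume i: "i < N"
    have "sqrt (real N) * L2norm (dpl N (eb N t b)) = sqrt (real N * ip (dpl N (eb N t b)) (dpl N (eb N t b)))"
      by (simp add: L2norm_def real_sqrt_mult)
    also have "\<dots> \<le> sqrt (real N * (3 * (1 / real N)))" by (intro real_sqrt_le_mono mult_left_mono small) simp
    also have "\<dots> \<le> 2" using n by (simp add: real_le_lsqrt)
    finally show "\<bar>real N * (eb N t b (Suc i) - eb N t b i)\<bar> \<le> 2" using dpl_node_bound[OF N i, of "eb N t b"] by linarith
  qed
  moreover have "\<bar>dpl N (nod N (u t)) x\<bar> \<le> M"
    using dpl_nod_bound[OF N Ck_facts(1)[OF regu(1)[OF t] bnd(3)[OF t]] Ck_facts(5)[OF regu(1)[OF t] bnd(3)[OF t]]] by simp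
  moreover have "dpl N (eb N t b) x = dpl N (nod N (u t)) x - dpl N b x"
    unfolding eb_def[abs_def] dpl_diff ..
  ultimately show "\<bar>dpl N b x\<bar> \<le> 4 * M" using M(1) by linarith
qed

lemma interp_bounds:
  assumes t: "t \<in> {0..T}" and N: "0 < N"
  shows "x \<in> {0..1} \<Longrightarrow> \<bar>\<eta> t x - pl N (nod N (\<eta> t)) x\<bar> \<le> M / (real N)\<^sup>2"
    and "x \<in> {0..1} \<Longrightarrow> \<bar>Dt T \<eta> t x - pl N (nod N (Dt T \<eta> t)) x\<bar> \<le> M / (real N)\<^sup>2"
    and "x \<in> {0..1} \<Longrightarrow> \<bar>u t x - pl N (nod N (u t)) x\<bar> \<le> M / (real N)\<^sup>2"
    and "x \<in> {0..1} \<Longrightarrow> \<bar>Dt T u t x - pl N (nod N (Dt T u t)) x\<bar> \<le> M / (real N)\<^sup>2"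
    and "L2norm (\<lambda>x. Dx (u t) x - dpl N (nod N (u t)) x) \<le> M / real N"
proof -
  note F\<eta> = Ck_facts[OF reg(1)[OF t] bnd(1)[OF t]] and F\<eta>t = Ck_facts[OF reg(2)[OF t] bnd(2)[OF t]]
    and Fu = Ck_facts[OF regu(1)[OF t] bnd(3)[OF t]] and Fut = Ck_facts[OF regu(2)[OF t] bnd(4)[OF t]]
  have M0: "0 \<le> M" using M(1) by simp
  have at: "(f has_real_derivative d) (at x)" if "(f has_real_derivative d) (at x within {0..1})" "x \<in> {0<..<1}" for f d x
    using that by (simp add: at_within_Icc_at)
  show "\<bar>\<eta> t x - pl N (nod N (\<eta> t)) x\<bar> \<le> M / (real N)\<^sup>2" if "x \<in> {0..1}"
    by (rule interp_sup(1)[OF N _ at[OF F\<eta>(1)] unit_lipschitz[of "Dx (\<eta> t)" "Dx (Dx (\<eta> t))"] M0 that])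
      (use F\<eta> Ck_continuous[OF reg(1)[OF t]] in auto)
  show "\<bar>Dt T \<eta> t x - pl N (nod N (Dt T \<eta> t)) x\<bar> \<le> M / (real N)\<^sup>2" if "x \<in> {0..1}"
    by (rule interp_sup(1)[OF N _ at[OF F\<eta>t(1)] unit_lipschitz[of "Dx (Dt T \<eta> t)" "Dx (Dx (Dt T \<eta> t))"] M0 that])
      (use F\<eta>t Ck_continuous[OF reg(2)[OF t]] in auto)
  show "\<bar>u t x - pl N (nod N (u t)) x\<bar> \<le> M / (real N)\<^sup>2" if "x \<in> {0..1}"
    by (rule interp_sup(1)[OF N _ at[OF Fu(1)] unit_lipschitz[of "Dx (u t)" "Dx (Dx (u t))"] M0 that])
      (use Fu Ck_continuous[OF regu(1)[OF t]] in auto)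
  show "\<bar>Dt T u t x - pl N (nod N (Dt T u t)) x\<bar> \<le> M / (real N)\<^sup>2" if "x \<in> {0..1}"
    by (rule interp_sup(1)[OF N _ at[OF Fut(1)] unit_lipschitz[of "Dx (Dt T u t)" "Dx (Dx (Dt T u t))"] M0 that])
      (use Fut Ck_continuous[OF regu(2)[OF t]] in auto)
  show "L2norm (\<lambda>x. Dx (u t) x - dpl N (nod N (u t)) x) \<le> M / real N"
    by (rule interp_sup(2)[OF N _ at[OF Fu(1)] unit_lipschitz[of "Dx (u t)" "Dx (Dx (u t))"] M0])
      (use Fu Ck_continuous[OF regu(1)[OF t]] wd_bm(2)[OF wd_u[OF t]] in auto)
qed

text \<open>The products are linearised asymmetrically: \<open>\<eta> u\<close> minus its discrete
  counterpart is \<eta> times the error of \<open>u\<close> plus the discrete \<open>u\<close> times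
  the error of \<eta>. So \<open>w1\<close> is smooth, and \<open>w2\<close> is a discrete function
  with bounded slope that vanishes at the end points, as the energy estimate demands. The squares
  factor into sum times difference.\<close>

lemma error_locale:
  assumes t: "t \<in> {0..T}" and N: "0 < N" and K: "200 * M ^ 3 \<le> K"
    and de: "discrete_eqs \<alpha> \<beta> \<gamma> N a b a' b'" and b0: "b 0 = 0" "b N = 0" "b' 0 = 0" "b' N = 0"
    and y: "err2 N t a b \<le> 1 / real N"
  shows "galerkin_error N K (1 / sqrt (real N)) (\<gamma> / 2) (ea N t a) (eb N t b) (ea' N t a') (eb' N t b')
    (\<lambda>x. \<eta> t x - pl N (nod N (\<eta> t)) x) (\<lambda>x. Dt T \<eta> t x - pl N (nod N (Dt T \<eta> t)) x)
    (\<lambda>x. u t x - pl N (nod N (u t)) x) (\<lambda>x. Dt T u t x - pl N (nod N (Dt T u t)) x)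
    (\<lambda>x. 1 + \<alpha> * \<eta> t x) (\<lambda>x. 0 + \<alpha> * Dx (\<eta> t) x) (\<lambda>x. \<alpha> * pl N b x) (\<lambda>x. \<alpha> * dpl N b x)
    (\<lambda>x. \<beta> / 2 * (u t x + pl N b x)) (\<lambda>x. 1 + \<gamma> / 2 * (\<eta> t x + pl N a x)) (\<lambda>x. 1 + \<gamma> * \<eta> t x) (\<lambda>x. 0 + \<gamma> * Dx (\<eta> t) x)"
proof -
  note F\<eta> = Ck_facts[OF reg(1)[OF t] bnd(1)[OF t]] and F\<eta>t = Ck_facts[OF reg(2)[OF t] bnd(2)[OF t]]
    and Fu = Ck_facts[OF regu(1)[OF t] bnd(3)[OF t]] and Fut = Ck_facts[OF regu(2)[OF t] bnd(4)[OF t]]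
  note db = discrete_bounds[OF t N y]
  have n: "real N > 0" using N by simp
  have M0: "0 \<le> M" using M(1) by simp
  have Mp: "1 \<le> M\<^sup>2" "M \<le> M\<^sup>2" "M\<^sup>2 \<le> M ^ 3" using power_increasing[of 0 2 M] power_increasing[of 1 2 M] power_increasing[of 2 3 M] M(1) by auto
  have K5: "5 * M\<^sup>2 \<le> K" "M \<le> K" "1 \<le> K" using K Mp M(1) by linarith+
  have K60: "60 * M ^ 3 \<le> K" using K zero_le_power[OF M0, of 3] by linarith
  have H4: "(1 / sqrt (real N)) ^ 4 = 1 / (real N)\<^sup>2"
  proof -
    have "(1 / sqrt (real N)) ^ 4 = ((1 / sqrt (real N))\<^sup>2)\<^sup>2" by (simp flip: power_mult)
    then show ?thesis using n by (simp add: power_divide)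
  qed
  have mm: "\<bar>x * y\<bar> \<le> c * (M * M)" if "\<bar>x\<bar> \<le> M" "\<bar>y\<bar> \<le> c * M" for x y c
  proof -
    have "\<bar>x\<bar> * \<bar>y\<bar> \<le> M * (c * M)" using that M0 by (intro mult_mono) auto
    then show ?thesis by (simp add: abs_mult algebra_simps)
  qed
  note bms = wd_bm[OF wd_eta[OF t]] wd_bm[OF wd_u[OF t]] wd_bm[OF wd_etat[OF t]] wd_bm[OF wd_ut[OF t]] pl_bm[OF N] dpl_bm[OF N]
  have at: "(f has_real_derivative d) (at x)" if "(f has_real_derivative d) (at x within {0..1})" "x \<in> {0<..<1}" for f d x
    using that by (simp add: at_within_Icc_at)
  note i\<eta> = interp_bounds(1)[OF t N] and i\<eta>t = interp_bounds(2)[OF t N] and iu = interp_bounds(3)[OF t N] and iut = interp_bounds(4)[OF t N]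
  have MK: "M / (real N)\<^sup>2 \<le> K * (1 / sqrt (real N)) ^ 4"
    unfolding H4 using K5(2) by (simp add: divide_right_mono)
  have w1b: "\<bar>1 + \<alpha> * \<eta> t x\<bar> \<le> 5 * M\<^sup>2" "\<bar>0 + \<alpha> * Dx (\<eta> t) x\<bar> \<le> 5 * M\<^sup>2" "\<bar>\<alpha> * pl N b x\<bar> \<le> 5 * M\<^sup>2" "\<bar>\<alpha> * dpl N b x\<bar> \<le> 5 * M\<^sup>2"
     "\<bar>\<beta> / 2 * (u t x + pl N b x)\<bar> \<le> 5 * M\<^sup>2" "\<bar>1 + \<gamma> / 2 * (\<eta> t x + pl N a x)\<bar> \<le> 5 * M\<^sup>2"
     "\<bar>1 + \<gamma> * \<eta> t x\<bar> \<le> 5 * M\<^sup>2" "\<bar>0 + \<gamma> * Dx (\<eta> t) x\<bar> \<le> 5 * M\<^sup>2"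
    if x: "x \<in> {0..1}" for x
  proof -
    note Fx = F\<eta>(4,5)[OF x, simplified] Fu(4)[OF x] db(1,2)[OF x] db(3)[of x]
    have a1: "\<bar>\<alpha> * \<eta> t x\<bar> \<le> M * M" "\<bar>\<alpha> * Dx (\<eta> t) x\<bar> \<le> M * M"
      "\<bar>\<gamma> * \<eta> t x\<bar> \<le> M * M" "\<bar>\<gamma> * Dx (\<eta> t) x\<bar> \<le> M * M"
      by (rule mm[of _ _ 1, unfolded mult_1, OF M(3)] mm[of _ _ 1, unfolded mult_1, OF M(5)], rule Fx)+
    have a2: "\<bar>\<alpha> * pl N b x\<bar> \<le> 4 * (M * M)" "\<bar>\<alpha> * dpl N b x\<bar> \<le> 4 * (M * M)"
      by (rule mm[OF M(3)], rule Fx)+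
    have "\<bar>u t x + pl N b x\<bar> \<le> 5 * M" "\<bar>\<eta> t x + pl N a x\<bar> \<le> 5 * M"
      using Fx(1) Fx(3-5) by linarith+
    then have a3: "\<bar>\<beta> * (u t x + pl N b x)\<bar> \<le> 5 * (M * M)" "\<bar>\<gamma> * (\<eta> t x + pl N a x)\<bar> \<le> 5 * (M * M)"
      using mm[OF M(4)] mm[OF M(5)] by blast+
    have half: "\<bar>c / 2 * y\<bar> \<le> 5 * (M * M) / 2" if "\<bar>c * y\<bar> \<le> 5 * (M * M)" for c y
      using that by (simp add: abs_mult)
    note a4 = half[OF a3(1)] half[OF a3(2)]
    have MM: "1 \<le> M * M" using Mp(1) by (simp add: power2_eq_square)
    show "\<bar>1 + \<alpha> * \<eta> t x\<bar> \<le> 5 * M\<^sup>2" "\<bar>0 + \<alpha> * Dx (\<eta> t) x\<bar> \<le> 5 * M\<^sup>2" "\<bar>\<alpha> * pl N b x\<bar> \<le> 5 * M\<^sup>2" "\<bar>\<alpha> * dpl N b x\<bar> \<le> 5 * M\<^sup>2"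
     "\<bar>\<beta> / 2 * (u t x + pl N b x)\<bar> \<le> 5 * M\<^sup>2" "\<bar>1 + \<gamma> / 2 * (\<eta> t x + pl N a x)\<bar> \<le> 5 * M\<^sup>2"
     "\<bar>1 + \<gamma> * \<eta> t x\<bar> \<le> 5 * M\<^sup>2" "\<bar>0 + \<gamma> * Dx (\<eta> t) x\<bar> \<le> 5 * M\<^sup>2"
      unfolding power2_eq_square using a1 a2 a4 MM by linarith+
  qed
  have wd1: "wd (\<lambda>x. 1 + \<alpha> * \<eta> t x) (\<lambda>x. 0 + \<alpha> * Dx (\<eta> t) x)" by (intro wd_add wd_const wd_cmult wd_eta t)
  have wd5: "wd (\<lambda>x. 1 + \<gamma> * \<eta> t x) (\<lambda>x. 0 + \<gamma> * Dx (\<eta> t) x)" by (intro wd_add wd_const wd_cmult wd_eta t)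
  have wd2: "wd (\<lambda>x. \<alpha> * pl N b x) (\<lambda>x. \<alpha> * dpl N b x)" by (intro wd_cmult wd_pl N)
  show ?thesis
  proof
    show "eb N t b 0 = 0" "eb N t b N = 0" "eb' N t b' 0 = 0" "eb' N t b' N = 0"
      using N by (auto simp: eb_def eb'_def nod_def b0 bdry0[OF t])
    show "\<bar>\<gamma> / 2\<bar> \<le> K" using M K5(2) by simp
    show "1 + \<gamma> / 2 * (\<eta> t x + pl N a x) = 1 + \<gamma> * \<eta> t x - \<gamma> / 2 * (\<eta> t x - pl N (nod N (\<eta> t)) x + pl N (ea N t a) x)" for x
      unfolding ea_def[abs_def] pl_diff by (simp add: algebra_simps)
  next
    fix c :: "nat \<Rightarrow> real" and S assume c: "\<And>j. j \<le> N \<Longrightarrow> \<bar>c j\<bar> \<le> S"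
    have S: "0 \<le> S" using c[of 0] by simp
    have 1: "\<bar>ip (\<lambda>x. (1 + \<alpha> * \<eta> t x) * (u t x - pl N (nod N (u t)) x)) (dpl N c)\<bar> \<le> 6 * (5 * M\<^sup>2) * M * S / (real N)\<^sup>2"
      by (rule superconvergence[OF N _ _ at[OF Fu(1)] at[OF Fu(2)] _ unit_lipschitz[of "Dx (Dx (u t))" "Dx (Dx (Dx (u t)))"] w1b(1) wd_lipschitz[OF wd1 w1b(2)] c])
        (use Fu wd1 wd_u[OF t] in \<open>auto simp: wd_def\<close>)
    \<comment> \<open>The weight is a discrete function here; superconvergence asks only for a
      Lipschitz weight, and the bound on the slopes of \<open>b\<close> provides it.\<close>
    have 2: "\<bar>ip (\<lambda>x. (\<alpha> * pl N b x) * (\<eta> t x - pl N (nod N (\<eta> t)) x)) (dpl N c)\<bar> \<le> 6 * (5 * M\<^sup>2) * M * S / (real N)\<^sup>2"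
      by (rule superconvergence[OF N _ _ at[OF F\<eta>(1)] at[OF F\<eta>(2)] _ unit_lipschitz[of "Dx (Dx (\<eta> t))" "Dx (Dx (Dx (\<eta> t)))"] w1b(3) wd_lipschitz[OF wd2 w1b(4)] c])
        (use F\<eta> wd2 wd_eta[OF t] in \<open>auto simp: wd_def\<close>)
    have "ip (\<lambda>x. (1 + \<alpha> * \<eta> t x) * (u t x - pl N (nod N (u t)) x) + (\<alpha> * pl N b x) * (\<eta> t x - pl N (nod N (\<eta> t)) x)) (dpl N c)
      = ip (\<lambda>x. (1 + \<alpha> * \<eta> t x) * (u t x - pl N (nod N (u t)) x)) (dpl N c) + ip (\<lambda>x. (\<alpha> * pl N b x) * (\<eta> t x - pl N (nod N (\<eta> t)) x)) (dpl N c)"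
      by (rule ip_add_left) (intro bm_intros bms)+
    then have "\<bar>ip (\<lambda>x. (1 + \<alpha> * \<eta> t x) * (u t x - pl N (nod N (u t)) x) + (\<alpha> * pl N b x) * (\<eta> t x - pl N (nod N (\<eta> t)) x)) (dpl N c)\<bar>
      \<le> 6 * (5 * M\<^sup>2) * M * S / (real N)\<^sup>2 + 6 * (5 * M\<^sup>2) * M * S / (real N)\<^sup>2"
      using order.trans[OF abs_triangle_ineq add_mono[OF 1 2]] by (simp only:)
    also have "\<dots> = (60 * M ^ 3) * S * (1 / (real N)\<^sup>2)" by (simp add: power2_eq_square power3_eq_cube)
    also have "\<dots> \<le> K * S * (1 / (real N)\<^sup>2)"
      using K60 S by (intro mult_right_mono) auto
    finally show "\<bar>ip (\<lambda>x. (1 + \<alpha> * \<eta> t x) * (u t x - pl N (nod N (u t)) x) + (\<alpha> * pl N b x) * (\<eta> t x - pl N (nod N (\<eta> t)) x)) (dpl N c)\<bar>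
       \<le> K * S * (1 / sqrt (real N)) ^ 4" by (simp add: H4)
  next
    fix c :: "nat \<Rightarrow> real"
    have "ip (pl N (ea' N t a')) (pl N c) = ip (\<lambda>x. Dt T \<eta> t x - (Dt T \<eta> t x - pl N (nod N (Dt T \<eta> t)) x) - pl N a' x) (pl N c)"
      by (rule ip_cong) (simp add: ea'_def[abs_def] pl_diff)
    also have "\<dots> = ip (Dt T \<eta> t) (pl N c) - ip (\<lambda>x. Dt T \<eta> t x - pl N (nod N (Dt T \<eta> t)) x) (pl N c) - ip (pl N a') (pl N c)"
      by (subst ip_diff_left, (intro bm_intros bms)+)+ simp
    also have "ip (Dt T \<eta> t) (pl N c) = ip (\<lambda>x. u t x + \<alpha> * (\<eta> t x * u t x)) (dpl N c)" by (rule weak1[OF t N])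
    also have "ip (pl N a') (pl N c) = ip (\<lambda>x. pl N b x + \<alpha> * (pl N a x * pl N b x)) (dpl N c)"
      using de by (simp add: discrete_eqs_def)
    finally have "ip (pl N (ea' N t a')) (pl N c) = - ip (\<lambda>x. Dt T \<eta> t x - pl N (nod N (Dt T \<eta> t)) x) (pl N c)
       + (ip (\<lambda>x. u t x + \<alpha> * (\<eta> t x * u t x)) (dpl N c) - ip (\<lambda>x. pl N b x + \<alpha> * (pl N a x * pl N b x)) (dpl N c))" by simp
    also have "ip (\<lambda>x. u t x + \<alpha> * (\<eta> t x * u t x)) (dpl N c) - ip (\<lambda>x. pl N b x + \<alpha> * (pl N a x * pl N b x)) (dpl N c)
       = ip (\<lambda>x. (u t x + \<alpha> * (\<eta> t x * u t x)) - (pl N b x + \<alpha> * (pl N a x * pl N b x))) (dpl N c)"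
      by (rule ip_diff_left[symmetric]) (intro bm_intros bms)+
    also have "\<dots> = ip (\<lambda>x. (1 + \<alpha> * \<eta> t x) * (u t x - pl N (nod N (u t)) x + pl N (eb N t b) x)
       + (\<alpha> * pl N b x) * (\<eta> t x - pl N (nod N (\<eta> t)) x + pl N (ea N t a) x)) (dpl N c)"
      by (rule ip_cong) (simp add: ea_def[abs_def] eb_def[abs_def] pl_diff algebra_simps)
    finally show "ip (pl N (ea' N t a')) (pl N c) = - ip (\<lambda>x. Dt T \<eta> t x - pl N (nod N (Dt T \<eta> t)) x) (pl N c)
       + ip (\<lambda>x. (1 + \<alpha> * \<eta> t x) * (u t x - pl N (nod N (u t)) x + pl N (eb N t b) x)
       + (\<alpha> * pl N b x) * (\<eta> t x - pl N (nod N (\<eta> t)) x + pl N (ea N t a) x)) (dpl N c)" .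
  next
    fix c :: "nat \<Rightarrow> real" assume c: "c 0 = 0" "c N = 0"
    have "ip (pl N (eb' N t b')) (pl N c) = ip (\<lambda>x. Dt T u t x - (Dt T u t x - pl N (nod N (Dt T u t)) x) - pl N b' x) (pl N c)"
      by (rule ip_cong) (simp add: eb'_def[abs_def] pl_diff)
    also have "\<dots> = ip (Dt T u t) (pl N c) - ip (\<lambda>x. Dt T u t x - pl N (nod N (Dt T u t)) x) (pl N c) - ip (pl N b') (pl N c)"
      by (subst ip_diff_left, (intro bm_intros bms)+)+ simp
    finally have 1: "ip (pl N (eb' N t b')) (pl N c) = ip (Dt T u t) (pl N c) - ip (\<lambda>x. Dt T u t x - pl N (nod N (Dt T u t)) x) (pl N c) - ip (pl N b') (pl N c)" .
    \<comment> \<open>Without this orthogonality the slope error of the interpolant of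
      \<open>u_t\<close> would enter the residual, and it is only of first order.\<close>
    have "ip (\<lambda>x. Dx (Dt T u t) x - dpl N (nod N (Dt T u t)) x) (dpl N c) = 0"
      by (rule ip_orth_dpl[OF N wd_diff[OF wd_ut[OF t] wd_pl[OF N]]]) (simp add: pl_node N nod_def)
    moreover have "ip (\<lambda>x. Dx (Dt T u t) x - dpl N (nod N (Dt T u t)) x) (dpl N c)
        = ip (Dx (Dt T u t)) (dpl N c) - ip (dpl N (nod N (Dt T u t))) (dpl N c)"
      by (rule ip_diff_left) (intro bms)+
    moreover have "ip (dpl N (eb' N t b')) (dpl N c) = ip (dpl N (nod N (Dt T u t))) (dpl N c) - ip (dpl N b') (dpl N c)"
      unfolding eb'_def[abs_def] dpl_diff[abs_def] by (rule ip_diff_left) (intro bms)+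
    ultimately have 2: "ip (dpl N (eb' N t b')) (dpl N c) = ip (Dx (Dt T u t)) (dpl N c) - ip (dpl N b') (dpl N c)" by simp
    have 3: "ip (Dt T u t) (pl N c) + 1/3 * ip (Dx (Dt T u t)) (dpl N c)
     = ip (\<lambda>x. \<eta> t x + \<beta> / 2 * (u t x * u t x) + \<gamma> / 2 * (\<eta> t x * \<eta> t x)) (dpl N c)" by (rule weak2[OF t N c])
    have 4: "ip (pl N b') (pl N c) + 1/3 * ip (dpl N b') (dpl N c) =
        ip (\<lambda>x. pl N a x + \<beta> / 2 * (pl N b x * pl N b x) + \<gamma> / 2 * (pl N a x * pl N a x)) (dpl N c)"
      using de c by (simp add: discrete_eqs_def)
    have "ip (\<lambda>x. \<eta> t x + \<beta> / 2 * (u t x * u t x) + \<gamma> / 2 * (\<eta> t x * \<eta> t x)) (dpl N c)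
       - ip (\<lambda>x. pl N a x + \<beta> / 2 * (pl N b x * pl N b x) + \<gamma> / 2 * (pl N a x * pl N a x)) (dpl N c)
       = ip (\<lambda>x. (\<eta> t x + \<beta> / 2 * (u t x * u t x) + \<gamma> / 2 * (\<eta> t x * \<eta> t x)) - (pl N a x + \<beta> / 2 * (pl N b x * pl N b x) + \<gamma> / 2 * (pl N a x * pl N a x))) (dpl N c)"
      by (rule ip_diff_left[symmetric]) (intro bm_intros bms)+
    also have "\<dots> = ip (\<lambda>x. \<beta> / 2 * (u t x + pl N b x) * (u t x - pl N (nod N (u t)) x + pl N (eb N t b) x)
       + (1 + \<gamma> / 2 * (\<eta> t x + pl N a x)) * (\<eta> t x - pl N (nod N (\<eta> t)) x + pl N (ea N t a) x)) (dpl N c)"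
      by (rule ip_cong) (simp add: ea_def[abs_def] eb_def[abs_def] pl_diff field_simps)
    finally show "ip (pl N (eb' N t b')) (pl N c) + 1/3 * ip (dpl N (eb' N t b')) (dpl N c) = - ip (\<lambda>x. Dt T u t x - pl N (nod N (Dt T u t)) x) (pl N c)
       + ip (\<lambda>x. \<beta> / 2 * (u t x + pl N b x) * (u t x - pl N (nod N (u t)) x + pl N (eb N t b) x)
       + (1 + \<gamma> / 2 * (\<eta> t x + pl N a x)) * (\<eta> t x - pl N (nod N (\<eta> t)) x + pl N (ea N t a) x)) (dpl N c)"
      using 1 2 3 4 by linarith
  qed (assumption | rule N K5(3) refl wd1 wd2 wd5 order.trans[OF w1b(1) K5(1)] order.trans[OF w1b(2) K5(1)] order.trans[OF w1b(3) K5(1)]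
      order.trans[OF w1b(4) K5(1)] order.trans[OF w1b(5) K5(1)] order.trans[OF w1b(6) K5(1)] order.trans[OF w1b(7) K5(1)] order.trans[OF w1b(8) K5(1)]
      order.trans[OF i\<eta> MK] order.trans[OF i\<eta>t MK] order.trans[OF iu MK] order.trans[OF iut MK]
      | (intro bm_intros bms)[1] | simp add: pl_0 pl_1 N b0)+
qed

end

section \<open>Integration of the estimates in time\<close>

context boussinesq
begin

text \<open>Nodal values with their time derivatives, initial and boundary values, but without the
  discrete equations; solutions of the truncated problem therefore qualify as well.\<close>

definition traj :: "nat \<Rightarrow> (real \<Rightarrow> nat \<Rightarrow> real) \<Rightarrow> (real \<Rightarrow> nat \<Rightarrow> real) \<Rightarrow> (real \<Rightarrow> nat \<Rightarrow> real) \<Rightarrow> (real \<Rightarrow> nat \<Rightarrow> real) \<Rightarrow> bool" where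
  "traj N a b a' b' \<longleftrightarrow>
     (\<forall>t\<in>{0..T}. \<forall>i\<le>N. ((\<lambda>s. a s i) has_real_derivative a' t i) (at t within {0..T}) \<and>
        ((\<lambda>s. b s i) has_real_derivative b' t i) (at t within {0..T})) \<and>
     (\<forall>t\<in>{0..T}. b t 0 = 0 \<and> b t N = 0 \<and> b' t 0 = 0 \<and> b' t N = 0) \<and>
     (\<forall>i\<le>N. a 0 i = nod N \<eta>0 i \<and> b 0 i = nod N u0 i)"

text \<open>\<open>K0\<close> is the constant of the error equations. \<open>C1\<close> and
  \<open>C2\<close> come from Gronwall's inequality in the first and second step, with 64 from twice
  \<open>2 * (4 * K0^2)^2\<close> and 1400 from twice 700. \<open>K2\<close> gathers
  \<open>K0\<close>, the bound for A(1) and the bound of the first step; \<open>C3\<close> dominates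
  all final constants.\<close>

definition K0 :: real where "K0 = 200 * M ^ 3"
definition C1 :: real where "C1 = 64 * K0 ^ 4 * T * exp (2 * (5 * K0 + 2) * T)"
definition K2 :: real where "K2 = K0 + T * K0 + sqrt C1"
definition C2 :: real where "C2 = 1400 * K2 ^ 3 * T * exp (1400 * K2 ^ 3 * T)"
definition C3 :: real where "C3 = 2 * K2 + 2 * sqrt C2 + 180 * K2 ^ 3 * (1 + 3 * sqrt C2)"

lemma const_pos: "1 \<le> K0" "0 \<le> C1" "K0 \<le> K2" "T * K0 \<le> K2" "sqrt C1 \<le> K2" "1 \<le> K2" "0 \<le> C2" "2 * K2 \<le> C3" "2 * sqrt C2 \<le> C3"
    "180 * K2 ^ 3 * (1 + 3 * sqrt C2) \<le> C3" "M \<le> K0" "0 \<le> C3"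
proof -
  have m: "1 \<le> M ^ 3" "M \<le> M ^ 3" using power_increasing[of 0 3 M] power_increasing[of 1 3 M] M(1) by auto
  show K0: "1 \<le> K0" "M \<le> K0" using m M(1) by (auto simp: K0_def)
  show C1: "0 \<le> C1" using K0 T by (simp add: C1_def)
  have TK: "0 \<le> T * K0" using K0 T by simp
  show "K0 \<le> K2" "T * K0 \<le> K2" "sqrt C1 \<le> K2" using TK K0 C1 by (auto simp: K2_def)
  then show K2: "1 \<le> K2" using K0 by linarith
  then show C2: "0 \<le> C2" using T by (simp add: C2_def)
  have "0 \<le> 180 * K2 ^ 3 * (1 + 3 * sqrt C2)" using K2 C2 by simp
  then show "2 * K2 \<le> C3" "2 * sqrt C2 \<le> C3" "180 * K2 ^ 3 * (1 + 3 * sqrt C2) \<le> C3" "0 \<le> C3"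
    using K2 C2 by (auto simp: C3_def)
qed

context
  fixes N a b a' b' assumes N: "0 < N" and tr: "traj N a b a' b'"
begin

lemma ea_deriv: "t \<in> {0..T} \<Longrightarrow> i \<le> N \<Longrightarrow> ((\<lambda>s. ea N s (a s) i) has_real_derivative ea' N t (a' t) i) (at t within {0..T})"
  unfolding ea_def ea'_def nod_def using tr N
  by (intro DERIV_diff Dt_works diffable) (auto simp: traj_def)

lemma eb_deriv: "t \<in> {0..T} \<Longrightarrow> i \<le> N \<Longrightarrow> ((\<lambda>s. eb N s (b s) i) has_real_derivative eb' N t (b' t) i) (at t within {0..T})"
  unfolding eb_def eb'_def nod_def using tr N
  by (intro DERIV_diff Dt_works diffable) (auto simp: traj_def)

lemma err2_deriv: "t \<in> {0..T} \<Longrightarrow> ((\<lambda>s. err2 N s (a s) (b s)) has_real_derivative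
    2 * (ip (pl N (ea' N t (a' t))) (pl N (ea N t (a t))) + (ip (pl N (eb' N t (b' t))) (pl N (eb N t (b t)))
       + 1/3 * ip (dpl N (eb' N t (b' t))) (dpl N (eb N t (b t)))))) (at t within {0..T})"
proof -
  assume t: "t \<in> {0..T}"
  note 1 = ip_pl_deriv[OF N ea_deriv[OF t]] and 2 = ip_pl_deriv[OF N eb_deriv[OF t]] and 3 = ip_dpl_deriv[OF N eb_deriv[OF t]]
  show ?thesis unfolding err2_def
    using DERIV_add[OF 1 DERIV_add[OF 2 DERIV_cmult[OF 3, where c = "1/3"]]] by (simp add: distrib_left)
qed

lemma init0: "i \<le> N \<Longrightarrow> ea N 0 (a 0) i = 0" "i \<le> N \<Longrightarrow> eb N 0 (b 0) i = 0"
proof -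
  have *: "\<eta> 0 x = \<eta>0 x" "u 0 x = u0 x" if "x \<in> {0..1}" for x
    using pde that by (auto simp: GB_def init_bdry_def)
  show "i \<le> N \<Longrightarrow> ea N 0 (a 0) i = 0" "i \<le> N \<Longrightarrow> eb N 0 (b 0) i = 0"
    using tr N *[of "real i / real N"] by (auto simp: traj_def ea_def eb_def nod_def)
qed

lemma pl_init0: "pl N (ea N 0 (a 0)) = (\<lambda>x. 0)" "pl N (eb N 0 (b 0)) = (\<lambda>x. 0)" "dpl N (eb N 0 (b 0)) = (\<lambda>x. 0)"
  using pl_cong[OF N, of "ea N 0 (a 0)" "\<lambda>i. 0"] pl_cong[OF N, of "eb N 0 (b 0)" "\<lambda>i. 0"] dpl_cong[OF N, of "eb N 0 (b 0)" "\<lambda>i. 0"] init0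
  by (auto simp: pl_zero dpl_zero)

lemma err2_0: "err2 N 0 (a 0) (b 0) = 0"
  by (simp add: err2_def pl_init0 ip_zero_left)

abbreviation "H \<equiv> 1 / sqrt (real N)"

text \<open>\<open>L\<close> is either of the two error locales, instantiated with the errors and
  weights at time \<open>t\<close>.\<close>

abbreviation "at_time L K t \<equiv> L N K H (\<gamma> / 2) (ea N t (a t)) (eb N t (b t)) (ea' N t (a' t)) (eb' N t (b' t))
    (\<lambda>x. \<eta> t x - pl N (nod N (\<eta> t)) x) (\<lambda>x. Dt T \<eta> t x - pl N (nod N (Dt T \<eta> t)) x)
    (\<lambda>x. u t x - pl N (nod N (u t)) x) (\<lambda>x. Dt T u t x - pl N (nod N (Dt T u t)) x)
    (\<lambda>x. 1 + \<alpha> * \<eta> t x) (\<lambda>x. 0 + \<alpha> * Dx (\<eta> t) x) (\<lambda>x. \<alpha> * pl N (b t) x) (\<lambda>x. \<alpha> * dpl N (b t) x)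
    (\<lambda>x. \<beta> / 2 * (u t x + pl N (b t) x)) (\<lambda>x. 1 + \<gamma> / 2 * (\<eta> t x + pl N (a t) x)) (\<lambda>x. 1 + \<gamma> * \<eta> t x) (\<lambda>x. 0 + \<gamma> * Dx (\<eta> t) x)"

lemma galerkin_at:
  assumes "t \<in> {0..T}" "discrete_eqs \<alpha> \<beta> \<gamma> N (a t) (b t) (a' t) (b' t)" "err2 N t (a t) (b t) \<le> 1 / real N" "K0 \<le> K"
  shows "at_time galerkin_error K t"
  using tr assms by (intro error_locale[OF assms(1) N _ assms(2)]) (auto simp: traj_def K0_def)

text \<open>The hypotheses are required up to \<tau> only, since the bound is used inside the
  continuation argument.\<close>

lemma first_bound:
  assumes \<tau>: "\<tau> \<in> {0..T}"
    and h: "\<And>s. s \<in> {0..\<tau>} \<Longrightarrow> discrete_eqs \<alpha> \<beta> \<gamma> N (a s) (b s) (a' s) (b' s)" "\<And>s. s \<in> {0..\<tau>} \<Longrightarrow> err2 N s (a s) (b s) \<le> 1 / real N"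
  shows "err2 N \<tau> (a \<tau>) (b \<tau>) \<le> C1 * H ^ 6"
proof -
  define D where "D = 64 * K0 ^ 4 * H ^ 6"
  have D: "0 \<le> D" using const_pos(1) by (simp add: D_def)
  have "err2 N \<tau> (a \<tau>) (b \<tau>) \<le> (err2 N 0 (a 0) (b 0) + D * \<tau>) * exp (2 * (5 * K0 + 2) * \<tau>)"
  proof (rule Gronwall[where y = "\<lambda>s. err2 N s (a s) (b s)" and \<tau> = \<tau> and T = T])
    fix s assume s: "s \<in> {0..\<tau>}"
    then have sT: "s \<in> {0..T}" using \<tau> by auto
    show "((\<lambda>s. err2 N s (a s) (b s)) has_real_derivative
      2 * (ip (pl N (ea' N s (a' s))) (pl N (ea N s (a s))) + (ip (pl N (eb' N s (b' s))) (pl N (eb N s (b s)))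
       + 1/3 * ip (dpl N (eb' N s (b' s))) (dpl N (eb N s (b s)))))) (at s within {0..T})"
      by (rule err2_deriv[OF sT])
    note g = galerkin_at[OF sT h(1)[OF s] h(2)[OF s] order.refl]
    have "2 * (4 * K0\<^sup>2 * H ^ 3)\<^sup>2 * 2 = D" unfolding D_def by (simp add: power_mult_distrib power_divide flip: power_mult)
    then show "2 * (ip (pl N (ea' N s (a' s))) (pl N (ea N s (a s))) + (ip (pl N (eb' N s (b' s))) (pl N (eb N s (b s)))
       + 1/3 * ip (dpl N (eb' N s (b' s))) (dpl N (eb N s (b s))))) \<le> 2 * (5 * K0 + 2) * err2 N s (a s) (b s) + D"
      using galerkin_error.first_energy[OF g] unfolding err2_def[symmetric] by (simp add: algebra_simps)
  qed (use \<tau> D const_pos in auto)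
  also have "\<dots> \<le> (D * T) * exp (2 * (5 * K0 + 2) * T)"
    unfolding err2_0 using \<tau> D const_pos(1) by (intro mult_mono) (auto intro!: mult_left_mono)
  also have "\<dots> = C1 * H ^ 6" by (simp add: C1_def D_def)
  finally show ?thesis .
qed

text \<open>Discrete conservation of mass: tested with the constant 1, whose slope vanishes, the
  first equation leaves only the interpolation error of \<open>\<eta>_t\<close>.\<close>

lemma J_err_bound:
  assumes \<tau>: "\<tau> \<in> {0..T}"
    and h: "\<And>s. s \<in> {0..T} \<Longrightarrow> discrete_eqs \<alpha> \<beta> \<gamma> N (a s) (b s) (a' s) (b' s)" "\<And>s. s \<in> {0..T} \<Longrightarrow> err2 N s (a s) (b s) \<le> 1 / real N"
  shows "\<bar>J (pl N (ea N \<tau> (a \<tau>))) 1\<bar> \<le> K2 * H ^ 4"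
proof -
  have d: "\<bar>J (pl N (ea' N s (a' s))) 1\<bar> \<le> K0 * H ^ 4" if s: "s \<in> {0..T}" for s
  proof -
    note g = galerkin_at[OF s h(1)[OF s] h(2)[OF s] order.refl]
    have "J (pl N (ea' N s (a' s))) 1 = ip (pl N (ea' N s (a' s))) (pl N (\<lambda>_. 1))"
      unfolding J_def pl_const[abs_def] by (simp add: ip_integral pl_bm[OF N] bm_const)
    also have "\<dots> = - ip (\<lambda>x. Dt T \<eta> s x - pl N (nod N (Dt T \<eta> s)) x) (pl N (\<lambda>_. 1))"
      unfolding galerkin_error.eq1[OF g] dpl_const[abs_def] ip_commute[of _ "\<lambda>x. 0"] ip_zero_left by simp
    finally have "\<bar>J (pl N (ea' N s (a' s))) 1\<bar> \<le> K0 * H ^ 4 * L2norm (pl N (\<lambda>_. 1))"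
      using galerkin_error.small_ip(1)[OF g, of "\<lambda>_. 1"] by simp
    then show ?thesis unfolding pl_const[abs_def] L2norm_const by simp
  qed
  have KH: "0 \<le> K0 * H ^ 4" using const_pos by simp
  note jd = J_pl_1_deriv[OF N ea_deriv]
  have J0: "J (pl N (ea N 0 (a 0))) 1 = 0" unfolding pl_init0 by (simp add: J_def)
  \<comment> \<open>With growth rate 0 Gronwall's inequality is a mean value inequality; it is
    applied to both signs.\<close>
  have "J (pl N (ea N \<tau> (a \<tau>))) 1 \<le> (J (pl N (ea N 0 (a 0))) 1 + K0 * H ^ 4 * \<tau>) * exp (0 * \<tau>)"
    by (rule Gronwall[where y = "\<lambda>s. J (pl N (ea N s (a s))) 1" and \<tau> = T and T = T, OF _ KH _ _ _ jd])
      (use \<tau> d in \<open>auto simp: abs_le_iff\<close>)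
  moreover have "- J (pl N (ea N \<tau> (a \<tau>))) 1 \<le> (- J (pl N (ea N 0 (a 0))) 1 + K0 * H ^ 4 * \<tau>) * exp (0 * \<tau>)"
    by (rule Gronwall[where y = "\<lambda>s. - J (pl N (ea N s (a s))) 1" and \<tau> = T and T = T, OF _ KH _ _ _ DERIV_minus[OF jd]])
      (use \<tau> d in \<open>auto simp: abs_le_iff\<close>)
  moreover have "K0 * H ^ 4 * \<tau> \<le> K2 * H ^ 4"
  proof -
    have "K0 * H ^ 4 * \<tau> \<le> K0 * H ^ 4 * T" using KH \<tau> by (intro mult_left_mono) auto
    also have "\<dots> = (T * K0) * H ^ 4" by simp
    also have "\<dots> \<le> K2 * H ^ 4" by (intro mult_right_mono const_pos) simp
    finally show ?thesis .
  qed
  ultimately show ?thesis using J0 by (auto simp: abs_le_iff)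
qed

lemma L2norm_le_sqrt: "ip f f \<le> C * (h ^ k)\<^sup>2 \<Longrightarrow> 0 \<le> h \<Longrightarrow> L2norm f \<le> sqrt C * h ^ k"
  unfolding L2norm_def using real_sqrt_le_mono[of "ip f f" "C * (h ^ k)\<^sup>2"] by (simp add: real_sqrt_mult)

lemma second_bound:
  assumes h: "\<And>s. s \<in> {0..T} \<Longrightarrow> discrete_eqs \<alpha> \<beta> \<gamma> N (a s) (b s) (a' s) (b' s)" "\<And>s. s \<in> {0..T} \<Longrightarrow> err2 N s (a s) (b s) \<le> 1 / real N"
    and t: "t \<in> {0..T}"
  shows "L2norm (pl N (ea N t (a t))) \<le> C3 * H ^ 3" "L2norm (dpl N (eb N t (b t))) \<le> C3 * H ^ 3"
    "L2norm (pl N (eb N t (b t))) \<le> C3 * H ^ 4" "L2norm (pl N (eb' N t (b' t))) \<le> C3 * H ^ 4"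
proof -
  have H0: "0 \<le> H" by simp
  have H6: "H ^ 6 = (H ^ 3)\<^sup>2" "H ^ 8 = (H ^ 4)\<^sup>2" by (simp_all flip: power_mult)
  have y: "err2 N s (a s) (b s) \<le> C1 * (H ^ 3)\<^sup>2" if "s \<in> {0..T}" for s
    using first_bound[OF that h] that unfolding H6 by auto
  have pb: "L2norm (pl N (ea N s (a s))) \<le> sqrt C1 * H ^ 3" "L2norm (pl N (eb N s (b s))) \<le> sqrt C1 * H ^ 3"
    "L2norm (dpl N (eb N s (b s))) \<le> 2 * (sqrt C1 * H ^ 3)" if s: "s \<in> {0..T}" for s
  proof -
    note nn = ip_self_nonneg[of "pl N (ea N s (a s))"] ip_self_nonneg[of "pl N (eb N s (b s))"] ip_self_nonneg[of "dpl N (eb N s (b s))"]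
    have *: "ip (pl N (ea N s (a s))) (pl N (ea N s (a s))) \<le> C1 * (H ^ 3)\<^sup>2" "ip (pl N (eb N s (b s))) (pl N (eb N s (b s))) \<le> C1 * (H ^ 3)\<^sup>2"
      "ip (dpl N (eb N s (b s))) (dpl N (eb N s (b s))) \<le> 3 * (C1 * (H ^ 3)\<^sup>2)"
      using y[OF s] nn unfolding err2_def by linarith+
    show "L2norm (pl N (ea N s (a s))) \<le> sqrt C1 * H ^ 3" "L2norm (pl N (eb N s (b s))) \<le> sqrt C1 * H ^ 3"
      by (rule L2norm_le_sqrt[OF _ H0]; fact *)+
    \<comment> \<open>The factor 3 is rounded up to 4, which has the square root 2.\<close>
    have "ip (dpl N (eb N s (b s))) (dpl N (eb N s (b s))) \<le> (4 * C1) * (H ^ 3)\<^sup>2"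
      using *(3) mult_nonneg_nonneg[OF const_pos(2) zero_le_power2[of "H ^ 3"]] by linarith
    from L2norm_le_sqrt[OF this H0] show "L2norm (dpl N (eb N s (b s))) \<le> 2 * (sqrt C1 * H ^ 3)"
      by (simp add: real_sqrt_mult)
  qed
  have le: "sqrt C1 * H ^ 3 \<le> K2 * H ^ 3" by (intro mult_right_mono const_pos) simp
  have gal: "at_time galerkin_error2 K2 s"
    if s: "s \<in> {0..T}" for s
    unfolding galerkin_error2_def galerkin_error2_axioms_def
    using galerkin_at[OF s h(1)[OF s] h(2)[OF s] const_pos(3)] pb[OF s] le J_err_bound[OF s h] by auto
  \<comment> \<open>The energy of the second step: A stands for theta in a negative norm, and the
    flux term with the L2 norm of \<open>b\<close> is the same shift applied to the form
    \<open>a_form\<close>.\<close>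
  define z where "z s = ip (J (pl N (ea N s (a s)))) (J (pl N (ea N s (a s)))) +
    (ip (flux N (eb N s (b s))) (flux N (eb N s (b s))) + 1/3 * ip (pl N (eb N s (b s))) (pl N (eb N s (b s))))" for s
  have zb: "z s \<le> C2 * H ^ 8" if s: "s \<in> {0..T}" for s
  proof -
    define C D where "C = 1400 * K2 ^ 3" and "D = 1400 * K2 ^ 3 * H ^ 8"
    have CD: "0 \<le> C" "0 \<le> D" using const_pos(6) by (auto simp: C_def D_def)
    have "z s \<le> (z 0 + D * s) * exp (C * s)"
    proof (rule Gronwall[where y = z and \<tau> = T and T = T, OF CD])
      fix r assume r: "r \<in> {0..T}"
      note 1 = ip_J_pl_deriv[OF N ea_deriv[OF r]] and 2 = ip_flux_deriv[OF N eb_deriv[OF r]] and 3 = ip_pl_deriv[OF N eb_deriv[OF r]]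
      show "(z has_real_derivative 2 * (ip (J (pl N (ea' N r (a' r)))) (J (pl N (ea N r (a r)))) +
         (ip (flux N (eb' N r (b' r))) (flux N (eb N r (b r))) + 1/3 * ip (pl N (eb' N r (b' r))) (pl N (eb N r (b r)))))) (at r within {0..T})"
        unfolding z_def[abs_def]
        using DERIV_add[OF 1 DERIV_add[OF 2 DERIV_cmult[OF 3, where c = "1/3"]]] by (simp add: distrib_left)
      note g = gal[OF r]
      show "2 * (ip (J (pl N (ea' N r (a' r)))) (J (pl N (ea N r (a r)))) +
         (ip (flux N (eb' N r (b' r))) (flux N (eb N r (b r))) + 1/3 * ip (pl N (eb' N r (b' r))) (pl N (eb N r (b r))))) \<le> C * z r + D"
        using galerkin_error2.second_energy[OF g z_def[of r]] by (simp add: C_def D_def algebra_simps)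
    qed (use s in auto)
    also have "z 0 = 0"
      unfolding z_def pl_init0 flux_def[abs_def] J_def[of "\<lambda>x. 0"] by (simp add: J_def ip_zero_left)
    also have "(0 + D * s) * exp (C * s) \<le> (D * T) * exp (C * T)"
      using s CD by (intro mult_mono) (auto intro!: mult_left_mono)
    also have "\<dots> = C2 * H ^ 8" by (simp add: C2_def C_def D_def)
    finally show ?thesis .
  qed
  note nn = ip_self_nonneg[of "J (pl N (ea N t (a t)))"] ip_self_nonneg[of "flux N (eb N t (b t))"] ip_self_nonneg[of "pl N (eb N t (b t))"]
  have "ip (J (pl N (ea N t (a t)))) (J (pl N (ea N t (a t)))) \<le> C2 * (H ^ 4)\<^sup>2"
    using zb[OF t] nn unfolding z_def H6(2) by linarith
  then have s1: "L2norm (J (pl N (ea N t (a t)))) \<le> sqrt C2 * H ^ 4" by (rule L2norm_le_sqrt[OF _ H0])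
  have "ip (pl N (eb N t (b t))) (pl N (eb N t (b t))) \<le> (4 * C2) * (H ^ 4)\<^sup>2"
    using zb[OF t] nn mult_nonneg_nonneg[OF const_pos(7) zero_le_power2[of "H ^ 4"]] unfolding z_def H6(2) by linarith
  from L2norm_le_sqrt[OF this H0] have q1: "L2norm (pl N (eb N t (b t))) \<le> 2 * sqrt C2 * H ^ 4"
    by (simp add: real_sqrt_mult)
  have up: "c * H ^ k \<le> C3 * H ^ k" if "c \<le> C3" for c k using that by (intro mult_right_mono) auto
  show "L2norm (pl N (eb N t (b t))) \<le> C3 * H ^ 4" using q1 up[OF const_pos(9), of 4] by linarith
  have k2: "sqrt C1 \<le> C3" "2 * sqrt C1 \<le> C3" using const_pos(5,6,8) by linarith+
  show "L2norm (pl N (ea N t (a t))) \<le> C3 * H ^ 3" using pb(1)[OF t] up[OF k2(1), of 3] by linarith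
  show "L2norm (dpl N (eb N t (b t))) \<le> C3 * H ^ 3" using pb(3)[OF t] up[OF k2(2), of 3] by (simp add: mult.assoc)
  note g = gal[OF t]
  have "L2norm (pl N (eb' N t (b' t))) \<le> 180 * K2 ^ 3 * (H ^ 4 + L2norm (pl N (eb N t (b t))) + L2norm (J (pl N (ea N t (a t)))))"
    by (rule galerkin_error2.b'_final[OF g])
  also have "\<dots> \<le> 180 * K2 ^ 3 * (H ^ 4 + 2 * sqrt C2 * H ^ 4 + sqrt C2 * H ^ 4)"
    using const_pos(6) by (intro mult_left_mono add_mono order.refl q1 s1) auto
  also have "\<dots> = 180 * K2 ^ 3 * (1 + 3 * sqrt C2) * H ^ 4" by (simp add: algebra_simps)
  also have "\<dots> \<le> C3 * H ^ 4" by (rule up[OF const_pos(10)])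
  finally show "L2norm (pl N (eb' N t (b' t))) \<le> C3 * H ^ 4" .
qed

end

end

section \<open>Continuation argument and global existence for Lipschitz systems\<close>

text \<open>At the first time \<open>m\<close> where \<open>f\<close> reaches \<open>h\<close>,
  continuity gives the value \<open>h\<close> exactly, while \<open>step\<close> applies on
  \<open>{0..m}\<close> and gives \<open>h / 2\<close>.\<close>

lemma bootstrap:
  fixes f :: "real \<Rightarrow> real"
  assumes c: "continuous_on {0..T} f" and h: "0 < h" "f 0 < h"
    and step: "\<And>\<tau>. \<tau> \<in> {0..T} \<Longrightarrow> (\<And>s. s \<in> {0..\<tau>} \<Longrightarrow> f s \<le> h) \<Longrightarrow> f \<tau> \<le> h / 2"
    and t: "t \<in> {0..T}"
  shows "f t \<le> h"
proof (rule ccontr)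
  assume n: "\<not> f t \<le> h"
  define Z where "Z = {s \<in> {0..t}. h \<le> f s}"
  have ct: "continuous_on {0..t} f" by (rule continuous_on_subset[OF c]) (use t in auto)
  have "closed Z" unfolding Z_def using continuous_on_closed_Collect_le[of "{0..t}" "\<lambda>_. h" f] ct by auto
  moreover have "bounded Z" unfolding Z_def by (rule bounded_subset[of "{0..t}"]) auto
  ultimately have cZ: "compact Z" by (simp add: compact_eq_bounded_closed)
  have "Z \<noteq> {}" using n t unfolding Z_def by force
  then obtain m where m: "m \<in> Z" "\<And>s. s \<in> Z \<Longrightarrow> m \<le> s" using compact_attains_inf[OF cZ] by blast
  have m0: "0 \<le> m" "m \<le> t" "h \<le> f m" using m(1) by (auto simp: Z_def)
  have lt: "f s < h" if "0 \<le> s" "s < m" for s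
    using m(2)[of s] that m0 by (force simp: Z_def)
  have "\<exists>x\<ge>0. x \<le> m \<and> f x = h"
    by (rule IVT') (use h m0 continuous_on_subset[OF ct] in auto)
  then have fm: "f m = h" using lt by force
  have "f m \<le> h / 2"
    by (rule step) (use m0 t lt fm in \<open>auto simp: le_less\<close>)
  then show False using fm h by simp
qed

text \<open>Extends an assignment on the naturals to a continuous function of a real index.\<close>

definition hat :: "nat \<Rightarrow> real \<Rightarrow> real" where
  "hat k x = max 0 (1 - \<bar>x - real k\<bar>)"

lemma hat_node: "hat k (real i) = (if i = k then 1 else 0)"
proof (cases "i = k")
  case False
  then have "1 \<le> \<bar>real i - real k\<bar>" by linarith
  then show ?thesis using False by (simp add: hat_def)
qed (simp add: hat_def)

lemma hat_bounds: "0 \<le> hat k x" "hat k x \<le> 1"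
  by (auto simp: hat_def)

text \<open>Picard iteration in the Bielecki norm. Since the number of unknowns is not fixed by a type,
  they are encoded as the values at \<open>(0, t), (1, t), \<dots>\<close> of one bounded continuous function.\<close>

lemma global_lipschitz_ode:
  fixes F :: "nat \<Rightarrow> (nat \<Rightarrow> real) \<Rightarrow> real"
  assumes T: "0 \<le> T" and L: "0 \<le> L"
    and lip: "\<And>k x y d. k < n \<Longrightarrow> (\<And>j. j < n \<Longrightarrow> \<bar>x j - y j\<bar> \<le> d) \<Longrightarrow> \<bar>F k x - F k y\<bar> \<le> L * d"
    and cont: "\<And>w S k. (\<And>j. j < n \<Longrightarrow> continuous_on S (\<lambda>r::real. w r j)) \<Longrightarrow> k < n \<Longrightarrow> continuous_on S (\<lambda>r. F k (w r))"
  shows "\<exists>x. (\<forall>k<n. x 0 k = x0 k) \<and>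
    (\<forall>t\<in>{0..T}. \<forall>k<n. ((\<lambda>s. x s k) has_real_derivative F k (x t)) (at t within {0..T}))"
proof -
  \<comment> \<open>The exponential weight makes the iteration a contraction with factor
    \<open>n L / K\<close>, at most 1/2; the \<open>n\<close> comes from adding up the hats without
    using that few of them overlap.\<close>
  define K where "K = 2 * (real n * L + 1)"
  have K: "0 < K" using L by (simp add: K_def add_nonneg_pos)
  \<comment> \<open>Freezing the time outside \<open>{0..T}\<close> keeps the iterates bounded and
    continuous on the whole plane.\<close>
  define cl where "cl t = max 0 (min T t)" for t :: real
  have cl: "cl t \<in> {0..T}" "t \<in> {0..T} \<Longrightarrow> cl t = t" for t using T by (auto simp: cl_def)
  \<comment> \<open>The fixed point is sought for the solution multiplied by
    \<open>exp (- K * r)\<close>; \<open>W\<close> undoes the weight and reads off component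
    \<open>j\<close>.\<close>
  define W :: "((real \<times> real) \<Rightarrow>\<^sub>C real) \<Rightarrow> real \<Rightarrow> nat \<Rightarrow> real" where
    "W z r j = exp (K * r) * apply_bcontfun z (real j, r)" for z r j
  define I where "I z k s = integral {0..s} (\<lambda>r. F k (W z r))" for z k s
  define P where "P z p = (\<Sum>k<n. hat k (fst p) * (exp (- K * cl (snd p)) * (x0 k + I z k (cl (snd p)))))" for z p
  have cz: "continuous_on S (\<lambda>r. apply_bcontfun z (real j, r))" for z j S
    using continuous_on_compose2[OF continuous_on_apply_bcontfun[of UNIV z], of S "\<lambda>r. (real j, r)"]
    by (simp add: continuous_on_Pair)
  have cW: "continuous_on S (\<lambda>r. F k (W z r))" if "k < n" for z S k
    unfolding W_def by (intro cont that continuous_intros cz)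
  have dI: "(I z k has_real_derivative F k (W z s)) (at s within {0..T})" if "k < n" "s \<in> {0..T}" for z k s
    unfolding I_def has_real_derivative_iff_has_vector_derivative
    by (rule integral_has_vector_derivative[OF cW[OF that(1)] that(2)])
  have cI: "continuous_on {0..T} (I z k)" if "k < n" for z k
    by (rule DERIV_continuous_on[OF dI[OF that]])
  have cg: "continuous_on {0..T} (\<lambda>s. exp (- K * s) * (x0 k + I z k s))" if "k < n" for z k
    by (intro continuous_intros cI that)
  have cP: "continuous_on UNIV (P z)" for z
    unfolding P_def
  proof (intro continuous_on_sum continuous_on_mult)
    fix k assume "k \<in> {..<n}"
    then have k: "k < n" by simp
    show "continuous_on UNIV (\<lambda>p. hat k (fst p))" unfolding hat_def by (intro continuous_intros)
    show "continuous_on UNIV (\<lambda>p::real\<times>real. exp (- K * cl (snd p)))" unfolding cl_def by (intro continuous_intros)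
    have "continuous_on UNIV (\<lambda>p::real\<times>real. I z k (cl (snd p)))"
      by (rule continuous_on_compose2[OF cI[OF k]]) (use cl in \<open>auto simp: cl_def intro!: continuous_intros\<close>)
    then show "continuous_on UNIV (\<lambda>p::real\<times>real. x0 k + I z k (cl (snd p)))" by (intro continuous_intros)
  qed
  have bP: "\<exists>b. \<forall>p. norm (P z p) \<le> b" for z
  proof -
    have "\<exists>b. \<forall>s\<in>{0..T}. \<bar>exp (- K * s) * (x0 k + I z k s)\<bar> \<le> b" if "k < n" for k
    proof -
      have "bounded ((\<lambda>s. exp (- K * s) * (x0 k + I z k s)) ` {0..T})"
        using compact_continuous_image[OF cg[OF that]] compact_imp_bounded by blast
      then show ?thesis by (auto simp: bounded_iff)
    qed
    then obtain b where b: "\<And>k s. k < n \<Longrightarrow> s \<in> {0..T} \<Longrightarrow> \<bar>exp (- K * s) * (x0 k + I z k s)\<bar> \<le> b k" by metis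
    have "norm (P z p) \<le> (\<Sum>k<n. b k)" for p
      unfolding P_def real_norm_def
    proof (intro order.trans[OF sum_abs] sum_mono)
      fix k assume "k \<in> {..<n}"
      then have "\<bar>exp (- K * cl (snd p)) * (x0 k + I z k (cl (snd p)))\<bar> \<le> b k" using b cl by auto
      then show "\<bar>hat k (fst p) * (exp (- K * cl (snd p)) * (x0 k + I z k (cl (snd p))))\<bar> \<le> b k"
        unfolding abs_mult[of "hat k (fst p)"] using hat_bounds[of k "fst p"] mult_mono[of "\<bar>hat k (fst p)\<bar>" 1] by fastforce
    qed
    then show ?thesis by blast
  qed
  have Pb: "P z \<in> bcontfun" for z
    using bP[of z] bcontfun_normI[OF cP] by blast
  define G where "G z = Bcontfun (P z)" for z
  have G: "apply_bcontfun (G z) = P z" for z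
    unfolding G_def using Bcontfun_inverse[OF Pb] .
  have "\<exists>!z. G z = z"
  proof (rule banach_fix_type[of "1/2"])
    show "\<forall>z w. dist (G z) (G w) \<le> 1/2 * dist z w"
    proof (intro allI dist_bound)
      fix z w :: "(real \<times> real) \<Rightarrow>\<^sub>C real" and p :: "real \<times> real"
      define d where "d = dist z w"
      define s where "s = cl (snd p)"
      have s: "s \<in> {0..T}" unfolding s_def by (rule cl)
      have d0: "0 \<le> d" by (simp add: d_def)
      have Id: "\<bar>I z k s - I w k s\<bar> \<le> L * d / K * exp (K * s)" if k: "k < n" for k
      proof -
        have fi: "((\<lambda>r. L * d * exp (K * r)) has_integral (L * d / K * exp (K * s) - L * d / K * exp (K * 0))) {0..s}"
        proof (rule fundamental_theorem_of_calculus)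
          fix r
          have "((\<lambda>r. L * d / K * exp (K * r)) has_real_derivative L * d * exp (K * r)) (at r within {0..s})"
            using K by (auto intro!: derivative_eq_intros)
          then show "((\<lambda>r. L * d / K * exp (K * r)) has_vector_derivative L * d * exp (K * r)) (at r within {0..s})"
            by (simp add: has_real_derivative_iff_has_vector_derivative)
        qed (use s in auto)
        have "\<bar>I z k s - I w k s\<bar> = norm (integral {0..s} (\<lambda>r. F k (W z r) - F k (W w r)))"
          unfolding I_def by (subst integral_diff) (auto intro!: integrable_continuous_real cW k)
        also have "\<dots> \<le> integral {0..s} (\<lambda>r. L * d * exp (K * r))"
        proof (rule integral_norm_bound_integral)
          show "(\<lambda>r. F k (W z r) - F k (W w r)) integrable_on {0..s}"
            by (intro integrable_continuous_real continuous_intros cW k)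
          show "(\<lambda>r. L * d * exp (K * r)) integrable_on {0..s}"
            by (intro integrable_continuous_real continuous_intros)
          fix r
          have "\<bar>F k (W z r) - F k (W w r)\<bar> \<le> L * (exp (K * r) * d)"
          proof (rule lip[OF k])
            fix j
            have "\<bar>W z r j - W w r j\<bar> = exp (K * r) * \<bar>apply_bcontfun z (real j, r) - apply_bcontfun w (real j, r)\<bar>"
              unfolding W_def right_diff_distrib[symmetric] abs_mult by simp
            also have "\<dots> \<le> exp (K * r) * d"
              using dist_bounded[of z "(real j, r)" w] by (intro mult_left_mono) (auto simp: d_def dist_real_def)
            finally show "\<bar>W z r j - W w r j\<bar> \<le> exp (K * r) * d" .
          qed
          then show "norm (F k (W z r) - F k (W w r)) \<le> L * d * exp (K * r)" by (simp add: mult.commute mult.left_commute)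
        qed
        also have "\<dots> = L * d / K * exp (K * s) - L * d / K" using integral_unique[OF fi] by simp
        also have "\<dots> \<le> L * d / K * exp (K * s)" using L d0 K by simp
        finally show ?thesis .
      qed
      have "dist (apply_bcontfun (G z) p) (apply_bcontfun (G w) p) = \<bar>\<Sum>k<n. hat k (fst p) * (exp (- K * s) * (I z k s - I w k s))\<bar>"
        unfolding G P_def s_def[symmetric] dist_real_def sum_subtractf[symmetric] by (simp add: algebra_simps)
      also have "\<dots> \<le> (\<Sum>k<n. L * d / K)"
      proof (intro order.trans[OF sum_abs] sum_mono)
        fix k assume "k \<in> {..<n}"
        then have k: "k < n" by simp
        have "\<bar>hat k (fst p) * (exp (- K * s) * (I z k s - I w k s))\<bar> \<le> 1 * (exp (- K * s) * (L * d / K * exp (K * s)))"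
          unfolding abs_mult using Id[OF k] hat_bounds[of k "fst p"] by (intro mult_mono) auto
        also have "\<dots> = L * d / K" by (simp add: mult_exp_exp)
        finally show "\<bar>hat k (fst p) * (exp (- K * s) * (I z k s - I w k s))\<bar> \<le> L * d / K" .
      qed
      also have "\<dots> = (real n * L) * d / K" by simp
      also have "\<dots> \<le> (K / 2) * d / K" using d0 K by (intro divide_right_mono mult_right_mono) (auto simp: K_def)
      also have "\<dots> = 1/2 * dist z w" using K by (simp add: d_def)
      finally show "dist (apply_bcontfun (G z) p) (apply_bcontfun (G w) p) \<le> 1/2 * dist z w" .
    qed
  qed auto
  then obtain z where z: "G z = z" by blast
  have W: "W z t k = x0 k + I z k t" if "t \<in> {0..T}" "k < n" for t k
  proof -
    have "apply_bcontfun z (real k, t) = P z (real k, t)" using G[of z] z by simp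
    also have "\<dots> = (\<Sum>j<n. if j = k then exp (- K * t) * (x0 j + I z j t) else 0)"
      unfolding P_def by (intro sum.cong) (use that cl in \<open>auto simp: hat_node\<close>)
    also have "\<dots> = exp (- K * t) * (x0 k + I z k t)" using that(2) by simp
    finally show ?thesis unfolding W_def by (simp add: mult_exp_exp flip: mult.assoc)
  qed
  show ?thesis
  proof (intro exI[of _ "W z"] conjI ballI allI impI)
    fix k assume "k < n"
    then show "W z 0 k = x0 k" using W[of 0 k] T by (simp add: I_def)
  next
    fix t k assume t: "t \<in> {0..T}" and k: "k < n"
    have "((\<lambda>s. x0 k + I z k s) has_real_derivative F k (W z t)) (at t within {0..T})"
      using dI[OF k t] by (auto intro!: derivative_eq_intros)
    then show "((\<lambda>s. W z s k) has_real_derivative F k (W z t)) (at t within {0..T})"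
      by (rule has_field_derivative_transform_within[of _ _ _ _ 1]) (use W k t in auto)
  qed
qed

section \<open>Orthonormalisation for a semidefinite form\<close>

text \<open>On coefficient sequences the form is only semidefinite, as entries beyond
  \<open>N\<close> are invisible to it. Hence a dependent vector is recognised by
  \<open>B r r = 0\<close>, and spanning is claimed only up to a residual of seminorm 0.
  \<open>P\<close> carries the boundary conditions along.\<close>

lemma gram_schmidt:
  fixes B :: "(nat \<Rightarrow> real) \<Rightarrow> (nat \<Rightarrow> real) \<Rightarrow> real" and v :: "nat \<Rightarrow> nat \<Rightarrow> real"
  assumes sym: "\<And>x y. B x y = B y x"
    and diff: "\<And>x y z. B (\<lambda>i. x i - y i) z = B x z - B y z"
    and cm: "\<And>c x z. B (\<lambda>i. c * x i) z = c * B x z"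
    and sm: "\<And>m d e z. B (\<lambda>i. \<Sum>j<(m::nat). d j * e j i) z = (\<Sum>j<m. d j * B (e j) z)"
    and pos: "\<And>x. 0 \<le> B x x"
    and P: "\<And>k. k < n \<Longrightarrow> P (v k)" "\<And>x y. P x \<Longrightarrow> P y \<Longrightarrow> P (\<lambda>i. x i - y i)" "\<And>c x. P x \<Longrightarrow> P (\<lambda>i. c * x i)"
      "\<And>m d e. (\<And>j. j < (m::nat) \<Longrightarrow> P (e j)) \<Longrightarrow> P (\<lambda>i. \<Sum>j<m. d j * e j i)"
  shows "\<exists>m e. (\<forall>j<(m::nat). P (e j)) \<and> (\<forall>i<m. \<forall>j<m. B (e i) (e j) = (if i = j then 1 else 0)) \<and>
     (\<forall>k<n. \<exists>d. B (\<lambda>i. v k i - (\<Sum>j<m. d j * e j i)) (\<lambda>i. v k i - (\<Sum>j<m. d j * e j i)) = 0)"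
  using P(1)
proof (induction n)
  case 0
  show ?case by (intro exI[of _ 0]) auto
next
  case (Suc n)
  have "\<And>k. k < n \<Longrightarrow> P (v k)" using Suc.prems by simp
  from Suc.IH[OF this] obtain m e where E: "\<forall>j<(m::nat). P (e j)" "\<forall>i<m. \<forall>j<m. B (e i) (e j) = (if i = j then 1 else 0)"
     "\<forall>k<n. \<exists>d. B (\<lambda>i. v k i - (\<Sum>j<m. d j * e j i)) (\<lambda>i. v k i - (\<Sum>j<m. d j * e j i)) = 0"
    by blast
  have e: "\<And>j. j < m \<Longrightarrow> P (e j)" "\<And>i j. i < m \<Longrightarrow> j < m \<Longrightarrow> B (e i) (e j) = (if i = j then 1 else 0)"
    "\<And>k. k < n \<Longrightarrow> \<exists>d. B (\<lambda>i. v k i - (\<Sum>j<m. d j * e j i)) (\<lambda>i. v k i - (\<Sum>j<m. d j * e j i)) = 0"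
    using E by blast+
  define r where "r i = v n i - (\<Sum>j<m. B (v n) (e j) * e j i)" for i
  show ?case
  proof (cases "B r r = 0")
    \<comment> \<open>The residual is invisible to the form, so the family already found also serves
      the new vector.\<close>
    case True
    then have "\<exists>d. B (\<lambda>i. v n i - (\<Sum>j<m. d j * e j i)) (\<lambda>i. v n i - (\<Sum>j<m. d j * e j i)) = 0"
      unfolding r_def[abs_def] by (intro exI[of _ "\<lambda>j. B (v n) (e j)"])
    then have "\<exists>d. B (\<lambda>i. v k i - (\<Sum>j<m. d j * e j i)) (\<lambda>i. v k i - (\<Sum>j<m. d j * e j i)) = 0" if "k < Suc n" for k
      using that E(3) by (cases "k = n") auto
    then show ?thesis using E(1,2) by (intro exI[of _ m] exI[of _ e]) simp
  next
    case False
    then have rr: "0 < B r r" using pos[of r] by simp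
    define q where "q = sqrt (B r r)"
    have q: "0 < q" "q * q = B r r" using rr by (auto simp: q_def)
    define e' where "e' j = (if j < m then e j else (\<lambda>i. 1 / q * r i))" for j
    have Pr: "P r" unfolding r_def using Suc.prems e(1) by (intro P(2) P(4)) auto
    have orth: "B r (e j) = 0" if j: "j < m" for j
    proof -
      have "B r (e j) = B (v n) (e j) - (\<Sum>l<m. B (v n) (e l) * B (e l) (e j))"
        unfolding r_def[abs_def] diff sm ..
      also have "(\<Sum>l<m. B (v n) (e l) * B (e l) (e j)) = (\<Sum>l<m. if l = j then B (v n) (e l) else 0)"
        by (intro sum.cong) (use e(2) j in auto)
      finally show ?thesis using j by simp
    qed
    have s: "(\<Sum>j<Suc m. d j * e' j i) = (\<Sum>j<m. d j * e j i) + d m * (1 / q * r i)" for d i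
      by (simp add: e'_def)
    show ?thesis
    proof (intro exI[of _ "Suc m"] exI[of _ e'] conjI allI impI)
      have "P (\<lambda>i. 1 / q * r i)" by (rule P(3)[OF Pr])
      then show "P (e' j)" if "j < Suc m" for j
        unfolding e'_def using e(1) by (cases "j < m") (simp_all only: if_True if_False)
      show "B (e' i) (e' j) = (if i = j then 1 else 0)" if ij: "i < Suc m" "j < Suc m" for i j
      proof -
        have *: "B (e k) (\<lambda>i. 1 / q * r i) = 0" if "k < m" for k
          using orth[OF that] cm[of "1/q" r "e k"] sym by simp
        have "B (\<lambda>i. 1 / q * r i) (\<lambda>i. 1 / q * r i) = 1 / q * (1 / q * B r r)"
          unfolding cm sym[of r "\<lambda>i. 1 / q * r i"] by (simp only: cm)
        then have 1: "B (\<lambda>i. 1 / q * r i) (\<lambda>i. 1 / q * r i) = 1"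
          using q(1) unfolding q(2)[symmetric] by simp
        have **: "B (\<lambda>i. 1 / q * r i) (e k) = 0" if "k < m" for k
          using *[OF that] sym[of "e k" "\<lambda>i. 1 / q * r i"] by simp
        consider "i < m" "j < m" | "i < m" "j = m" | "i = m" "j < m" | "i = m" "j = m"
          using ij by linarith
        then show ?thesis
          by cases (simp_all only: e'_def if_True if_False less_irrefl e(2) * ** 1 simp_thms, auto)
      qed
      show "\<exists>d. B (\<lambda>i. v k i - (\<Sum>j<Suc m. d j * e' j i)) (\<lambda>i. v k i - (\<Sum>j<Suc m. d j * e' j i)) = 0" if "k < Suc n" for k
      proof (cases "k = n")
        case True
        have "(\<lambda>i. v k i - (\<Sum>j<Suc m. (if j < m then B (v n) (e j) else q) * e' j i)) = (\<lambda>i. 0 * r i)"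
          unfolding s using q by (auto simp: True r_def fun_eq_iff)
        then show ?thesis using cm[of 0 r "\<lambda>i. 0 * r i"] by (intro exI[of _ "\<lambda>j. if j < m then B (v n) (e j) else q"]) simp
      next
        case False
        then obtain d where d: "B (\<lambda>i. v k i - (\<Sum>j<m. d j * e j i)) (\<lambda>i. v k i - (\<Sum>j<m. d j * e j i)) = 0"
          using e(3)[of k] \<open>k < Suc n\<close> by auto
        then show ?thesis unfolding s by (intro exI[of _ "\<lambda>j. if j < m then d j else 0"]) simp
      qed
    qed
  qed
qed

section \<open>Passage between the finite element spaces and nodal values\<close>

lemma wd_cong:
  assumes "wd F f" "\<And>x. x \<in> {0..1} \<Longrightarrow> G x = F x" shows "wd G f"
proof -
  obtain S where S: "finite S" "\<And>x. x\<in>{0<..<1} - S \<Longrightarrow> (F has_real_derivative f x) (at x)"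
    using assms by (auto simp: wd_def)
  have "(G has_real_derivative f x) (at x)" if x: "x \<in> {0<..<1} - S" for x
    by (rule has_field_derivative_transform_within_open[OF S(2)[OF x], of "{0<..<1}"]) (use x assms(2) in auto)
  moreover have "continuous_on {0..1} G"
    using assms continuous_on_cong[of "{0..1}" "{0..1}" G F] by (auto simp: wd_def)
  ultimately show ?thesis using assms(1) S(1) by (auto simp: wd_def)
qed

lemma node_Suc: "node N (Suc i) = real i / real N"
  by (simp add: node_def of_nat_Suc)

lemma Sh_pl:
  assumes N: "0 < N" and \<phi>: "\<phi> \<in> Sh N" and x: "x \<in> {0..1}"
  shows "\<phi> x = pl N (nod N \<phi>) x"
proof -
  define j where "j = cell N x"
  have j: "j < N" using N by (simp add: j_def cell_less)
  have m: "x \<in> {real j / real N..real (Suc j) / real N}" using cell_mem[OF N x] by (simp add: j_def)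
  have "\<forall>j\<in>{1..N}. \<exists>p :: real poly. degree p \<le> 1 \<and> (\<forall>x\<in>{node N j..node N (j + 1)}. \<phi> x = poly p x)"
    using \<phi> unfolding Sh_def by blast
  from bspec[OF this, of "Suc j"] j obtain p :: "real poly" where p: "degree p \<le> 1" "\<And>x. x \<in> {real j / real N..real (Suc j) / real N} \<Longrightarrow> \<phi> x = poly p x"
    by (auto simp: node_Suc)
  obtain c q where pq: "p = pCons c q" by (cases p) auto
  have "degree q = 0" using p(1) unfolding pq by (auto simp: degree_pCons_eq_if split: if_splits)
  then obtain d where d: "q = [:d:]" by (rule degree_eq_zeroE)
  have e: "\<phi> y = c + d * y" if "y \<in> {real j / real N..real (Suc j) / real N}" for y
    using p(2)[OF that] by (simp add: pq d mult.commute)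
  have "nod N \<phi> j = c + d * (real j / real N)" "nod N \<phi> (Suc j) = c + d * (real (Suc j) / real N)"
    unfolding nod_def using N by (intro e; simp add: divide_right_mono)+
  then have "pl N (nod N \<phi>) x = c + d * (real j / real N) + (d * (real (Suc j) / real N) - d * (real j / real N)) * (real N * x - real j)"
    using pl_on[OF j m, of "nod N \<phi>"] by simp
  also have "\<dots> = c + d * x" using N by (simp add: of_nat_Suc field_simps)
  also have "\<dots> = \<phi> x" using e[OF m] by simp
  finally show ?thesis ..
qed

lemma pl_Sh:
  assumes N: "0 < N" shows "pl N a \<in> Sh N"
  unfolding Sh_def
proof (intro CollectI conjI ballI pl_continuous N)
  fix j assume "j \<in> {1..N}"
  then obtain i where i: "j = Suc i" "i < N" by (cases j) auto
  show "\<exists>p :: real poly. degree p \<le> 1 \<and> (\<forall>x\<in>{node N j..node N (j + 1)}. pl N a x = poly p x)"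
  proof (intro exI[of _ "[:a i - (a (Suc i) - a i) * real i, (a (Suc i) - a i) * real N:]"] conjI ballI)
    fix x assume "x \<in> {node N j..node N (j + 1)}"
    then have "x \<in> {real i / real N..real (Suc i) / real N}" by (simp add: i node_Suc)
    from pl_on[OF i(2) this, of a] show "pl N a x = poly [:a i - (a (Suc i) - a i) * real i, (a (Suc i) - a i) * real N:] x"
      by (simp add: algebra_simps)
  qed simp
qed

lemma pl_Sh0: "0 < N \<Longrightarrow> a 0 = 0 \<Longrightarrow> a N = 0 \<Longrightarrow> pl N a \<in> Sh0 N"
  by (simp add: Sh0_def pl_Sh pl_0 pl_1)

text \<open>\<open>interp\<close> is chosen by \<open>SOME\<close>, but an element of
  \<open>Sh N\<close> is determined on [0,1] by its nodal values.\<close>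

lemma interp_pl:
  assumes N: "0 < N" and S: "S \<subseteq> Sh N" "pl N (nod N v) \<in> S" and x: "x \<in> {0..1}"
  shows "interp S N v x = pl N (nod N v) x"
proof -
  have nd: "\<exists>k\<le>N. node N i = real k / real N \<and> i = Suc k" if "i \<in> {1..N+1}" for i
    using that by (cases i) (auto simp: node_Suc)
  have "\<exists>\<phi>. \<phi> \<in> S \<and> (\<forall>i\<in>{1..N+1}. \<phi> (node N i) = v (node N i))"
    using S(2) nd N by (intro exI[of _ "pl N (nod N v)"]) (metis pl_node nod_def)
  then have s: "interp S N v \<in> S" "\<And>i. i \<in> {1..N+1} \<Longrightarrow> interp S N v (node N i) = v (node N i)"
    using someI_ex[of "\<lambda>\<phi>. \<phi> \<in> S \<and> (\<forall>i\<in>{1..N+1}. \<phi> (node N i) = v (node N i))"] unfolding interp_def by blast+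
  have "nod N (interp S N v) k = nod N v k" if "k \<le> N" for k
    using s(2)[of "Suc k"] that by (simp add: nod_def node_Suc)
  then have "pl N (nod N (interp S N v)) = pl N (nod N v)" by (intro pl_cong N) auto
  then show ?thesis using Sh_pl[OF N _ x, of "interp S N v"] s(1) S(1) by auto
qed

context
  fixes N :: nat and a b a' b' :: "nat \<Rightarrow> real" and f g f' g' :: "real \<Rightarrow> real" and \<alpha> \<beta> \<gamma> :: real
  assumes N: "0 < N" and b0: "b 0 = 0" "b N = 0"
    and f: "\<And>x. x \<in> {0..1} \<Longrightarrow> f x = pl N a x" and g: "\<And>x. x \<in> {0..1} \<Longrightarrow> g x = pl N b x"
    and f': "\<And>x. x \<in> {0..1} \<Longrightarrow> f' x = pl N a' x" and g': "\<And>x. x \<in> {0..1} \<Longrightarrow> g' x = pl N b' x"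
begin

lemma wd_fg: "wd f (dpl N a)" "wd g (dpl N b)" "wd f' (dpl N a')" "wd g' (dpl N b')"
  by (rule wd_cong[OF wd_pl[OF N]]; simp add: f g f' g')+

lemma first_eq_form:
  assumes c: "\<And>x. x \<in> {0..1} \<Longrightarrow> \<phi> x = pl N c x"
  shows "ip f' \<phi> + ip (Dx g) \<phi> + \<alpha> * ip (Dx (\<lambda>x. f x * g x)) \<phi>
     = ip (pl N a') (pl N c) - ip (\<lambda>x. pl N b x + \<alpha> * (pl N a x * pl N b x)) (dpl N c)"
proof -
  have w\<phi>: "wd \<phi> (dpl N c)" by (rule wd_cong[OF wd_pl[OF N]]) (simp add: c)
  note wfg = wd_mult[OF wd_fg(1,2)]
  note bms = wd_bm[OF w\<phi>] wd_bm[OF wfg] wd_bm[OF wd_fg(1)] wd_bm[OF wd_fg(2)]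
  have g01: "g 0 = 0" "g 1 = 0" using g[of 0] g[of 1] b0 by (auto simp: pl_0 pl_1 N)
  have 1: "ip (Dx g) \<phi> = - ip g (dpl N c)"
    using wd_ip_Dx[OF wd_fg(2) bms(1)] wd_by_parts[OF wd_fg(2) w\<phi>] g01 by simp
  have 2: "ip (Dx (\<lambda>x. f x * g x)) \<phi> = - ip (\<lambda>x. f x * g x) (dpl N c)"
    using wd_ip_Dx[OF wfg bms(1)] wd_by_parts[OF wfg w\<phi>] g01 by simp
  have "ip (\<lambda>x. pl N b x + \<alpha> * (pl N a x * pl N b x)) (dpl N c) = ip (\<lambda>x. g x + \<alpha> * (f x * g x)) (dpl N c)"
    by (rule ip_cong) (simp add: f g)
  also have "\<dots> = ip g (dpl N c) + ip (\<lambda>x. \<alpha> * (f x * g x)) (dpl N c)"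
    by (rule ip_add_left) (intro bm_intros bms)+
  finally have 3: "ip (\<lambda>x. pl N b x + \<alpha> * (pl N a x * pl N b x)) (dpl N c) = ip g (dpl N c) + \<alpha> * ip (\<lambda>x. f x * g x) (dpl N c)"
    by (simp only: ip_cmult_left)
  have 4: "ip f' \<phi> = ip (pl N a') (pl N c)" by (rule ip_cong) (simp add: f' c)
  show ?thesis unfolding 1 2 3 4 by simp
qed

lemma half_square:
  assumes w: "wd p p'" "wd \<phi> \<phi>'" and z: "\<phi> 0 = 0" "\<phi> 1 = 0"
  shows "ip (\<lambda>x. p x * Dx p x) \<phi> = - 1/2 * ip (\<lambda>x. p x * p x) \<phi>'"
proof -
  note bms = wd_bm[OF w(1)] wd_bm[OF w(2)]
  have "ip (\<lambda>x. p x * Dx p x) \<phi> = ip (Dx p) (\<lambda>x. p x * \<phi> x)" by (rule ip_cong) simp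
  also have "\<dots> = ip p' (\<lambda>x. p x * \<phi> x)" by (rule wd_ip_Dx[OF w(1)]) (intro bm_intros bms)
  also have "\<dots> = 1/2 * ip (\<lambda>x. p' x * p x + p x * p' x) \<phi>"
    by (subst ip_cmult_left[symmetric]) (rule ip_cong, simp)
  also have "ip (\<lambda>x. p' x * p x + p x * p' x) \<phi> = - ip (\<lambda>x. p x * p x) \<phi>'"
    using wd_by_parts[OF wd_mult[OF w(1,1)] w(2)] z by simp
  finally show ?thesis by simp
qed

lemma second_eq_form:
  assumes c: "\<And>x. x \<in> {0..1} \<Longrightarrow> \<phi> x = pl N c x" and c0: "c 0 = 0" "c N = 0"
  shows "a_form g' \<phi> + ip (Dx f) \<phi> + \<beta> * ip (\<lambda>x. g x * Dx g x) \<phi> + \<gamma> * ip (\<lambda>x. f x * Dx f x) \<phi>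
     = ip (pl N b') (pl N c) + 1/3 * ip (dpl N b') (dpl N c)
       - ip (\<lambda>x. pl N a x + \<beta> / 2 * (pl N b x * pl N b x) + \<gamma> / 2 * (pl N a x * pl N a x)) (dpl N c)"
proof -
  have w\<phi>: "wd \<phi> (dpl N c)" by (rule wd_cong[OF wd_pl[OF N]]) (simp add: c)
  note bms = wd_bm[OF w\<phi>] wd_bm[OF wd_fg(1)] wd_bm[OF wd_fg(2)]
  have z: "\<phi> 0 = 0" "\<phi> 1 = 0" using c[of 0] c[of 1] c0 by (auto simp: pl_0 pl_1 N)
  have "a_form g' \<phi> = ip (pl N b') (pl N c) + 1/3 * ip (dpl N b') (dpl N c)"
    unfolding wd_a_form[OF wd_fg(4) w\<phi>] using ip_cong[of g' \<phi> "pl N b'" "pl N c"] by (simp add: g' c)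
  moreover have "ip (Dx f) \<phi> = - ip f (dpl N c)"
    using wd_ip_Dx[OF wd_fg(1) bms(1)] wd_by_parts[OF wd_fg(1) w\<phi>] z by simp
  moreover have "\<beta> * ip (\<lambda>x. g x * Dx g x) \<phi> = - (\<beta> / 2 * ip (\<lambda>x. g x * g x) (dpl N c))"
    unfolding half_square[OF wd_fg(2) w\<phi> z] by simp
  moreover have "\<gamma> * ip (\<lambda>x. f x * Dx f x) \<phi> = - (\<gamma> / 2 * ip (\<lambda>x. f x * f x) (dpl N c))"
    unfolding half_square[OF wd_fg(1) w\<phi> z] by simp
  moreover have "ip (\<lambda>x. pl N a x + \<beta> / 2 * (pl N b x * pl N b x) + \<gamma> / 2 * (pl N a x * pl N a x)) (dpl N c)
     = ip (\<lambda>x. f x + \<beta> / 2 * (g x * g x) + \<gamma> / 2 * (f x * f x)) (dpl N c)"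
    by (rule ip_cong) (simp add: f g)
  moreover have "\<dots> = ip f (dpl N c) + \<beta> / 2 * ip (\<lambda>x. g x * g x) (dpl N c) + \<gamma> / 2 * ip (\<lambda>x. f x * f x) (dpl N c)"
    by (subst ip_add_left, (intro bm_intros bms)+)+ (simp only: ip_cmult_left)
  ultimately show ?thesis by linarith
qed

text \<open>One direction reduces an arbitrary solution to nodal values for uniqueness, the other
  turns constructed nodal values into a solution. The functions are only assumed to agree with
  \<open>pl\<close> on [0,1], because elements of \<open>Sh\<close> are arbitrary elsewhere.\<close>

lemma discrete_eqs_iff:
  "(\<forall>\<phi>\<in>Sh N. ip f' \<phi> + ip (Dx g) \<phi> + \<alpha> * ip (Dx (\<lambda>x. f x * g x)) \<phi> = 0) \<and>
   (\<forall>\<omega>\<in>Sh0 N. a_form g' \<omega> + ip (Dx f) \<omega> + \<beta> * ip (\<lambda>x. g x * Dx g x) \<omega> + \<gamma> * ip (\<lambda>x. f x * Dx f x) \<omega> = 0)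
   \<longleftrightarrow> discrete_eqs \<alpha> \<beta> \<gamma> N a b a' b'" (is "?A \<and> ?B \<longleftrightarrow> ?R")
proof
  assume AB: "?A \<and> ?B"
  show ?R unfolding discrete_eqs_def
  proof (intro conjI allI impI)
    fix c
    show "ip (pl N a') (pl N c) = ip (\<lambda>x. pl N b x + \<alpha> * (pl N a x * pl N b x)) (dpl N c)"
      using first_eq_form[of "pl N c" c] AB pl_Sh[OF N, of c] by simp
    assume "c 0 = 0" "c N = 0"
    then show "ip (pl N b') (pl N c) + 1/3 * ip (dpl N b') (dpl N c) =
        ip (\<lambda>x. pl N a x + \<beta> / 2 * (pl N b x * pl N b x) + \<gamma> / 2 * (pl N a x * pl N a x)) (dpl N c)"
      using second_eq_form[of "pl N c" c] AB pl_Sh0[OF N, of c] by simp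
  qed
next
  assume R: ?R
  show "?A \<and> ?B"
  proof (intro conjI ballI)
    fix \<phi> assume "\<phi> \<in> Sh N"
    then show "ip f' \<phi> + ip (Dx g) \<phi> + \<alpha> * ip (Dx (\<lambda>x. f x * g x)) \<phi> = 0"
      using first_eq_form[OF Sh_pl[OF N]] R by (simp add: discrete_eqs_def)
  next
    fix \<phi> assume \<phi>: "\<phi> \<in> Sh0 N"
    then have "nod N \<phi> 0 = 0" "nod N \<phi> N = 0" "\<phi> \<in> Sh N" using N by (auto simp: Sh0_def nod_def)
    then show "a_form g' \<phi> + ip (Dx f) \<phi> + \<beta> * ip (\<lambda>x. g x * Dx g x) \<phi> + \<gamma> * ip (\<lambda>x. f x * Dx f x) \<phi> = 0"
      using second_eq_form[OF Sh_pl[OF N]] R by (simp add: discrete_eqs_def)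
  qed
qed

end

lemma pl_time_deriv:
  assumes N: "0 < N" and t: "t \<in> {0..T}" and x: "x \<in> {0..1}"
    and d: "\<And>i. i \<le> N \<Longrightarrow> ((\<lambda>s. a s i) has_real_derivative a' i) (at t within {0..T})"
    and e: "\<And>s. s \<in> {0..T} \<Longrightarrow> f s x = pl N (a s) x"
  shows "((\<lambda>s. f s x) has_real_derivative pl N a' x) (at t within {0..T})"
proof -
  have "((\<lambda>s. \<Sum>k\<le>N. a s k * pl N (kron k) x) has_real_derivative (\<Sum>k\<le>N. a' k * pl N (kron k) x)) (at t within {0..T})"
    by (auto intro!: derivative_eq_intros d)
  then have "((\<lambda>s. pl N (a s) x) has_real_derivative pl N a' x) (at t within {0..T})"
    using pl_expand[OF N, of a' x] pl_expand[OF N, of "a _" x] by simp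
  then show ?thesis
    by (rule has_field_derivative_transform_within[of _ _ _ _ 1]) (use e t in auto)
qed

context boussinesq
begin

lemma u0_bdry: "u0 0 = 0" "u0 1 = 0"
proof -
  have "u 0 x = u0 x" if "x \<in> {0..1}" for x
    using pde that by (auto simp: GB_def init_bdry_def)
  from this[of 0] this[of 1] show "u0 0 = 0" "u0 1 = 0" using bdry0[of 0] T by auto
qed

lemma interp_init:
  assumes N: "0 < N" and x: "x \<in> {0..1}"
  shows "interp (Sh N) N \<eta>0 x = pl N (nod N \<eta>0) x" "interp (Sh0 N) N u0 x = pl N (nod N u0) x"
proof -
  show "interp (Sh N) N \<eta>0 x = pl N (nod N \<eta>0) x" by (rule interp_pl[OF N _ pl_Sh[OF N] x]) simp
  show "interp (Sh0 N) N u0 x = pl N (nod N u0) x"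
    by (rule interp_pl[OF N _ pl_Sh0[OF N] x]) (use N u0_bdry in \<open>auto simp: Sh0_def nod_def\<close>)
qed

lemma GBh_traj:
  assumes N: "0 < N" and G: "GBh \<alpha> \<beta> \<gamma> N T \<eta>0 u0 \<eta>h uh"
  defines "a \<equiv> \<lambda>t. nod N (\<eta>h t)" and "b \<equiv> \<lambda>t. nod N (uh t)"
    and "a' \<equiv> \<lambda>t. nod N (Dt T \<eta>h t)" and "b' \<equiv> \<lambda>t. nod N (Dt T uh t)"
  shows "traj N a b a' b'"
    and "\<And>t. t \<in> {0..T} \<Longrightarrow> discrete_eqs \<alpha> \<beta> \<gamma> N (a t) (b t) (a' t) (b' t)"
    and "\<And>t x. t \<in> {0..T} \<Longrightarrow> x \<in> {0..1} \<Longrightarrow> \<eta>h t x = pl N (a t) x"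
    and "\<And>t x. t \<in> {0..T} \<Longrightarrow> x \<in> {0..1} \<Longrightarrow> uh t x = pl N (b t) x"
proof -
  have S: "\<eta>h t \<in> Sh N" "uh t \<in> Sh0 N" if "t \<in> {0..T}" for t
    using G that by (auto simp: GBh_def semidiscrete_def)
  have df: "(\<lambda>s. \<eta>h s x) differentiable (at t within {0..T})" "(\<lambda>s. uh s x) differentiable (at t within {0..T})"
    if "t \<in> {0..T}" "x \<in> {0..1}" for t x
    using G that by (auto simp: GBh_def semidiscrete_def)
  show e: "\<And>t x. t \<in> {0..T} \<Longrightarrow> x \<in> {0..1} \<Longrightarrow> \<eta>h t x = pl N (a t) x"
    unfolding a_def by (rule Sh_pl[OF N S(1)])
  show eu: "\<And>t x. t \<in> {0..T} \<Longrightarrow> x \<in> {0..1} \<Longrightarrow> uh t x = pl N (b t) x"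
    unfolding b_def by (rule Sh_pl[OF N]) (use S(2) in \<open>auto simp: Sh0_def\<close>)
  have nd: "real i / real N \<in> {0..1}" if "i \<le> N" for i using that N by auto
  have da: "((\<lambda>s. a s i) has_real_derivative a' t i) (at t within {0..T})" "((\<lambda>s. b s i) has_real_derivative b' t i) (at t within {0..T})"
    if "t \<in> {0..T}" "i \<le> N" for t i
    unfolding a_def a'_def b_def b'_def nod_def using df[OF that(1) nd[OF that(2)]] by (auto intro!: Dt_works)
  have b0: "b t 0 = 0" "b t N = 0" if "t \<in> {0..T}" for t
    using S(2)[OF that] N by (auto simp: b_def nod_def Sh0_def)
  have b'0: "b' t 0 = 0" "b' t N = 0" if t: "t \<in> {0..T}" for t
  proof -
    have "Dt T uh t 0 = 0" "Dt T uh t 1 = 0"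
      by (rule Dt_at[OF T t], rule has_field_derivative_transform_within[OF DERIV_const, of 1], use S(2) t in \<open>auto simp: Sh0_def\<close>)+
    then show "b' t 0 = 0" "b' t N = 0" using N by (auto simp: b'_def nod_def)
  qed
  have i0: "a 0 i = nod N \<eta>0 i" "b 0 i = nod N u0 i" if "i \<le> N" for i
  proof -
    have "\<eta>h 0 (real i / real N) = interp (Sh N) N \<eta>0 (real i / real N)" "uh 0 (real i / real N) = interp (Sh0 N) N u0 (real i / real N)"
      using G nd[OF that] by (auto simp: GBh_def semidiscrete_def)
    then show "a 0 i = nod N \<eta>0 i" "b 0 i = nod N u0 i"
      using interp_init[OF N nd[OF that]] that N by (auto simp: a_def b_def pl_node nod_def[of N "\<eta>h 0"] nod_def[of N "uh 0"])
  qed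
  show "traj N a b a' b'" unfolding traj_def using da b0 b'0 i0 by blast
  show "discrete_eqs \<alpha> \<beta> \<gamma> N (a t) (b t) (a' t) (b' t)" if t: "t \<in> {0..T}" for t
  proof -
    have Da: "Dt T \<eta>h t x = pl N (a' t) x" if "x \<in> {0..1}" for x
      by (rule Dt_at[where f = \<eta>h, OF T t], rule pl_time_deriv[where f = \<eta>h and a = a, OF N t that]) (use da(1)[OF t] e that in auto)
    have Db: "Dt T uh t x = pl N (b' t) x" if "x \<in> {0..1}" for x
      by (rule Dt_at[where f = uh, OF T t], rule pl_time_deriv[where f = uh and a = b, OF N t that]) (use da(2)[OF t] eu that in auto)
    note eqs = G[unfolded GBh_def, THEN conjunct2, THEN bspec, OF t]
    show ?thesis
      by (rule iffD1[OF discrete_eqs_iff[OF N b0[OF t] e[OF t] eu[OF t] Da Db] eqs])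
  qed
qed

lemma traj_GBh:
  assumes N: "0 < N" and tr: "traj N a b a' b'"
    and de: "\<And>t. t \<in> {0..T} \<Longrightarrow> discrete_eqs \<alpha> \<beta> \<gamma> N (a t) (b t) (a' t) (b' t)"
  shows "GBh \<alpha> \<beta> \<gamma> N T \<eta>0 u0 (\<lambda>t. pl N (a t)) (\<lambda>t. pl N (b t))"
    and "\<And>t x. t \<in> {0..T} \<Longrightarrow> x \<in> {0..1} \<Longrightarrow> Dt T (\<lambda>t. pl N (b t)) t x = pl N (b' t) x"
proof -
  have da: "((\<lambda>s. a s i) has_real_derivative a' t i) (at t within {0..T})" "((\<lambda>s. b s i) has_real_derivative b' t i) (at t within {0..T})"
    if "t \<in> {0..T}" "i \<le> N" for t i using tr that by (auto simp: traj_def)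
  have d: "((\<lambda>s. pl N (a s) x) has_real_derivative pl N (a' t) x) (at t within {0..T})"
     "((\<lambda>s. pl N (b s) x) has_real_derivative pl N (b' t) x) (at t within {0..T})" if tx: "t \<in> {0..T}" "x \<in> {0..1}" for t x
  proof -
    show "((\<lambda>s. pl N (a s) x) has_real_derivative pl N (a' t) x) (at t within {0..T})"
      by (rule pl_time_deriv[where f = "\<lambda>t. pl N (a t)" and a = a, OF N tx]) (use da(1)[OF tx(1)] in auto)
    show "((\<lambda>s. pl N (b s) x) has_real_derivative pl N (b' t) x) (at t within {0..T})"
      by (rule pl_time_deriv[where f = "\<lambda>t. pl N (b t)" and a = b, OF N tx]) (use da(2)[OF tx(1)] in auto)
  qed
  have Da: "Dt T (\<lambda>t. pl N (a t)) t x = pl N (a' t) x" if "t \<in> {0..T}" "x \<in> {0..1}" for t x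
    using Dt_at[where f = "\<lambda>t. pl N (a t)", OF T that(1) d(1)[OF that]] .
  show Db: "Dt T (\<lambda>t. pl N (b t)) t x = pl N (b' t) x" if "t \<in> {0..T}" "x \<in> {0..1}" for t x
    using Dt_at[where f = "\<lambda>t. pl N (b t)", OF T that(1) d(2)[OF that]] .
  have b0: "b t 0 = 0" "b t N = 0" if "t \<in> {0..T}" for t using tr that by (auto simp: traj_def)
  have i0: "pl N (a 0) = pl N (nod N \<eta>0)" "pl N (b 0) = pl N (nod N u0)"
    using tr by (auto intro!: pl_cong N simp: traj_def)
  have sd: "semidiscrete N T \<eta>0 u0 (\<lambda>t. pl N (a t)) (\<lambda>t. pl N (b t))"
    unfolding semidiscrete_def
  proof (intro conjI ballI)
    fix t assume t: "t \<in> {0..T}"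
    show "pl N (a t) \<in> Sh N" "pl N (b t) \<in> Sh0 N" using pl_Sh[OF N] pl_Sh0[OF N b0[OF t]] by auto
    fix x :: real assume x: "x \<in> {0..1}"
    show "(\<lambda>s. pl N (a s) x) differentiable (at t within {0..T})" "(\<lambda>s. pl N (b s) x) differentiable (at t within {0..T})"
      using d[OF t x] by (auto simp: real_differentiable_def)
  next
    fix x :: real assume x: "x \<in> {0..1}"
    show "pl N (a 0) x = interp (Sh N) N \<eta>0 x" "pl N (b 0) x = interp (Sh0 N) N u0 x"
      using interp_init[OF N x] i0 by auto
  qed
  show "GBh \<alpha> \<beta> \<gamma> N T \<eta>0 u0 (\<lambda>t. pl N (a t)) (\<lambda>t. pl N (b t))"
    unfolding GBh_def
  proof (intro conjI ballI sd)
    fix t assume t: "t \<in> {0..T}"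
    have *: "(\<forall>\<phi>\<in>Sh N. ip (Dt T (\<lambda>t. pl N (a t)) t) \<phi> + ip (Dx (pl N (b t))) \<phi> + \<alpha> * ip (Dx (\<lambda>x. pl N (a t) x * pl N (b t) x)) \<phi> = 0) \<and>
      (\<forall>\<omega>\<in>Sh0 N. a_form (Dt T (\<lambda>t. pl N (b t)) t) \<omega> + ip (Dx (pl N (a t))) \<omega> + \<beta> * ip (\<lambda>x. pl N (b t) x * Dx (pl N (b t)) x) \<omega>
         + \<gamma> * ip (\<lambda>x. pl N (a t) x * Dx (pl N (a t)) x) \<omega> = 0)"
      by (rule discrete_eqs_iff[OF N b0[OF t] refl refl Da[OF t] Db[OF t], THEN iffD2, OF _ _ de[OF t]])
    show "ip (Dt T (\<lambda>t. pl N (a t)) t) \<phi> + ip (Dx (pl N (b t))) \<phi> + \<alpha> * ip (Dx (\<lambda>x. pl N (a t) x * pl N (b t) x)) \<phi> = 0" if "\<phi> \<in> Sh N" for \<phi>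
      using * that by blast
    show "a_form (Dt T (\<lambda>t. pl N (b t)) t) \<omega> + ip (Dx (pl N (a t))) \<omega> + \<beta> * ip (\<lambda>x. pl N (b t) x * Dx (pl N (b t)) x) \<omega>
         + \<gamma> * ip (\<lambda>x. pl N (a t) x * Dx (pl N (a t)) x) \<omega> = 0" if "\<omega> \<in> Sh0 N" for \<omega>
      using * that by blast
  qed
qed

end

section \<open>Orthonormal bases of the discrete spaces\<close>

lemma span_from_kron:
  assumes k: "\<And>k. k \<le> N \<Longrightarrow> c k \<noteq> 0 \<Longrightarrow> \<exists>d. \<forall>i\<le>N. kron k i = (\<Sum>j<(m::nat). d j * e j i)"
  shows "\<exists>d. \<forall>i\<le>N. c i = (\<Sum>j<m. d j * e j i)"
proof -
  have "\<exists>d. \<forall>i\<le>N. c k * kron k i = c k * (\<Sum>j<m. d j * e j i)" if "k \<le> N" for k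
    using k[OF that] by (cases "c k = 0") auto
  then have "\<forall>k\<in>{..N}. \<exists>d. \<forall>i\<le>N. c k * kron k i = c k * (\<Sum>j<m. d j * e j i)" by simp
  from bchoice[OF this] obtain D where D: "\<And>k i. k \<le> N \<Longrightarrow> i \<le> N \<Longrightarrow> c k * kron k i = c k * (\<Sum>j<m. D k j * e j i)"
    by auto
  have "c i = (\<Sum>j<m. (\<Sum>k\<le>N. c k * D k j) * e j i)" if i: "i \<le> N" for i
  proof -
    have "c i = (\<Sum>k\<le>N. c k * kron k i)" by (rule kron_expand[OF i, symmetric])
    also have "\<dots> = (\<Sum>k\<le>N. c k * (\<Sum>j<m. D k j * e j i))"
      by (rule sum.cong[OF refl D[OF _ i]]) simp
    also have "\<dots> = (\<Sum>k\<le>N. \<Sum>j<m. c k * D k j * e j i)"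
      by (simp only: sum_distrib_left mult.assoc)
    also have "\<dots> = (\<Sum>j<m. \<Sum>k\<le>N. c k * D k j * e j i)" by (rule sum.swap)
    also have "\<dots> = (\<Sum>j<m. (\<Sum>k\<le>N. c k * D k j) * e j i)"
      by (simp only: sum_distrib_right)
    finally show ?thesis .
  qed
  then show ?thesis by (intro exI[of _ "\<lambda>j. \<Sum>k\<le>N. c k * D k j"]) blast
qed

lemma ip_pl_linear:
  assumes N: "0 < N"
  shows "ip (pl N (\<lambda>i. x i - y i)) (pl N z) = ip (pl N x) (pl N z) - ip (pl N y) (pl N z)"
    and "ip (pl N (\<lambda>i. c * x i)) (pl N z) = c * ip (pl N x) (pl N z)"
    and "ip (pl N (\<lambda>i. \<Sum>j<(m::nat). d j * e j i)) (pl N z) = (\<Sum>j<m. d j * ip (pl N (e j)) (pl N z))"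
    and "ip (dpl N (\<lambda>i. x i - y i)) (dpl N z) = ip (dpl N x) (dpl N z) - ip (dpl N y) (dpl N z)"
    and "ip (dpl N (\<lambda>i. c * x i)) (dpl N z) = c * ip (dpl N x) (dpl N z)"
    and "ip (dpl N (\<lambda>i. \<Sum>j<(m::nat). d j * e j i)) (dpl N z) = (\<Sum>j<m. d j * ip (dpl N (e j)) (dpl N z))"
proof -
  note p = pl_bm[OF N] and d = dpl_bm[OF N]
  show "ip (pl N (\<lambda>i. x i - y i)) (pl N z) = ip (pl N x) (pl N z) - ip (pl N y) (pl N z)"
    unfolding pl_diff[abs_def] by (rule ip_diff_left[OF p p p])
  show "ip (pl N (\<lambda>i. c * x i)) (pl N z) = c * ip (pl N x) (pl N z)"
    unfolding pl_cmult[abs_def] by (rule ip_cmult_left)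
  show "ip (pl N (\<lambda>i. \<Sum>j<m. d j * e j i)) (pl N z) = (\<Sum>j<m. d j * ip (pl N (e j)) (pl N z))"
    using ip_sum_left[of "{..<m}" "\<lambda>j x. d j * pl N (e j) x" "pl N z"] bm_cmult[OF p] p
    by (simp add: pl_sum[abs_def] pl_cmult ip_cmult_left)
  show "ip (dpl N (\<lambda>i. x i - y i)) (dpl N z) = ip (dpl N x) (dpl N z) - ip (dpl N y) (dpl N z)"
    unfolding dpl_diff[abs_def] by (rule ip_diff_left[OF d d d])
  show "ip (dpl N (\<lambda>i. c * x i)) (dpl N z) = c * ip (dpl N x) (dpl N z)"
    unfolding dpl_cmult[abs_def] by (rule ip_cmult_left)
  show "ip (dpl N (\<lambda>i. \<Sum>j<m. d j * e j i)) (dpl N z) = (\<Sum>j<m. d j * ip (dpl N (e j)) (dpl N z))"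
    using ip_sum_left[of "{..<m}" "\<lambda>j x. d j * dpl N (e j) x" "dpl N z"] bm_cmult[OF d] d
    by (simp add: dpl_sum[abs_def] dpl_cmult ip_cmult_left)
qed

text \<open>In an orthonormal basis the mass matrix is the identity, so the semidiscrete problem is
  an explicit system of ordinary differential equations and no matrix has to be inverted.\<close>

lemma pl_basis:
  assumes N: "0 < N"
  obtains m e where "\<And>i j. i < (m::nat) \<Longrightarrow> j < m \<Longrightarrow> ip (pl N (e i)) (pl N (e j)) = (if i = j then 1 else 0)"
    "\<And>c. \<exists>d. \<forall>i\<le>N. c i = (\<Sum>j<m. d j * e j i)"
proof -
  let ?B = "\<lambda>x y. ip (pl N x) (pl N y)"
  note [simp] = pl_bm[OF N]
  have "\<exists>m e. (\<forall>j<(m::nat). True) \<and> (\<forall>i<m. \<forall>j<m. ?B (e i) (e j) = (if i = j then 1 else 0)) \<and>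
     (\<forall>k<Suc N. \<exists>d. ?B (\<lambda>i. kron k i - (\<Sum>j<m. d j * e j i)) (\<lambda>i. kron k i - (\<Sum>j<m. d j * e j i)) = 0)"
  proof (rule gram_schmidt[where P = "\<lambda>_. True"])
    show "?B x y = ?B y x" for x y by (rule ip_commute)
    show "?B (\<lambda>i. x i - y i) z = ?B x z - ?B y z" for x y z by (rule ip_pl_linear(1)[OF N])
    show "?B (\<lambda>i. c * x i) z = c * ?B x z" for c x z by (rule ip_pl_linear(2)[OF N])
    show "?B (\<lambda>i. \<Sum>j<(m::nat). d j * e j i) z = (\<Sum>j<m. d j * ?B (e j) z)" for m d e z by (rule ip_pl_linear(3)[OF N])
    show "0 \<le> ?B x x" for x by (rule ip_self_nonneg)
  qed (rule TrueI)+
  then obtain m e where e: "\<And>i j. i < (m::nat) \<Longrightarrow> j < m \<Longrightarrow> ?B (e i) (e j) = (if i = j then 1 else 0)"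
    "\<And>k. k < Suc N \<Longrightarrow> \<exists>d. ?B (\<lambda>i. kron k i - (\<Sum>j<m. d j * e j i)) (\<lambda>i. kron k i - (\<Sum>j<m. d j * e j i)) = 0"
    by blast
  have "\<exists>d. \<forall>i\<le>N. kron k i = (\<Sum>j<m. d j * e j i)" if k: "k \<le> N" for k
  proof -
    obtain d where "?B (\<lambda>i. kron k i - (\<Sum>j<m. d j * e j i)) (\<lambda>i. kron k i - (\<Sum>j<m. d j * e j i)) = 0"
      using e(2)[of k] k by auto
    \<comment> \<open>A residual of norm 0 has vanishing nodal values, by the inverse
      inequality.\<close>
    then have "(kron k i - (\<Sum>j<m. d j * e j i))\<^sup>2 \<le> 0" if "i \<le> N" for i
      using pl_node_sq[OF N that, of "\<lambda>i. kron k i - (\<Sum>j<m. d j * e j i)"] by simp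
    then show ?thesis by (intro exI[of _ d]) auto
  qed
  then have sp: "\<exists>d. \<forall>i\<le>N. c i = (\<Sum>j<m. d j * e j i)" for c by (rule span_from_kron)
  show thesis using e(1) sp by (rule that[of m e])
qed

text \<open>The analogue for \<open>a_form\<close>. Only the inner nodes
  \<open>1, ..., N - 1\<close> contribute, hence \<open>kron (Suc k)\<close> with
  \<open>k < N - 1\<close>.\<close>

lemma pl_basis0:
  assumes N: "0 < N"
  obtains m e where "\<And>i j. i < (m::nat) \<Longrightarrow> j < m \<Longrightarrow> ip (pl N (e i)) (pl N (e j)) + 1/3 * ip (dpl N (e i)) (dpl N (e j)) = (if i = j then 1 else 0)"
    "\<And>j. j < m \<Longrightarrow> e j 0 = 0" "\<And>j. j < m \<Longrightarrow> e j N = 0"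
    "\<And>c. c 0 = 0 \<Longrightarrow> c N = 0 \<Longrightarrow> \<exists>d. \<forall>i\<le>N. c i = (\<Sum>j<m. d j * e j i)"
proof -
  let ?B = "\<lambda>x y. ip (pl N x) (pl N y) + 1/3 * ip (dpl N x) (dpl N y)"
  let ?P = "\<lambda>x::nat \<Rightarrow> real. x 0 = 0 \<and> x N = 0"
  note [simp] = pl_bm[OF N] dpl_bm[OF N]
  have "\<exists>m e. (\<forall>j<(m::nat). ?P (e j)) \<and> (\<forall>i<m. \<forall>j<m. ?B (e i) (e j) = (if i = j then 1 else 0)) \<and>
     (\<forall>k<N - 1. \<exists>d. ?B (\<lambda>i. kron (Suc k) i - (\<Sum>j<m. d j * e j i)) (\<lambda>i. kron (Suc k) i - (\<Sum>j<m. d j * e j i)) = 0)"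
  proof (rule gram_schmidt[where P = ?P])
    show "?B x y = ?B y x" for x y by (simp add: ip_commute)
    show "0 \<le> ?B x x" for x by (simp add: ip_self_nonneg)
    show "?B (\<lambda>i. \<Sum>j<(m::nat). d j * e j i) z = (\<Sum>j<m. d j * ?B (e j) z)" for m d e z
      unfolding ip_pl_linear[OF N] by (simp add: distrib_left sum.distrib sum_divide_distrib)
    show "?B (\<lambda>i. x i - y i) z = ?B x z - ?B y z" for x y z
      unfolding ip_pl_linear[OF N] by simp
    show "?B (\<lambda>i. c * x i) z = c * ?B x z" for c x z
      unfolding ip_pl_linear[OF N] by (simp add: distrib_left)
    show "?P (kron (Suc k))" if "k < N - 1" for k using that by (auto simp: kron_def)
    show "?P (\<lambda>i. \<Sum>j<(m::nat). d j * e j i)" if "\<And>j. j < m \<Longrightarrow> ?P (e j)" for m d e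
      using that by (auto intro!: sum.neutral)
  qed simp_all
  then obtain m e where e: "\<And>j. j < (m::nat) \<Longrightarrow> ?P (e j)" "\<And>i j. i < m \<Longrightarrow> j < m \<Longrightarrow> ?B (e i) (e j) = (if i = j then 1 else 0)"
    "\<And>k. k < N - 1 \<Longrightarrow> \<exists>d. ?B (\<lambda>i. kron (Suc k) i - (\<Sum>j<m. d j * e j i)) (\<lambda>i. kron (Suc k) i - (\<Sum>j<m. d j * e j i)) = 0"
    by blast
  have *: "\<exists>d. \<forall>i\<le>N. kron k i = (\<Sum>j<m. d j * e j i)" if k: "k \<le> N" "k \<noteq> 0" "k \<noteq> N" for k
  proof -
    obtain l where l: "k = Suc l" "l < N - 1" using k by (cases k) auto
    obtain d where d: "?B (\<lambda>i. kron k i - (\<Sum>j<m. d j * e j i)) (\<lambda>i. kron k i - (\<Sum>j<m. d j * e j i)) = 0"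
      using e(3)[OF l(2)] l(1) by auto
    have "ip (pl N (\<lambda>i. kron k i - (\<Sum>j<m. d j * e j i))) (pl N (\<lambda>i. kron k i - (\<Sum>j<m. d j * e j i))) = 0"
      using d ip_self_nonneg[of "pl N (\<lambda>i. kron k i - (\<Sum>j<m. d j * e j i))"] ip_self_nonneg[of "dpl N (\<lambda>i. kron k i - (\<Sum>j<m. d j * e j i))"]
      by linarith
    then have "(kron k i - (\<Sum>j<m. d j * e j i))\<^sup>2 \<le> 0" if "i \<le> N" for i
      using pl_node_sq[OF N that, of "\<lambda>i. kron k i - (\<Sum>j<m. d j * e j i)"] by simp
    then show ?thesis by (intro exI[of _ d]) auto
  qed
  show thesis
  proof (rule that[of m e])
    fix c :: "nat \<Rightarrow> real" assume c: "c 0 = 0" "c N = 0"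
    show "\<exists>d. \<forall>i\<le>N. c i = (\<Sum>j<m. d j * e j i)"
    proof (rule span_from_kron)
      fix k assume k: "k \<le> N" "c k \<noteq> 0"
      show "\<exists>d. \<forall>i\<le>N. kron k i = (\<Sum>j<m. d j * e j i)"
        by (rule *[OF k(1)]) (use k(2) c in metis)+
    qed
  qed (rule e(2) | use e(1) in blast)+
qed

section \<open>The truncated system\<close>

definition clamp1 :: "real \<Rightarrow> real \<Rightarrow> real" where
  "clamp1 r x = max (- r) (min r x)"

lemma clamp1_props:
  "0 \<le> r \<Longrightarrow> \<bar>clamp1 r x\<bar> \<le> r" "\<bar>clamp1 r x - clamp1 r y\<bar> \<le> \<bar>x - y\<bar>" "\<bar>x\<bar> \<le> r \<Longrightarrow> clamp1 r x = x"
proof -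
  have "\<bar>max (- r) p - max (- r) q\<bar> \<le> \<bar>p - q\<bar>" "\<bar>min r p - min r q\<bar> \<le> \<bar>p - q\<bar>" for p q
    by (auto simp: max_def min_def)
  then show "\<bar>clamp1 r x - clamp1 r y\<bar> \<le> \<bar>x - y\<bar>"
    unfolding clamp1_def using order.trans by blast
  show "0 \<le> r \<Longrightarrow> \<bar>clamp1 r x\<bar> \<le> r" unfolding clamp1_def by (auto simp: max_def min_def)
  show "\<bar>x\<bar> \<le> r \<Longrightarrow> clamp1 r x = x" unfolding clamp1_def by (auto simp: max_def min_def)
qed

text \<open>Clamping every unknown to \<open>[- r, r]\<close> makes a quadratic field globally
  Lipschitz: a product of two clamped unknowns changes by at most \<open>2 r\<close> times the
  distance.\<close>

lemma quadratic_ode: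
  fixes A :: "nat \<Rightarrow> nat \<Rightarrow> real" and Q :: "nat \<Rightarrow> nat \<Rightarrow> nat \<Rightarrow> real"
  assumes T: "0 \<le> T" and r: "0 \<le> r"
  shows "\<exists>x. (\<forall>k<n. x 0 k = x0 k) \<and> (\<forall>t\<in>{0..T}. \<forall>k<n. ((\<lambda>s. x s k) has_real_derivative
    (\<Sum>j<n. A k j * clamp1 r (x t j)) + (\<Sum>j<n. \<Sum>l<n. Q k j l * (clamp1 r (x t j) * clamp1 r (x t l)))) (at t within {0..T}))"
proof (rule global_lipschitz_ode[OF T])
  define L where "L k = (\<Sum>j<n. \<bar>A k j\<bar>) + (\<Sum>j<n. \<Sum>l<n. \<bar>Q k j l\<bar> * (2 * r))" for k
  have L0: "0 \<le> L k" for k unfolding L_def using r by (intro add_nonneg_nonneg sum_nonneg) auto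
  show "0 \<le> (\<Sum>k<n. L k)" by (intro sum_nonneg L0)
  show "continuous_on S (\<lambda>s. (\<Sum>j<n. A k j * clamp1 r (w s j)) + (\<Sum>j<n. \<Sum>l<n. Q k j l * (clamp1 r (w s j) * clamp1 r (w s l))))"
    if "\<And>j. j < n \<Longrightarrow> continuous_on S (\<lambda>s::real. w s j)" for w S k
    unfolding clamp1_def by (intro continuous_intros that) auto
  fix k and x y :: "nat \<Rightarrow> real" and d :: real assume k: "k < n" and d: "\<And>j. j < n \<Longrightarrow> \<bar>x j - y j\<bar> \<le> d"
  have d0: "0 \<le> d" using d[OF k] by linarith
  let ?c = "clamp1 r"
  have c: "\<bar>?c (x j) - ?c (y j)\<bar> \<le> d" if "j < n" for j using clamp1_props(2) d[OF that] order.trans by blast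
  have cc: "\<bar>?c (x j) * ?c (x l) - ?c (y j) * ?c (y l)\<bar> \<le> 2 * r * d" if "j < n" "l < n" for j l
  proof -
    have "?c (x j) * ?c (x l) - ?c (y j) * ?c (y l) = ?c (x j) * (?c (x l) - ?c (y l)) + (?c (x j) - ?c (y j)) * ?c (y l)"
      by (simp add: algebra_simps)
    also have "\<bar>\<dots>\<bar> \<le> r * d + d * r"
      unfolding abs_mult using c that r d0 clamp1_props(1)[OF r]
      by (intro order.trans[OF abs_triangle_ineq] add_mono) (auto simp: abs_mult intro!: mult_mono)
    finally show ?thesis by (simp add: mult_ac)
  qed
  have d1: "(\<Sum>j<n. A k j * ?c (x j)) - (\<Sum>j<n. A k j * ?c (y j)) = (\<Sum>j<n. A k j * (?c (x j) - ?c (y j)))"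
    by (simp only: right_diff_distrib sum_subtractf)
  have d2: "(\<Sum>j<n. \<Sum>l<n. Q k j l * (?c (x j) * ?c (x l))) - (\<Sum>j<n. \<Sum>l<n. Q k j l * (?c (y j) * ?c (y l)))
     = (\<Sum>j<n. \<Sum>l<n. Q k j l * (?c (x j) * ?c (x l) - ?c (y j) * ?c (y l)))"
    by (simp only: right_diff_distrib sum_subtractf)
  have e1: "\<bar>\<Sum>j<n. A k j * (?c (x j) - ?c (y j))\<bar> \<le> (\<Sum>j<n. \<bar>A k j\<bar> * d)"
    by (rule order.trans[OF sum_abs], rule sum_mono, unfold abs_mult, rule mult_left_mono[OF c]) auto
  have e2: "\<bar>\<Sum>j<n. \<Sum>l<n. Q k j l * (?c (x j) * ?c (x l) - ?c (y j) * ?c (y l))\<bar> \<le> (\<Sum>j<n. \<Sum>l<n. \<bar>Q k j l\<bar> * (2 * r * d))"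
    by (rule order.trans[OF sum_abs], rule sum_mono, rule order.trans[OF sum_abs], rule sum_mono, simp only: abs_mult[of "Q _ _ _"], rule mult_left_mono[OF cc]) auto
  have "\<bar>((\<Sum>j<n. A k j * ?c (x j)) + (\<Sum>j<n. \<Sum>l<n. Q k j l * (?c (x j) * ?c (x l)))) - ((\<Sum>j<n. A k j * ?c (y j)) + (\<Sum>j<n. \<Sum>l<n. Q k j l * (?c (y j) * ?c (y l))))\<bar>
     \<le> (\<Sum>j<n. \<bar>A k j\<bar> * d) + (\<Sum>j<n. \<Sum>l<n. \<bar>Q k j l\<bar> * (2 * r * d))"
    using e1 e2 d1 d2 by linarith
  also have "\<dots> = L k * d" by (simp add: L_def sum_distrib_right distrib_right mult.assoc)
  also have "\<dots> \<le> (\<Sum>k<n. L k) * d"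
    using k L0 d0 by (intro mult_right_mono member_le_sum) auto
  finally show "\<bar>((\<Sum>j<n. A k j * ?c (x j)) + (\<Sum>j<n. \<Sum>l<n. Q k j l * (?c (x j) * ?c (x l)))) - ((\<Sum>j<n. A k j * ?c (y j)) + (\<Sum>j<n. \<Sum>l<n. Q k j l * (?c (y j) * ?c (y l))))\<bar>
     \<le> (\<Sum>k<n. L k) * d" .
qed

lemma ip_bilinear_sum:
  fixes p q :: "nat \<Rightarrow> real \<Rightarrow> real"
  assumes "\<And>j. p j \<in> bm" "\<And>j. q j \<in> bm" "g \<in> bm"
  shows "ip (\<lambda>y. (\<Sum>j<n. x j * p j y) * (\<Sum>l<n. z l * q l y)) g = (\<Sum>j<n. \<Sum>l<n. x j * z l * ip (\<lambda>y. p j y * q l y) g)"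
proof -
  have "ip (\<lambda>y. (\<Sum>j<n. x j * p j y) * (\<Sum>l<n. z l * q l y)) g = ip (\<lambda>y. \<Sum>j<n. \<Sum>l<n. x j * z l * (p j y * q l y)) g"
    by (rule ip_cong) (simp add: sum_product mult_ac)
  also have "\<dots> = (\<Sum>j<n. \<Sum>l<n. ip (\<lambda>y. x j * z l * (p j y * q l y)) g)"
    by (subst ip_sum_left, (intro bm_intros assms)+)+ (rule refl)
  finally show ?thesis by (simp add: ip_cmult_left)
qed

lemma nodes_bounded:
  fixes a :: "real \<Rightarrow> nat \<Rightarrow> real"
  assumes "\<And>i. i \<le> N \<Longrightarrow> continuous_on {0..T} (\<lambda>t. a t i)"
  shows "\<exists>B\<ge>0. \<forall>t\<in>{0..T}. \<forall>i\<le>N. \<bar>a t i\<bar> \<le> B"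
proof -
  have "\<forall>i\<in>{..N}. \<exists>B. \<forall>t\<in>{0..T}. \<bar>a t i\<bar> \<le> B"
  proof
    fix i assume "i \<in> {..N}"
    then have "bounded ((\<lambda>t. a t i) ` {0..T})"
      using compact_continuous_image[OF assms] compact_imp_bounded by auto
    then show "\<exists>B. \<forall>t\<in>{0..T}. \<bar>a t i\<bar> \<le> B" by (auto simp: bounded_iff)
  qed
  from bchoice[OF this] obtain B where "\<forall>i\<in>{..N}. \<forall>t\<in>{0..T}. \<bar>a t i\<bar> \<le> B i" by blast
  then have B: "\<And>i t. i \<le> N \<Longrightarrow> t \<in> {0..T} \<Longrightarrow> \<bar>a t i\<bar> \<le> B i" by auto
  have "\<bar>a t i\<bar> \<le> (\<Sum>i\<le>N. \<bar>B i\<bar>)" if "t \<in> {0..T}" "i \<le> N" for t i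
  proof -
    have "\<bar>a t i\<bar> \<le> \<bar>B i\<bar>" using B[OF that(2,1)] by linarith
    also have "\<dots> \<le> (\<Sum>i\<le>N. \<bar>B i\<bar>)" using that by (intro member_le_sum[of _ _ "\<lambda>i. \<bar>B i\<bar>"]) auto
    finally show ?thesis .
  qed
  then show ?thesis by (intro exI[of _ "\<Sum>i\<le>N. \<bar>B i\<bar>"]) (auto intro: sum_nonneg)
qed

lemma ip_dpl_sum_right:
  assumes N: "0 < N" and g: "g \<in> bm"
  shows "ip g (dpl N (\<lambda>i. \<Sum>j<(m::nat). d j * e j i)) = (\<Sum>j<m. d j * ip g (dpl N (e j)))"
  using ip_sum_right[of "{..<m}" "\<lambda>j x. d j * dpl N (e j) x" g] bm_cmult[OF dpl_bm[OF N]] g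
  by (simp add: dpl_sum[abs_def] dpl_cmult ip_cmult_right)

lemma orthonormal_coeff:
  assumes "\<And>i. i < m \<Longrightarrow> B i = (if i = j then 1 else (0::real))" "j < (m::nat)"
  shows "(\<Sum>i<m. d i * B i) = d j"
proof -
  have "(\<Sum>i<m. d i * B i) = (\<Sum>i<m. if i = j then d i else 0)"
    by (intro sum.cong) (auto simp: assms(1))
  then show ?thesis using assms(2) by simp
qed

section \<open>Uniqueness and truncated existence for the discrete problem\<close>

context boussinesq
begin

text \<open>The competing solution is arbitrary and need not be close to the exact one, so its
  bounds come from compactness of the time interval. The constants may depend on \<open>N\<close>;
  this does no harm, since the initial difference is 0 and the residual in the energy estimate
  vanishes.\<close>

lemma traj_unique:
  assumes N: "0 < N" and tr1: "traj N a b a' b'" and tr2: "traj N c d c' d'"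
    and de1: "\<And>t. t \<in> {0..T} \<Longrightarrow> discrete_eqs \<alpha> \<beta> \<gamma> N (a t) (b t) (a' t) (b' t)"
    and de2: "\<And>t. t \<in> {0..T} \<Longrightarrow> discrete_eqs \<alpha> \<beta> \<gamma> N (c t) (d t) (c' t) (d' t)"
    and t: "t \<in> {0..T}" and i: "i \<le> N"
  shows "a t i = c t i" "b t i = d t i"
proof -
  have der: "((\<lambda>s. a s i) has_real_derivative a' t i) (at t within {0..T})" "((\<lambda>s. b s i) has_real_derivative b' t i) (at t within {0..T})"
    "((\<lambda>s. c s i) has_real_derivative c' t i) (at t within {0..T})" "((\<lambda>s. d s i) has_real_derivative d' t i) (at t within {0..T})"
    if "t \<in> {0..T}" "i \<le> N" for t i using tr1 tr2 that by (auto simp: traj_def)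
  obtain Ba where Ba: "0 \<le> Ba" "\<forall>t\<in>{0..T}. \<forall>i\<le>N. \<bar>a t i\<bar> \<le> Ba" using nodes_bounded[of N T a] DERIV_continuous_on[OF der(1)] by blast
  obtain Bb where Bb: "0 \<le> Bb" "\<forall>t\<in>{0..T}. \<forall>i\<le>N. \<bar>b t i\<bar> \<le> Bb" using nodes_bounded[of N T b] DERIV_continuous_on[OF der(2)] by blast
  obtain Bc where Bc: "0 \<le> Bc" "\<forall>t\<in>{0..T}. \<forall>i\<le>N. \<bar>c t i\<bar> \<le> Bc" using nodes_bounded[of N T c] DERIV_continuous_on[OF der(3)] by blast
  obtain Bd where Bd: "0 \<le> Bd" "\<forall>t\<in>{0..T}. \<forall>i\<le>N. \<bar>d t i\<bar> \<le> Bd" using nodes_bounded[of N T d] DERIV_continuous_on[OF der(4)] by blast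
  define B where "B = Ba + Bb + Bc + Bd"
  have B0: "0 \<le> B" using Ba Bb Bc Bd by (simp add: B_def)
  have B: "\<bar>a t i\<bar> \<le> B" "\<bar>b t i\<bar> \<le> B" "\<bar>c t i\<bar> \<le> B" "\<bar>d t i\<bar> \<le> B" if "t \<in> {0..T}" "i \<le> N" for t i
  proof -
    have "\<bar>a t i\<bar> \<le> Ba" "\<bar>b t i\<bar> \<le> Bb" "\<bar>c t i\<bar> \<le> Bc" "\<bar>d t i\<bar> \<le> Bd" using that Ba Bb Bc Bd by blast+
    then show "\<bar>a t i\<bar> \<le> B" "\<bar>b t i\<bar> \<le> B" "\<bar>c t i\<bar> \<le> B" "\<bar>d t i\<bar> \<le> B" using Ba(1) Bb(1) Bc(1) Bd(1) unfolding B_def by linarith+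
  qed
  \<comment> \<open>Bounds the weights and their slopes; \<open>2 * real N * B\<close> is the crude
    slope bound for nodal values of size \<open>B\<close>.\<close>
  define K where "K = 1 + M * ((2 * real N + 1) * B)"
  have M0: "0 \<le> M" using M(1) by simp
  have K0: "0 \<le> K" using M0 B0 by (simp add: K_def)
  define e f e' f' where "e t i = a t i - c t i" and "f t i = b t i - d t i" and "e' t i = a' t i - c' t i" and "f' t i = b' t i - d' t i" for t i
  define y where "y t = ip (pl N (e t)) (pl N (e t)) + (ip (pl N (f t)) (pl N (f t)) + 1/3 * ip (dpl N (f t)) (dpl N (f t)))" for t
  have ed: "((\<lambda>s. e s i) has_real_derivative e' t i) (at t within {0..T})" "((\<lambda>s. f s i) has_real_derivative f' t i) (at t within {0..T})"
    if "t \<in> {0..T}" "i \<le> N" for t i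
    unfolding e_def e'_def f_def f'_def by (intro DERIV_diff der that)+
  note [simp] = pl_bm[OF N] dpl_bm[OF N]
  have "y t \<le> (y 0 + 0 * t) * exp ((2 * (5 * K + 2)) * t)"
  proof (rule Gronwall[where y = y and \<tau> = T and T = T])
    fix s assume s: "s \<in> {0..T}"
    note 1 = ip_pl_deriv[OF N ed(1)[OF s]] and 2 = ip_pl_deriv[OF N ed(2)[OF s]] and 3 = ip_dpl_deriv[OF N ed(2)[OF s]]
    show "(y has_real_derivative 2 * (ip (pl N (e' s)) (pl N (e s)) + (ip (pl N (f' s)) (pl N (f s)) + 1/3 * ip (dpl N (f' s)) (dpl N (f s))))) (at s within {0..T})"
      unfolding y_def[abs_def]
      using DERIV_add[OF 1 DERIV_add[OF 2 DERIV_cmult[OF 3, where c = "1/3"]]] by (simp add: distrib_left)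
    have plb: "\<bar>pl N (a s) x\<bar> \<le> B" "\<bar>pl N (b s) x\<bar> \<le> B" "\<bar>pl N (c s) x\<bar> \<le> B" "\<bar>pl N (d s) x\<bar> \<le> B" if "x \<in> {0..1}" for x
      by (rule pl_sup[OF N B(1)[OF s] that] pl_sup[OF N B(2)[OF s] that] pl_sup[OF N B(3)[OF s] that] pl_sup[OF N B(4)[OF s] that]; assumption)+
    have db: "\<bar>dpl N v x\<bar> \<le> 2 * real N * B" if "\<And>i. i \<le> N \<Longrightarrow> \<bar>v i\<bar> \<le> B" for v x
    proof (rule dpl_sup[OF N])
      fix i assume "i < N"
      then have "\<bar>v (Suc i) - v i\<bar> \<le> 2 * B" using that[of i] that[of "Suc i"] by auto
      then show "\<bar>real N * (v (Suc i) - v i)\<bar> \<le> 2 * real N * B"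
        unfolding abs_mult using mult_left_mono[of "\<bar>v (Suc i) - v i\<bar>" "2 * B" "real N"] by simp
    qed
    have dab: "\<bar>dpl N (a s) x\<bar> \<le> 2 * real N * B" "\<bar>dpl N (d s) x\<bar> \<le> 2 * real N * B" for x
      using db[of "a s" x] db[of "d s" x] B(1,4)[OF s] by blast+
    have mb: "\<bar>p * q\<bar> \<le> M * Z" if "\<bar>p\<bar> \<le> M" "\<bar>q\<bar> \<le> Z" for p q Z
      unfolding abs_mult using that M0 by (intro mult_mono) auto
    have MK: "M * B \<le> K - 1" "M * (2 * real N * B) \<le> K - 1" 
      unfolding K_def using M0 B0 by (auto intro!: mult_left_mono simp: algebra_simps)
    have w1: "wd (\<lambda>x. 1 + \<alpha> * pl N (a s) x) (\<lambda>x. 0 + \<alpha> * dpl N (a s) x)" by (intro wd_add wd_const wd_cmult wd_pl N)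
    have w2: "wd (\<lambda>x. \<alpha> * pl N (d s) x) (\<lambda>x. \<alpha> * dpl N (d s) x)" by (intro wd_cmult wd_pl N)
    have lin: "ip (pl N (e' s)) (pl N z) = ip (\<lambda>x. (1 + \<alpha> * pl N (a s) x) * pl N (f s) x) (dpl N z) + ip (\<lambda>x. \<alpha> * pl N (d s) x * pl N (e s) x) (dpl N z)" for z
    proof -
      have "ip (pl N (e' s)) (pl N z) = ip (pl N (a' s)) (pl N z) - ip (pl N (c' s)) (pl N z)"
        unfolding e'_def[abs_def] by (rule ip_pl_linear(1)[OF N])
      also have "\<dots> = ip (\<lambda>x. pl N (b s) x + \<alpha> * (pl N (a s) x * pl N (b s) x)) (dpl N z) - ip (\<lambda>x. pl N (d s) x + \<alpha> * (pl N (c s) x * pl N (d s) x)) (dpl N z)"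
        using de1[OF s] de2[OF s] by (simp add: discrete_eqs_def)
      also have "\<dots> = ip (\<lambda>x. (pl N (b s) x + \<alpha> * (pl N (a s) x * pl N (b s) x)) - (pl N (d s) x + \<alpha> * (pl N (c s) x * pl N (d s) x))) (dpl N z)"
        by (rule ip_diff_left[symmetric]) (intro bm_intros pl_bm dpl_bm N)+
      also have "\<dots> = ip (\<lambda>x. (1 + \<alpha> * pl N (a s) x) * pl N (f s) x + \<alpha> * pl N (d s) x * pl N (e s) x) (dpl N z)"
        by (rule ip_cong) (simp add: e_def[abs_def] f_def[abs_def] pl_diff algebra_simps)
      also have "\<dots> = ip (\<lambda>x. (1 + \<alpha> * pl N (a s) x) * pl N (f s) x) (dpl N z) + ip (\<lambda>x. \<alpha> * pl N (d s) x * pl N (e s) x) (dpl N z)"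
        by (rule ip_add_left) (intro bm_intros pl_bm dpl_bm N)+
      finally show ?thesis .
    qed
    have bd: "b s 0 = 0" "b s N = 0" "d s 0 = 0" "d s N = 0" using tr1 tr2 s by (auto simp: traj_def)
    then have f0: "f s 0 = 0" "f s N = 0" by (auto simp: f_def)
    have lin2: "ip (pl N (f' s)) (pl N (f s)) + 1/3 * ip (dpl N (f' s)) (dpl N (f s))
        = ip (\<lambda>x. \<beta> / 2 * (pl N (b s) x + pl N (d s) x) * pl N (f s) x) (dpl N (f s))
         + ip (\<lambda>x. (1 + \<gamma> / 2 * (pl N (a s) x + pl N (c s) x)) * pl N (e s) x) (dpl N (f s))"
    proof -
      have "ip (pl N (f' s)) (pl N (f s)) + 1/3 * ip (dpl N (f' s)) (dpl N (f s))
        = (ip (pl N (b' s)) (pl N (f s)) + 1/3 * ip (dpl N (b' s)) (dpl N (f s))) - (ip (pl N (d' s)) (pl N (f s)) + 1/3 * ip (dpl N (d' s)) (dpl N (f s)))"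
        unfolding f'_def[abs_def] ip_pl_linear[OF N] by simp
      also have "\<dots> = ip (\<lambda>x. pl N (a s) x + \<beta> / 2 * (pl N (b s) x * pl N (b s) x) + \<gamma> / 2 * (pl N (a s) x * pl N (a s) x)) (dpl N (f s))
         - ip (\<lambda>x. pl N (c s) x + \<beta> / 2 * (pl N (d s) x * pl N (d s) x) + \<gamma> / 2 * (pl N (c s) x * pl N (c s) x)) (dpl N (f s))"
        using de1[OF s] de2[OF s] f0 by (simp add: discrete_eqs_def)
      also have "\<dots> = ip (\<lambda>x. (pl N (a s) x + \<beta> / 2 * (pl N (b s) x * pl N (b s) x) + \<gamma> / 2 * (pl N (a s) x * pl N (a s) x))
         - (pl N (c s) x + \<beta> / 2 * (pl N (d s) x * pl N (d s) x) + \<gamma> / 2 * (pl N (c s) x * pl N (c s) x))) (dpl N (f s))"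
        by (rule ip_diff_left[symmetric]) (intro bm_intros pl_bm dpl_bm N)+
      also have "\<dots> = ip (\<lambda>x. \<beta> / 2 * (pl N (b s) x + pl N (d s) x) * pl N (f s) x + (1 + \<gamma> / 2 * (pl N (a s) x + pl N (c s) x)) * pl N (e s) x) (dpl N (f s))"
        by (rule ip_cong) (simp add: e_def[abs_def] f_def[abs_def] pl_diff field_simps)
      also have "\<dots> = ip (\<lambda>x. \<beta> / 2 * (pl N (b s) x + pl N (d s) x) * pl N (f s) x) (dpl N (f s))
         + ip (\<lambda>x. (1 + \<gamma> / 2 * (pl N (a s) x + pl N (c s) x)) * pl N (e s) x) (dpl N (f s))"
        by (rule ip_add_left) (intro bm_intros pl_bm dpl_bm N)+
      finally show ?thesis .
    qed
    have twice: "2 * X \<le> (2 * k) * Y + 0" if "X \<le> k * Y + 2 * 0\<^sup>2" for X Y k :: real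
      using that by simp
    have "ip (pl N (e' s)) (pl N (e s)) + (ip (pl N (f' s)) (pl N (f s)) + 1/3 * ip (dpl N (f' s)) (dpl N (f s)))
       \<le> (5 * K + 2) * (ip (pl N (e s)) (pl N (e s)) + (ip (pl N (f s)) (pl N (f s)) + 1/3 * ip (dpl N (f s)) (dpl N (f s)))) + 2 * 0\<^sup>2"
    proof (rule energy_estimate[OF N f0 w1 w2])
      fix x :: real assume x: "x \<in> {0..1}"
      show "\<bar>1 + \<alpha> * pl N (a s) x\<bar> \<le> K" using mb[OF M(3) plb(1)[OF x]] MK(1) by linarith
      show "\<bar>0 + \<alpha> * dpl N (a s) x\<bar> \<le> K" using mb[OF M(3) dab(1)[of x]] MK(2) by linarith
      show "\<bar>\<alpha> * dpl N (d s) x\<bar> \<le> K" using mb[OF M(3) dab(2)[of x]] MK(2) by linarith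
      have "\<bar>pl N (b s) x + pl N (d s) x\<bar> \<le> 2 * B" "\<bar>pl N (a s) x + pl N (c s) x\<bar> \<le> 2 * B" using plb[OF x] by linarith+
      note h = mb[OF M(4) this(1)] mb[OF M(5) this(2)]
      show "\<bar>\<beta> / 2 * (pl N (b s) x + pl N (d s) x)\<bar> \<le> K" using h(1) MK(1) by (simp add: abs_mult)
      have "\<bar>\<gamma> / 2 * (pl N (a s) x + pl N (c s) x)\<bar> \<le> M * B" using h(2) by (simp add: abs_mult)
      then show "\<bar>1 + \<gamma> / 2 * (pl N (a s) x + pl N (c s) x)\<bar> \<le> K" using MK(1) by linarith
    next
      show "(\<lambda>x. \<beta> / 2 * (pl N (b s) x + pl N (d s) x)) \<in> bm" "(\<lambda>x. 1 + \<gamma> / 2 * (pl N (a s) x + pl N (c s) x)) \<in> bm"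
        by (intro bm_intros pl_bm N)+
      show "\<alpha> * pl N (d s) 0 = 0" "\<alpha> * pl N (d s) 1 = 0" using bd by (simp_all add: pl_0 pl_1 N)
    qed (use lin lin2 in simp_all)
    then show "2 * (ip (pl N (e' s)) (pl N (e s)) + (ip (pl N (f' s)) (pl N (f s)) + 1/3 * ip (dpl N (f' s)) (dpl N (f s)))) \<le> (2 * (5 * K + 2)) * y s + 0"
      unfolding y_def by (rule twice)
  qed (use t K0 in auto)
  moreover have "y 0 = 0"
  proof -
    have "e 0 i = 0" "f 0 i = 0" if "i \<le> N" for i using tr1 tr2 that by (auto simp: traj_def e_def f_def)
    then have "pl N (e 0) = pl N (\<lambda>_. 0)" "pl N (f 0) = pl N (\<lambda>_. 0)" "dpl N (f 0) = dpl N (\<lambda>_. 0)"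
      by (intro pl_cong dpl_cong N; simp)+
    then show ?thesis unfolding y_def by (simp add: pl_zero[abs_def] dpl_zero[abs_def] ip_zero_left)
  qed
  ultimately have "y t \<le> 0" by simp
  then have z: "ip (pl N (e t)) (pl N (e t)) \<le> 0" "ip (pl N (f t)) (pl N (f t)) \<le> 0"
    using ip_self_nonneg[of "pl N (e t)"] ip_self_nonneg[of "pl N (f t)"] ip_self_nonneg[of "dpl N (f t)"] unfolding y_def by linarith+
  have sq0: "v i = 0" if "ip (pl N v) (pl N v) \<le> 0" for v
    using order.trans[OF pl_node_sq[OF N i] mult_nonneg_nonpos[OF _ that, of "6 * real N"]] by simp
  have "e t i = 0" "f t i = 0" by (intro sq0 z)+
  then show "a t i = c t i" "b t i = d t i" by (auto simp: e_def f_def)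
qed

text \<open>A global solution of the clamped system. It satisfies the true equations at every time
  at which the functions are bounded by \<open>R\<close>, because then the coefficients are at most
  \<open>2 R\<close> and the clamps do nothing.\<close>

lemma truncated_solution:
  assumes N: "0 < N" and R: "0 \<le> R"
  shows "\<exists>a b a' b'. traj N a b a' b' \<and> (\<forall>t\<in>{0..T}. (\<forall>x\<in>{0..1}. \<bar>pl N (a t) x\<bar> \<le> R \<and> \<bar>pl N (b t) x\<bar> \<le> R \<and> \<bar>dpl N (b t) x\<bar> \<le> R)
     \<longrightarrow> discrete_eqs \<alpha> \<beta> \<gamma> N (a t) (b t) (a' t) (b' t))"
proof -
  obtain m e where e: "\<And>i j. i < (m::nat) \<Longrightarrow> j < m \<Longrightarrow> ip (pl N (e i)) (pl N (e j)) = (if i = j then 1 else 0)"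
    and esp: "\<And>c. \<exists>d. \<forall>i\<le>N. c i = (\<Sum>j<m. d j * e j i)" by (rule pl_basis[OF N]) (rule that)
  obtain k f where f: "\<And>i j. i < (k::nat) \<Longrightarrow> j < k \<Longrightarrow> ip (pl N (f i)) (pl N (f j)) + 1/3 * ip (dpl N (f i)) (dpl N (f j)) = (if i = j then 1 else 0)"
    and f0: "\<And>j. j < k \<Longrightarrow> f j 0 = 0" "\<And>j. j < k \<Longrightarrow> f j N = 0"
    and fsp: "\<And>c. c 0 = 0 \<Longrightarrow> c N = 0 \<Longrightarrow> \<exists>d. \<forall>i\<le>N. c i = (\<Sum>j<k. d j * f j i)" by (rule pl_basis0[OF N]) (rule that)
  \<comment> \<open>The coefficients of both unknowns form one vector of length
    \<open>m + k\<close>; \<open>E\<close> and \<open>U\<close> are the basis vectors padded with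
    zeros, so that a single quadratic field describes the coupled system.\<close>
  define n where "n = m + k"
  define E where "E j = (if j < m then e j else (\<lambda>_. 0))" for j
  define U where "U j = (if j < m then (\<lambda>_. 0) else f (j - m))" for j
  have sumE: "(\<Sum>j<n. z j * E j i) = (\<Sum>j<m. z j * e j i)" for z i
    unfolding n_def by (induction k) (auto simp: E_def)
  have sumU: "(\<Sum>j<n. z j * U j i) = (\<Sum>j<k. z (m + j) * f j i)" for z i
  proof -
    have "(\<Sum>j<m + l. z j * U j i) = (\<Sum>j<l. z (m + j) * f j i)" for l
      by (induction l) (auto simp: U_def)
    then show ?thesis by (simp add: n_def)
  qed
  obtain d\<eta> where d\<eta>: "\<And>i. i \<le> N \<Longrightarrow> nod N \<eta>0 i = (\<Sum>j<m. d\<eta> j * e j i)" using esp by blast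
  have "nod N u0 0 = 0" "nod N u0 N = 0" using N u0_bdry by (simp_all add: nod_def)
  then obtain du where du: "\<And>i. i \<le> N \<Longrightarrow> nod N u0 i = (\<Sum>j<k. du j * f j i)" using fsp by blast
  define x0 where "x0 j = (if j < m then d\<eta> j else du (j - m))" for j
  define A where "A p j = ip (pl N (U j)) (dpl N (E p)) + ip (pl N (E j)) (dpl N (U p))" for p j
  define Q where "Q p j l = \<alpha> * ip (\<lambda>y. pl N (E j) y * pl N (U l) y) (dpl N (E p))
     + (\<beta> / 2 * ip (\<lambda>y. pl N (U j) y * pl N (U l) y) (dpl N (U p)) + \<gamma> / 2 * ip (\<lambda>y. pl N (E j) y * pl N (E l) y) (dpl N (U p)))" for p j l
  define G where "G z p = (\<Sum>j<n. A p j * clamp1 (2 * R) (z j)) + (\<Sum>j<n. \<Sum>l<n. Q p j l * (clamp1 (2 * R) (z j) * clamp1 (2 * R) (z l)))" for z p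
  have "\<exists>x. (\<forall>k<n. x 0 k = x0 k) \<and> (\<forall>t\<in>{0..T}. \<forall>k<n. ((\<lambda>s. x s k) has_real_derivative G (x t) k) (at t within {0..T}))"
    unfolding G_def by (rule quadratic_ode) (use T R in auto)
  then obtain x where x0: "\<And>p. p < n \<Longrightarrow> x 0 p = x0 p"
    and x: "\<And>t p. t \<in> {0..T} \<Longrightarrow> p < n \<Longrightarrow> ((\<lambda>s. x s p) has_real_derivative G (x t) p) (at t within {0..T})" by blast
  define a b a' b' where "a t i = (\<Sum>j<m. x t j * e j i)" and "b t i = (\<Sum>j<k. x t (m + j) * f j i)"
    and "a' t i = (\<Sum>j<m. G (x t) j * e j i)" and "b' t i = (\<Sum>j<k. G (x t) (m + j) * f j i)" for t i
  have "traj N a b a' b'"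
    unfolding traj_def
  proof (intro conjI ballI allI impI)
    fix t i assume t: "t \<in> {0..T}"
    show "((\<lambda>s. a s i) has_real_derivative a' t i) (at t within {0..T})" "((\<lambda>s. b s i) has_real_derivative b' t i) (at t within {0..T})"
      unfolding a_def a'_def b_def b'_def using t by (auto intro!: derivative_eq_intros x simp: n_def)
  next
    fix t show "b t 0 = 0" "b t N = 0" "b' t 0 = 0" "b' t N = 0"
      using f0 by (auto simp: b_def b'_def intro!: sum.neutral)
  next
    fix i assume i: "i \<le> N"
    show "a 0 i = nod N \<eta>0 i" unfolding a_def d\<eta>[OF i] by (intro sum.cong) (auto simp: x0 x0_def n_def)
    show "b 0 i = nod N u0 i" unfolding b_def du[OF i] by (intro sum.cong) (auto simp: x0 x0_def n_def)
  qed
  moreover have "discrete_eqs \<alpha> \<beta> \<gamma> N (a t) (b t) (a' t) (b' t)"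
    if t: "t \<in> {0..T}" and bnd: "\<forall>x\<in>{0..1}. \<bar>pl N (a t) x\<bar> \<le> R \<and> \<bar>pl N (b t) x\<bar> \<le> R \<and> \<bar>dpl N (b t) x\<bar> \<le> R" for t
  proof -
    note P = pl_bm[OF N] and D = dpl_bm[OF N]
    have na: "L2norm (pl N (a t)) \<le> R" "L2norm (pl N (b t)) \<le> R" "L2norm (dpl N (b t)) \<le> R"
      using bnd R by (auto intro!: L2norm_le_sup P D)
    have xa: "x t j = ip (pl N (a t)) (pl N (e j))" if "j < m" for j
      unfolding a_def ip_pl_linear[OF N] by (rule orthonormal_coeff[symmetric]) (use e that in auto)
    have xb: "x t (m + j) = ip (pl N (b t)) (pl N (f j)) + 1/3 * ip (dpl N (b t)) (dpl N (f j))" if "j < k" for j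
    proof -
      have "(\<Sum>l<k. x t (m + l) * (ip (pl N (f l)) (pl N (f j)) + 1/3 * ip (dpl N (f l)) (dpl N (f j)))) = x t (m + j)"
        by (rule orthonormal_coeff) (use f that in auto)
      then show ?thesis unfolding b_def ip_pl_linear[OF N] by (simp add: distrib_left sum.distrib sum_divide_distrib)
    qed
    have xR: "\<bar>x t j\<bar> \<le> 2 * R" if j: "j < n" for j
    proof (cases "j < m")
      case True
      have "L2norm (pl N (e j)) \<le> 1" using e[OF True True] by (simp add: L2norm_def)
      then have "\<bar>x t j\<bar> \<le> R * 1" unfolding xa[OF True] by (intro abs_ip_le P na)
      then show ?thesis using R by simp
    next
      case False
      define l where "l = j - m"
      have l: "j = m + l" "l < k" using False j by (auto simp: l_def n_def)
      \<comment> \<open>Normalisation for \<open>a_form\<close> bounds the basis function by 1 and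
        its slope by sqrt 3, so by 2; a coefficient is therefore at most
        \<open>R + 2 * R / 3\<close>, which is below \<open>2 * R\<close>.\<close>
      have s: "(L2norm (pl N (f l)))\<^sup>2 + 1/3 * (L2norm (dpl N (f l)))\<^sup>2 = 1" using f[OF l(2) l(2)] by (simp add: L2norm_sq)
      then have "(L2norm (pl N (f l)))\<^sup>2 \<le> 1\<^sup>2" "(L2norm (dpl N (f l)))\<^sup>2 \<le> 2\<^sup>2"
        using zero_le_power2[of "L2norm (dpl N (f l))"] zero_le_power2[of "L2norm (pl N (f l))"] power2_eq_square[of "2::real"] unfolding one_power2 by linarith+
      then have "L2norm (pl N (f l)) \<le> 1" "L2norm (dpl N (f l)) \<le> 2" by (auto intro: power2_le_imp_le)
      then have "\<bar>ip (pl N (b t)) (pl N (f l))\<bar> \<le> R * 1" "\<bar>ip (dpl N (b t)) (dpl N (f l))\<bar> \<le> R * 2"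
        using abs_ip_le[OF P P na(2)] abs_ip_le[OF D D na(3)] by blast+
      then show ?thesis unfolding l(1) xb[OF l(2)] using R by linarith
    qed
    have aE: "pl N (a t) = (\<lambda>y. \<Sum>j<n. x t j * pl N (E j) y)"
    proof -
      have "a t = (\<lambda>i. \<Sum>j<n. x t j * E j i)" by (simp add: sumE a_def fun_eq_iff)
      then show ?thesis by (simp add: pl_sum[abs_def] pl_cmult)
    qed
    have bU: "pl N (b t) = (\<lambda>y. \<Sum>j<n. x t j * pl N (U j) y)"
    proof -
      have "b t = (\<lambda>i. \<Sum>j<n. x t j * U j i)" by (simp add: sumU b_def fun_eq_iff)
      then show ?thesis by (simp add: pl_sum[abs_def] pl_cmult)
    qed
    define g1 where "g1 = (\<lambda>y. pl N (b t) y + \<alpha> * (pl N (a t) y * pl N (b t) y))"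
    define g2 where "g2 = (\<lambda>y. pl N (a t) y + \<beta> / 2 * (pl N (b t) y * pl N (b t) y) + \<gamma> / 2 * (pl N (a t) y * pl N (a t) y))"
    have g: "g1 \<in> bm" "g2 \<in> bm" unfolding g1_def g2_def by (intro bm_intros P)+
    have Gx: "G (x t) p = ip g1 (dpl N (E p)) + ip g2 (dpl N (U p))" for p
    proof -
      have 1: "ip g1 (dpl N (E p)) = (\<Sum>j<n. x t j * ip (pl N (U j)) (dpl N (E p)))
          + \<alpha> * (\<Sum>j<n. \<Sum>l<n. x t j * x t l * ip (\<lambda>y. pl N (E j) y * pl N (U l) y) (dpl N (E p)))"
      proof -
        have "ip g1 (dpl N (E p)) = ip (pl N (b t)) (dpl N (E p)) + ip (\<lambda>y. \<alpha> * (pl N (a t) y * pl N (b t) y)) (dpl N (E p))"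
          unfolding g1_def by (rule ip_add_left) (intro bm_intros P D)+
        also have "ip (pl N (b t)) (dpl N (E p)) = (\<Sum>j<n. ip (\<lambda>y. x t j * pl N (U j) y) (dpl N (E p)))"
          unfolding bU by (rule ip_sum_left) (intro bm_intros P D)+
        also have "ip (\<lambda>y. \<alpha> * (pl N (a t) y * pl N (b t) y)) (dpl N (E p)) = \<alpha> * ip (\<lambda>y. pl N (a t) y * pl N (b t) y) (dpl N (E p))"
          by (rule ip_cmult_left)
        also have "ip (\<lambda>y. pl N (a t) y * pl N (b t) y) (dpl N (E p)) = (\<Sum>j<n. \<Sum>l<n. x t j * x t l * ip (\<lambda>y. pl N (E j) y * pl N (U l) y) (dpl N (E p)))"
          unfolding aE bU by (rule ip_bilinear_sum[OF P P D])
        finally show ?thesis by (simp only: ip_cmult_left)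
      qed
      have 2: "ip g2 (dpl N (U p)) = (\<Sum>j<n. x t j * ip (pl N (E j)) (dpl N (U p)))
          + \<beta> / 2 * (\<Sum>j<n. \<Sum>l<n. x t j * x t l * ip (\<lambda>y. pl N (U j) y * pl N (U l) y) (dpl N (U p)))
          + \<gamma> / 2 * (\<Sum>j<n. \<Sum>l<n. x t j * x t l * ip (\<lambda>y. pl N (E j) y * pl N (E l) y) (dpl N (U p)))"
      proof -
        have "ip g2 (dpl N (U p)) = ip (\<lambda>y. pl N (a t) y + \<beta> / 2 * (pl N (b t) y * pl N (b t) y)) (dpl N (U p)) + ip (\<lambda>y. \<gamma> / 2 * (pl N (a t) y * pl N (a t) y)) (dpl N (U p))"
          unfolding g2_def by (rule ip_add_left) (intro bm_intros P D)+
        also have "ip (\<lambda>y. pl N (a t) y + \<beta> / 2 * (pl N (b t) y * pl N (b t) y)) (dpl N (U p)) = ip (pl N (a t)) (dpl N (U p)) + ip (\<lambda>y. \<beta> / 2 * (pl N (b t) y * pl N (b t) y)) (dpl N (U p))"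
          by (rule ip_add_left) (intro bm_intros P D)+
        also have "ip (pl N (a t)) (dpl N (U p)) = (\<Sum>j<n. ip (\<lambda>y. x t j * pl N (E j) y) (dpl N (U p)))"
          unfolding aE by (rule ip_sum_left) (intro bm_intros P D)+
        also have "ip (\<lambda>y. \<beta> / 2 * (pl N (b t) y * pl N (b t) y)) (dpl N (U p)) = \<beta> / 2 * ip (\<lambda>y. pl N (b t) y * pl N (b t) y) (dpl N (U p))"
          by (rule ip_cmult_left)
        also have "ip (\<lambda>y. pl N (b t) y * pl N (b t) y) (dpl N (U p)) = (\<Sum>j<n. \<Sum>l<n. x t j * x t l * ip (\<lambda>y. pl N (U j) y * pl N (U l) y) (dpl N (U p)))"
          unfolding bU by (rule ip_bilinear_sum[OF P P D])
        also have "ip (\<lambda>y. \<gamma> / 2 * (pl N (a t) y * pl N (a t) y)) (dpl N (U p)) = \<gamma> / 2 * ip (\<lambda>y. pl N (a t) y * pl N (a t) y) (dpl N (U p))"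
          by (rule ip_cmult_left)
        also have "ip (\<lambda>y. pl N (a t) y * pl N (a t) y) (dpl N (U p)) = (\<Sum>j<n. \<Sum>l<n. x t j * x t l * ip (\<lambda>y. pl N (E j) y * pl N (E l) y) (dpl N (U p)))"
          unfolding aE by (rule ip_bilinear_sum[OF P P D])
        finally show ?thesis by (simp only: ip_cmult_left)
      qed
      have cl: "clamp1 (2 * R) (x t j) = x t j" if "j < n" for j by (rule clamp1_props(3)[OF xR[OF that]])
      have "G (x t) p = (\<Sum>j<n. A p j * x t j) + (\<Sum>j<n. \<Sum>l<n. Q p j l * (x t j * x t l))"
        unfolding G_def by (intro arg_cong2[of _ _ _ _ "(+)"] sum.cong refl) (simp_all only: lessThan_iff cl)
      also have "(\<Sum>j<n. A p j * x t j) = (\<Sum>j<n. x t j * ip (pl N (U j)) (dpl N (E p))) + (\<Sum>j<n. x t j * ip (pl N (E j)) (dpl N (U p)))"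
        unfolding sum.distrib[symmetric] by (intro sum.cong refl) (simp add: A_def algebra_simps)
      also have "(\<Sum>j<n. \<Sum>l<n. Q p j l * (x t j * x t l)) =
          \<alpha> * (\<Sum>j<n. \<Sum>l<n. x t j * x t l * ip (\<lambda>y. pl N (E j) y * pl N (U l) y) (dpl N (E p)))
          + (\<beta> / 2 * (\<Sum>j<n. \<Sum>l<n. x t j * x t l * ip (\<lambda>y. pl N (U j) y * pl N (U l) y) (dpl N (U p)))
          + \<gamma> / 2 * (\<Sum>j<n. \<Sum>l<n. x t j * x t l * ip (\<lambda>y. pl N (E j) y * pl N (E l) y) (dpl N (U p))))"
        unfolding sum_distrib_left sum.distrib[symmetric] by (intro sum.cong refl) (simp only: Q_def distrib_left distrib_right mult_ac)
      finally show ?thesis unfolding 1 2 by linarith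
    qed
    have z0: "ip h (dpl N (\<lambda>_. 0)) = 0" for h
      unfolding dpl_zero[abs_def] using ip_commute[of h] ip_zero_left by simp
    have G1: "G (x t) j = ip g1 (dpl N (e j))" if "j < m" for j
      unfolding Gx using that z0 by (simp add: E_def U_def)
    have G2: "G (x t) (m + j) = ip g2 (dpl N (f j))" for j
      unfolding Gx using z0 by (simp add: E_def U_def)
    show ?thesis
      unfolding discrete_eqs_def
    proof (intro conjI allI impI)
      fix c
      obtain dc where dc: "\<And>i. i \<le> N \<Longrightarrow> c i = (\<Sum>j<m. dc j * e j i)" using esp by blast
      have c: "pl N c = pl N (\<lambda>i. \<Sum>j<m. dc j * e j i)" "dpl N c = dpl N (\<lambda>i. \<Sum>j<m. dc j * e j i)"
        by (intro pl_cong dpl_cong N dc; assumption)+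
      have "ip (pl N (a' t)) (pl N c) = (\<Sum>j<m. dc j * ip (pl N (e j)) (pl N (a' t)))"
        unfolding c ip_commute[of "pl N (a' t)"] by (rule ip_pl_linear(3)[OF N])
      also have "\<dots> = (\<Sum>j<m. dc j * G (x t) j)"
      proof (intro sum.cong refl arg_cong[where f = "(*) _"])
        fix j assume "j \<in> {..<m}"
        then have j: "j < m" by simp
        have "ip (pl N (a' t)) (pl N (e j)) = (\<Sum>l<m. G (x t) l * ip (pl N (e l)) (pl N (e j)))"
          unfolding a'_def by (rule ip_pl_linear(3)[OF N])
        also have "\<dots> = G (x t) j" by (rule orthonormal_coeff) (use e j in auto)
        finally show "ip (pl N (e j)) (pl N (a' t)) = G (x t) j" by (simp only: ip_commute)
      qed
      also have "\<dots> = (\<Sum>j<m. dc j * ip g1 (dpl N (e j)))" by (intro sum.cong refl) (simp add: G1)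
      also have "\<dots> = ip g1 (dpl N c)" unfolding c by (rule ip_dpl_sum_right[OF N g(1), symmetric])
      finally show "ip (pl N (a' t)) (pl N c) = ip (\<lambda>x. pl N (b t) x + \<alpha> * (pl N (a t) x * pl N (b t) x)) (dpl N c)"
        unfolding g1_def .
    next
      fix c :: "nat \<Rightarrow> real" assume "c 0 = 0" "c N = 0"
      then obtain dc where dc: "\<And>i. i \<le> N \<Longrightarrow> c i = (\<Sum>j<k. dc j * f j i)" using fsp by blast
      have c: "pl N c = pl N (\<lambda>i. \<Sum>j<k. dc j * f j i)" "dpl N c = dpl N (\<lambda>i. \<Sum>j<k. dc j * f j i)"
        by (intro pl_cong dpl_cong N dc; assumption)+
      have "ip (pl N (b' t)) (pl N c) + 1/3 * ip (dpl N (b' t)) (dpl N c)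
         = (\<Sum>j<k. dc j * ip (pl N (f j)) (pl N (b' t))) + 1/3 * (\<Sum>j<k. dc j * ip (dpl N (f j)) (dpl N (b' t)))"
        unfolding c ip_commute[of "pl N (b' t)"] ip_commute[of "dpl N (b' t)"] ip_pl_linear[OF N] ..
      also have "\<dots> = (\<Sum>j<k. dc j * (ip (pl N (b' t)) (pl N (f j)) + 1/3 * ip (dpl N (b' t)) (dpl N (f j))))"
        unfolding ip_commute[of "pl N (b' t)"] ip_commute[of "dpl N (b' t)"] by (simp add: distrib_left sum.distrib sum_divide_distrib)
      also have "\<dots> = (\<Sum>j<k. dc j * G (x t) (m + j))"
      proof (intro sum.cong refl arg_cong[where f = "(*) _"])
        fix j assume "j \<in> {..<k}"
        then have j: "j < k" by simp
        have "ip (pl N (b' t)) (pl N (f j)) + 1/3 * ip (dpl N (b' t)) (dpl N (f j))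
          = (\<Sum>l<k. G (x t) (m + l) * (ip (pl N (f l)) (pl N (f j)) + 1/3 * ip (dpl N (f l)) (dpl N (f j))))"
          unfolding b'_def ip_pl_linear[OF N] by (simp add: distrib_left sum.distrib sum_divide_distrib)
        also have "\<dots> = G (x t) (m + j)" by (rule orthonormal_coeff) (use f j in auto)
        finally show "ip (pl N (b' t)) (pl N (f j)) + 1/3 * ip (dpl N (b' t)) (dpl N (f j)) = G (x t) (m + j)" .
      qed
      also have "\<dots> = (\<Sum>j<k. dc j * ip g2 (dpl N (f j)))" by (simp only: G2)
      also have "\<dots> = ip g2 (dpl N c)" unfolding c by (rule ip_dpl_sum_right[OF N g(2), symmetric])
      finally show "ip (pl N (b' t)) (pl N c) + 1/3 * ip (dpl N (b' t)) (dpl N c)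
         = ip (\<lambda>x. pl N (a t) x + \<beta> / 2 * (pl N (b t) x * pl N (b t) x) + \<gamma> / 2 * (pl N (a t) x * pl N (a t) x)) (dpl N c)"
        unfolding g2_def .
    qed
  qed
  ultimately show ?thesis by blast
qed

end

section \<open>Existence, error bounds and conclusion\<close>

context boussinesq
begin

text \<open>As long as the energy error is at most \<open>1 / N\<close>, the discrete functions are
  bounded by \<open>4 M\<close>, so the truncation at that level is inactive and the first step
  applies. The mesh condition makes its result \<open>C1 h^3\<close> at most half the threshold,
  which is what the continuation argument asks for.\<close>

lemma solution_exists:
  assumes N: "0 < N" and big: "2 * C1 \<le> (real N)\<^sup>2"
  shows "\<exists>a b a' b'. traj N a b a' b' \<and>
    (\<forall>t\<in>{0..T}. discrete_eqs \<alpha> \<beta> \<gamma> N (a t) (b t) (a' t) (b' t) \<and> err2 N t (a t) (b t) \<le> 1 / real N)"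
proof -
  have "0 \<le> 4 * M" using M(1) by simp
  from truncated_solution[OF N this] obtain a b a' b' where tr: "traj N a b a' b'"
    and tru: "\<And>t. t \<in> {0..T} \<Longrightarrow> \<forall>x\<in>{0..1}. \<bar>pl N (a t) x\<bar> \<le> 4 * M \<and> \<bar>pl N (b t) x\<bar> \<le> 4 * M \<and> \<bar>dpl N (b t) x\<bar> \<le> 4 * M \<Longrightarrow>
      discrete_eqs \<alpha> \<beta> \<gamma> N (a t) (b t) (a' t) (b' t)" by blast
  have de: "discrete_eqs \<alpha> \<beta> \<gamma> N (a t) (b t) (a' t) (b' t)" if "t \<in> {0..T}" "err2 N t (a t) (b t) \<le> 1 / real N" for t
    using discrete_bounds[OF that(1) N that(2)] by (intro tru that) auto
  have n: "real N > 0" using N by simp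
  have small: "C1 * (1 / sqrt (real N)) ^ 6 \<le> 1 / real N / 2"
  proof -
    have "(1 / sqrt (real N)) ^ 6 = ((1 / sqrt (real N))\<^sup>2) ^ 3" by (simp flip: power_mult)
    also have "\<dots> = 1 / real N ^ 3" using n by (simp add: power_divide)
    finally have "C1 * (1 / sqrt (real N)) ^ 6 = 2 * C1 / (2 * real N ^ 3)" by simp
    also have "\<dots> \<le> (real N)\<^sup>2 / (2 * real N ^ 3)" using big n by (intro divide_right_mono) auto
    also have "\<dots> = 1 / real N / 2" using n by (simp add: power2_eq_square power3_eq_cube)
    finally show ?thesis .
  qed
  have err: "err2 N t (a t) (b t) \<le> 1 / real N" if t: "t \<in> {0..T}" for t
  proof (rule bootstrap[of T "\<lambda>t. err2 N t (a t) (b t)", OF DERIV_continuous_on[OF err2_deriv[OF N tr]] _ _ _ t])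
    show "0 < 1 / real N" "err2 N 0 (a 0) (b 0) < 1 / real N" using n by (simp_all add: err2_0[OF N tr])
    fix \<tau> assume \<tau>: "\<tau> \<in> {0..T}" and h: "\<And>s. s \<in> {0..\<tau>} \<Longrightarrow> err2 N s (a s) (b s) \<le> 1 / real N"
    have "err2 N \<tau> (a \<tau>) (b \<tau>) \<le> C1 * (1 / sqrt (real N)) ^ 6"
      by (rule first_bound[OF N tr \<tau> de h]) (use \<tau> h in auto)
    then show "err2 N \<tau> (a \<tau>) (b \<tau>) \<le> 1 / real N / 2" using small by linarith
  qed
  then show ?thesis using tr de by blast
qed

lemma final_bounds:
  assumes N: "0 < N" and tr: "traj N a b a' b'"
    and h: "\<And>s. s \<in> {0..T} \<Longrightarrow> discrete_eqs \<alpha> \<beta> \<gamma> N (a s) (b s) (a' s) (b' s)" "\<And>s. s \<in> {0..T} \<Longrightarrow> err2 N s (a s) (b s) \<le> 1 / real N"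
    and t: "t \<in> {0..T}"
  defines "h \<equiv> 1 / sqrt (real N)"
  shows "L2norm (\<lambda>x. \<eta> t x - pl N (a t) x) \<le> (M + C3) * h ^ 3"
    and "L2norm (\<lambda>x. u t x - pl N (b t) x) \<le> (M + C3) * h ^ 4"
    and "L2norm (\<lambda>x. Dx (u t) x - dpl N (b t) x) \<le> (M + C3) * h\<^sup>2"
    and "L2norm (\<lambda>x. Dt T u t x - pl N (b' t) x) \<le> (M + C3) * h ^ 4"
proof -
  note sb = second_bound[OF N tr h(1,2) t, folded h_def] and ib = interp_bounds[OF t N]
  have n: "real N > 0" using N by simp
  have h2: "1 / real N = h\<^sup>2" using n by (simp add: h_def power_divide)
  have h4: "M / (real N)\<^sup>2 = M * h ^ 4"
  proof -
    have "h ^ 4 = (h\<^sup>2)\<^sup>2" by (simp flip: power_mult)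
    then show ?thesis by (simp add: h2[symmetric] power_divide)
  qed
  have h01: "0 \<le> h" "h \<le> 1" using n N by (auto simp: h_def)
  have M0: "0 \<le> M" using M(1) by simp
  have mono: "M * h ^ p \<le> M * h ^ q" if "q \<le> p" for p q
    using power_decreasing[OF that h01] M0 by (intro mult_left_mono) auto
  have monoC: "C3 * h ^ p \<le> C3 * h ^ q" if "q \<le> p" for p q
    using power_decreasing[OF that h01] const_pos(12) by (intro mult_left_mono) auto
  note bms = wd_bm[OF wd_eta[OF t]] wd_bm[OF wd_u[OF t]] wd_bm[OF wd_ut[OF t]] pl_bm[OF N] dpl_bm[OF N]
  have split: "L2norm (\<lambda>x. v x - w x) \<le> A + B" if "v \<in> bm" "w \<in> bm" "i \<in> bm" "L2norm (\<lambda>x. v x - i x) \<le> A" "L2norm (\<lambda>x. i x - w x) \<le> B" for v w i A B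
  proof -
    have "L2norm (\<lambda>x. v x - w x) = L2norm (\<lambda>x. (v x - i x) + (i x - w x))" by simp
    also have "\<dots> \<le> L2norm (\<lambda>x. v x - i x) + L2norm (\<lambda>x. i x - w x)" by (rule L2norm_triangle) (intro bm_intros that)+
    finally show ?thesis using that by linarith
  qed
  have sup: "L2norm f \<le> M * h ^ 4" if "f \<in> bm" "\<And>x. x \<in> {0..1} \<Longrightarrow> \<bar>f x\<bar> \<le> M / (real N)\<^sup>2" for f
    by (rule L2norm_le_sup) (use that M0 h01 in \<open>auto simp: h4\<close>)
  have "L2norm (\<lambda>x. \<eta> t x - pl N (a t) x) \<le> M * h ^ 4 + C3 * h ^ 3"
    by (rule split[OF _ _ _ sup sb(1)[unfolded ea_def[abs_def] pl_diff[abs_def]]]) (intro bm_intros bms ib(1); assumption)+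
  then show "L2norm (\<lambda>x. \<eta> t x - pl N (a t) x) \<le> (M + C3) * h ^ 3" using mono[of 3 4] by (simp add: distrib_right)
  have "L2norm (\<lambda>x. u t x - pl N (b t) x) \<le> M * h ^ 4 + C3 * h ^ 4"
    by (rule split[OF _ _ _ sup sb(3)[unfolded eb_def[abs_def] pl_diff[abs_def]]]) (intro bm_intros bms ib(3); assumption)+
  then show "L2norm (\<lambda>x. u t x - pl N (b t) x) \<le> (M + C3) * h ^ 4" by (simp add: distrib_right)
  have "L2norm (\<lambda>x. Dt T u t x - pl N (b' t) x) \<le> M * h ^ 4 + C3 * h ^ 4"
    by (rule split[OF _ _ _ sup sb(4)[unfolded eb'_def[abs_def] pl_diff[abs_def]]]) (intro bm_intros bms ib(4); assumption)+
  then show "L2norm (\<lambda>x. Dt T u t x - pl N (b' t) x) \<le> (M + C3) * h ^ 4" by (simp add: distrib_right)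
  have "L2norm (\<lambda>x. Dx (u t) x - dpl N (b t) x) \<le> M / real N + C3 * h ^ 3"
    by (rule split[OF _ _ _ ib(5) sb(2)[unfolded eb_def[abs_def] dpl_diff[abs_def]]]) (intro bms)+
  moreover have "M / real N = M * h\<^sup>2" using h2 by (metis mult.right_neutral times_divide_eq_right)
  ultimately show "L2norm (\<lambda>x. Dx (u t) x - dpl N (b t) x) \<le> (M + C3) * h\<^sup>2"
    using monoC[of 2 3] by (simp add: distrib_right)
qed

lemma convergence:
  "\<exists>C N0. \<forall>N\<ge>N0. 2 \<le> N \<longrightarrow>
        (\<exists>\<eta>h uh. GBh \<alpha> \<beta> \<gamma> N T \<eta>0 u0 \<eta>h uh \<and>
          (\<forall>\<eta>h' uh'. GBh \<alpha> \<beta> \<gamma> N T \<eta>0 u0 \<eta>h' uh' \<longrightarrow> same_on T \<eta>h' \<eta>h \<and> same_on T uh' uh) \<and>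
          (\<forall>t\<in>{0..T}.
            L2norm (\<lambda>x. \<eta> t x - \<eta>h t x) \<le> C * (1 / real N) powr (3/2) \<and>
            norm1 (\<lambda>x. u t x - uh t x) \<le> C * (1 / real N) \<and>
            L2norm (\<lambda>x. u t x - uh t x) \<le> C * (1 / real N)^2 \<and>
            L2norm (\<lambda>x. Dt T u t x - Dt T uh t x) \<le> C * (1 / real N)^2))"
\<comment> \<open>The factor 2 is for \<open>norm1\<close>, which is bounded by the sum of the L2
  norms of the error and of its derivative. The second witness gives \<open>2 * C1 \<le> N\<close>,
  hence the mesh condition \<open>2 * C1 \<le> N^2\<close>.\<close>
proof (intro exI[of _ "2 * (M + C3)"] exI[of _ "nat \<lceil>2 * C1\<rceil> + 1"] allI impI)
  fix N :: nat assume N1: "nat \<lceil>2 * C1\<rceil> + 1 \<le> N" and "2 \<le> N"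
  then have N: "0 < N" by simp
  have "2 * C1 \<le> real N" using N1 by linarith
  also have "\<dots> \<le> (real N)\<^sup>2" using N by (simp add: power2_eq_square)
  finally have big: "2 * C1 \<le> (real N)\<^sup>2" .
  from solution_exists[OF N big] obtain a b a' b' where tr: "traj N a b a' b'"
    and de: "\<And>t. t \<in> {0..T} \<Longrightarrow> discrete_eqs \<alpha> \<beta> \<gamma> N (a t) (b t) (a' t) (b' t)"
    and er: "\<And>t. t \<in> {0..T} \<Longrightarrow> err2 N t (a t) (b t) \<le> 1 / real N" by blast
  define h where "h = 1 / sqrt (real N)"
  have h0: "0 < h" "h \<le> 1" and h2: "1 / real N = h\<^sup>2" using N by (auto simp: h_def power_divide)
  have h4: "(1 / real N)^2 = h ^ 4" unfolding h2 by (simp flip: power_mult)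
  have h3: "(1 / real N) powr (3/2) = h ^ 3"
  proof -
    have "(1 / real N) powr (3/2) = (h powr 2) powr (3/2)" using h0 by (simp add: h2)
    also have "\<dots> = h powr 3" by (simp only: powr_powr) simp
    also have "\<dots> = h ^ 3" using h0 by simp
    finally show ?thesis .
  qed
  have C0: "0 \<le> M + C3" using M(1) const_pos(12) by simp
  note fb = final_bounds[OF N tr de er, folded h_def]
  have up: "x \<le> 2 * (M + C3) * h ^ k" if "x \<le> (M + C3) * h ^ k" for x k
  proof -
    have "0 \<le> (M + C3) * h ^ k" using C0 h0 by simp
    then show ?thesis using that unfolding mult.assoc by linarith
  qed
  show "\<exists>\<eta>h uh. GBh \<alpha> \<beta> \<gamma> N T \<eta>0 u0 \<eta>h uh \<and>
          (\<forall>\<eta>h' uh'. GBh \<alpha> \<beta> \<gamma> N T \<eta>0 u0 \<eta>h' uh' \<longrightarrow> same_on T \<eta>h' \<eta>h \<and> same_on T uh' uh) \<and>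
          (\<forall>t\<in>{0..T}.
            L2norm (\<lambda>x. \<eta> t x - \<eta>h t x) \<le> 2 * (M + C3) * (1 / real N) powr (3/2) \<and>
            norm1 (\<lambda>x. u t x - uh t x) \<le> 2 * (M + C3) * (1 / real N) \<and>
            L2norm (\<lambda>x. u t x - uh t x) \<le> 2 * (M + C3) * (1 / real N)^2 \<and>
            L2norm (\<lambda>x. Dt T u t x - Dt T uh t x) \<le> 2 * (M + C3) * (1 / real N)^2)"
  proof (rule exI[of _ "\<lambda>t. pl N (a t)"], rule exI[of _ "\<lambda>t. pl N (b t)"], intro conjI allI impI ballI)
    show "GBh \<alpha> \<beta> \<gamma> N T \<eta>0 u0 (\<lambda>t. pl N (a t)) (\<lambda>t. pl N (b t))" by (rule traj_GBh(1)[OF N tr de])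
  next
    fix \<eta>h' uh' assume G: "GBh \<alpha> \<beta> \<gamma> N T \<eta>0 u0 \<eta>h' uh'"
    note q = GBh_traj[OF N G]
    note un = traj_unique[OF N q(1) tr q(2) de]
    show "same_on T \<eta>h' (\<lambda>t. pl N (a t))" "same_on T uh' (\<lambda>t. pl N (b t))"
      unfolding same_on_def
    proof (safe)
      fix t x assume t: "t \<in> {0..T}" and x: "x \<in> {0..1::real}"
      have "pl N (nod N (\<eta>h' t)) = pl N (a t)" "pl N (nod N (uh' t)) = pl N (b t)"
        by (intro pl_cong N un t; assumption)+
      then show "\<eta>h' t x = pl N (a t) x" "uh' t x = pl N (b t) x" using q(3,4)[OF t x] by simp_all
    qed
  next
    fix t assume t: "t \<in> {0..T}"
    note fb = fb[OF _ _ t]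
    show "L2norm (\<lambda>x. \<eta> t x - pl N (a t) x) \<le> 2 * (M + C3) * (1 / real N) powr (3/2)"
      unfolding h3 by (intro up fb(1))
    show "L2norm (\<lambda>x. u t x - pl N (b t) x) \<le> 2 * (M + C3) * (1 / real N)^2"
      unfolding h4 by (intro up fb(2))
    have "L2norm (\<lambda>x. Dt T u t x - Dt T (\<lambda>t. pl N (b t)) t x) = L2norm (\<lambda>x. Dt T u t x - pl N (b' t) x)"
      by (rule L2norm_cong) (simp only: traj_GBh(2)[OF N tr de t])
    then show "L2norm (\<lambda>x. Dt T u t x - Dt T (\<lambda>t. pl N (b t)) t x) \<le> 2 * (M + C3) * (1 / real N)^2"
      unfolding h4 by (simp only:) (intro up fb(4))
    let ?e = "\<lambda>x. u t x - pl N (b t) x" and ?e' = "\<lambda>x. Dx (u t) x - dpl N (b t) x"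
    have "norm1 ?e = sqrt (ip ?e ?e + 1/3 * ip ?e' ?e')"
      by (rule wd_norm1) (intro wd_diff wd_u wd_pl N t)
    also have "\<dots> \<le> L2norm ?e + L2norm ?e'"
    proof (rule real_le_lsqrt)
      have "0 \<le> L2norm ?e * L2norm ?e'" by (intro mult_nonneg_nonneg L2norm_nonneg)
      then show "ip ?e ?e + 1/3 * ip ?e' ?e' \<le> (L2norm ?e + L2norm ?e')\<^sup>2"
        using ip_self_nonneg[of ?e'] by (simp add: power2_sum L2norm_sq)
    qed (intro add_nonneg_nonneg L2norm_nonneg)
    also have "\<dots> \<le> (M + C3) * h ^ 4 + (M + C3) * h\<^sup>2" by (intro add_mono fb)
    also have "(M + C3) * h ^ 4 \<le> (M + C3) * h\<^sup>2"
      using power_decreasing[of 2 4 h] h0 C0 by (intro mult_left_mono) auto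
    finally have "norm1 ?e \<le> 2 * ((M + C3) * h\<^sup>2)" by simp
    then show "norm1 ?e \<le> 2 * (M + C3) * (1 / real N)" unfolding h2 mult.assoc .
  qed
qed

end

lemma GB_convergence:
  fixes T :: real and \<eta>0 u0 :: "real \<Rightarrow> real" and \<eta> u :: "real \<Rightarrow> real \<Rightarrow> real"
  assumes T: "0 < T"
    and r: "\<eta> \<in> C_time T (Ck 3) (Ck_norm 3)" "Dt T \<eta> \<in> C_time T (Ck 2) (Ck_norm 2)"
      "u \<in> C_time T (Ck0 3) (Ck_norm 3)" "Dt T u \<in> C_time T (Ck0 3) (Ck_norm 3)"
    and pde: "GB \<alpha> \<beta> \<gamma> T \<eta>0 u0 \<eta> u"
  shows "\<exists>C N0. \<forall>N\<ge>N0. 2 \<le> N \<longrightarrow>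
        (\<exists>\<eta>h uh. GBh \<alpha> \<beta> \<gamma> N T \<eta>0 u0 \<eta>h uh \<and>
          (\<forall>\<eta>h' uh'. GBh \<alpha> \<beta> \<gamma> N T \<eta>0 u0 \<eta>h' uh' \<longrightarrow> same_on T \<eta>h' \<eta>h \<and> same_on T uh' uh) \<and>
          (\<forall>t\<in>{0..T}.
            L2norm (\<lambda>x. \<eta> t x - \<eta>h t x) \<le> C * (1 / real N) powr (3/2) \<and>
            norm1 (\<lambda>x. u t x - uh t x) \<le> C * (1 / real N) \<and>
            L2norm (\<lambda>x. u t x - uh t x) \<le> C * (1 / real N)^2 \<and>
            L2norm (\<lambda>x. Dt T u t x - Dt T uh t x) \<le> C * (1 / real N)^2))"
proof -
  obtain M1 where M1: "\<And>t. t \<in> {0..T} \<Longrightarrow> Ck_norm 3 (\<eta> t) \<le> M1" using C_time_bounded[OF r(1)] by blast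
  obtain M2 where M2: "\<And>t. t \<in> {0..T} \<Longrightarrow> Ck_norm 2 (Dt T \<eta> t) \<le> M2" using C_time_bounded[OF r(2)] by blast
  obtain M3 where M3: "\<And>t. t \<in> {0..T} \<Longrightarrow> Ck_norm 3 (u t) \<le> M3" using C_time_bounded[OF r(3)] by blast
  obtain M4 where M4: "\<And>t. t \<in> {0..T} \<Longrightarrow> Ck_norm 3 (Dt T u t) \<le> M4" using C_time_bounded[OF r(4)] by blast
  define M where "M = 1 + T + \<bar>\<alpha>\<bar> + \<bar>\<beta>\<bar> + \<bar>\<gamma>\<bar> + \<bar>M1\<bar> + \<bar>M2\<bar> + \<bar>M3\<bar> + \<bar>M4\<bar>"
  have le: "1 \<le> M" "T \<le> M" "\<bar>\<alpha>\<bar> \<le> M" "\<bar>\<beta>\<bar> \<le> M" "\<bar>\<gamma>\<bar> \<le> M" "M1 \<le> M" "M2 \<le> M" "M3 \<le> M" "M4 \<le> M"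
    using T unfolding M_def by linarith+
  interpret boussinesq \<alpha> \<beta> \<gamma> T M \<eta>0 u0 \<eta> u
  proof
    show "\<And>t. t \<in> {0..T} \<Longrightarrow> Ck_norm 3 (\<eta> t) \<le> M" using M1 le order.trans by blast
    show "\<And>t. t \<in> {0..T} \<Longrightarrow> Ck_norm 2 (Dt T \<eta> t) \<le> M" using M2 le order.trans by blast
    show "\<And>t. t \<in> {0..T} \<Longrightarrow> Ck_norm 3 (u t) \<le> M" using M3 le order.trans by blast
    show "\<And>t. t \<in> {0..T} \<Longrightarrow> Ck_norm 3 (Dt T u t) \<le> M" using M4 le order.trans by blast
    show "\<And>t. t \<in> {0..T} \<Longrightarrow> \<eta> t \<in> Ck 3" "\<And>t. t \<in> {0..T} \<Longrightarrow> Dt T \<eta> t \<in> Ck 2"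
      "\<And>t. t \<in> {0..T} \<Longrightarrow> u t \<in> Ck0 3" "\<And>t. t \<in> {0..T} \<Longrightarrow> Dt T u t \<in> Ck0 3"
      using r unfolding C_time_def by blast+
  qed (fact T pde le)+
  show ?thesis by (rule convergence)
qed

theorem theorem2p1:
  fixes T :: real and \<eta>0 u0 :: "real \<Rightarrow> real" and \<eta> u :: "real \<Rightarrow> real \<Rightarrow> real"
  assumes "0 < T"
    and "\<eta> \<in> C_time T (Ck 3) (Ck_norm 3)"
    and "Dt T \<eta> \<in> C_time T (Ck 2) (Ck_norm 2)"
    and "u \<in> C_time T (Ck0 3) (Ck_norm 3)"
    and "Dt T u \<in> C_time T (Ck0 3) (Ck_norm 3)"
  shows "(CB T \<eta>0 u0 \<eta> u \<longrightarrow>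
      (\<exists>C N0. \<forall>N\<ge>N0. 2 \<le> N \<longrightarrow>
        (\<exists>\<eta>h uh. CBh N T \<eta>0 u0 \<eta>h uh \<and>
          (\<forall>\<eta>h' uh'. CBh N T \<eta>0 u0 \<eta>h' uh' \<longrightarrow> same_on T \<eta>h' \<eta>h \<and> same_on T uh' uh) \<and>
          (\<forall>t\<in>{0..T}.
            L2norm (\<lambda>x. \<eta> t x - \<eta>h t x) \<le> C * (1 / real N) powr (3/2) \<and>
            norm1 (\<lambda>x. u t x - uh t x) \<le> C * (1 / real N) \<and>
            L2norm (\<lambda>x. u t x - uh t x) \<le> C * (1 / real N)^2 \<and>
            L2norm (\<lambda>x. Dt T u t x - Dt T uh t x) \<le> C * (1 / real N)^2))))
    \<and> (SCB T \<eta>0 u0 \<eta> u \<longrightarrow>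
      (\<exists>C N0. \<forall>N\<ge>N0. 2 \<le> N \<longrightarrow>
        (\<exists>\<eta>h uh. SCBh N T \<eta>0 u0 \<eta>h uh \<and>
          (\<forall>\<eta>h' uh'. SCBh N T \<eta>0 u0 \<eta>h' uh' \<longrightarrow> same_on T \<eta>h' \<eta>h \<and> same_on T uh' uh) \<and>
          (\<forall>t\<in>{0..T}.
            L2norm (\<lambda>x. \<eta> t x - \<eta>h t x) \<le> C * (1 / real N) powr (3/2) \<and>
            norm1 (\<lambda>x. u t x - uh t x) \<le> C * (1 / real N) \<and>
            L2norm (\<lambda>x. u t x - uh t x) \<le> C * (1 / real N)^2 \<and>
            L2norm (\<lambda>x. Dt T u t x - Dt T uh t x) \<le> C * (1 / real N)^2))))"
  unfolding CB_eq_GB SCB_eq_GB CBh_eq_GBh SCBh_eq_GBh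
  by (intro conjI impI GB_convergence assms)

end
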